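(* Let $N\ge 2$, let $g$ and the crack $\Gamma$ be as in the context, and let $f$ satisfy either the set of assumptions (A) or the set of assumptions (B) described in the context. Let $u\in H^1(B_{\hat R})$ be a weak solution to $-\Delta u=fu$ in $B_{\hat R}\setminus\Gamma$, $u=0$ on $\Gamma$. Then, for a.e. $r\in(0,r_0)$, $$-\frac{N-1}{2}\int_{B_r}|\nabla u|^2dx+\frac r2\int_{\partial B_r}|\nabla u|^2dS-r\int_{\partial B_r}\left|\frac{\partial u}{\partial\nu}\right|^2dS-\mathcal R(r,u)\ge0$$ and $$\int_{B_r}|\nabla u|^2dx=\int_{B_r}fu^2dx+\int_{\partial B_r}u\frac{\partial u}{\partial\nu}dS,$$ where $\nu$ is the outward unit normal to $\partial B_r$ and $\mathcal R(r,u)$ and $r_0$ are defined in the context.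
   Context: Let $N\ge2$ and $\hat R>0$. Points of $\mathbb{R}^{N+1}$ are written $x=(x',x_N,x_{N+1})$ with $x'\in\mathbb{R}^{N-1}$; $B_r=\{x\in\mathbb{R}^{N+1}:|x|<r\}$ and $dS$ is the surface measure on spheres. Crack: $g\in C^2(\mathbb{R}^{N-1})$ is real valued with $g(0)=0$, $\nabla g(0)=0$ and $g(x')-x'\cdot\nabla g(x')\ge0$ for all $|x'|<\hat R$. $\Gamma=\{(x',x_N)\in\mathbb{R}^N: x_N\ge g(x')\}$, regarded as a subset of $\mathbb{R}^{N+1}$ by identifying $\mathbb{R}^N$ with $\{x_{N+1}=0\}$. Potential: $f:B_{\hat R}\to\mathbb{R}$ is measurable and bounded in $B_{\hat R}\setminus B_\delta$ for every $\delta\in(0,\hat R)$. Put $\xi_f(r)=\sup_{x\in\overline{B_r}}|x|^2|f(x)|$ and, for $h\in L^\infty_{\rm loc}(B_{\hat R}\setminus\{0\})$, $\eta(r,h)=\sup_{w\in H^1(B_r)\setminus\{0\}}\dfrac{\int_{B_r}|h|w^2\,dx}{\int_{B_r}|\nabla w|^2dx+\frac{N-1}{2r}\int_{\partial B_r}|w|^2dS}$, for $r\in(0,\hat R)$. Assumptions (A): $\lim_{r\to0^+}\xi_f(r)=0$, $\frac{\xi_f(r)}{r}\in L^1(0,\hat R)$ and $\frac1r\int_0^r\frac{\xi_f(s)}{s}ds\in L^1(0,\hat R)$. Assumptions (B): $\lim_{r\to0^+}\eta(r,f)=0$; $\frac{\eta(r,f)}{r}\in L^1(0,\hat R)$ and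 $\frac1r\int_0^r\frac{\eta(s,f)}{s}ds\in L^1(0,\hat R)$; $\nabla f\in L^\infty_{\rm loc}(B_{\hat R}\setminus\{0\})$; $\frac{\eta(r,\nabla f\cdot x)}{r}\in L^1(0,\hat R)$ and $\frac1r\int_0^r\frac{\eta(s,\nabla f\cdot x)}{s}ds\in L^1(0,\hat R)$. Weak solution: for $R>0$, $H^1_\Gamma(B_R)$ is the closure in $H^1(B_R)$ of $\{w\in C^\infty(\overline{B_R}): w=0\text{ in a neighborhood of }\Gamma\}$. $u\in H^1(B_{\hat R})$ is a weak solution if $u\in H^1_\Gamma(B_{\hat R})$ and $\int_{B_{\hat R}}\nabla u\cdot\nabla v\,dx-\int_{B_{\hat R}}fuv\,dx=0$ for all $v\in C_c^\infty(B_{\hat R}\setminus\Gamma)$. The radius $r_0$: let $\omega(r)=\frac{2}{N-1}\frac{\xi_f(r)}{r}$ under (A) and $\omega(r)=\frac{N-1}{2}\frac{\eta(r,f)}{r}$ under (B). $r_0\in(0,\hat R)$ is a fixed number such that, for all $r\in(0,r_0]$, $r\omega(r)<\frac{N-1}4$ and $\int_{B_r}(|\nabla w|^2-|f|w^2)dx\ge\frac12\int_{B_r}|\nabla w|^2dx-\omega(r)\int_{\partial B_r}w^2dS$ for all $w\in H^1(B_r)$ (such $r_0$ exists). Remainder term: for $r\in(0,r_0)$ and $w\in H^1(B_r)$, $\mathcal R(r,w)=\int_{B_r}f\,w\,(x\cdot\nabla w)\,dx$ if $f$ satisfies (A), and $\mathcal R(r,w)=\frac r2\int_{\partial B_r}f\,w^2dS-\frac12\int_{B_r}\big(\nabla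 f\cdot x+(N+1)f\big)w^2dx$ if $f$ satisfies (B). *)

theory Defs
  imports "HOL-Analysis.Analysis"
begin

section \<open>Smooth functions\<close>

definition gradient :: "('a::euclidean_space \<Rightarrow> real) \<Rightarrow> 'a \<Rightarrow> 'a" where
  "gradient \<phi> x = (\<Sum>i\<in>Basis. frechet_derivative \<phi> (at x) i *\<^sub>R i)"

primrec Ck :: "nat \<Rightarrow> ('a::euclidean_space \<Rightarrow> real) \<Rightarrow> bool" where
  "Ck 0 \<phi> \<longleftrightarrow> continuous_on UNIV \<phi>"
| "Ck (Suc k) \<phi> \<longleftrightarrow> (\<forall>x. \<phi> differentiable (at x)) \<and> (\<forall>i\<in>Basis. Ck k (\<lambda>x. gradient \<phi> x \<bullet> i))"

definition smooth :: "('a::euclidean_space \<Rightarrow> real) \<Rightarrow> bool" where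
  "smooth \<phi> \<longleftrightarrow> (\<forall>k. Ck k \<phi>)"

text \<open>The space \<open>C\<^sub>c\<^sup>\<infinity>(\<Omega>)\<close>, its elements being extended by zero to the whole space.\<close>

definition test_functions :: "'a::euclidean_space set \<Rightarrow> ('a \<Rightarrow> real) set" where
  "test_functions \<Omega> = {\<phi>. smooth \<phi> \<and> (\<exists>K. compact K \<and> K \<subseteq> \<Omega> \<and> (\<forall>x. x \<notin> K \<longrightarrow> \<phi> x = 0))}"


section \<open>Sobolev spaces\<close>

text \<open>Elements of Lebesgue and Sobolev spaces are represented by functions; only their values
  almost everywhere in the underlying set matter.\<close>

definition L2 :: "'a measure \<Rightarrow> ('a \<Rightarrow> 'b::euclidean_space) \<Rightarrow> bool" where
  "L2 M v \<longleftrightarrow> v \<in> borel_measurable M \<and> integrable M (\<lambda>x. (norm (v x))\<^sup>2)"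

definition loc_integrable :: "'a::euclidean_space set \<Rightarrow> ('a \<Rightarrow> 'b::euclidean_space) \<Rightarrow> bool" where
  "loc_integrable \<Omega> v \<longleftrightarrow> (\<forall>K. compact K \<and> K \<subseteq> \<Omega> \<longrightarrow> set_integrable lebesgue K v)"

definition loc_ess_bounded :: "'a::euclidean_space set \<Rightarrow> ('a \<Rightarrow> 'b::euclidean_space) \<Rightarrow> bool" where
  "loc_ess_bounded \<Omega> v \<longleftrightarrow> v \<in> borel_measurable (lebesgue_on \<Omega>) \<and>
     (\<forall>K. compact K \<and> K \<subseteq> \<Omega> \<longrightarrow> (\<exists>C. AE x in lebesgue. x \<in> K \<longrightarrow> norm (v x) \<le> C))"

definition has_weak_gradient ::
  "'a::euclidean_space set \<Rightarrow> ('a \<Rightarrow> real) \<Rightarrow> ('a \<Rightarrow> 'a) \<Rightarrow> bool" where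
  "has_weak_gradient \<Omega> v G \<longleftrightarrow> loc_integrable \<Omega> v \<and> loc_integrable \<Omega> G \<and>
     (\<forall>\<phi>\<in>test_functions \<Omega>.
        (LINT x:\<Omega>|lebesgue. v x *\<^sub>R gradient \<phi> x) = - (LINT x:\<Omega>|lebesgue. \<phi> x *\<^sub>R G x))"

text \<open>The weak gradient is unique up to null sets; an arbitrary representative is chosen.\<close>

definition weak_gradient :: "'a::euclidean_space set \<Rightarrow> ('a \<Rightarrow> real) \<Rightarrow> 'a \<Rightarrow> 'a" where
  "weak_gradient \<Omega> v = (SOME G. has_weak_gradient \<Omega> v G)"

definition H1 :: "'a::euclidean_space set \<Rightarrow> ('a \<Rightarrow> real) set" where
  "H1 \<Omega> = {v. L2 (lebesgue_on \<Omega>) v \<and>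
     (\<exists>G. has_weak_gradient \<Omega> v G \<and> L2 (lebesgue_on \<Omega>) G)}"

definition H1_norm :: "'a::euclidean_space set \<Rightarrow> ('a \<Rightarrow> real) \<Rightarrow> real" where
  "H1_norm \<Omega> v = sqrt ((LINT x:\<Omega>|lebesgue. (v x)\<^sup>2) +
     (LINT x:\<Omega>|lebesgue. (norm (weak_gradient \<Omega> v x))\<^sup>2))"


section \<open>Surface measure and traces on spheres\<close>

text \<open>Surface measure on the sphere of radius \<open>r\<close> about the origin, defined through polar
  coordinates: with \<open>d\<close> the dimension, the measure of a Borel set \<open>A\<close> of the sphere is \<open>d / r\<close> times
  the Lebesgue measure of the cone \<open>{t a | 0 < t < 1, a \<in> A}\<close>. The measure lives on the whole space
  and is concentrated on the sphere (the centre of the ball, where the radial projection is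
  not defined, is a null set). The completion makes restrictions to almost every sphere of
  Lebesgue measurable functions measurable.\<close>

definition sphere_measure :: "real \<Rightarrow> 'a::euclidean_space measure" where
  "sphere_measure r = completion (scale_measure (ennreal (real DIM('a) / r))
     (distr (restrict_space lborel (ball 0 r)) borel (\<lambda>x. (r / norm x) *\<^sub>R x)))"

lemma emeasure_sphere_measure:
  assumes "A \<in> sets borel"
  shows "emeasure (sphere_measure r :: 'a::euclidean_space measure) A =
    ennreal (real DIM('a) / r) * emeasure lborel {x \<in> ball 0 r. (r / norm x) *\<^sub>R x \<in> A}"
proof -
  let ?p = "\<lambda>x::'a. (r / norm x) *\<^sub>R x"
  have m: "?p \<in> measurable (restrict_space lborel (ball 0 r)) borel"
    by (rule measurable_restrict_space1) measurable
  have "emeasure (sphere_measure r :: 'a measure) A =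
    ennreal (real DIM('a) / r) * emeasure (distr (restrict_space lborel (ball 0 r)) borel ?p) A"
    using assms by (simp add: sphere_measure_def emeasure_completion)
  also have "emeasure (distr (restrict_space lborel (ball 0 r)) borel ?p) A =
    emeasure (restrict_space lborel (ball 0 r)) (?p -` A \<inter> ball 0 r)"
    using m assms by (subst emeasure_distr) (simp_all add: space_restrict_space)
  also have "\<dots> = emeasure lborel {x \<in> ball 0 r. ?p x \<in> A}"
    by (subst emeasure_restrict_space) (auto intro!: arg_cong2[where f=emeasure])
  finally show ?thesis .
qed

lemma emeasure_sphere_measure_UNIV:
  assumes "r > 0"
  shows "emeasure (sphere_measure r :: 'a::euclidean_space measure) UNIV =
    ennreal (real DIM('a) * unit_ball_vol (real DIM('a)) * r ^ (DIM('a) - 1))"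
proof -
  have "{x \<in> ball 0 r. (r / norm x) *\<^sub>R x \<in> UNIV} = (ball 0 r :: 'a set)"
    by auto
  then have "emeasure (sphere_measure r :: 'a measure) UNIV =
    ennreal (real DIM('a) / r) * ennreal (unit_ball_vol (real DIM('a)) * r ^ DIM('a))"
    using assms emeasure_sphere_measure[of "UNIV :: 'a set" r] emeasure_ball[of r "0::'a"]
    by (metis sets.top space_borel less_imp_le)
  also have "\<dots> = ennreal (real DIM('a) / r * (unit_ball_vol (real DIM('a)) * r ^ DIM('a)))"
    using assms by (subst ennreal_mult') simp_all
  also have "real DIM('a) / r * (unit_ball_vol (real DIM('a)) * r ^ DIM('a)) =
    real DIM('a) * unit_ball_vol (real DIM('a)) * r ^ (DIM('a) - 1)"
    using assms by (simp add: power_eq_if)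
  finally show ?thesis .
qed

text \<open>The trace of \<open>v \<in> H\<^sup>1(B\<^sub>r)\<close> on the boundary sphere: the value at \<open>v\<close> of the continuous
  extension of the restriction map from functions that are smooth up to the boundary.\<close>

definition has_trace :: "real \<Rightarrow> ('a::euclidean_space \<Rightarrow> real) \<Rightarrow> ('a \<Rightarrow> real) \<Rightarrow> bool" where
  "has_trace r v \<tau> \<longleftrightarrow> L2 (sphere_measure r) \<tau> \<and>
     (\<exists>\<phi>. (\<forall>n. smooth (\<phi> n)) \<and>
        (\<lambda>n. H1_norm (ball 0 r) (\<lambda>x. \<phi> n x - v x)) \<longlonglongrightarrow> 0 \<and>
        (\<lambda>n::nat. LINT x|sphere_measure r. (\<phi> n x - \<tau> x)\<^sup>2) \<longlonglongrightarrow> 0)"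

definition sphere_trace :: "real \<Rightarrow> ('a::euclidean_space \<Rightarrow> real) \<Rightarrow> 'a \<Rightarrow> real" where
  "sphere_trace r v = (SOME \<tau>. has_trace r v \<tau>)"

text \<open>The derivative of \<open>v \<in> H\<^sup>1(B\<^sub>R)\<close> in the direction \<open>x / |x|\<close>, the outward unit normal at \<open>x\<close> of
  the sphere through \<open>x\<close>.\<close>

definition normal_derivative :: "real \<Rightarrow> ('a::euclidean_space \<Rightarrow> real) \<Rightarrow> 'a \<Rightarrow> real" where
  "normal_derivative R v x = weak_gradient (ball 0 R) v x \<bullet> (x /\<^sub>R norm x)"


section \<open>The crack\<close>

text \<open>With \<open>N - 1 = CARD('n)\<close>, the space of dimension \<open>N + 1\<close> is modelled as a product, carrying the
  Euclidean norm and inner product. As \<open>CARD('n) \<ge> 1\<close>, the condition \<open>N \<ge> 2\<close> is automatic.\<close>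

type_synonym 'n pt = "(real ^ 'n) \<times> real \<times> real"

definition admissible_profile :: "real \<Rightarrow> (real ^ 'n::finite \<Rightarrow> real) \<Rightarrow> bool" where
  "admissible_profile R g \<longleftrightarrow> Ck 2 g \<and> g 0 = 0 \<and> gradient g 0 = 0 \<and>
     (\<forall>x'. norm x' < R \<longrightarrow> g x' - x' \<bullet> gradient g x' \<ge> 0)"

definition crack :: "(real ^ 'n::finite \<Rightarrow> real) \<Rightarrow> 'n pt set" where
  "crack g = {(x', x\<^sub>N, z). x\<^sub>N \<ge> g x' \<and> z = 0}"

text \<open>Functions smooth on the closed ball are restrictions of smooth functions on the whole space;
  their vanishing near the crack is only required inside the closed ball.\<close>

definition smooth_off_crack :: "real \<Rightarrow> (real ^ 'n::finite \<Rightarrow> real) \<Rightarrow> ('n pt \<Rightarrow> real) set" where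
  "smooth_off_crack R g = {\<phi>. smooth \<phi> \<and>
     (\<exists>U. open U \<and> crack g \<subseteq> U \<and> (\<forall>x \<in> U \<inter> cball 0 R. \<phi> x = 0))}"

definition H1_crack :: "real \<Rightarrow> (real ^ 'n::finite \<Rightarrow> real) \<Rightarrow> ('n pt \<Rightarrow> real) set" where
  "H1_crack R g = {v \<in> H1 (ball 0 R).
     \<forall>\<epsilon>>0. \<exists>\<phi>\<in>smooth_off_crack R g. H1_norm (ball 0 R) (\<lambda>x. v x - \<phi> x) < \<epsilon>}"

definition weak_solution ::
  "real \<Rightarrow> (real ^ 'n::finite \<Rightarrow> real) \<Rightarrow> ('n pt \<Rightarrow> real) \<Rightarrow> ('n pt \<Rightarrow> real) \<Rightarrow> bool" where
  "weak_solution R g f u \<longleftrightarrow> u \<in> H1_crack R g \<and>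
     (\<forall>v\<in>test_functions (ball 0 R - crack g).
        (LINT x:ball 0 R|lebesgue. weak_gradient (ball 0 R) u x \<bullet> gradient v x)
        - (LINT x:ball 0 R|lebesgue. f x * u x * v x) = 0)"


section \<open>The potential\<close>

definition admissible_potential :: "real \<Rightarrow> ('n::finite pt \<Rightarrow> real) \<Rightarrow> bool" where
  "admissible_potential R f \<longleftrightarrow> f \<in> borel_measurable (lebesgue_on (ball 0 R)) \<and>
     (\<forall>\<delta>. 0 < \<delta> \<and> \<delta> < R \<longrightarrow> (\<exists>C. \<forall>x \<in> ball 0 R - ball 0 \<delta>. \<bar>f x\<bar> \<le> C))"

text \<open>The suprema take values in the extended nonnegative reals, so that they are
  meaningful without any boundedness assumption.\<close>

definition xi :: "('n::finite pt \<Rightarrow> real) \<Rightarrow> real \<Rightarrow> ennreal" where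
  "xi f r = (SUP x\<in>cball 0 r. ennreal ((norm x)\<^sup>2 * \<bar>f x\<bar>))"

definition eta :: "('n::finite pt \<Rightarrow> real) \<Rightarrow> real \<Rightarrow> ennreal" where
  "eta h r = (SUP w \<in> {w \<in> H1 (ball 0 r). \<not> (AE x in lebesgue. x \<in> ball 0 r \<longrightarrow> w x = 0)}.
     (\<integral>\<^sup>+x. ennreal (\<bar>h x\<bar> * (w x)\<^sup>2) \<partial>lebesgue_on (ball 0 r)) /
     ((\<integral>\<^sup>+x. ennreal ((norm (weak_gradient (ball 0 r) w x))\<^sup>2) \<partial>lebesgue_on (ball 0 r)) +
      ennreal (real CARD('n) / (2 * r)) *
        (\<integral>\<^sup>+x. ennreal ((sphere_trace r w x)\<^sup>2) \<partial>sphere_measure r)))"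

definition L1_interval :: "real \<Rightarrow> (real \<Rightarrow> ennreal) \<Rightarrow> bool" where
  "L1_interval R F \<longleftrightarrow> F \<in> borel_measurable (lebesgue_on {0<..<R}) \<and>
     (\<integral>\<^sup>+r. F r \<partial>lebesgue_on {0<..<R}) < \<infinity>"

definition dini_conditions :: "real \<Rightarrow> (real \<Rightarrow> ennreal) \<Rightarrow> bool" where
  "dini_conditions R F \<longleftrightarrow> L1_interval R (\<lambda>r. F r / ennreal r) \<and>
     L1_interval R (\<lambda>r. (\<integral>\<^sup>+s. F s / ennreal s \<partial>lebesgue_on {0<..<r}) / ennreal r)"

definition assumption_A :: "real \<Rightarrow> ('n::finite pt \<Rightarrow> real) \<Rightarrow> bool" where
  "assumption_A R f \<longleftrightarrow> (xi f \<longlongrightarrow> 0) (at_right 0) \<and> dini_conditions R (xi f)"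

definition potential_gradient :: "real \<Rightarrow> ('n::finite pt \<Rightarrow> real) \<Rightarrow> 'n pt \<Rightarrow> 'n pt" where
  "potential_gradient R f = weak_gradient (ball 0 R - {0}) f"

definition assumption_B :: "real \<Rightarrow> ('n::finite pt \<Rightarrow> real) \<Rightarrow> bool" where
  "assumption_B R f \<longleftrightarrow> (eta f \<longlongrightarrow> 0) (at_right 0) \<and> dini_conditions R (eta f) \<and>
     has_weak_gradient (ball 0 R - {0}) f (potential_gradient R f) \<and>
     loc_ess_bounded (ball 0 R - {0}) (potential_gradient R f) \<and>
     dini_conditions R (eta (\<lambda>x. potential_gradient R f x \<bullet> x))"

definition omega_A :: "('n::finite pt \<Rightarrow> real) \<Rightarrow> real \<Rightarrow> ennreal" where
  "omega_A f r = ennreal (2 / real CARD('n)) * (xi f r / ennreal r)"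

definition omega_B :: "('n::finite pt \<Rightarrow> real) \<Rightarrow> real \<Rightarrow> ennreal" where
  "omega_B f r = ennreal (real CARD('n) / 2) * (eta f r / ennreal r)"

text \<open>The first condition forces \<open>\<omega> r < \<infinity>\<close>, so the conversion to a real number in the second
  one is harmless.\<close>

definition admissible_radius ::
  "real \<Rightarrow> ('n::finite pt \<Rightarrow> real) \<Rightarrow> (real \<Rightarrow> ennreal) \<Rightarrow> real \<Rightarrow> bool" where
  "admissible_radius R f \<omega> r0 \<longleftrightarrow> 0 < r0 \<and> r0 < R \<and>
     (\<forall>r. 0 < r \<and> r \<le> r0 \<longrightarrow>
        ennreal r * \<omega> r < ennreal (real CARD('n) / 4) \<and>
        (\<forall>w\<in>H1 (ball 0 r).
           (LINT x:ball 0 r|lebesgue.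
              (norm (weak_gradient (ball 0 r) w x))\<^sup>2 - \<bar>f x\<bar> * (w x)\<^sup>2)
           \<ge> 1 / 2 * (LINT x:ball 0 r|lebesgue. (norm (weak_gradient (ball 0 r) w x))\<^sup>2)
             - enn2real (\<omega> r) * (LINT x|sphere_measure r. (sphere_trace r w x)\<^sup>2)))"

definition remainder_A :: "('n::finite pt \<Rightarrow> real) \<Rightarrow> real \<Rightarrow> ('n pt \<Rightarrow> real) \<Rightarrow> real" where
  "remainder_A f r w =
     (LINT x:ball 0 r|lebesgue. f x * w x * (x \<bullet> weak_gradient (ball 0 r) w x))"

definition remainder_B :: "real \<Rightarrow> ('n::finite pt \<Rightarrow> real) \<Rightarrow> real \<Rightarrow> ('n pt \<Rightarrow> real) \<Rightarrow> real" where
  "remainder_B R f r w =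
     r / 2 * (LINT x|sphere_measure r. f x * (sphere_trace r w x)\<^sup>2)
     - 1 / 2 * (LINT x:ball 0 r|lebesgue.
         (potential_gradient R f x \<bullet> x + real (CARD('n) + 2) * f x) * (w x)\<^sup>2)"

end

theory Submission
  imports Defs
begin

text \<open>
  The sign condition on \<open>g\<close> makes \<open>s \<mapsto> g(sx') / s\<close> nonincreasing, so dilations by factors \<open>t \<ge> 1\<close> map the
  crack into itself: its complement is starshaped about the origin (\<open>crack_dilation\<close>). If \<open>w\<close> is
  smooth and vanishes near the crack, then so does \<open>w(t\<cdot>)\<close>. Hence, with smooth \<open>w\<^sub>n\<close> approximating
  the solution \<open>u\<close> in \<open>H\<^sup>1\<close> and a nonnegative radial cutoff \<open>\<phi>\<close> supported in an annulus, the function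
  \<open>\<phi> (w\<^sub>n(t\<cdot>) - w\<^sub>n)\<close> may be used as a test function (\<open>dilated_test_function\<close>).

  This one-sided variation takes the place of testing with \<open>x \<cdot> \<nabla>u\<close>, for which \<open>u\<close> is not regular enough
  at the edge of the crack, and no approximation of the domain is involved. The pairing of \<open>\<nabla>u\<close> with
  \<open>\<nabla>(w\<^sub>n(t\<cdot>))\<close> is estimated by Young's inequality, and the energy of a dilated function is known from a
  change of variables. Letting \<open>n \<rightarrow> \<infinity>\<close>, dividing by \<open>t - 1\<close> and letting \<open>t \<rightarrow> 1\<close> from above gives a Pohozaev
  inequality for cutoffs (\<open>cutoff_pohozaev\<close>); it is an inequality because the contribution of the crack,
  which has a sign, never appears. The test function \<open>\<phi> w\<^sub>n\<close> gives the energy identity for cutoffs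
  (\<open>cutoff_energy\<close>).

  Both statements have the form \<open>\<integral> \<Phi>(|x|\<^sup>2) A + \<Phi>'(|x|\<^sup>2) B dx \<ge> 0\<close> with \<open>\<phi>(x) = \<Phi>(|x|\<^sup>2)\<close>. In polar
  coordinates, and as \<open>\<Phi>\<close> is arbitrary, this becomes an inequality between the integral of \<open>A\<close> over \<open>B\<^sub>r\<close>
  and that of \<open>B\<close> over its boundary, for almost every \<open>r\<close> (\<open>AE_ball_sphere_inequality\<close>). The cutoffs vanish
  near the origin, where \<open>f\<close> may be singular; removing the inner cutoff requires that \<open>B / |x|\<^sup>2\<close> be
  integrable, which comes from Hardy's inequality \<open>u / |x| \<in> L\<^sup>2\<close> in dimension at least three
  (\<open>hardy_integrable\<close>).

  Under (A), \<open>|x|\<^sup>2 f\<close> is bounded, so \<open>f u x \<cdot> \<nabla>u\<close> is integrable and directly gives the remainder term.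
  Under (B), the finiteness of \<open>\<eta>\<close> at almost every radius makes \<open>f u\<^sup>2\<close> and \<open>(\<nabla>f \<cdot> x) u\<^sup>2\<close> integrable, and
  \<open>\<phi> f u x \<cdot> \<nabla>u\<close> is integrated by parts (\<open>cutoff_potential_by_parts\<close>). Traces enter only through the fact
  that, by Fubini's theorem, \<open>u\<close> is its own trace on almost every sphere (\<open>AE_has_trace_self\<close>).
\<close>

section \<open>Calculus of smooth functions\<close>

lemma gradient_eqI:
  fixes \<phi> :: "'a::euclidean_space \<Rightarrow> real"
  assumes "(\<phi> has_derivative (\<lambda>v. D \<bullet> v)) (at x)"
  shows "gradient \<phi> x = D"
proof -
  have "frechet_derivative \<phi> (at x) = (\<lambda>v. D \<bullet> v)"
    using frechet_derivative_at[OF assms] by simp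
  then show ?thesis
    by (simp add: gradient_def euclidean_representation)
qed

lemma has_derivative_gradient:
  fixes \<phi> :: "'a::euclidean_space \<Rightarrow> real"
  assumes "\<phi> differentiable (at x)"
  shows "(\<phi> has_derivative (\<lambda>v. gradient \<phi> x \<bullet> v)) (at x)"
proof -
  have d: "(\<phi> has_derivative frechet_derivative \<phi> (at x)) (at x)"
    using assms by (simp add: frechet_derivative_works)
  then interpret bounded_linear "frechet_derivative \<phi> (at x)"
    by (rule has_derivative_bounded_linear)
  have "frechet_derivative \<phi> (at x) v = gradient \<phi> x \<bullet> v" for v
  proof -
    have "frechet_derivative \<phi> (at x) v = frechet_derivative \<phi> (at x) (\<Sum>i\<in>Basis. (v \<bullet> i) *\<^sub>R i)"
      by (simp add: euclidean_representation)
    also have "\<dots> = (\<Sum>i\<in>Basis. (v \<bullet> i) * frechet_derivative \<phi> (at x) i)"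
      by (simp add: sum scaleR)
    also have "\<dots> = gradient \<phi> x \<bullet> v"
      unfolding gradient_def inner_sum_left inner_scaleR_left
      by (intro sum.cong) (simp_all add: inner_commute mult.commute)
    finally show ?thesis .
  qed
  then have "frechet_derivative \<phi> (at x) = (\<lambda>v. gradient \<phi> x \<bullet> v)"
    by auto
  then show ?thesis
    using d by simp
qed

text \<open>Any field that represents the derivative may be used to establish smoothness, so the inductions over \<open>k\<close>
  below never compute \<open>gradient\<close> from its definition.\<close>

lemma Ck_SucI:
  fixes \<phi> :: "'a::euclidean_space \<Rightarrow> real"
  assumes "\<And>x. (\<phi> has_derivative (\<lambda>v. D x \<bullet> v)) (at x)"
    and "\<And>i. i \<in> Basis \<Longrightarrow> Ck k (\<lambda>x. D x \<bullet> i)"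
  shows "Ck (Suc k) \<phi>"
  using assms gradient_eqI[OF assms(1)] by (auto simp: differentiable_def)

lemma Ck_SucD:
  fixes \<phi> :: "'a::euclidean_space \<Rightarrow> real"
  assumes "Ck (Suc k) \<phi>"
  shows "(\<phi> has_derivative (\<lambda>v. gradient \<phi> x \<bullet> v)) (at x)"
    and "i \<in> Basis \<Longrightarrow> Ck k (\<lambda>x. gradient \<phi> x \<bullet> i)"
  using assms has_derivative_gradient by auto

lemma Ck_Suc_imp_Ck: "Ck (Suc k) \<phi> \<Longrightarrow> Ck k \<phi>"
proof (induction k arbitrary: \<phi>)
  case 0
  then show ?case
    by (simp add: continuous_at_imp_continuous_on differentiable_imp_continuous_within)
qed auto

lemma Ck_const: "Ck k (\<lambda>x::'a::euclidean_space. c)"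
proof (induction k arbitrary: c)
  case (Suc k)
  show ?case
    by (rule Ck_SucI[where D = "\<lambda>x. 0"]) (simp_all add: Suc)
qed simp

lemma Ck_inner: "Ck k (\<lambda>x::'a::euclidean_space. x \<bullet> a)"
proof (cases k)
  case 0
  then show ?thesis by (simp add: continuous_intros)
next
  case (Suc m)
  show ?thesis unfolding Suc
    by (rule Ck_SucI[where D = "\<lambda>x. a"]) 
      (auto intro!: derivative_eq_intros Ck_const simp: inner_commute)
qed

lemma Ck_add:
  fixes \<phi> \<psi> :: "'a::euclidean_space \<Rightarrow> real"
  shows "Ck k \<phi> \<Longrightarrow> Ck k \<psi> \<Longrightarrow> Ck k (\<lambda>x. \<phi> x + \<psi> x)"
proof (induction k arbitrary: \<phi> \<psi>)
  case 0
  then show ?case by (simp add: continuous_on_add)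
next
  case (Suc k)
  show ?case
  proof (rule Ck_SucI[where D = "\<lambda>x. gradient \<phi> x + gradient \<psi> x"])
    show "((\<lambda>x. \<phi> x + \<psi> x) has_derivative (\<lambda>v. (gradient \<phi> x + gradient \<psi> x) \<bullet> v)) (at x)" for x
      unfolding inner_add_left by (intro has_derivative_add Ck_SucD[OF Suc.prems(1)] Ck_SucD[OF Suc.prems(2)])
    show "Ck k (\<lambda>x. (gradient \<phi> x + gradient \<psi> x) \<bullet> i)" if "i \<in> Basis" for i
      unfolding inner_add_left
      by (rule Suc.IH[OF Ck_SucD(2)[OF Suc.prems(1) that] Ck_SucD(2)[OF Suc.prems(2) that]])
  qed
qed

lemma Ck_mult:
  fixes \<phi> \<psi> :: "'a::euclidean_space \<Rightarrow> real"
  shows "Ck k \<phi> \<Longrightarrow> Ck k \<psi> \<Longrightarrow> Ck k (\<lambda>x. \<phi> x * \<psi> x)"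
proof (induction k arbitrary: \<phi> \<psi>)
  case 0
  then show ?case by (simp add: continuous_on_mult)
next
  case (Suc k)
  show ?case
  proof (rule Ck_SucI[where D = "\<lambda>x. \<phi> x *\<^sub>R gradient \<psi> x + \<psi> x *\<^sub>R gradient \<phi> x"])
    show "((\<lambda>x. \<phi> x * \<psi> x) has_derivative (\<lambda>v. (\<phi> x *\<^sub>R gradient \<psi> x + \<psi> x *\<^sub>R gradient \<phi> x) \<bullet> v)) (at x)" for x
      using has_derivative_mult[OF Ck_SucD(1)[OF Suc.prems(1)] Ck_SucD(1)[OF Suc.prems(2)], of x]
      by (simp add: inner_add_left mult.commute)
    show "Ck k (\<lambda>x. (\<phi> x *\<^sub>R gradient \<psi> x + \<psi> x *\<^sub>R gradient \<phi> x) \<bullet> i)" if "i \<in> Basis" for i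
      unfolding inner_add_left inner_scaleR_left
      using Suc.prems that by (intro Ck_add Suc.IH) (blast intro: Ck_Suc_imp_Ck Ck_SucD(2))+
  qed
qed

lemma Ck_compose:
  fixes \<phi> :: "'a::euclidean_space \<Rightarrow> real" and h :: "real \<Rightarrow> real"
  shows "Ck k h \<Longrightarrow> Ck k \<phi> \<Longrightarrow> Ck k (\<lambda>x. h (\<phi> x))"
proof (induction k arbitrary: \<phi> h)
  case 0
  then show ?case
    using continuous_on_compose2[of UNIV h UNIV \<phi>] by simp
next
  case (Suc k)
  show ?case
  proof (rule Ck_SucI[where D = "\<lambda>x. (gradient h (\<phi> x) \<bullet> 1) *\<^sub>R gradient \<phi> x"])
    show "((\<lambda>x. h (\<phi> x)) has_derivative (\<lambda>v. ((gradient h (\<phi> x) \<bullet> 1) *\<^sub>R gradient \<phi> x) \<bullet> v)) (at x)" for x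
      using has_derivative_compose[OF Ck_SucD(1)[OF Suc.prems(2)] Ck_SucD(1)[OF Suc.prems(1)], of x]
      by simp
    show "Ck k (\<lambda>x. ((gradient h (\<phi> x) \<bullet> 1) *\<^sub>R gradient \<phi> x) \<bullet> i)" if "i \<in> Basis" for i
      unfolding inner_scaleR_left
      by (rule Ck_mult[OF Suc.IH[where h = "\<lambda>y. gradient h y \<bullet> 1"]])
        (use Ck_Suc_imp_Ck[OF Suc.prems(2)] Ck_SucD(2)[OF Suc.prems(1), of 1]
          Ck_SucD(2)[OF Suc.prems(2) that] in simp_all)
  qed
qed

lemma Ck_dilation:
  fixes \<phi> :: "'a::euclidean_space \<Rightarrow> real"
  shows "Ck k \<phi> \<Longrightarrow> Ck k (\<lambda>x. \<phi> (t *\<^sub>R x))"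
proof (induction k arbitrary: \<phi>)
  case 0
  then show ?case
    using continuous_on_compose2[of UNIV \<phi> UNIV "\<lambda>x. t *\<^sub>R x"] by (simp add: continuous_intros)
next
  case (Suc k)
  show ?case
  proof (rule Ck_SucI[where D = "\<lambda>x. t *\<^sub>R gradient \<phi> (t *\<^sub>R x)"])
    show "((\<lambda>x. \<phi> (t *\<^sub>R x)) has_derivative (\<lambda>v. (t *\<^sub>R gradient \<phi> (t *\<^sub>R x)) \<bullet> v)) (at x)" for x
      using has_derivative_compose[OF has_derivative_scaleR_right[OF has_derivative_ident]
          Ck_SucD(1)[OF Suc.prems(1)], of t x] by simp
    show "Ck k (\<lambda>x. (t *\<^sub>R gradient \<phi> (t *\<^sub>R x)) \<bullet> i)" if "i \<in> Basis" for i
      unfolding inner_scaleR_left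
      by (rule Ck_mult[OF Ck_const Suc.IH[where \<phi> = "\<lambda>y. gradient \<phi> y \<bullet> i",
              OF Ck_SucD(2)[OF Suc.prems(1) that]]])
  qed
qed

named_theorems smooth_intros

lemma smooth_const [smooth_intros]: "smooth (\<lambda>x::'a::euclidean_space. c)"
  by (simp add: smooth_def Ck_const)

lemma smooth_inner [smooth_intros]: "smooth (\<lambda>x::'a::euclidean_space. x \<bullet> a)"
  by (simp add: smooth_def Ck_inner)

lemma smooth_add [smooth_intros]: "smooth \<phi> \<Longrightarrow> smooth \<psi> \<Longrightarrow> smooth (\<lambda>x. \<phi> x + \<psi> x)"
  by (simp add: smooth_def Ck_add)

lemma smooth_mult [smooth_intros]: "smooth \<phi> \<Longrightarrow> smooth \<psi> \<Longrightarrow> smooth (\<lambda>x. \<phi> x * \<psi> x)"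
  by (simp add: smooth_def Ck_mult)

lemma smooth_compose: "smooth h \<Longrightarrow> smooth \<phi> \<Longrightarrow> smooth (\<lambda>x. h (\<phi> x))"
  for h :: "real \<Rightarrow> real"
  by (simp add: smooth_def Ck_compose)

lemma smooth_dilation [smooth_intros]: "smooth \<phi> \<Longrightarrow> smooth (\<lambda>x. \<phi> (t *\<^sub>R x))"
  by (simp add: smooth_def Ck_dilation)

lemma smooth_ident [smooth_intros]: "smooth (\<lambda>x::real. x)"
  using smooth_inner[of "1::real"] by simp

lemma smooth_diff [smooth_intros]:
  assumes "smooth \<phi>" "smooth \<psi>"
  shows "smooth (\<lambda>x. \<phi> x - \<psi> x)"
  using smooth_add[OF assms(1) smooth_mult[OF smooth_const[of "-1"] assms(2)]] by simp

lemma smooth_sum [smooth_intros]: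
  "(\<And>i. i \<in> I \<Longrightarrow> smooth (\<phi> i)) \<Longrightarrow> smooth (\<lambda>x. \<Sum>i\<in>I. \<phi> i x)"
  by (induction I rule: infinite_finite_induct) (auto intro: smooth_intros)

lemma smooth_prod [smooth_intros]:
  "(\<And>i. i \<in> I \<Longrightarrow> smooth (\<phi> i)) \<Longrightarrow> smooth (\<lambda>x. \<Prod>i\<in>I. \<phi> i x)"
  by (induction I rule: infinite_finite_induct) (auto intro: smooth_intros)

lemma smooth_power2 [smooth_intros]: "smooth \<phi> \<Longrightarrow> smooth (\<lambda>x. (\<phi> x)\<^sup>2)"
  unfolding power2_eq_square by (intro smooth_intros)

lemma smooth_norm_square [smooth_intros]: "smooth (\<lambda>x::'a::euclidean_space. (norm x)\<^sup>2)"
proof -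
  have "smooth (\<lambda>x::'a. \<Sum>i\<in>Basis. (x \<bullet> i)\<^sup>2)"
    by (intro smooth_intros)
  moreover have "(norm x)\<^sup>2 = (\<Sum>i\<in>Basis. (x \<bullet> i)\<^sup>2)" for x :: 'a
    unfolding power2_norm_eq_inner by (subst euclidean_inner) (simp add: power2_eq_square)
  ultimately show ?thesis
    by presburger
qed

lemma smooth_has_derivative:
  "smooth \<phi> \<Longrightarrow> (\<phi> has_derivative (\<lambda>v. gradient \<phi> x \<bullet> v)) (at x)"
  by (rule Ck_SucD(1)[of 0]) (simp only: smooth_def)

lemma smooth_gradient_inner_Basis: "smooth \<phi> \<Longrightarrow> i \<in> Basis \<Longrightarrow> smooth (\<lambda>x. gradient \<phi> x \<bullet> i)"
  unfolding smooth_def using Ck_SucD(2) by blast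

lemma smooth_continuous_on: "smooth \<phi> \<Longrightarrow> continuous_on A \<phi>"
  unfolding smooth_def using Ck.simps(1) continuous_on_subset by blast

lemma smooth_continuous_on_gradient:
  fixes \<phi> :: "'a::euclidean_space \<Rightarrow> real"
  assumes "smooth \<phi>"
  shows "continuous_on A (gradient \<phi>)"
proof -
  have "continuous_on A (\<lambda>x. \<Sum>i\<in>Basis. (gradient \<phi> x \<bullet> i) *\<^sub>R i)"
    by (intro continuous_intros smooth_continuous_on smooth_gradient_inner_Basis assms)
  then show ?thesis
    by (simp add: euclidean_representation)
qed

lemma borel_measurable_smooth:
  "smooth \<phi> \<Longrightarrow> \<phi> \<in> borel_measurable borel"
  by (simp add: borel_measurable_continuous_onI smooth_continuous_on)

lemma borel_measurable_gradient:
  "smooth \<phi> \<Longrightarrow> gradient \<phi> \<in> borel_measurable borel"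
  by (simp add: borel_measurable_continuous_onI smooth_continuous_on_gradient)

lemma gradient_mult:
  fixes \<phi> \<psi> :: "'a::euclidean_space \<Rightarrow> real"
  assumes "smooth \<phi>" "smooth \<psi>"
  shows "gradient (\<lambda>x. \<phi> x * \<psi> x) x = \<phi> x *\<^sub>R gradient \<psi> x + \<psi> x *\<^sub>R gradient \<phi> x"
  by (rule gradient_eqI)
    (use has_derivative_mult[OF smooth_has_derivative[OF assms(1)] smooth_has_derivative[OF assms(2)], of x]
      in \<open>simp add: inner_add_left mult.commute\<close>)

lemma gradient_diff:
  fixes \<phi> \<psi> :: "'a::euclidean_space \<Rightarrow> real"
  assumes "smooth \<phi>" "smooth \<psi>"
  shows "gradient (\<lambda>x. \<phi> x - \<psi> x) x = gradient \<phi> x - gradient \<psi> x"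
  by (rule gradient_eqI)
    (use has_derivative_diff[OF smooth_has_derivative[OF assms(1)] smooth_has_derivative[OF assms(2)], of x]
      in \<open>simp add: inner_diff_left\<close>)

lemma gradient_dilation:
  fixes \<phi> :: "'a::euclidean_space \<Rightarrow> real"
  assumes "smooth \<phi>"
  shows "gradient (\<lambda>x. \<phi> (t *\<^sub>R x)) x = t *\<^sub>R gradient \<phi> (t *\<^sub>R x)"
  by (rule gradient_eqI)
    (use has_derivative_compose[OF has_derivative_scaleR_right[OF has_derivative_ident]
        smooth_has_derivative[OF assms], of t x] in simp)

lemma gradient_radial:
  fixes \<Phi> \<Phi>' :: "real \<Rightarrow> real"
  assumes "\<And>y. (\<Phi> has_real_derivative \<Phi>' y) (at y)"
  shows "gradient (\<lambda>x::'a::euclidean_space. \<Phi> ((norm x)\<^sup>2)) x = (2 * \<Phi>' ((norm x)\<^sup>2)) *\<^sub>R x"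
proof (rule gradient_eqI)
  have "((\<lambda>x::'a. x \<bullet> x) has_derivative (\<lambda>v. 2 * (x \<bullet> v))) (at x)"
    by (auto intro!: derivative_eq_intros simp: inner_commute)
  moreover have "(\<Phi> has_derivative (\<lambda>v. \<Phi>' (x \<bullet> x) * v)) (at (x \<bullet> x))"
    using assms[of "x \<bullet> x"] by (simp add: has_field_derivative_def)
  ultimately show "((\<lambda>x::'a. \<Phi> ((norm x)\<^sup>2)) has_derivative (\<lambda>v. ((2 * \<Phi>' ((norm x)\<^sup>2)) *\<^sub>R x) \<bullet> v)) (at x)"
    using has_derivative_compose[of "\<lambda>x. x \<bullet> x" "\<lambda>v. 2 * (x \<bullet> v)" x UNIV \<Phi> "\<lambda>v. \<Phi>' (x \<bullet> x) * v"]
    by (simp add: power2_norm_eq_inner algebra_simps)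
qed

lemma gradient_inner: "gradient (\<lambda>x::'a::euclidean_space. x \<bullet> a) x = a"
  by (rule gradient_eqI) (auto intro!: derivative_eq_intros simp: inner_commute)

lemma smooth_ray_derivative:
  fixes \<phi> :: "'a::euclidean_space \<Rightarrow> real"
  assumes "smooth \<phi>"
  shows "((\<lambda>t. \<phi> (a + t *\<^sub>R b)) has_real_derivative (gradient \<phi> (a + t *\<^sub>R b) \<bullet> b)) (at t)"
  unfolding has_field_derivative_def
  by (rule has_derivative_eq_rhs[OF has_derivative_compose[OF _ smooth_has_derivative[OF assms]]])
    (auto intro!: derivative_eq_intros)

text \<open>On the line, smoothness can be read off any function known to be the derivative; this is how
  the bump functions below are seen to be smooth.\<close>

lemma smooth_primitive:
  fixes h h' :: "real \<Rightarrow> real"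
  assumes "\<And>x. (h has_real_derivative h' x) (at x)" "smooth h'"
  shows "smooth h"
  unfolding smooth_def
proof
  fix k
  have "(h has_derivative (\<lambda>v. h' x \<bullet> v)) (at x)" for x
    using assms(1)[of x] by (simp add: has_field_derivative_def)
  then have "Ck (Suc k) h"
    by (rule Ck_SucI) (use assms(2) in \<open>simp add: smooth_def\<close>)
  then show "Ck k h"
    by (rule Ck_Suc_imp_Ck)
qed

section \<open>Bump functions\<close>

text \<open>The functions \<open>p(1/x) exp(-1/x)\<close>, \<open>x > 0\<close>, with a polynomial \<open>p\<close>: up to the choice of \<open>p\<close>
  they are closed under differentiation, and \<open>p = 1\<close> gives the standard flat function.\<close>

definition flat :: "real poly \<Rightarrow> real \<Rightarrow> real" where
  "flat p x = (if x > 0 then poly p (1 / x) * exp (- (1 / x)) else 0)"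

lemma poly_times_exp_tendsto_0: "((\<lambda>y::real. poly p y * exp (- y)) \<longlongrightarrow> 0) at_top"
proof -
  have "((\<lambda>y::real. \<Sum>i\<le>degree p. coeff p i * (y ^ i / exp y)) \<longlongrightarrow> (\<Sum>i\<le>degree p. coeff p i * 0)) at_top"
    by (intro tendsto_sum tendsto_mult tendsto_const tendsto_power_div_exp_0)
  then show ?thesis
    by (simp add: poly_altdef sum_distrib_right exp_minus divide_inverse mult.assoc)
qed

text \<open>At the origin the difference quotient is again a polynomial in \<open>1/x\<close> times \<open>exp(-1/x)\<close>, hence tends to
  zero; elsewhere this is the product rule.\<close>

lemma flat_has_derivative:
  "(flat p has_real_derivative flat ([:0, 0, 1:] * (p - pderiv p)) x) (at x)"
proof -
  let ?q = "[:0, 0, 1:] * (p - pderiv p)"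
  consider "x > 0" | "x < 0" | "x = 0" by linarith
  then show ?thesis
  proof cases
    case 1
    have "((\<lambda>x. poly p (1 / x)) has_real_derivative (poly (pderiv p) (1 / x) * (- (1 / x\<^sup>2)))) (at x)"
      by (rule DERIV_chain2[OF poly_DERIV]) (use 1 in \<open>auto intro!: derivative_eq_intros simp: power2_eq_square\<close>)
    moreover have "((\<lambda>x. exp (- (1 / x))) has_real_derivative (exp (- (1 / x)) * (1 / x\<^sup>2))) (at x)"
      using 1 by (auto intro!: derivative_eq_intros simp: power2_eq_square)
    ultimately have "((\<lambda>x. poly p (1 / x) * exp (- (1 / x))) has_real_derivative flat ?q x) (at x)"
      by (rule DERIV_cong[OF DERIV_mult])
        (use 1 in \<open>simp add: flat_def power2_eq_square algebra_simps\<close>)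
    then show ?thesis
      by (rule has_field_derivative_transform_within_open[where S = "{0<..}"])
        (use 1 in \<open>auto simp: flat_def\<close>)
  next
    case 2
    have "((\<lambda>x. 0) has_real_derivative flat ?q x) (at x)"
      using 2 by (simp add: flat_def)
    then show ?thesis
      by (rule has_field_derivative_transform_within_open[where S = "{..<0}"])
        (use 2 in \<open>auto simp: flat_def\<close>)
  next
    case 3
    have "((\<lambda>h. flat p h / h) \<longlongrightarrow> 0) (at 0)"
    proof (rule filterlim_split_at)
      show "((\<lambda>h. flat p h / h) \<longlongrightarrow> 0) (at_left 0)"
        by (rule tendsto_eventually)
          (auto simp: flat_def eventually_at_filter intro!: always_eventually)
      have "((\<lambda>y. flat p (inverse y) / inverse y) \<longlongrightarrow> 0) at_top"
        by (rule Lim_transform_eventually[OF poly_times_exp_tendsto_0[of "[:0, 1:] * p"]])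
          (auto simp: flat_def inverse_eq_divide intro!: eventually_mono[OF eventually_gt_at_top[of 0]])
      then show "((\<lambda>h. flat p h / h) \<longlongrightarrow> 0) (at_right 0)"
        by (subst filterlim_at_right_to_top)
    qed
    then show ?thesis
      using 3 by (simp add: DERIV_def flat_def)
  qed
qed

lemma smooth_flat: "smooth (flat p)"
proof -
  have "Ck k (flat p)" for k
  proof (induction k arbitrary: p)
    case 0
    show ?case
      using DERIV_isCont[OF flat_has_derivative[of p]] by (simp add: continuous_at_imp_continuous_on)
  next
    case (Suc k)
    have "(flat p has_derivative (\<lambda>v. flat ([:0, 0, 1:] * (p - pderiv p)) x \<bullet> v)) (at x)" for x
      using flat_has_derivative[of p x] by (simp add: has_field_derivative_def)
    then show ?case
      by (rule Ck_SucI) (use Suc in simp)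
  qed
  then show ?thesis
    by (simp add: smooth_def)
qed

text \<open>A base point to the left of the interval on which \<open>\<rho>\<close> lives makes the primitive vanish on the left side.\<close>

lemma smooth_bump_primitive:
  fixes \<rho> :: "real \<Rightarrow> real"
  assumes \<rho>: "smooth \<rho>" "\<And>x. \<not> (p < x \<and> x < q) \<Longrightarrow> \<rho> x = 0"
    and "p < q"
  obtains T where "smooth T" "\<And>x. (T has_real_derivative \<rho> x) (at x)"
    "\<And>x. x \<le> p \<Longrightarrow> T x = 0" "\<And>x. x \<ge> q \<Longrightarrow> T x = integral {p..q} \<rho>"
proof -
  define T where "T x = integral {p - 1..x} \<rho>" for x
  have int: "\<rho> integrable_on {a..b}" for a b
    by (rule integrable_continuous_interval) (rule smooth_continuous_on[OF \<rho>(1)])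
  have deriv: "(T has_real_derivative \<rho> x) (at x)" for x
  proof (cases "x > p - 1")
    case True
    have "(T has_real_derivative \<rho> x) (at x within {p - 1..x + 1})"
      unfolding T_def
      by (rule integral_has_real_derivative) (use True smooth_continuous_on[OF \<rho>(1)] in auto)
    then show ?thesis
      using True by (simp add: at_within_Icc_at)
  next
    case False
    have 0: "T y = 0" if "y < p" for y
      unfolding T_def by (rule integral_unique[OF has_integral_is_0]) (use that \<rho>(2) in auto)
    have "((\<lambda>x. 0) has_real_derivative \<rho> x) (at x)"
      using \<rho>(2)[of x] False by simp
    then show ?thesis
      by (rule has_field_derivative_transform_within_open[where S = "{..<p}"])
        (use False 0 in auto)
  qed
  have T0: "T x = 0" if "x \<le> p" for x
    unfolding T_def by (rule integral_unique[OF has_integral_is_0]) (use that \<rho>(2) in auto)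
  have Tq: "T x = integral {p..q} \<rho>" if "x \<ge> q" for x
  proof -
    have "T x = integral {p - 1..p} \<rho> + integral {p..x} \<rho>"
      unfolding T_def using that \<open>p < q\<close> by (intro Henstock_Kurzweil_Integration.integral_combine[symmetric] int) auto
    also have "integral {p - 1..p} \<rho> = 0"
      by (rule integral_unique[OF has_integral_is_0]) (use \<rho>(2) in auto)
    also have "integral {p..x} \<rho> = integral {p..q} \<rho> + integral {q..x} \<rho>"
      using that \<open>p < q\<close> by (intro Henstock_Kurzweil_Integration.integral_combine[symmetric] int) auto
    also have "integral {q..x} \<rho> = 0"
      by (rule integral_unique[OF has_integral_is_0]) (use \<rho>(2) in auto)
    finally show ?thesis by simp
  qed
  show thesis
    by (rule that[OF smooth_primitive[OF deriv \<rho>(1)] deriv T0 Tq])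
qed

text \<open>The normalised primitive of the bump that is positive exactly on the unit interval.\<close>

lemma smooth_step_exists:
  obtains S S' :: "real \<Rightarrow> real" and C where "smooth S" "smooth S'"
    "\<And>x. (S has_real_derivative S' x) (at x)"
    "\<And>x. x \<le> 0 \<Longrightarrow> S x = 0" "\<And>x. x \<ge> 1 \<Longrightarrow> S x = 1" "\<And>x. 0 \<le> S x" "\<And>x. S x \<le> 1"
    "\<And>x. x \<le> 0 \<Longrightarrow> S' x = 0" "\<And>x. x \<ge> 1 \<Longrightarrow> S' x = 0" "\<And>x. \<bar>S' x\<bar> \<le> C"
proof -
  define \<beta> where "\<beta> x = flat 1 x * flat 1 (1 + (-1) * x)" for x
  have pos: "\<beta> x > 0" if "0 < x" "x < 1" for x
    using that by (simp add: \<beta>_def flat_def)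
  have nonneg: "\<beta> x \<ge> 0" for x
    by (simp add: \<beta>_def flat_def)
  have le1: "\<bar>\<beta> x\<bar> \<le> 1" for x
  proof -
    have flat01: "0 \<le> flat 1 y" "flat 1 y \<le> 1" for y
      by (simp_all add: flat_def)
    show ?thesis
      unfolding \<beta>_def abs_mult using flat01 by (intro mult_le_one) simp_all
  qed
  have zero: "\<not> (0 < x \<and> x < 1) \<Longrightarrow> \<beta> x = 0" for x
    by (auto simp: \<beta>_def flat_def)
  have sm: "smooth \<beta>"
    unfolding \<beta>_def by (intro smooth_intros smooth_flat smooth_compose[OF smooth_flat])
  obtain T where T: "smooth T" "\<And>x. (T has_real_derivative \<beta> x) (at x)"
    "\<And>x. x \<le> 0 \<Longrightarrow> T x = 0" "\<And>x. x \<ge> 1 \<Longrightarrow> T x = integral {0..1} \<beta>"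
    using smooth_bump_primitive[OF sm zero zero_less_one] by blast
  have mono: "T x \<le> T y" if "x \<le> y" for x y
    using DERIV_nonneg_imp_nondecreasing[OF that, of T] T(2) nonneg by blast
  have Tpos: "T x > 0" if "x > 0" for x
  proof -
    have "T 0 < T (min x 1)"
    proof (rule DERIV_pos_imp_increasing_open[of 0 "min x 1" T])
      show "\<exists>y'. DERIV T y :> y' \<and> y' > 0" if "0 < y" "y < min x 1" for y
        using that pos[of y] T(2)[of y] by auto
      show "continuous_on {0..min x 1} T"
        using DERIV_isCont[OF T(2)] by (simp add: continuous_at_imp_continuous_on)
    qed (use that in simp)
    also have "\<dots> \<le> T x" by (rule mono) simp
    finally show ?thesis using T(3)[of 0] by simp
  qed
  have m: "T 1 > 0" "x \<ge> 1 \<Longrightarrow> T x = T 1" for x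
    using Tpos[of 1] T(4)[of 1] T(4)[of x] by simp_all
  have T_nonneg: "T x \<ge> 0" for x
    using T(3)[of x] Tpos[of x] by (cases "x \<le> 0") auto
  have T_le: "T x \<le> T 1" for x
    using mono[of x 1] m(2)[of x] by (cases "x \<le> 1") auto
  show thesis
  proof (rule that[of "\<lambda>x. 1 / T 1 * T x" "\<lambda>x. 1 / T 1 * \<beta> x" "1 / T 1"])
    show "((\<lambda>x. 1 / T 1 * T x) has_real_derivative 1 / T 1 * \<beta> x) (at x)" for x
      by (rule DERIV_cmult[OF T(2)])
    show "smooth (\<lambda>x. 1 / T 1 * T x)" "smooth (\<lambda>x. 1 / T 1 * \<beta> x)"
      by (intro smooth_intros T(1) sm)+
    show "1 / T 1 * T x = 1" if "x \<ge> 1" for x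
      using m(1) m(2)[OF that] by (simp only: nonzero_divide_eq_eq divide_self_if) simp
    show "\<bar>1 / T 1 * \<beta> x\<bar> \<le> 1 / T 1" for x
      using m(1) le1[of x] by (simp add: abs_mult divide_right_mono)
  qed (use T(3) m(1) T_nonneg T_le Tpos zero in \<open>auto simp: divide_le_eq_1\<close>)
qed

text \<open>Scaled smooth steps turn the indicator of an open interval into a bounded pointwise limit of
  smooth functions supported in that interval.\<close>

lemma smooth_approx_interval:
  obtains \<beta> :: "nat \<Rightarrow> real \<Rightarrow> real \<Rightarrow> real \<Rightarrow> real" where
    "\<And>n p q. smooth (\<beta> n p q)"
    "\<And>n p q x. 0 \<le> \<beta> n p q x" "\<And>n p q x. \<beta> n p q x \<le> 1"
    "\<And>n p q x. \<not> (p < x \<and> x < q) \<Longrightarrow> \<beta> n p q x = 0"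
    "\<And>p q x. (\<lambda>n. \<beta> n p q x) \<longlonglongrightarrow> indicator {p<..<q} x"
proof -
  obtain S S' :: "real \<Rightarrow> real" where S: "smooth S" "\<And>x. x \<le> 0 \<Longrightarrow> S x = 0" "\<And>x. x \<ge> 1 \<Longrightarrow> S x = 1"
    "\<And>x. 0 \<le> S x" "\<And>x. S x \<le> 1"
    using smooth_step_exists by metis
  define \<beta> where "\<beta> n p q x = S (real n * (x - p)) * S (real n * (q - x))" for n p q x
  have lim: "(\<lambda>n. S (real n * y)) \<longlonglongrightarrow> 1" if y: "y > 0" for y
  proof (rule tendsto_eventually)
    obtain N :: nat where N: "real N * y > 1"
      using reals_Archimedean3[OF y] by blast
    show "\<forall>\<^sub>F n in sequentially. S (real n * y) = 1"
      using eventually_ge_at_top[of N]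
    proof eventually_elim
      case (elim n)
      have "1 \<le> real N * y" using N by simp
      also have "\<dots> \<le> real n * y" using elim y by (intro mult_right_mono) auto
      finally show ?case by (rule S(3))
    qed
  qed
  show thesis
  proof (rule that[of \<beta>])
    show "smooth (\<beta> n p q)" for n p q
      unfolding \<beta>_def by (intro smooth_intros smooth_compose[OF S(1)])
    show zero: "\<beta> n p q x = 0" if "\<not> (p < x \<and> x < q)" for n p q x
      using S(2)[of "real n * (x - p)"] S(2)[of "real n * (q - x)"] that
      by (auto simp: \<beta>_def mult_le_0_iff not_less)
    show "(\<lambda>n. \<beta> n p q x) \<longlonglongrightarrow> indicator {p<..<q} x" for p q x
    proof (cases "p < x \<and> x < q")
      case True
      then show ?thesis
        using tendsto_mult[OF lim[of "x - p"] lim[of "q - x"]] by (simp add: \<beta>_def)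
    next
      case False
      then show ?thesis
        using zero[OF False] by auto
    qed
  qed (use S in \<open>auto simp: \<beta>_def mult_le_one\<close>)
qed

section \<open>Integration\<close>

text \<open>Lebesgue differentiation along small cubes: at almost every point the averages over the cubes
  \<open>[x, x + h]\<close> converge to the value of \<open>f\<close>.\<close>

lemma AE_nonneg_if_box_integrals_nonneg:
  fixes f :: "'a::euclidean_space \<Rightarrow> real"
  assumes "open \<Omega>"
    and int: "\<And>a b. cbox a b \<subseteq> \<Omega> \<Longrightarrow> f integrable_on cbox a b"
    and nonneg: "\<And>a b. cbox a b \<subseteq> \<Omega> \<Longrightarrow> integral (cbox a b) f \<ge> 0"
  shows "AE x in lebesgue. x \<in> \<Omega> \<longrightarrow> f x \<ge> 0"
proof -
  have loc: "AE x in lebesgue. x \<in> cbox c d \<longrightarrow> f x \<ge> 0" if cd: "cbox c d \<subseteq> \<Omega>" for c d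
  proof -
    define g where "g x = (if x \<in> cbox c d then f x else 0)" for x
    have "g integrable_on UNIV"
      unfolding g_def by (subst integrable_restrict_UNIV) (rule int[OF cd])
    then have "g integrable_on cbox a b" for a b
      using integrable_on_subcbox by blast
    then obtain N where N: "negligible N"
      "\<And>x e. \<lbrakk>x \<notin> N; 0 < e\<rbrakk> \<Longrightarrow> \<exists>\<delta>>0. \<forall>h. 0 < h \<and> h < \<delta> \<longrightarrow>
         norm (integral (cbox x (x + h *\<^sub>R One)) g /\<^sub>R h ^ DIM('a) - g x) < e"
      using integrable_ccontinuous_explicit[of g] by metis
    have pos: "f x \<ge> 0" if x: "x \<in> box c d" "x \<notin> N" for x
    proof (rule ccontr)
      assume neg: "\<not> f x \<ge> 0"
      have gx: "g x = f x"
        using x box_subset_cbox by (auto simp: g_def)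
      obtain \<delta> where \<delta>: "\<delta> > 0" "\<And>h. 0 < h \<Longrightarrow> h < \<delta> \<Longrightarrow>
         norm (integral (cbox x (x + h *\<^sub>R One)) g /\<^sub>R h ^ DIM('a) - g x) < - f x"
        using N(2)[of x "- f x"] x neg by auto
      obtain \<epsilon> where \<epsilon>: "\<epsilon> > 0" "ball x \<epsilon> \<subseteq> box c d"
        using x open_box open_contains_ball by metis
      define h where "h = min (\<delta> / 2) (\<epsilon> / (2 * (norm (One::'a) + 1)))"
      have h: "0 < h" "h < \<delta>" "h * (norm (One::'a) + 1) < \<epsilon>"
      proof -
        show "0 < h" "h < \<delta>"
          using \<delta> \<epsilon> by (auto simp: h_def min_less_iff_disj intro!: divide_pos_pos add_nonneg_pos)
        have "h * (norm (One::'a) + 1) \<le> \<epsilon> / (2 * (norm (One::'a) + 1)) * (norm (One::'a) + 1)"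
          by (intro mult_right_mono) (auto simp: h_def)
        also have "\<dots> = \<epsilon> / 2"
          by (simp add: field_simps add_nonneg_eq_0_iff)
        finally show "h * (norm (One::'a) + 1) < \<epsilon>"
          using \<epsilon>(1) by linarith
      qed
      have sub: "cbox x (x + h *\<^sub>R One) \<subseteq> box c d"
      proof (rule subset_trans[OF _ \<epsilon>(2)], rule)
        fix y assume y: "y \<in> cbox x (x + h *\<^sub>R One)"
        have "norm (y - x) \<le> norm (h *\<^sub>R (One::'a))"
          by (rule norm_le_componentwise)
            (use y h(1) in \<open>auto simp: mem_box inner_diff_left inner_add_left\<close>)
        also have "\<dots> \<le> h * (norm (One::'a) + 1)"
          using h(1) by (simp add: algebra_simps)
        finally show "y \<in> ball x \<epsilon>"
          using h(3) by (simp add: dist_norm norm_minus_commute)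
      qed
      then have sub': "cbox x (x + h *\<^sub>R One) \<subseteq> cbox c d"
        using box_subset_cbox by blast
      have "integral (cbox x (x + h *\<^sub>R One)) g = integral (cbox x (x + h *\<^sub>R One)) f"
        by (rule integral_cong) (use sub' in \<open>auto simp: g_def\<close>)
      also have "\<dots> \<ge> 0"
        by (rule nonneg) (use sub' cd in blast)
      finally have "integral (cbox x (x + h *\<^sub>R One)) g /\<^sub>R h ^ DIM('a) \<ge> 0"
        using h(1) by simp
      then show False
        using \<delta>(2)[OF h(1,2)] gx by (simp add: abs_if split: if_splits)
    qed
    \<comment> \<open>The cubes that start at \<open>x\<close> must lie in the box, so the boundary of the box is left out.\<close>
    have "negligible (N \<union> (cbox c d - box c d))"
      using N(1) negligible_frontier_interval by (rule negligible_Un)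
    then have "AE x in lebesgue. x \<notin> N \<union> (cbox c d - box c d)"
      using AE_not_in[of "N \<union> (cbox c d - box c d)" lebesgue] by (simp only: negligible_iff_null_sets)
    then show ?thesis
      by eventually_elim (use pos in auto)
  qed
  obtain D where D: "countable D" "\<And>X. X \<in> D \<Longrightarrow> X \<subseteq> \<Omega> \<and> (\<exists>a b. X = cbox a b)" "\<Union>D = \<Omega>"
    using open_countable_Union_open_cbox[OF \<open>open \<Omega>\<close>] by (metis PowD subsetD)
  have "\<forall>X\<in>D. AE x in lebesgue. x \<in> X \<longrightarrow> f x \<ge> 0"
    using D(2) loc by metis
  then have "AE x in lebesgue. \<forall>X\<in>D. x \<in> X \<longrightarrow> f x \<ge> 0"
    by (subst AE_ball_countable[OF D(1)])
  then show ?thesis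
    by eventually_elim (use D(3) in blast)
qed

text \<open>The mean value theorem bounds the difference quotients by \<open>B\<close>, so dominated convergence applies.\<close>

lemma has_derivative_under_integral:
  fixes H H' :: "real \<Rightarrow> 'a \<Rightarrow> real"
  assumes t0: "a < t0" "t0 < b"
    and deriv: "\<And>t x. a < t \<Longrightarrow> t < b \<Longrightarrow> x \<in> space M \<Longrightarrow> ((\<lambda>t. H t x) has_real_derivative H' t x) (at t)"
    and int: "\<And>t. a < t \<Longrightarrow> t < b \<Longrightarrow> integrable M (H t)"
    and bound: "\<And>t x. a < t \<Longrightarrow> t < b \<Longrightarrow> x \<in> space M \<Longrightarrow> \<bar>H' t x\<bar> \<le> B x"
    and B: "integrable M B"
  shows "((\<lambda>t. \<integral>x. H t x \<partial>M) has_real_derivative (\<integral>x. H' t0 x \<partial>M)) (at t0)"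
  unfolding has_field_derivative_iff tendsto_at_iff_sequentially
proof (intro allI impI)
  fix X :: "nat \<Rightarrow> real"
  assume X: "\<forall>i. X i \<in> UNIV - {t0}" "X \<longlonglongrightarrow> t0"
  have "\<forall>\<^sub>F n in sequentially. X n \<in> {a<..<b}"
    using X(2) t0 by (intro topological_tendstoD) auto
  then obtain N where N: "\<And>n. n \<ge> N \<Longrightarrow> a < X n \<and> X n < b"
    by (auto simp: eventually_sequentially)
  define s where "s n x = (H (X (n + N)) x - H t0 x) / (X (n + N) - t0)" for n x
  have lim: "(\<lambda>n. s n x) \<longlonglongrightarrow> H' t0 x" if "x \<in> space M" for x
  proof -
    have "((\<lambda>y. (H y x - H t0 x) / (y - t0)) \<longlongrightarrow> H' t0 x) (at t0)"
      using deriv[OF t0 that] by (simp add: has_field_derivative_iff)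
    then have "((\<lambda>y. (H y x - H t0 x) / (y - t0)) \<circ> X) \<longlonglongrightarrow> H' t0 x"
      unfolding tendsto_at_iff_sequentially using X by blast
    then show ?thesis
      unfolding s_def o_def by (rule LIMSEQ_ignore_initial_segment)
  qed
  have s_int: "integrable M (s n)" for n
    unfolding s_def using N[of "n + N"] t0 by (intro integrable_divide Bochner_Integration.integrable_diff int) auto
  have s_bound: "norm (s n x) \<le> B x" if x: "x \<in> space M" for n x
  proof -
    define y where "y = X (n + N)"
    have y: "a < y" "y < b" "y \<noteq> t0"
      using N[of "n + N"] X(1) by (auto simp: y_def)
    have "\<exists>z. a < z \<and> z < b \<and> H y x - H t0 x = (y - t0) * H' z x"
    proof (cases "y > t0")
      case True
      then obtain z where "t0 < z" "z < y" "H y x - H t0 x = (y - t0) * H' z x"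
        using MVT2[of t0 y "\<lambda>t. H t x" "\<lambda>t. H' t x"] deriv x t0 y by force
      then show ?thesis using t0 y by (intro exI[of _ z]) auto
    next
      case False
      then have "y < t0" using y by simp
      then obtain z where "y < z" "z < t0" "H t0 x - H y x = (t0 - y) * H' z x"
        using MVT2[of y t0 "\<lambda>t. H t x" "\<lambda>t. H' t x"] deriv x t0 y by force
      then show ?thesis using t0 y by (intro exI[of _ z]) (auto simp: algebra_simps)
    qed
    then obtain z where z: "a < z" "z < b" "H y x - H t0 x = (y - t0) * H' z x"
      by blast
    have "s n x = H' z x"
      using z(3) y(3) by (simp add: s_def y_def[symmetric])
    then show ?thesis
      using bound[OF z(1,2) x] by simp
  qed
  have meas: "H' t0 \<in> borel_measurable M"
    by (rule borel_measurable_LIMSEQ_real[where u = s]) (use lim s_int in auto)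
  have "(\<lambda>n. \<integral>x. s n x \<partial>M) \<longlonglongrightarrow> (\<integral>x. H' t0 x \<partial>M)"
    by (rule integral_dominated_convergence[where w = B])
      (use lim s_bound s_int B meas in \<open>auto intro: AE_I2\<close>)
  moreover have "(\<integral>x. s n x \<partial>M) = ((\<integral>x. H (X (n + N)) x \<partial>M) - (\<integral>x. H t0 x \<partial>M)) / (X (n + N) - t0)" for n
    unfolding s_def using N[of "n + N"] t0 int by simp
  ultimately have "(\<lambda>n. ((\<lambda>y. ((\<integral>x. H y x \<partial>M) - (\<integral>x. H t0 x \<partial>M)) / (y - t0)) \<circ> X) (n + N))
      \<longlonglongrightarrow> (\<integral>x. H' t0 x \<partial>M)"
    by simp
  then show "((\<lambda>y. ((\<integral>x. H y x \<partial>M) - (\<integral>x. H t0 x \<partial>M)) / (y - t0)) \<circ> X) \<longlonglongrightarrow> (\<integral>x. H' t0 x \<partial>M)"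
    by (rule LIMSEQ_offset)
qed

lemma lborel_dilation:
  fixes c :: real
  assumes "c > 0"
  shows "distr lborel borel (\<lambda>x::'a::euclidean_space. c *\<^sub>R x) = density lborel (\<lambda>_. ennreal ((1 / c) ^ DIM('a)))"
proof -
  have "density lborel (\<lambda>_. ennreal ((1 / c) ^ DIM('a))) =
      density (density (distr lborel borel (\<lambda>x::'a. c *\<^sub>R x)) (\<lambda>_. ennreal (c ^ DIM('a)))) (\<lambda>_. ennreal ((1 / c) ^ DIM('a)))"
    by (subst lborel_affine[of c 0]) (use assms in simp_all)
  also have "\<dots> = density (distr lborel borel (\<lambda>x::'a. c *\<^sub>R x)) (\<lambda>_. 1)"
    using assms by (subst density_density_eq) (simp_all flip: ennreal_mult' power_mult_distrib)
  finally show ?thesis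
    by (simp add: density_1)
qed

lemma nn_integral_dilation:
  fixes h :: "'a::euclidean_space \<Rightarrow> ennreal"
  assumes "c > 0" and [measurable]: "h \<in> borel_measurable borel"
  shows "(\<integral>\<^sup>+x. h (c *\<^sub>R x) \<partial>lborel) = ennreal ((1 / c) ^ DIM('a)) * (\<integral>\<^sup>+x. h x \<partial>lborel)"
proof -
  have "(\<integral>\<^sup>+x. h (c *\<^sub>R x) \<partial>lborel) = (\<integral>\<^sup>+x. h x \<partial>distr lborel borel (\<lambda>x::'a. c *\<^sub>R x))"
    by (subst nn_integral_distr) simp_all
  also have "\<dots> = ennreal ((1 / c) ^ DIM('a)) * (\<integral>\<^sup>+x. h x \<partial>lborel)"
    unfolding lborel_dilation[OF assms(1)] by (subst nn_integral_density) (simp_all add: nn_integral_cmult)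
  finally show ?thesis .
qed

lemma integral_dilation:
  fixes h :: "'a::euclidean_space \<Rightarrow> real"
  assumes "c > 0" and [measurable]: "h \<in> borel_measurable borel"
  shows "(\<integral>x. h (c *\<^sub>R x) \<partial>lborel) = (1 / c) ^ DIM('a) * (\<integral>x. h x \<partial>lborel)"
proof -
  have "(\<integral>x. h (c *\<^sub>R x) \<partial>lborel) = (\<integral>x. h x \<partial>distr lborel borel (\<lambda>x::'a. c *\<^sub>R x))"
    by (subst integral_distr) simp_all
  also have "\<dots> = (1 / c) ^ DIM('a) * (\<integral>x. h x \<partial>lborel)"
    unfolding lborel_dilation[OF assms(1)] using assms(1) by (subst integral_density) simp_all
  finally show ?thesis .
qed

lemma integrable_continuous_compact_support:
  fixes h :: "'a::euclidean_space \<Rightarrow> 'b::euclidean_space"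
  assumes "continuous_on UNIV h" "compact K" "\<And>x. x \<notin> K \<Longrightarrow> h x = 0"
  shows "integrable lborel h"
proof -
  have "integrable lborel (\<lambda>x. indicator K x *\<^sub>R h x)"
    using borel_integrable_compact[OF assms(2) continuous_on_subset[OF assms(1) subset_UNIV]] .
  also have "(\<lambda>x. indicator K x *\<^sub>R h x) = h"
    using assms(3) by (auto simp: indicator_def)
  finally show ?thesis .
qed

lemma gradient_eq_0_outside:
  fixes F :: "'a::euclidean_space \<Rightarrow> real"
  assumes "compact K" "\<And>x. x \<notin> K \<Longrightarrow> F x = 0" "x \<notin> K"
  shows "gradient F x = 0"
proof (rule gradient_eqI)
  have "open (- K)"
    using assms(1) by (simp add: compact_imp_closed open_Compl)
  show "(F has_derivative (\<lambda>v. 0 \<bullet> v)) (at x)"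
    by (rule has_derivative_transform_within_open[where f = "\<lambda>x. 0", OF _ \<open>open (- K)\<close>])
      (use assms in auto)
qed

text \<open>Translating a function does not change its integral, so partial derivatives of compactly
  supported functions have mean zero. This is the only form of the divergence theorem used below.\<close>

lemma integral_gradient_eq_0:
  fixes F :: "'a::euclidean_space \<Rightarrow> real"
  assumes "smooth F" "compact K" "\<And>x. x \<notin> K \<Longrightarrow> F x = 0" "i \<in> Basis"
  shows "(\<integral>x. gradient F x \<bullet> i \<partial>lborel) = 0"
proof -
  have zero: "gradient F x = 0" if "x \<notin> K" for x
    using gradient_eq_0_outside[of K F x] assms(2,3) that by blast
  define L where "L = (\<lambda>(x, t). x - t *\<^sub>R i) ` (K \<times> {-1..1::real})"
  have L: "compact L"
    unfolding L_def by (rule compact_continuous_image)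
      (auto intro!: continuous_intros compact_Times assms(2) simp: split_beta)
  have inL: "x \<in> L" if "x + t *\<^sub>R i \<in> K" "-1 \<le> t" "t \<le> 1" for x t
    unfolding L_def using that by (force intro: image_eqI[where x = "(x + t *\<^sub>R i, t)"])
  have cg: "continuous_on UNIV (\<lambda>x. gradient F x \<bullet> i)"
    by (intro continuous_intros smooth_continuous_on_gradient assms)
  have "compact ((\<lambda>x. gradient F x \<bullet> i) ` K)"
    by (intro compact_continuous_image continuous_on_subset[OF cg] assms) auto
  then obtain C where C: "\<And>x. x \<in> K \<Longrightarrow> \<bar>gradient F x \<bullet> i\<bar> \<le> C"
    using compact_imp_bounded by (force simp: bounded_iff)
  have C': "\<bar>gradient F x \<bullet> i\<bar> \<le> max C 0" for x
    using C[of x] zero[of x] by (cases "x \<in> K") auto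
  have "((\<lambda>t. \<integral>x. F (x + t *\<^sub>R i) \<partial>lborel) has_real_derivative
      (\<integral>x. gradient F (x + 0 *\<^sub>R i) \<bullet> i \<partial>lborel)) (at 0)"
  proof (rule has_derivative_under_integral[where a = "-1" and b = 1 and B = "\<lambda>x. max C 0 * indicator L x"])
    show "((\<lambda>t. F (x + t *\<^sub>R i)) has_real_derivative gradient F (x + t *\<^sub>R i) \<bullet> i) (at t)" for t x
      by (rule smooth_ray_derivative[OF assms(1)])
    show "integrable lborel (\<lambda>x. F (x + t *\<^sub>R i))" if "-1 < t" "t < 1" for t
      by (rule integrable_continuous_compact_support[OF _ L])
        (use inL[of _ t] that assms(3) in
          \<open>auto intro!: continuous_on_compose2[OF smooth_continuous_on[OF assms(1)]] continuous_intros\<close>)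
    show "\<bar>gradient F (x + t *\<^sub>R i) \<bullet> i\<bar> \<le> max C 0 * indicator L x" if "-1 < t" "t < 1" for t x
    proof (cases "x \<in> L")
      case False
      then have "x + t *\<^sub>R i \<notin> K"
        using inL[of x t] that by auto
      then show ?thesis
        using zero[of "x + t *\<^sub>R i"] by simp
    qed (use C' in simp)
    have "emeasure lborel L < \<infinity>"
      using L by (intro emeasure_bounded_finite compact_imp_bounded)
    then show "integrable lborel (\<lambda>x. max C 0 * indicator L x)"
      using L by (intro integrable_mult_right integrable_real_indicator) (auto simp: compact_imp_closed)
  qed auto
  moreover have "(\<lambda>t. \<integral>x. F (x + t *\<^sub>R i) \<partial>lborel) = (\<lambda>t. \<integral>x. F x \<partial>lborel)"
  proof
    fix t
    have [measurable]: "F \<in> borel_measurable borel"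
      by (rule borel_measurable_smooth[OF assms(1)])
    have "(\<integral>x. F x \<partial>lborel) = (\<integral>x. F x \<partial>distr lborel borel ((+) (t *\<^sub>R i)))"
      by (simp add: lborel_distr_plus)
    also have "\<dots> = (\<integral>x. F (t *\<^sub>R i + x) \<partial>lborel)"
      by (subst integral_distr) simp_all
    finally show "(\<integral>x. F (x + t *\<^sub>R i) \<partial>lborel) = (\<integral>x. F x \<partial>lborel)"
      by (simp add: add.commute)
  qed
  ultimately have "((\<lambda>t. \<integral>x. F x \<partial>lborel) has_real_derivative (\<integral>x. gradient F x \<bullet> i \<partial>lborel)) (at (0::real))"
    by simp
  then show ?thesis
    using DERIV_unique DERIV_const by blast
qed

section \<open>Square integrable functions\<close>

lemma L2_Cauchy_Schwarz:
  fixes X Y :: "'a \<Rightarrow> 'b::euclidean_space"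
  assumes "L2 M X" "L2 M Y"
  shows "integrable M (\<lambda>x. X x \<bullet> Y x)"
    and "\<bar>\<integral>x. X x \<bullet> Y x \<partial>M\<bar> \<le> sqrt (\<integral>x. (norm (X x))\<^sup>2 \<partial>M) * sqrt (\<integral>x. (norm (Y x))\<^sup>2 \<partial>M)"
proof -
  have [measurable]: "X \<in> borel_measurable M" "Y \<in> borel_measurable M"
    and int: "integrable M (\<lambda>x. (norm (X x))\<^sup>2)" "integrable M (\<lambda>x. (norm (Y x))\<^sup>2)"
    using assms by (auto simp: L2_def)
  have prod_int: "integrable M (\<lambda>x. norm (X x) * norm (Y x))"
  proof (rule Bochner_Integration.integrable_bound[OF Bochner_Integration.integrable_add[OF int]])
    show "AE x in M. norm (norm (X x) * norm (Y x)) \<le> norm ((norm (X x))\<^sup>2 + (norm (Y x))\<^sup>2)"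
    proof (rule AE_I2)
      fix x
      have "2 * (norm (X x) * norm (Y x)) \<le> (norm (X x))\<^sup>2 + (norm (Y x))\<^sup>2"
        using sum_squares_bound[of "norm (X x)" "norm (Y x)"] by simp
      then show "norm (norm (X x) * norm (Y x)) \<le> norm ((norm (X x))\<^sup>2 + (norm (Y x))\<^sup>2)"
        by (simp add: abs_mult) (smt (verit) mult_nonneg_nonneg norm_ge_zero)
    qed
  qed simp
  show *: "integrable M (\<lambda>x. X x \<bullet> Y x)"
    by (rule Bochner_Integration.integrable_bound[OF prod_int]) (auto simp: Cauchy_Schwarz_ineq2 abs_mult)
  have "(\<integral>\<^sup>+x. ennreal (norm (X x)) * ennreal (norm (Y x)) \<partial>M)\<^sup>2 \<le>
      (\<integral>\<^sup>+x. (ennreal (norm (X x)))\<^sup>2 \<partial>M) * (\<integral>\<^sup>+x. (ennreal (norm (Y x)))\<^sup>2 \<partial>M)"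
    by (rule Cauchy_Schwarz_nn_integral) simp_all
  also have "(\<integral>\<^sup>+x. ennreal (norm (X x)) * ennreal (norm (Y x)) \<partial>M) = ennreal (\<integral>x. norm (X x) * norm (Y x) \<partial>M)"
    using nn_integral_eq_integral[OF prod_int] by (simp add: ennreal_mult')
  also have "(\<integral>\<^sup>+x. (ennreal (norm (X x)))\<^sup>2 \<partial>M) = ennreal (\<integral>x. (norm (X x))\<^sup>2 \<partial>M)"
    using nn_integral_eq_integral[OF int(1)] by (simp add: ennreal_power)
  also have "(\<integral>\<^sup>+x. (ennreal (norm (Y x)))\<^sup>2 \<partial>M) = ennreal (\<integral>x. (norm (Y x))\<^sup>2 \<partial>M)"
    using nn_integral_eq_integral[OF int(2)] by (simp add: ennreal_power)
  finally have "(\<integral>x. norm (X x) * norm (Y x) \<partial>M)\<^sup>2 \<le> (\<integral>x. (norm (X x))\<^sup>2 \<partial>M) * (\<integral>x. (norm (Y x))\<^sup>2 \<partial>M)"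
    by (simp add: ennreal_power ennreal_mult'[symmetric] ennreal_le_iff)
  then have CS: "(\<integral>x. norm (X x) * norm (Y x) \<partial>M) \<le> sqrt (\<integral>x. (norm (X x))\<^sup>2 \<partial>M) * sqrt (\<integral>x. (norm (Y x))\<^sup>2 \<partial>M)"
    using real_le_rsqrt by (simp add: real_sqrt_mult[symmetric])
  have "\<bar>\<integral>x. X x \<bullet> Y x \<partial>M\<bar> \<le> (\<integral>x. \<bar>X x \<bullet> Y x\<bar> \<partial>M)"
    using integral_norm_bound[of M "\<lambda>x. X x \<bullet> Y x"] by simp
  also have "\<dots> \<le> (\<integral>x. norm (X x) * norm (Y x) \<partial>M)"
    by (intro integral_mono integrable_abs * prod_int Cauchy_Schwarz_ineq2)
  finally show "\<bar>\<integral>x. X x \<bullet> Y x \<partial>M\<bar> \<le> sqrt (\<integral>x. (norm (X x))\<^sup>2 \<partial>M) * sqrt (\<integral>x. (norm (Y x))\<^sup>2 \<partial>M)"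
    using CS by linarith
qed

lemma norm_add_square_le: "(norm (x + y))\<^sup>2 \<le> 2 * (norm x)\<^sup>2 + 2 * (norm (y::'b::real_inner))\<^sup>2"
proof -
  have "(norm (x + y))\<^sup>2 \<le> (norm x + norm y)\<^sup>2"
    by (intro power_mono norm_triangle_ineq) simp
  also have "\<dots> \<le> 2 * (norm x)\<^sup>2 + 2 * (norm y)\<^sup>2"
    using sum_squares_bound[of "norm x" "norm y"] by (simp add: power2_sum)
  finally show ?thesis .
qed

lemma L2_add:
  fixes X Y :: "'a \<Rightarrow> 'b::euclidean_space"
  assumes "L2 M X" "L2 M Y"
  shows "L2 M (\<lambda>x. X x + Y x)"
proof -
  have [measurable]: "X \<in> borel_measurable M" "Y \<in> borel_measurable M"
    and int: "integrable M (\<lambda>x. 2 * (norm (X x))\<^sup>2)" "integrable M (\<lambda>x. 2 * (norm (Y x))\<^sup>2)"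
    using assms by (auto simp: L2_def)
  have "integrable M (\<lambda>x. (norm (X x + Y x))\<^sup>2)"
    by (rule Bochner_Integration.integrable_bound[OF Bochner_Integration.integrable_add[OF int]])
      (auto intro: norm_add_square_le)
  then show ?thesis by (simp add: L2_def)
qed

lemma L2_bounded_mult:
  fixes X :: "'a \<Rightarrow> 'b::euclidean_space"
  assumes "L2 M X" and [measurable]: "q \<in> borel_measurable M" and C: "AE x in M. \<bar>q x\<bar> \<le> C"
  shows "L2 M (\<lambda>x. q x *\<^sub>R X x)"
proof -
  have [measurable]: "X \<in> borel_measurable M" and int: "integrable M (\<lambda>x. C\<^sup>2 * (norm (X x))\<^sup>2)"
    using assms by (auto simp: L2_def)
  have "integrable M (\<lambda>x. (norm (q x *\<^sub>R X x))\<^sup>2)"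
  proof (rule Bochner_Integration.integrable_bound[OF int])
    show "AE x in M. norm ((norm (q x *\<^sub>R X x))\<^sup>2) \<le> norm (C\<^sup>2 * (norm (X x))\<^sup>2)"
      using C
    proof eventually_elim
      case (elim x)
      then have "(q x)\<^sup>2 \<le> C\<^sup>2"
        using power_mono[of "\<bar>q x\<bar>" C 2] by simp
      then show ?case
        by (simp add: power_mult_distrib mult_right_mono)
    qed
  qed simp
  then show ?thesis by (simp add: L2_def)
qed

lemma L2_diff:
  fixes X Y :: "'a \<Rightarrow> 'b::euclidean_space"
  assumes "L2 M X" "L2 M Y"
  shows "L2 M (\<lambda>x. X x - Y x)"
  using L2_add[OF assms(1) L2_bounded_mult[OF assms(2), of "\<lambda>_. - 1" 1]] by simp

definition L2_converges :: "'a measure \<Rightarrow> (nat \<Rightarrow> 'a \<Rightarrow> 'b::euclidean_space) \<Rightarrow> ('a \<Rightarrow> 'b) \<Rightarrow> bool" where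
  "L2_converges M X Y \<longleftrightarrow> (\<forall>n. L2 M (X n)) \<and> L2 M Y \<and> (\<lambda>n. \<integral>x. (norm (X n x - Y x))\<^sup>2 \<partial>M) \<longlonglongrightarrow> 0"

lemma L2_converges_const: "L2 M X \<Longrightarrow> L2_converges M (\<lambda>n. X) X"
  by (simp add: L2_converges_def)

lemma L2_converges_bounded_mult:
  assumes X: "L2_converges M X Y" and q: "q \<in> borel_measurable M" "AE x in M. \<bar>q x\<bar> \<le> C"
  shows "L2_converges M (\<lambda>n x. q x *\<^sub>R X n x) (\<lambda>x. q x *\<^sub>R Y x)"
proof -
  have L2: "L2 M (X n)" "L2 M Y" for n
    using X by (auto simp: L2_converges_def)
  note [measurable] = q(1)
  have d: "L2 M (\<lambda>x. X n x - Y x)" for n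
    by (intro L2_diff L2)
  have "(\<lambda>n. \<integral>x. (norm (q x *\<^sub>R X n x - q x *\<^sub>R Y x))\<^sup>2 \<partial>M) \<longlonglongrightarrow> 0"
  proof (rule tendsto_sandwich[where f = "\<lambda>_. 0"])
    show "(\<lambda>n. C\<^sup>2 * (\<integral>x. (norm (X n x - Y x))\<^sup>2 \<partial>M)) \<longlonglongrightarrow> 0"
      using X by (auto simp: L2_converges_def intro: tendsto_mult_right_zero)
    have "(\<integral>x. (norm (q x *\<^sub>R X n x - q x *\<^sub>R Y x))\<^sup>2 \<partial>M) \<le> (\<integral>x. C\<^sup>2 * (norm (X n x - Y x))\<^sup>2 \<partial>M)" for n
    proof (rule integral_mono_AE)
      show "integrable M (\<lambda>x. (norm (q x *\<^sub>R X n x - q x *\<^sub>R Y x))\<^sup>2)"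
        using L2_bounded_mult[OF d q, of n] by (simp add: L2_def scaleR_diff_right)
      show "integrable M (\<lambda>x. C\<^sup>2 * (norm (X n x - Y x))\<^sup>2)"
        using d[of n] by (simp add: L2_def)
      show "AE x in M. (norm (q x *\<^sub>R X n x - q x *\<^sub>R Y x))\<^sup>2 \<le> C\<^sup>2 * (norm (X n x - Y x))\<^sup>2"
        using q(2)
      proof eventually_elim
        case (elim x)
        then have "(q x)\<^sup>2 \<le> C\<^sup>2"
          using power_mono[of "\<bar>q x\<bar>" C 2] by simp
        then show ?case
          by (simp add: power_mult_distrib mult_right_mono flip: scaleR_diff_right)
      qed
    qed
    then show "\<forall>\<^sub>F n in sequentially. (\<integral>x. (norm (q x *\<^sub>R X n x - q x *\<^sub>R Y x))\<^sup>2 \<partial>M) \<le> C\<^sup>2 * (\<integral>x. (norm (X n x - Y x))\<^sup>2 \<partial>M)"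
      by simp
  qed simp_all
  then show ?thesis
    using L2_bounded_mult[OF L2(1) q] L2_bounded_mult[OF L2(2) q] by (simp add: L2_converges_def)
qed

lemma L2_converges_inner:
  assumes "L2_converges M X X'" "L2_converges M Y Y'"
  shows "(\<lambda>n. \<integral>x. X n x \<bullet> Y n x \<partial>M) \<longlonglongrightarrow> (\<integral>x. X' x \<bullet> Y' x \<partial>M)"
proof -
  define N where "N Z = sqrt (\<integral>x. (norm (Z x))\<^sup>2 \<partial>M)" for Z :: "_ \<Rightarrow> 'b"
  define D where "D n x = X n x - X' x" for n x
  define E where "E n x = Y n x - Y' x" for n x
  have L2: "L2 M (X n)" "L2 M X'" "L2 M (Y n)" "L2 M Y'" "L2 M (D n)" "L2 M (E n)" for n
    using assms by (auto simp: L2_converges_def D_def[abs_def] E_def[abs_def] intro!: L2_diff)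
  have D0: "(\<lambda>n. N (D n)) \<longlonglongrightarrow> 0" and E0: "(\<lambda>n. N (E n)) \<longlonglongrightarrow> 0"
    using assms tendsto_real_sqrt[of _ 0] unfolding N_def D_def E_def L2_converges_def by fastforce+
  have split: "(\<integral>x. X n x \<bullet> Y n x \<partial>M) - (\<integral>x. X' x \<bullet> Y' x \<partial>M) =
      (\<integral>x. D n x \<bullet> E n x \<partial>M) + (\<integral>x. D n x \<bullet> Y' x \<partial>M) + (\<integral>x. X' x \<bullet> E n x \<partial>M)" for n
  proof -
    note i = L2_Cauchy_Schwarz(1)
    have "(\<integral>x. X n x \<bullet> Y n x \<partial>M) - (\<integral>x. X' x \<bullet> Y' x \<partial>M) = (\<integral>x. X n x \<bullet> Y n x - X' x \<bullet> Y' x \<partial>M)"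
      by (rule Bochner_Integration.integral_diff[symmetric]) (intro i L2)+
    also have "\<dots> = (\<integral>x. D n x \<bullet> E n x + D n x \<bullet> Y' x + X' x \<bullet> E n x \<partial>M)"
      by (simp add: D_def E_def algebra_simps inner_diff)
    also have "\<dots> = (\<integral>x. D n x \<bullet> E n x + D n x \<bullet> Y' x \<partial>M) + (\<integral>x. X' x \<bullet> E n x \<partial>M)"
      by (intro Bochner_Integration.integral_add Bochner_Integration.integrable_add i L2)
    also have "(\<integral>x. D n x \<bullet> E n x + D n x \<bullet> Y' x \<partial>M) = (\<integral>x. D n x \<bullet> E n x \<partial>M) + (\<integral>x. D n x \<bullet> Y' x \<partial>M)"
      by (intro Bochner_Integration.integral_add Bochner_Integration.integrable_add i L2)
    finally show ?thesis .
  qed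
  have "(\<lambda>n. (\<integral>x. X n x \<bullet> Y n x \<partial>M) - (\<integral>x. X' x \<bullet> Y' x \<partial>M)) \<longlonglongrightarrow> 0"
  proof (rule Lim_null_comparison)
    show "(\<lambda>n. N (D n) * N (E n) + N (D n) * N Y' + N X' * N (E n)) \<longlonglongrightarrow> 0"
      using tendsto_add[OF tendsto_add[OF tendsto_mult[OF D0 E0] tendsto_mult[OF D0 tendsto_const[of "N Y'"]]]
          tendsto_mult[OF tendsto_const[of "N X'"] E0]] by simp
    have "\<bar>(\<integral>x. X n x \<bullet> Y n x \<partial>M) - (\<integral>x. X' x \<bullet> Y' x \<partial>M)\<bar> \<le> N (D n) * N (E n) + N (D n) * N Y' + N X' * N (E n)" for n
      using L2_Cauchy_Schwarz(2)[OF L2(5,6), of n n] L2_Cauchy_Schwarz(2)[OF L2(5,4), of n]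
        L2_Cauchy_Schwarz(2)[OF L2(2,6), of n]
      unfolding split N_def by linarith
    then show "\<forall>\<^sub>F n in sequentially. norm ((\<integral>x. X n x \<bullet> Y n x \<partial>M) - (\<integral>x. X' x \<bullet> Y' x \<partial>M))
        \<le> N (D n) * N (E n) + N (D n) * N Y' + N X' * N (E n)"
      by simp
  qed
  then show ?thesis
    by (simp add: LIM_zero_iff)
qed

lemma L2_converges_AE_subseq:
  assumes "L2_converges M X Y"
  obtains r :: "nat \<Rightarrow> nat" where "strict_mono r" "AE x in M. (\<lambda>n. X (r n) x) \<longlonglongrightarrow> Y x"
proof -
  have L2: "L2 M (\<lambda>x. X n x - Y x)" for n
    using assms by (auto simp: L2_converges_def intro: L2_diff)
  have "\<exists>r::nat\<Rightarrow>nat. strict_mono r \<and> (AE x in M. (\<lambda>n. (norm (X (r n) x - Y x))\<^sup>2) \<longlonglongrightarrow> 0)"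
    by (rule tendsto_L1_AE_subseq) (use L2 assms in \<open>auto simp: L2_def L2_converges_def\<close>)
  then obtain r :: "nat \<Rightarrow> nat" where r: "strict_mono r" "AE x in M. (\<lambda>n. (norm (X (r n) x - Y x))\<^sup>2) \<longlonglongrightarrow> 0"
    by blast
  have "AE x in M. (\<lambda>n. X (r n) x) \<longlonglongrightarrow> Y x"
    using r(2)
  proof eventually_elim
    case (elim x)
    then have "(\<lambda>n. sqrt ((norm (X (r n) x - Y x))\<^sup>2)) \<longlonglongrightarrow> sqrt 0"
      by (rule tendsto_real_sqrt)
    then show ?case
      by (simp add: tendsto_norm_zero_iff LIM_zero_iff)
  qed
  with r(1) show thesis ..
qed

section \<open>Weak gradients\<close>

lemma set_lint_eq_lebesgue_on:
  fixes h :: "'a::euclidean_space \<Rightarrow> 'b::euclidean_space"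
  assumes "\<Omega> \<in> sets lebesgue"
  shows "(LINT x:\<Omega>|lebesgue. h x) = (\<integral>x. h x \<partial>lebesgue_on \<Omega>)"
  using assms by (simp add: set_lebesgue_integral_def integral_restrict_space)

lemma lint_lebesgue_eq_lborel:
  fixes h :: "'a::euclidean_space \<Rightarrow> 'b::euclidean_space"
  assumes "h \<in> borel_measurable borel" "\<And>x. x \<notin> \<Omega> \<Longrightarrow> h x = 0"
  shows "(LINT x:\<Omega>|lebesgue. h x) = (\<integral>x. h x \<partial>lborel)"
proof -
  have "(LINT x:\<Omega>|lebesgue. h x) = (\<integral>x. h x \<partial>lebesgue)"
    unfolding set_lebesgue_integral_def
    by (rule Bochner_Integration.integral_cong) (use assms(2) in \<open>auto simp: indicator_def\<close>)
  then show ?thesis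
    using assms(1) by (simp add: integral_completion)
qed

lemma lint_lebesgue_on_eq_lborel:
  fixes h :: "'a::euclidean_space \<Rightarrow> 'b::euclidean_space"
  assumes "h \<in> borel_measurable borel" "\<And>x. x \<notin> \<Omega> \<Longrightarrow> h x = 0" "\<Omega> \<in> sets lebesgue"
  shows "(\<integral>x. h x \<partial>lebesgue_on \<Omega>) = (\<integral>x. h x \<partial>lborel)"
  using lint_lebesgue_eq_lborel[of h \<Omega>] set_lint_eq_lebesgue_on[OF assms(3), of h] assms by simp

lemma test_functionsD:
  assumes "\<phi> \<in> test_functions \<Omega>"
  obtains K where "smooth \<phi>" "compact K" "K \<subseteq> \<Omega>" "\<And>x. x \<notin> K \<Longrightarrow> \<phi> x = 0"
    "\<And>x. x \<notin> K \<Longrightarrow> gradient \<phi> x = 0"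
  using assms gradient_eq_0_outside unfolding test_functions_def by blast

lemma test_functionsI:
  assumes "smooth \<phi>" "compact K" "K \<subseteq> \<Omega>" "\<And>x. x \<notin> K \<Longrightarrow> \<phi> x = 0"
  shows "\<phi> \<in> test_functions \<Omega>"
  using assms unfolding test_functions_def by (intro CollectI conjI exI[of _ K]) auto

lemma loc_integrable_continuous:
  fixes h :: "'a::euclidean_space \<Rightarrow> 'b::euclidean_space"
  assumes "continuous_on UNIV h"
  shows "loc_integrable \<Omega> h"
  unfolding loc_integrable_def
proof (intro allI impI)
  fix K :: "'a set" assume K: "compact K \<and> K \<subseteq> \<Omega>"
  have "integrable lborel (\<lambda>x. indicator K x *\<^sub>R h x)"
    by (rule borel_integrable_compact) (use K continuous_on_subset[OF assms] in auto)
  then show "set_integrable lebesgue K h"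
    unfolding set_integrable_def by (simp add: integrable_completion)
qed

text \<open>Integration by parts: \<open>\<nabla>(\<phi>\<psi>)\<close> has mean zero for every test function \<open>\<psi>\<close>.\<close>

lemma smooth_has_weak_gradient:
  fixes \<phi> :: "'a::euclidean_space \<Rightarrow> real"
  assumes "smooth \<phi>"
  shows "has_weak_gradient \<Omega> \<phi> (gradient \<phi>)"
  unfolding has_weak_gradient_def
proof (intro conjI ballI)
  show "loc_integrable \<Omega> \<phi>" "loc_integrable \<Omega> (gradient \<phi>)"
    by (intro loc_integrable_continuous smooth_continuous_on smooth_continuous_on_gradient assms)+
  fix \<psi> assume "\<psi> \<in> test_functions \<Omega>"
  then obtain K where \<psi>: "smooth \<psi>" "compact K" "K \<subseteq> \<Omega>" "\<And>x. x \<notin> K \<Longrightarrow> \<psi> x = 0"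
    "\<And>x. x \<notin> K \<Longrightarrow> gradient \<psi> x = 0"
    by (rule test_functionsD) blast
  have c: "continuous_on UNIV (\<lambda>x. \<phi> x *\<^sub>R gradient \<psi> x)" "continuous_on UNIV (\<lambda>x. \<psi> x *\<^sub>R gradient \<phi> x)"
    by (intro continuous_intros smooth_continuous_on smooth_continuous_on_gradient assms \<psi>)+
  have i: "integrable lborel (\<lambda>x. \<phi> x *\<^sub>R gradient \<psi> x)" "integrable lborel (\<lambda>x. \<psi> x *\<^sub>R gradient \<phi> x)"
    using integrable_continuous_compact_support[OF c(1) \<psi>(2)]
      integrable_continuous_compact_support[OF c(2) \<psi>(2)] \<psi>(4,5) by simp_all
  have "(\<integral>x. \<phi> x *\<^sub>R gradient \<psi> x \<partial>lborel) + (\<integral>x. \<psi> x *\<^sub>R gradient \<phi> x \<partial>lborel) = 0"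
  proof (rule euclidean_eqI)
    fix b :: 'a assume b: "b \<in> Basis"
    have "((\<integral>x. \<phi> x *\<^sub>R gradient \<psi> x \<partial>lborel) + (\<integral>x. \<psi> x *\<^sub>R gradient \<phi> x \<partial>lborel)) \<bullet> b =
        (\<integral>x. \<phi> x *\<^sub>R gradient \<psi> x + \<psi> x *\<^sub>R gradient \<phi> x \<partial>lborel) \<bullet> b"
      using i by simp
    also have "\<dots> = (\<integral>x. gradient (\<lambda>x. \<phi> x * \<psi> x) x \<bullet> b \<partial>lborel)"
      using i by (subst integral_inner_left[symmetric]) (simp_all add: gradient_mult[OF assms \<psi>(1)])
    also have "\<dots> = 0"
      by (rule integral_gradient_eq_0[OF smooth_mult[OF assms \<psi>(1)] \<psi>(2) _ b]) (simp add: \<psi>)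
    finally show "((\<integral>x. \<phi> x *\<^sub>R gradient \<psi> x \<partial>lborel) + (\<integral>x. \<psi> x *\<^sub>R gradient \<phi> x \<partial>lborel)) \<bullet> b = 0 \<bullet> b"
      by simp
  qed
  then show "(LINT x:\<Omega>|lebesgue. \<phi> x *\<^sub>R gradient \<psi> x) = - (LINT x:\<Omega>|lebesgue. \<psi> x *\<^sub>R gradient \<phi> x)"
    using \<psi>(3-5) c
    by (subst (1 2) lint_lebesgue_eq_lborel)
      (auto simp: borel_measurable_continuous_onI eq_neg_iff_add_eq_0)
qed

lemma integrable_test_mult:
  fixes v :: "'a::euclidean_space \<Rightarrow> 'b::euclidean_space"
  assumes v: "loc_integrable \<Omega> v" and K: "compact K" "K \<subseteq> \<Omega>"
    and h: "continuous_on UNIV h" "\<And>x. x \<notin> K \<Longrightarrow> h x = 0"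
  shows "integrable lebesgue (\<lambda>x. (h x :: real) *\<^sub>R v x)"
proof -
  have "set_integrable lebesgue K v"
    using v K by (simp add: loc_integrable_def)
  moreover obtain C where C: "\<And>x. x \<in> K \<Longrightarrow> \<bar>h x\<bar> \<le> C"
  proof -
    have "compact (h ` K)"
      by (intro compact_continuous_image continuous_on_subset[OF h(1)] K) auto
    then show thesis
      using that compact_imp_bounded by (force simp: bounded_iff)
  qed
  have [measurable]: "h \<in> borel_measurable lebesgue"
    using h(1) by (simp add: borel_measurable_continuous_onI measurable_completion)
  have "integrable lebesgue (\<lambda>x. h x *\<^sub>R (indicator K x *\<^sub>R v x))"
  proof (rule Bochner_Integration.integrable_bound)
    show "integrable lebesgue (\<lambda>x. C *\<^sub>R (indicator K x *\<^sub>R v x))"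
      using calculation unfolding set_integrable_def by (intro integrable_scaleR_right)
    show "(\<lambda>x. h x *\<^sub>R indicat_real K x *\<^sub>R v x) \<in> borel_measurable lebesgue"
      using calculation unfolding set_integrable_def by measurable
    show "AE x in lebesgue. norm (h x *\<^sub>R indicat_real K x *\<^sub>R v x) \<le> norm (C *\<^sub>R indicat_real K x *\<^sub>R v x)"
      using C by (intro AE_I2) (auto simp: indicator_def intro!: mult_right_mono order_trans[OF _ abs_ge_self])
  qed
  moreover have "(\<lambda>x. h x *\<^sub>R (indicator K x *\<^sub>R v x)) = (\<lambda>x. h x *\<^sub>R v x)"
    using h(2) by (auto simp: indicator_def fun_eq_iff)
  ultimately show ?thesis by simp
qed

text \<open>Products of smooth bumps in the coordinates approximate the indicators of boxes, so a weak
  gradient is determined by its integrals over all small boxes.\<close>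

lemma has_weak_gradient_unique:
  fixes v :: "'a::euclidean_space \<Rightarrow> real"
  assumes "open \<Omega>" and G: "has_weak_gradient \<Omega> v G" and H: "has_weak_gradient \<Omega> v H"
  shows "AE x in lebesgue. x \<in> \<Omega> \<longrightarrow> G x = H x"
proof -
  obtain \<beta> :: "nat \<Rightarrow> real \<Rightarrow> real \<Rightarrow> real \<Rightarrow> real" where \<beta>:
    "\<And>n p q. smooth (\<beta> n p q)" "\<And>n p q x. 0 \<le> \<beta> n p q x" "\<And>n p q x. \<beta> n p q x \<le> 1"
    "\<And>n p q x. \<not> (p < x \<and> x < q) \<Longrightarrow> \<beta> n p q x = 0"
    "\<And>p q x. (\<lambda>n. \<beta> n p q x) \<longlonglongrightarrow> indicator {p<..<q} x"
    using smooth_approx_interval by blast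
  have loc: "loc_integrable \<Omega> G" "loc_integrable \<Omega> H"
    using G H by (auto simp: has_weak_gradient_def)
  have box0: "(\<integral>x. indicator (box a b) x *\<^sub>R (G x - H x) \<partial>lebesgue) = 0" if ab: "cbox a b \<subseteq> \<Omega>" for a b
  proof -
    define \<phi> where "\<phi> n x = (\<Prod>i\<in>Basis. \<beta> n (a \<bullet> i) (b \<bullet> i) (x \<bullet> i))" for n and x :: 'a
    have sm: "smooth (\<phi> n)" for n
      unfolding \<phi>_def by (intro smooth_intros smooth_compose[OF \<beta>(1)])
    have zero: "\<phi> n x = 0" if "x \<notin> box a b" for n x
      using that \<beta>(4) by (force simp: \<phi>_def mem_box)
    then have zero': "\<phi> n x = 0" if "x \<notin> cbox a b" for n x
      using that box_subset_cbox by blast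
    have test: "\<phi> n \<in> test_functions \<Omega>" for n
      by (rule test_functionsI[OF sm compact_cbox ab zero'])
    have bd: "0 \<le> \<phi> n x" "\<phi> n x \<le> 1" for n x
      unfolding \<phi>_def by (auto intro!: prod_nonneg prod_le_1 \<beta>)
    have lim: "(\<lambda>n. \<phi> n x) \<longlonglongrightarrow> indicator (box a b) x" for x
    proof -
      have "(\<lambda>n. \<phi> n x) \<longlonglongrightarrow> (\<Prod>i\<in>Basis. indicator {a \<bullet> i<..<b \<bullet> i} (x \<bullet> i))"
        unfolding \<phi>_def by (intro tendsto_prod \<beta>)
      also have "(\<Prod>i\<in>Basis. indicator {a \<bullet> i<..<b \<bullet> i} (x \<bullet> i)) = (indicator (box a b) x :: real)"
        by (cases "x \<in> box a b") (auto simp: mem_box indicator_def)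
      finally show ?thesis .
    qed
    have int: "integrable lebesgue (\<lambda>x. indicator (cbox a b) x *\<^sub>R (G x - H x))"
      using loc ab compact_cbox by (auto simp: loc_integrable_def set_integrable_def scaleR_diff_right)
    have int_test: "integrable lebesgue (\<lambda>x. \<phi> n x *\<^sub>R X x)" if "loc_integrable \<Omega> X" for n and X :: "'a \<Rightarrow> 'a"
      by (rule integrable_test_mult[OF that compact_cbox ab smooth_continuous_on[OF sm] zero'])
    have zero_int: "(\<integral>x. \<phi> n x *\<^sub>R (G x - H x) \<partial>lebesgue) = 0" for n
    proof -
      have "(LINT x:\<Omega>|lebesgue. \<phi> n x *\<^sub>R G x) = (LINT x:\<Omega>|lebesgue. \<phi> n x *\<^sub>R H x)"
        using G H test[of n] unfolding has_weak_gradient_def by (metis neg_equal_iff_equal)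
      moreover have "(LINT x:\<Omega>|lebesgue. \<phi> n x *\<^sub>R X x) = (\<integral>x. \<phi> n x *\<^sub>R X x \<partial>lebesgue)" for X :: "'a \<Rightarrow> 'a"
        unfolding set_lebesgue_integral_def
        by (rule Bochner_Integration.integral_cong) (use zero' ab in \<open>auto simp: indicator_def\<close>)
      moreover have "integrable lebesgue (\<lambda>x. \<phi> n x *\<^sub>R G x)" "integrable lebesgue (\<lambda>x. \<phi> n x *\<^sub>R H x)"
        by (rule int_test[OF loc(1)], rule int_test[OF loc(2)])
      ultimately show ?thesis
        by (simp add: scaleR_diff_right)
    qed
    have "(\<lambda>n. \<integral>x. \<phi> n x *\<^sub>R (G x - H x) \<partial>lebesgue) \<longlonglongrightarrow> (\<integral>x. indicator (box a b) x *\<^sub>R (G x - H x) \<partial>lebesgue)"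
    proof (rule integral_dominated_convergence)
      show "integrable lebesgue (\<lambda>x. norm (indicator (cbox a b) x *\<^sub>R (G x - H x)))"
        using int by (rule integrable_norm)
      show "AE x in lebesgue. (\<lambda>n. \<phi> n x *\<^sub>R (G x - H x)) \<longlonglongrightarrow> indicator (box a b) x *\<^sub>R (G x - H x)"
        by (intro AE_I2 tendsto_intros lim)
      show "AE x in lebesgue. norm (\<phi> n x *\<^sub>R (G x - H x)) \<le> norm (indicator (cbox a b) x *\<^sub>R (G x - H x))" for n
        using bd zero' by (intro AE_I2) (auto simp: indicator_def mult_left_le_one_le)
      have "(\<lambda>x. indicator (box a b) x *\<^sub>R (indicator (cbox a b) x *\<^sub>R (G x - H x))) \<in> borel_measurable lebesgue"
        by (intro borel_measurable_scaleR borel_measurable_indicator borel_measurable_integrable[OF int]) simp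
      also have "(\<lambda>x. indicator (box a b) x *\<^sub>R (indicator (cbox a b) x *\<^sub>R (G x - H x))) =
          (\<lambda>x. indicator (box a b) x *\<^sub>R (G x - H x))"
        using box_subset_cbox[of a b] by (auto simp: indicator_def fun_eq_iff)
      finally show "(\<lambda>x. indicator (box a b) x *\<^sub>R (G x - H x)) \<in> borel_measurable lebesgue" .
      show "(\<lambda>x. \<phi> n x *\<^sub>R (G x - H x)) \<in> borel_measurable lebesgue" for n
      proof -
        have "integrable lebesgue (\<lambda>x. \<phi> n x *\<^sub>R G x)" "integrable lebesgue (\<lambda>x. \<phi> n x *\<^sub>R H x)"
          by (rule int_test[OF loc(1)], rule int_test[OF loc(2)])
        then show ?thesis
          by (auto simp: scaleR_diff_right)
      qed
    qed
    then show ?thesis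
      using zero_int LIMSEQ_unique tendsto_const by (simp add: LIMSEQ_const_iff)
  qed
  \<comment> \<open>Both signs of \<open>c\<close> are used: a function that is almost everywhere nonnegative and nonpositive vanishes.\<close>
  have comp: "AE x in lebesgue. x \<in> \<Omega> \<longrightarrow> c *\<^sub>R (G x - H x) \<bullet> i \<ge> 0" for c and i :: 'a
  proof (rule AE_nonneg_if_box_integrals_nonneg[OF \<open>open \<Omega>\<close>])
    fix a b assume ab: "cbox a b \<subseteq> \<Omega>"
    have "set_integrable lebesgue (cbox a b) (\<lambda>x. G x - H x)"
      using loc ab compact_cbox by (auto simp: loc_integrable_def)
    then have int: "set_integrable lebesgue (cbox a b) (\<lambda>x. c *\<^sub>R (G x - H x) \<bullet> i)"
    proof -
      assume "set_integrable lebesgue (cbox a b) (\<lambda>x. G x - H x)"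
      then have "integrable lebesgue (\<lambda>x. (indicator (cbox a b) x *\<^sub>R (G x - H x)) \<bullet> (c *\<^sub>R i))"
        unfolding set_integrable_def by (intro integrable_inner_left)
      then show ?thesis
        by (simp add: set_integrable_def mult.left_commute)
    qed
    then show "(\<lambda>x. c *\<^sub>R (G x - H x) \<bullet> i) integrable_on cbox a b"
      by (rule set_lebesgue_integral_eq_integral)
    have int': "integrable lebesgue (\<lambda>x. indicator (box a b) x *\<^sub>R (G x - H x))"
    proof -
      have "set_integrable lebesgue (box a b) (\<lambda>x. G x - H x)"
        by (rule set_integrable_subset[OF \<open>set_integrable lebesgue (cbox a b) (\<lambda>x. G x - H x)\<close> _ box_subset_cbox]) simp
      then show ?thesis by (simp add: set_integrable_def)
    qed
    have "integral (cbox a b) (\<lambda>x. c *\<^sub>R (G x - H x) \<bullet> i) = integral (box a b) (\<lambda>x. c *\<^sub>R (G x - H x) \<bullet> i)"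
      by (rule integral_open_interval[symmetric])
    also have "\<dots> = (LINT x:box a b|lebesgue. c *\<^sub>R (G x - H x) \<bullet> i)"
      by (intro set_lebesgue_integral_eq_integral(2)[symmetric] set_integrable_subset[OF int _ box_subset_cbox]) simp
    also have "\<dots> = (\<integral>x. (indicator (box a b) x *\<^sub>R (G x - H x)) \<bullet> (c *\<^sub>R i) \<partial>lebesgue)"
      by (simp add: set_lebesgue_integral_def mult.left_commute)
    also have "\<dots> = (\<integral>x. indicator (box a b) x *\<^sub>R (G x - H x) \<partial>lebesgue) \<bullet> (c *\<^sub>R i)"
      by (intro integral_inner_left int')
    also have "\<dots> = 0"
      by (simp add: box0[OF ab])
    finally show "integral (cbox a b) (\<lambda>x. c *\<^sub>R (G x - H x) \<bullet> i) \<ge> 0" by (simp only: order_refl)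
  qed
  have "\<forall>i\<in>Basis. AE x in lebesgue. x \<in> \<Omega> \<longrightarrow> (G x - H x) \<bullet> i = 0"
  proof
    fix i :: 'a
    show "AE x in lebesgue. x \<in> \<Omega> \<longrightarrow> (G x - H x) \<bullet> i = 0"
      using comp[of 1 i] comp[of "-1" i] by eventually_elim (auto simp: inner_diff_left)
  qed
  then have "AE x in lebesgue. \<forall>i\<in>Basis. x \<in> \<Omega> \<longrightarrow> (G x - H x) \<bullet> i = 0"
    by (subst AE_ball_countable[OF countable_finite[OF finite_Basis]])
  then show ?thesis
    by eventually_elim (auto intro: euclidean_eqI simp: inner_diff_left)
qed

lemma has_weak_gradient_subset:
  assumes "has_weak_gradient \<Omega> v G" "\<Omega>' \<subseteq> \<Omega>"
  shows "has_weak_gradient \<Omega>' v G"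
  unfolding has_weak_gradient_def
proof (intro conjI ballI)
  show "loc_integrable \<Omega>' v" "loc_integrable \<Omega>' G"
    using assms by (auto simp: has_weak_gradient_def loc_integrable_def)
  fix \<phi> assume \<phi>: "\<phi> \<in> test_functions \<Omega>'"
  then obtain K where K: "compact K" "K \<subseteq> \<Omega>'" "\<And>x. x \<notin> K \<Longrightarrow> \<phi> x = 0" "\<And>x. x \<notin> K \<Longrightarrow> gradient \<phi> x = 0"
    by (rule test_functionsD) blast
  have eq: "(LINT x:\<Omega>'|lebesgue. X x) = (LINT x:\<Omega>|lebesgue. X x)" if "\<And>x. x \<notin> K \<Longrightarrow> X x = 0" for X :: "'a \<Rightarrow> 'a"
    unfolding set_lebesgue_integral_def
    by (rule Bochner_Integration.integral_cong) (use that K(2) assms(2) in \<open>force simp: indicator_def\<close>)+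
  have "\<phi> \<in> test_functions \<Omega>"
    using \<phi> assms(2) by (auto simp: test_functions_def)
  then show "(LINT x:\<Omega>'|lebesgue. v x *\<^sub>R gradient \<phi> x) = - (LINT x:\<Omega>'|lebesgue. \<phi> x *\<^sub>R G x)"
    using assms(1) K by (subst (1 2) eq) (auto simp: has_weak_gradient_def)
qed

lemma integrable_test_gradient:
  fixes y :: "'a::euclidean_space \<Rightarrow> real"
  assumes y: "loc_integrable \<Omega> y" and \<phi>: "smooth \<phi>" and K: "compact K" "K \<subseteq> \<Omega>" "\<And>x. x \<notin> K \<Longrightarrow> gradient \<phi> x = 0"
  shows "integrable lebesgue (\<lambda>x. y x *\<^sub>R gradient \<phi> x)"
proof -
  have "integrable lebesgue (\<lambda>x. \<Sum>i\<in>Basis. ((gradient \<phi> x \<bullet> i) *\<^sub>R y x) *\<^sub>R i)"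
    by (intro Bochner_Integration.integrable_sum integrable_scaleR_left integrable_test_mult[OF y K(1,2)])
      (auto intro!: smooth_continuous_on smooth_gradient_inner_Basis \<phi> simp: K(3))
  also have "(\<lambda>x. \<Sum>i\<in>Basis. ((gradient \<phi> x \<bullet> i) *\<^sub>R y x) *\<^sub>R i) = (\<lambda>x. y x *\<^sub>R gradient \<phi> x)"
  proof
    fix x
    have "(\<Sum>i\<in>Basis. ((gradient \<phi> x \<bullet> i) *\<^sub>R y x) *\<^sub>R i) = y x *\<^sub>R (\<Sum>i\<in>Basis. (gradient \<phi> x \<bullet> i) *\<^sub>R i)"
      by (simp add: scaleR_sum_right mult.commute)
    then show "(\<Sum>i\<in>Basis. ((gradient \<phi> x \<bullet> i) *\<^sub>R y x) *\<^sub>R i) = y x *\<^sub>R gradient \<phi> x"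
      by (simp add: euclidean_representation)
  qed
  finally show ?thesis .
qed

lemma has_weak_gradient_diff:
  assumes v: "has_weak_gradient \<Omega> v G" and w: "has_weak_gradient \<Omega> w H"
  shows "has_weak_gradient \<Omega> (\<lambda>x. v x - w x) (\<lambda>x. G x - H x)"
  unfolding has_weak_gradient_def
proof (intro conjI ballI)
  have loc: "loc_integrable \<Omega> v" "loc_integrable \<Omega> w" "loc_integrable \<Omega> G" "loc_integrable \<Omega> H"
    using v w by (auto simp: has_weak_gradient_def)
  then show "loc_integrable \<Omega> (\<lambda>x. v x - w x)" "loc_integrable \<Omega> (\<lambda>x. G x - H x)"
    by (auto simp: loc_integrable_def)
  fix \<phi> assume \<phi>: "\<phi> \<in> test_functions \<Omega>"
  then obtain K where K: "smooth \<phi>" "compact K" "K \<subseteq> \<Omega>" "\<And>x. x \<notin> K \<Longrightarrow> \<phi> x = 0" "\<And>x. x \<notin> K \<Longrightarrow> gradient \<phi> x = 0"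
    by (rule test_functionsD) blast
  have eq: "(LINT x:\<Omega>|lebesgue. X x) = (\<integral>x. X x \<partial>lebesgue)" if "\<And>x. x \<notin> K \<Longrightarrow> X x = 0" for X :: "'a \<Rightarrow> 'a"
    unfolding set_lebesgue_integral_def
    by (rule Bochner_Integration.integral_cong) (use that K(3) in \<open>force simp: indicator_def\<close>)+
  have iG: "integrable lebesgue (\<lambda>x. \<phi> x *\<^sub>R X x)" if "loc_integrable \<Omega> X" for X :: "'a \<Rightarrow> 'a"
    by (rule integrable_test_mult[OF that K(2,3) smooth_continuous_on[OF K(1)] K(4)])
  have iv: "integrable lebesgue (\<lambda>x. y x *\<^sub>R gradient \<phi> x)" if "loc_integrable \<Omega> y" for y :: "'a \<Rightarrow> real"
    by (rule integrable_test_gradient[OF that K(1-3,5)])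
  have "(\<integral>x. v x *\<^sub>R gradient \<phi> x \<partial>lebesgue) = - (\<integral>x. \<phi> x *\<^sub>R G x \<partial>lebesgue)"
    "(\<integral>x. w x *\<^sub>R gradient \<phi> x \<partial>lebesgue) = - (\<integral>x. \<phi> x *\<^sub>R H x \<partial>lebesgue)"
    using v w \<phi> K by (auto simp: has_weak_gradient_def eq)
  then have "(\<integral>x. (v x - w x) *\<^sub>R gradient \<phi> x \<partial>lebesgue) = - (\<integral>x. \<phi> x *\<^sub>R (G x - H x) \<partial>lebesgue)"
    using iv[OF loc(1)] iv[OF loc(2)] iG[OF loc(3)] iG[OF loc(4)]
    by (simp add: scaleR_diff_left scaleR_diff_right)
  then show "(LINT x:\<Omega>|lebesgue. (v x - w x) *\<^sub>R gradient \<phi> x) = - (LINT x:\<Omega>|lebesgue. \<phi> x *\<^sub>R (G x - H x))"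
    using K by (subst (1 2) eq) auto
qed

section \<open>Sobolev functions on balls\<close>

lemma weak_gradient_AE_eq:
  fixes v :: "'a::euclidean_space \<Rightarrow> real"
  assumes "open \<Omega>" "has_weak_gradient \<Omega> v G"
  shows "AE x in lebesgue. x \<in> \<Omega> \<longrightarrow> weak_gradient \<Omega> v x = G x"
proof (rule has_weak_gradient_unique[OF assms(1) _ assms(2)])
  show "has_weak_gradient \<Omega> v (weak_gradient \<Omega> v)"
    unfolding weak_gradient_def by (rule someI[of "has_weak_gradient \<Omega> v" G]) (rule assms(2))
qed

lemma L2_cong_AE:
  fixes X Y :: "'a::euclidean_space \<Rightarrow> 'b::euclidean_space"
  assumes "L2 (lebesgue_on \<Omega>) X" "\<Omega> \<in> sets lebesgue" "AE x in lebesgue. x \<in> \<Omega> \<longrightarrow> X x = Y x"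
  shows "L2 (lebesgue_on \<Omega>) Y"
proof -
  have X: "X \<in> borel_measurable (lebesgue_on \<Omega>)" "integrable (lebesgue_on \<Omega>) (\<lambda>x. (norm (X x))\<^sup>2)"
    using assms(1) by (auto simp: L2_def)
  have "(\<lambda>x. if x \<in> \<Omega> then X x else 0) \<in> borel_measurable lebesgue"
    using X(1) assms(2) by (simp add: borel_measurable_if)
  then have "(\<lambda>x. if x \<in> \<Omega> then Y x else 0) \<in> borel_measurable lebesgue"
    by (rule borel_measurable_AE) (use assms(3) in \<open>eventually_elim, auto\<close>)
  then have Y: "Y \<in> borel_measurable (lebesgue_on \<Omega>)"
    using assms(2) by (simp add: borel_measurable_if)
  have "AE x in lebesgue_on \<Omega>. (norm (X x))\<^sup>2 = (norm (Y x))\<^sup>2"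
    using assms(2,3) by (subst AE_restrict_space_iff) auto
  then have "integrable (lebesgue_on \<Omega>) (\<lambda>x. (norm (Y x))\<^sup>2)"
    using X Y by (subst integrable_cong_AE[symmetric]) auto
  with Y show ?thesis by (simp add: L2_def)
qed

lemma H1_D:
  assumes "v \<in> H1 \<Omega>" "open \<Omega>"
  shows "L2 (lebesgue_on \<Omega>) v" "has_weak_gradient \<Omega> v (weak_gradient \<Omega> v)"
    "L2 (lebesgue_on \<Omega>) (weak_gradient \<Omega> v)"
proof -
  obtain G where G: "has_weak_gradient \<Omega> v G" "L2 (lebesgue_on \<Omega>) G"
    using assms by (auto simp: H1_def)
  show "L2 (lebesgue_on \<Omega>) v"
    using assms by (simp add: H1_def)
  show "has_weak_gradient \<Omega> v (weak_gradient \<Omega> v)"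
    unfolding weak_gradient_def by (rule someI[of "has_weak_gradient \<Omega> v" G]) (rule G(1))
  show "L2 (lebesgue_on \<Omega>) (weak_gradient \<Omega> v)"
    by (rule L2_cong_AE[OF G(2)])
      (use weak_gradient_AE_eq[OF assms(2) G(1)] assms(2) in \<open>auto elim: eventually_mono\<close>)
qed

lemma L2_lebesgue_on_subset:
  fixes X :: "'a::euclidean_space \<Rightarrow> 'b::euclidean_space"
  assumes "L2 (lebesgue_on \<Omega>) X" "\<Omega>' \<subseteq> \<Omega>" "\<Omega> \<in> sets lebesgue" "\<Omega>' \<in> sets lebesgue"
  shows "L2 (lebesgue_on \<Omega>') X"
proof -
  have "set_integrable lebesgue \<Omega> (\<lambda>x. (norm (X x))\<^sup>2)"
    using assms(1,3) by (simp add: L2_def integrable_restrict_space set_integrable_def)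
  then have "set_integrable lebesgue \<Omega>' (\<lambda>x. (norm (X x))\<^sup>2)"
    by (rule set_integrable_subset) (use assms in auto)
  moreover have "X \<in> borel_measurable (lebesgue_on \<Omega>')"
    using assms measurable_restrict_mono unfolding L2_def by blast
  ultimately show ?thesis
    using assms(4) by (simp add: L2_def integrable_restrict_space set_integrable_def)
qed

lemma H1_ball_subset:
  fixes v :: "'a::euclidean_space \<Rightarrow> real"
  assumes "v \<in> H1 (ball 0 R)" "r \<le> R"
  shows "v \<in> H1 (ball 0 r)"
    and "AE x in lebesgue. x \<in> ball 0 r \<longrightarrow> weak_gradient (ball 0 r) v x = weak_gradient (ball 0 R) v x"
proof -
  note v = H1_D[OF assms(1) open_ball]
  have sub: "ball 0 r \<subseteq> (ball 0 R :: 'a set)"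
    using assms(2) by (rule subset_ball)
  have "has_weak_gradient (ball 0 r) v (weak_gradient (ball 0 R) v)"
    using v(2) sub by (rule has_weak_gradient_subset)
  moreover have "L2 (lebesgue_on (ball 0 r)) v" "L2 (lebesgue_on (ball 0 r)) (weak_gradient (ball 0 R) v)"
    by (rule L2_lebesgue_on_subset[OF v(1) sub], simp, simp)
      (rule L2_lebesgue_on_subset[OF v(3) sub], simp, simp)
  ultimately show "v \<in> H1 (ball 0 r)"
    and "AE x in lebesgue. x \<in> ball 0 r \<longrightarrow> weak_gradient (ball 0 r) v x = weak_gradient (ball 0 R) v x"
    using weak_gradient_AE_eq[OF open_ball, of 0 r v "weak_gradient (ball 0 R) v"]
    unfolding H1_def by blast+
qed

lemma L2_continuous:
  fixes X :: "'a::euclidean_space \<Rightarrow> 'b::euclidean_space"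
  assumes "continuous_on UNIV X"
  shows "L2 (lebesgue_on (ball 0 r)) X"
proof -
  have "compact (X ` cball 0 r)"
    by (intro compact_continuous_image continuous_on_subset[OF assms]) auto
  then obtain C where C: "\<And>x. x \<in> cball 0 r \<Longrightarrow> norm (X x) \<le> C"
    using compact_imp_bounded by (force simp: bounded_iff)
  have m [measurable]: "X \<in> borel_measurable (lebesgue_on (ball 0 r))"
    using assms by (simp add: borel_measurable_continuous_onI measurable_completion measurable_restrict_space1)
  interpret finite_measure "lebesgue_on (ball 0 r :: 'a set)"
    by (rule finite_measure_lebesgue_on) simp
  have "integrable (lebesgue_on (ball 0 r)) (\<lambda>x. (norm (X x))\<^sup>2)"
    by (rule integrable_const_bound[where B = "C\<^sup>2"])
      (auto intro!: power_mono C)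
  with m show ?thesis by (simp add: L2_def)
qed

text \<open>Linearity and uniqueness of weak gradients replace the chosen representative for the difference by
  \<open>\<nabla>w\<close> minus the chosen representative for \<open>v\<close>; convergence in \<open>H\<^sup>1\<close> thereby becomes convergence in \<open>L\<^sup>2\<close> of
  the functions and of the gradients.\<close>

lemma H1_norm_diff_smooth:
  fixes v w :: "'a::euclidean_space \<Rightarrow> real"
  assumes "v \<in> H1 (ball 0 r)" "smooth w"
  shows "(H1_norm (ball 0 r) (\<lambda>x. w x - v x))\<^sup>2 =
      (\<integral>x. (norm (w x - v x))\<^sup>2 \<partial>lebesgue_on (ball 0 r)) +
      (\<integral>x. (norm (gradient w x - weak_gradient (ball 0 r) v x))\<^sup>2 \<partial>lebesgue_on (ball 0 r))"
    and "H1_norm (ball 0 r) (\<lambda>x. v x - w x) = H1_norm (ball 0 r) (\<lambda>x. w x - v x)"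
proof -
  let ?B = "ball 0 r :: 'a set" let ?G = "weak_gradient (ball 0 r) v"
  note v = H1_D[OF assms(1) open_ball]
  note w = smooth_has_weak_gradient[OF assms(2), of ?B]
  have L2: "L2 (lebesgue_on ?B) (\<lambda>x. gradient w x - ?G x)" "L2 (lebesgue_on ?B) (\<lambda>x. ?G x - gradient w x)"
    by (intro L2_diff v L2_continuous smooth_continuous_on_gradient assms(2))+
  have norm_eq: "(\<integral>x. (norm (weak_gradient ?B y x))\<^sup>2 \<partial>lebesgue_on ?B) = (\<integral>x. (norm (H x))\<^sup>2 \<partial>lebesgue_on ?B)"
    if y: "has_weak_gradient ?B y H" and H: "L2 (lebesgue_on ?B) H" for y H
  proof -
    note AE = weak_gradient_AE_eq[OF open_ball y]
    have "L2 (lebesgue_on ?B) (weak_gradient ?B y)"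
      by (rule L2_cong_AE[OF H]) (use AE in \<open>auto elim: eventually_mono\<close>)
    then show ?thesis
      using AE H by (intro integral_cong_AE) (auto simp: L2_def AE_restrict_space_iff elim: eventually_mono)
  qed
  have 1: "H1_norm ?B (\<lambda>x. w x - v x) = sqrt ((\<integral>x. (norm (w x - v x))\<^sup>2 \<partial>lebesgue_on ?B) +
      (\<integral>x. (norm (gradient w x - ?G x))\<^sup>2 \<partial>lebesgue_on ?B))"
    unfolding H1_norm_def by (simp add: set_lint_eq_lebesgue_on norm_eq[OF has_weak_gradient_diff[OF w v(2)] L2(1)])
  have 2: "H1_norm ?B (\<lambda>x. v x - w x) = sqrt ((\<integral>x. (norm (w x - v x))\<^sup>2 \<partial>lebesgue_on ?B) +
      (\<integral>x. (norm (gradient w x - ?G x))\<^sup>2 \<partial>lebesgue_on ?B))"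
    unfolding H1_norm_def
    by (simp add: set_lint_eq_lebesgue_on norm_eq[OF has_weak_gradient_diff[OF v(2) w] L2(2)]
        norm_minus_commute power2_commute[of "v _"])
  show "(H1_norm ?B (\<lambda>x. w x - v x))\<^sup>2 = (\<integral>x. (norm (w x - v x))\<^sup>2 \<partial>lebesgue_on ?B) +
      (\<integral>x. (norm (gradient w x - ?G x))\<^sup>2 \<partial>lebesgue_on ?B)"
    unfolding 1 by (rule real_sqrt_pow2) simp
  show "H1_norm ?B (\<lambda>x. v x - w x) = H1_norm ?B (\<lambda>x. w x - v x)"
    unfolding 1 2 ..
qed

lemma H1_smooth_convergence:
  fixes v :: "'a::euclidean_space \<Rightarrow> real"
  assumes "v \<in> H1 (ball 0 r)" "\<And>n. smooth (w n)"
    and "(\<lambda>n. H1_norm (ball 0 r) (\<lambda>x. w n x - v x)) \<longlonglongrightarrow> 0"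
  shows "L2_converges (lebesgue_on (ball 0 r)) w v"
    and "L2_converges (lebesgue_on (ball 0 r)) (\<lambda>n. gradient (w n)) (weak_gradient (ball 0 r) v)"
proof -
  let ?M = "lebesgue_on (ball 0 r :: 'a set)"
  have lim: "(\<lambda>n. (H1_norm (ball 0 r) (\<lambda>x. w n x - v x))\<^sup>2) \<longlonglongrightarrow> 0"
    using tendsto_power[OF assms(3), of 2] by simp
  note sq = H1_norm_diff_smooth(1)[OF assms(1,2)]
  have "(\<lambda>n. \<integral>x. (norm (w n x - v x))\<^sup>2 \<partial>?M) \<longlonglongrightarrow> 0"
    by (rule tendsto_sandwich[OF _ _ tendsto_const lim]) (auto simp: sq)
  moreover have "(\<lambda>n. \<integral>x. (norm (gradient (w n) x - weak_gradient (ball 0 r) v x))\<^sup>2 \<partial>?M) \<longlonglongrightarrow> 0"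
    by (rule tendsto_sandwich[OF _ _ tendsto_const lim]) (auto simp: sq)
  moreover have "L2 ?M (w n)" "L2 ?M (gradient (w n))" for n
    by (intro L2_continuous smooth_continuous_on smooth_continuous_on_gradient assms)+
  ultimately show "L2_converges ?M w v"
    "L2_converges ?M (\<lambda>n. gradient (w n)) (weak_gradient (ball 0 r) v)"
    using H1_D[OF assms(1) open_ball] unfolding L2_converges_def by auto
qed

lemma H1_norm_tendstoI:
  fixes v :: "'a::euclidean_space \<Rightarrow> real"
  assumes "v \<in> H1 (ball 0 r)" "\<And>n. smooth (w n)"
    and "L2_converges (lebesgue_on (ball 0 r)) w v"
    and "L2_converges (lebesgue_on (ball 0 r)) (\<lambda>n. gradient (w n)) (weak_gradient (ball 0 r) v)"
  shows "(\<lambda>n. H1_norm (ball 0 r) (\<lambda>x. w n x - v x)) \<longlonglongrightarrow> 0"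
proof -
  have "(\<lambda>n. (H1_norm (ball 0 r) (\<lambda>x. w n x - v x))\<^sup>2) \<longlonglongrightarrow> 0 + 0"
    unfolding H1_norm_diff_smooth(1)[OF assms(1,2)]
    using assms(3,4) by (intro tendsto_add) (auto simp: L2_converges_def)
  then have "(\<lambda>n. sqrt ((H1_norm (ball 0 r) (\<lambda>x. w n x - v x))\<^sup>2)) \<longlonglongrightarrow> sqrt 0"
    by (intro tendsto_real_sqrt) simp
  then show ?thesis
    by (simp add: tendsto_rabs_zero_iff)
qed

section \<open>Polar coordinates\<close>

text \<open>Surface measure on the unit sphere, normalised by cones as \<open>sphere_measure\<close> is.\<close>

definition angular_measure :: "'a::euclidean_space measure" where
  "angular_measure = density (distr (restrict_space lborel (ball 0 1)) borel (\<lambda>x. x /\<^sub>R norm x))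
     (\<lambda>_. ennreal (real DIM('a)))"

definition radial_measure :: "nat \<Rightarrow> real measure" where
  "radial_measure k = density lborel (\<lambda>s. ennreal (indicator {0<..} s * s ^ (k - 1)))"

lemma sets_angular_measure [simp, measurable_cong]: "sets angular_measure = sets borel"
  by (simp add: angular_measure_def)

lemma space_angular_measure [simp]: "space angular_measure = UNIV"
  by (simp add: angular_measure_def)

lemma sets_radial_measure [simp, measurable_cong]: "sets (radial_measure k) = sets borel"
  by (simp add: radial_measure_def)

lemma measurable_radial_projection [measurable]:
  "(\<lambda>x::'a::euclidean_space. x /\<^sub>R norm x) \<in> borel_measurable borel"
  by measurable

lemma emeasure_angular_measure:
  fixes B :: "'a::euclidean_space set"
  assumes [measurable]: "B \<in> sets borel"
  shows "emeasure angular_measure B = ennreal (real DIM('a)) * emeasure lborel {x \<in> ball 0 1. x /\<^sub>R norm x \<in> B}"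
proof -
  have m: "(\<lambda>x::'a. x /\<^sub>R norm x) \<in> measurable (restrict_space lborel (ball 0 1)) borel"
    by (rule measurable_restrict_space1) simp
  have "emeasure angular_measure B = ennreal (real DIM('a)) *
      emeasure (distr (restrict_space lborel (ball 0 1)) borel (\<lambda>x::'a. x /\<^sub>R norm x)) B"
    unfolding angular_measure_def by (subst emeasure_density_const) simp_all
  also have "emeasure (distr (restrict_space lborel (ball 0 1)) borel (\<lambda>x::'a. x /\<^sub>R norm x)) B =
      emeasure (restrict_space lborel (ball 0 1)) ((\<lambda>x. x /\<^sub>R norm x) -` B \<inter> ball 0 1)"
    using m by (subst emeasure_distr) (simp_all add: space_restrict_space)
  also have "\<dots> = emeasure lborel {x \<in> ball 0 1. x /\<^sub>R norm x \<in> B}"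
    by (subst emeasure_restrict_space) (auto intro!: arg_cong2[where f=emeasure])
  finally show ?thesis .
qed

lemma finite_measure_angular: "finite_measure (angular_measure :: 'a::euclidean_space measure)"
proof
  have "emeasure (angular_measure :: 'a measure) UNIV = ennreal (real DIM('a)) * emeasure lborel (ball (0::'a) 1)"
    by (subst emeasure_angular_measure) (simp_all add: ball_def)
  also have "\<dots> < \<infinity>"
    using emeasure_bounded_finite[OF bounded_ball, of "0::'a" 1] by (simp add: ennreal_mult_less_top)
  finally show "emeasure (angular_measure :: 'a measure) (space angular_measure) \<noteq> \<infinity>"
    by simp
qed

lemma sigma_finite_radial: "sigma_finite_measure (radial_measure k)"
  unfolding radial_measure_def
  by (subst sigma_finite_measure.sigma_finite_iff_density_finite[OF sigma_finite_lborel]) simp_all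

text \<open>The direction \<open>x / |x|\<close> is invariant under the dilation by \<open>c\<close>, which maps one cone onto the other.\<close>

lemma emeasure_cone:
  fixes B :: "'a::euclidean_space set"
  assumes [measurable]: "B \<in> sets borel" and c: "c > 0"
  shows "emeasure lborel {x \<in> ball 0 c. x /\<^sub>R norm x \<in> B} =
    ennreal (c ^ DIM('a)) * emeasure lborel {x \<in> ball 0 1. x /\<^sub>R norm x \<in> B}"
proof -
  let ?E = "\<lambda>r. {x::'a \<in> ball 0 r. x /\<^sub>R norm x \<in> B}"
  have m: "?E r \<in> sets borel" for r by measurable
  have scale: "c *\<^sub>R x \<in> ?E c \<longleftrightarrow> x \<in> ?E 1" for x
    using c by (auto simp: field_simps)
  have "emeasure lborel (?E 1) = (\<integral>\<^sup>+x. indicator (?E c) (c *\<^sub>R x) \<partial>lborel)"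
  proof -
    have "(\<integral>\<^sup>+x. indicator (?E c) (c *\<^sub>R x) \<partial>lborel) = (\<integral>\<^sup>+x. indicator (?E 1) x \<partial>lborel)"
      using scale by (intro nn_integral_cong) (simp only: indicator_def)
    also have "\<dots> = emeasure lborel (?E 1)"
      using m[of 1] by (intro nn_integral_indicator) simp
    finally show ?thesis ..
  qed
  also have "\<dots> = ennreal ((1 / c) ^ DIM('a)) * emeasure lborel (?E c)"
    using m[of c] by (subst nn_integral_dilation[OF c]) simp_all
  finally have "ennreal (c ^ DIM('a)) * emeasure lborel (?E 1) =
      ennreal (c ^ DIM('a) * (1 / c) ^ DIM('a)) * emeasure lborel (?E c)"
    using c by (simp add: ennreal_mult' mult.assoc del: times_divide_eq_right)
  also have "c ^ DIM('a) * (1 / c) ^ DIM('a) = 1"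
    using c by (simp flip: power_mult_distrib)
  finally show ?thesis by simp
qed

lemma emeasure_radial_lessThan:
  assumes "k > 0" "a > 0"
  shows "emeasure (radial_measure k) {..<a} = ennreal (a ^ k / real k)"
proof -
  have "emeasure (radial_measure k) {..<a} = (\<integral>\<^sup>+s. ennreal (indicator {0<..} s * s ^ (k - 1)) * indicator {..<a} s \<partial>lborel)"
    unfolding radial_measure_def by (subst emeasure_density) simp_all
  also have "\<dots> = (\<integral>\<^sup>+s. ennreal (s ^ (k - 1)) * indicator {0..a} s \<partial>lborel)"
  proof (rule nn_integral_cong_AE)
    have "AE s in lborel. s \<noteq> (0::real) \<and> s \<noteq> a"
      using AE_lborel_singleton[of 0] AE_lborel_singleton[of a] by eventually_elim simp
    then show "AE s in lborel. ennreal (indicator {0<..} s * s ^ (k - 1)) * indicator {..<a} s =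
        ennreal (s ^ (k - 1)) * indicator {0..a} s"
      by eventually_elim (auto simp: indicator_def)
  qed
  also have "\<dots> = ennreal (a ^ k / real k - 0 ^ k / real k)"
  proof (rule nn_integral_FTC_Icc)
    show "((\<lambda>s. s ^ k / real k) has_real_derivative s ^ (k - 1)) (at s)" for s
      using assms by (auto intro!: derivative_eq_intros)
  qed (use assms in auto)
  finally show ?thesis
    using assms by (simp add: zero_power)
qed

lemma emeasure_radial_neg:
  assumes "a \<le> 0"
  shows "emeasure (radial_measure k) {..<a} = 0"
proof -
  have "emeasure (radial_measure k) {..<a} = (\<integral>\<^sup>+s. ennreal (indicator {0<..} s * s ^ (k - 1)) * indicator {..<a} s \<partial>lborel)"
    unfolding radial_measure_def by (subst emeasure_density) simp_all
  also have "\<dots> = (\<integral>\<^sup>+s. 0 \<partial>(lborel :: real measure))"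
    using assms by (intro nn_integral_cong) (auto simp: indicator_def)
  finally show ?thesis by simp
qed

text \<open>Measures on a product are determined by rectangles \<open>A \<times> B\<close>, and for fixed \<open>B\<close> by the half-lines
  \<open>A = {s | s < a}\<close>. For these, both sides are volumes of truncated cones, which scale like \<open>a\<^sup>d\<close>.\<close>

lemma polar_coordinates:
  "radial_measure DIM('a) \<Otimes>\<^sub>M angular_measure =
     distr lborel (borel \<Otimes>\<^sub>M borel) (\<lambda>x::'a::euclidean_space. (norm x, x /\<^sub>R norm x))"
proof (rule pair_measure_eqI)
  show "sigma_finite_measure (radial_measure DIM('a))"
    by (rule sigma_finite_radial)
  show "sigma_finite_measure (angular_measure :: 'a measure)"
    using finite_measure_angular by (rule finite_measure.axioms(1))
  show "sets (radial_measure DIM('a) \<Otimes>\<^sub>M (angular_measure :: 'a measure)) =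
      sets (distr lborel (borel \<Otimes>\<^sub>M borel) (\<lambda>x::'a. (norm x, x /\<^sub>R norm x)))"
    by (simp cong: sets_pair_measure_cong)
  fix A :: "real set" and B :: "'a set"
  assume "A \<in> sets (radial_measure DIM('a))" "B \<in> sets angular_measure"
  then have [measurable]: "A \<in> sets borel" "B \<in> sets borel" by simp_all
  define \<mu> where "\<mu> = distr (density lborel (indicator {x::'a. x /\<^sub>R norm x \<in> B})) borel norm"
  define \<nu> where "\<nu> = density (radial_measure DIM('a)) (\<lambda>_. emeasure angular_measure B)"
  have \<mu>: "emeasure \<mu> A' = emeasure lborel {x::'a. norm x \<in> A' \<and> x /\<^sub>R norm x \<in> B}" if [measurable]: "A' \<in> sets borel" for A'
  proof -
    have "emeasure \<mu> A' = emeasure (density lborel (indicator {x::'a. x /\<^sub>R norm x \<in> B})) (norm -` A')"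
      unfolding \<mu>_def by (subst emeasure_distr) simp_all
    also have "\<dots> = (\<integral>\<^sup>+x. indicator {x. x /\<^sub>R norm x \<in> B} x * indicator (norm -` A') x \<partial>lborel)"
      using measurable_sets[of "norm :: 'a \<Rightarrow> real" borel borel A'] by (subst emeasure_density) simp_all
    also have "\<dots> = (\<integral>\<^sup>+x. indicator {x. norm x \<in> A' \<and> x /\<^sub>R norm x \<in> B} x \<partial>lborel)"
      by (intro nn_integral_cong) (auto simp: indicator_def)
    also have "\<dots> = emeasure lborel {x::'a. norm x \<in> A' \<and> x /\<^sub>R norm x \<in> B}"
      by (subst nn_integral_indicator) simp_all
    finally show ?thesis .
  qed
  have fin: "emeasure angular_measure B < \<infinity>"
    using finite_measure.emeasure_finite[OF finite_measure_angular, of B] by (simp add: less_top)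
  have \<nu>: "emeasure \<nu> A' = emeasure angular_measure B * emeasure (radial_measure DIM('a)) A'" if "A' \<in> sets borel" for A'
    unfolding \<nu>_def using that by (subst emeasure_density_const) simp_all
  have eq: "emeasure \<mu> {..<a} = emeasure \<nu> {..<a}" for a
  proof (cases "a > 0")
    case True
    have "emeasure \<mu> {..<a} = emeasure lborel {x::'a \<in> ball 0 a. x /\<^sub>R norm x \<in> B}"
      by (subst \<mu>) (auto intro!: arg_cong2[where f = emeasure])
    also have "\<dots> = ennreal (a ^ DIM('a)) * emeasure lborel {x::'a \<in> ball 0 1. x /\<^sub>R norm x \<in> B}"
      using True by (rule emeasure_cone[rotated]) simp
    also have "ennreal (a ^ DIM('a)) = ennreal (real DIM('a)) * ennreal (a ^ DIM('a) / real DIM('a))"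
      using True by (subst ennreal_mult[symmetric]) auto
    also have "\<dots> * emeasure lborel {x::'a \<in> ball 0 1. x /\<^sub>R norm x \<in> B} = emeasure \<nu> {..<a}"
      using True by (simp add: \<nu> emeasure_angular_measure emeasure_radial_lessThan mult_ac)
    finally show ?thesis .
  next
    case False
    then have "\<not> norm x < a" for x :: 'a
      using norm_ge_zero[of x] by linarith
    then have empty: "{x::'a. norm x \<in> {..<a} \<and> x /\<^sub>R norm x \<in> B} = {}"
      by simp
    have "emeasure \<mu> {..<a} = 0"
      by (subst \<mu>) (simp, simp only: empty emeasure_empty)
    then show ?thesis
      using False by (simp add: \<nu> emeasure_radial_neg)
  qed
  have "\<mu> = \<nu>"
  proof (rule measure_eqI_generator_eq[where E = "range lessThan" and \<Omega> = UNIV and A = "\<lambda>n. {..<real n}"])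
    show "Int_stable (range (lessThan :: real \<Rightarrow> real set))"
    proof -
      have "{..<a} \<inter> {..<b} = {..<min a b}" for a b :: real
        by auto
      then show ?thesis
        by (auto simp: Int_stable_def)
    qed
    show "emeasure \<mu> X = emeasure \<nu> X" if "X \<in> range lessThan" for X
      using that eq by auto
    have "sets (borel :: real measure) = sigma_sets UNIV (range lessThan)"
      by (subst borel_Iio) simp
    then show "sets \<mu> = sigma_sets UNIV (range lessThan)" "sets \<nu> = sigma_sets UNIV (range lessThan)"
      by (simp_all add: \<mu>_def \<nu>_def)
    show "(\<Union>n. {..<real n}) = UNIV"
      using reals_Archimedean2 by auto
    show "emeasure \<mu> {..<real n} \<noteq> \<infinity>" for n
      using fin unfolding eq
      by (cases "n = 0") (auto simp: \<nu> emeasure_radial_neg emeasure_radial_lessThan ennreal_mult_eq_top_iff)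
  qed auto
  then have "emeasure (radial_measure DIM('a)) A * emeasure angular_measure B =
      emeasure lborel {x::'a. norm x \<in> A \<and> x /\<^sub>R norm x \<in> B}"
    using \<mu>[of A] \<nu>[of A] by (simp add: mult.commute)
  also have "\<dots> = emeasure (distr lborel (borel \<Otimes>\<^sub>M borel) (\<lambda>x::'a. (norm x, x /\<^sub>R norm x))) (A \<times> B)"
    by (subst emeasure_distr) (auto intro!: arg_cong2[where f = emeasure])
  finally show "emeasure (radial_measure DIM('a)) A * emeasure angular_measure B =
      emeasure (distr lborel (borel \<Otimes>\<^sub>M borel) (\<lambda>x::'a. (norm x, x /\<^sub>R norm x))) (A \<times> B)" .
qed

text \<open>This reduces integrals over all spheres to the unit sphere, so that Fubini applies to polar coordinates.\<close>

lemma sphere_measure_eq: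
  assumes "r > 0"
  shows "(sphere_measure r :: 'a::euclidean_space measure) =
    completion (density (distr angular_measure borel (\<lambda>\<omega>. r *\<^sub>R \<omega>)) (\<lambda>_. ennreal (r ^ (DIM('a) - 1))))"
  unfolding sphere_measure_def
proof (rule arg_cong[where f = completion], rule measure_eqI)
  let ?p = "\<lambda>x::'a. (r / norm x) *\<^sub>R x"
  fix A assume "A \<in> sets (scale_measure (ennreal (real DIM('a) / r)) (distr (restrict_space lborel (ball 0 r)) borel ?p))"
  then have [measurable]: "A \<in> sets borel" by simp
  have V: "(\<lambda>\<omega>. r *\<^sub>R \<omega>) -` A \<in> sets borel"
    using measurable_sets[of "\<lambda>\<omega>::'a. r *\<^sub>R \<omega>" borel borel A] by simp
  have m: "?p \<in> measurable (restrict_space lborel (ball 0 r)) borel"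
    by (rule measurable_restrict_space1) measurable
  have "emeasure (scale_measure (ennreal (real DIM('a) / r)) (distr (restrict_space lborel (ball 0 r)) borel ?p)) A =
      ennreal (real DIM('a) / r) * emeasure (distr (restrict_space lborel (ball 0 r)) borel ?p) A"
    by simp
  also have "emeasure (distr (restrict_space lborel (ball 0 r)) borel ?p) A =
    emeasure (restrict_space lborel (ball 0 r)) (?p -` A \<inter> ball 0 r)"
    using m by (subst emeasure_distr) (simp_all add: space_restrict_space)
  also have "\<dots> = emeasure lborel {x \<in> ball 0 r. x /\<^sub>R norm x \<in> ((\<lambda>\<omega>. r *\<^sub>R \<omega>) -` A)}"
    by (subst emeasure_restrict_space) (auto intro!: arg_cong2[where f=emeasure] simp: divide_inverse)
  also have "\<dots> = ennreal (r ^ DIM('a)) * emeasure lborel {x \<in> ball 0 1. x /\<^sub>R norm x \<in> ((\<lambda>\<omega>. r *\<^sub>R \<omega>) -` A)}"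
    by (rule emeasure_cone[OF _ assms]) (rule V)
  also have "ennreal (real DIM('a) / r) * \<dots> = ennreal (r ^ (DIM('a) - 1)) *
      (ennreal (real DIM('a)) * emeasure lborel {x \<in> ball 0 1. x /\<^sub>R norm x \<in> ((\<lambda>\<omega>. r *\<^sub>R \<omega>) -` A)})"
  proof -
    have "real DIM('a) / r * r ^ DIM('a) = r ^ (DIM('a) - 1) * real DIM('a)"
      using assms by (simp add: power_eq_if)
    then have "ennreal (real DIM('a) / r) * ennreal (r ^ DIM('a)) = ennreal (r ^ (DIM('a) - 1)) * ennreal (real DIM('a))"
      using assms by (simp only: ennreal_mult[symmetric] zero_le_power less_imp_le divide_nonneg_pos of_nat_0_le_iff)
    then show ?thesis
      by (simp only: mult.assoc[symmetric])
  qed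
  also have "ennreal (real DIM('a)) * emeasure lborel {x \<in> ball 0 1. x /\<^sub>R norm x \<in> ((\<lambda>\<omega>. r *\<^sub>R \<omega>) -` A)} =
      emeasure angular_measure ((\<lambda>\<omega>. r *\<^sub>R \<omega>) -` A)"
    by (rule emeasure_angular_measure[symmetric]) (rule V)
  also have "ennreal (r ^ (DIM('a) - 1)) * \<dots> =
      emeasure (density (distr angular_measure borel (\<lambda>\<omega>. r *\<^sub>R \<omega>)) (\<lambda>_. ennreal (r ^ (DIM('a) - 1)))) A"
    by (subst emeasure_density_const) (simp_all add: emeasure_distr)
  finally show "emeasure (scale_measure (ennreal (real DIM('a) / r)) (distr (restrict_space lborel (ball 0 r)) borel ?p)) A =
      emeasure (density (distr angular_measure borel (\<lambda>\<omega>. r *\<^sub>R \<omega>)) (\<lambda>_. ennreal (r ^ (DIM('a) - 1)))) A" .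
qed simp

lemma sphere_measurable_borel [measurable (raw)]:
  "h \<in> borel_measurable borel \<Longrightarrow> h \<in> borel_measurable (sphere_measure r)"
  unfolding sphere_measure_def by (rule measurable_completion) simp

lemma nn_integral_sphere:
  fixes h :: "'a::euclidean_space \<Rightarrow> ennreal"
  assumes "r > 0" and [measurable]: "h \<in> borel_measurable borel"
  shows "(\<integral>\<^sup>+x. h x \<partial>sphere_measure r) = ennreal (r ^ (DIM('a) - 1)) * (\<integral>\<^sup>+\<omega>. h (r *\<^sub>R \<omega>) \<partial>angular_measure)"
  unfolding sphere_measure_eq[OF assms(1)] nn_integral_completion
  by (subst nn_integral_density) (simp_all add: nn_integral_cmult nn_integral_distr)

lemma integral_sphere:
  fixes h :: "'a::euclidean_space \<Rightarrow> real"
  assumes "r > 0" and [measurable]: "h \<in> borel_measurable borel"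
  shows "(\<integral>x. h x \<partial>sphere_measure r) = r ^ (DIM('a) - 1) * (\<integral>\<omega>. h (r *\<^sub>R \<omega>) \<partial>angular_measure)"
    and "integrable (sphere_measure r) h \<longleftrightarrow> integrable angular_measure (\<lambda>\<omega>. h (r *\<^sub>R \<omega>))"
proof -
  have "r ^ (DIM('a) - 1) \<noteq> 0" "r ^ (DIM('a) - 1) \<ge> 0" "r \<noteq> 0" using assms by simp_all
  then show "(\<integral>x. h x \<partial>sphere_measure r) = r ^ (DIM('a) - 1) * (\<integral>\<omega>. h (r *\<^sub>R \<omega>) \<partial>angular_measure)"
    "integrable (sphere_measure r) h \<longleftrightarrow> integrable angular_measure (\<lambda>\<omega>. h (r *\<^sub>R \<omega>))"
    unfolding sphere_measure_eq[OF assms(1)]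
    by (simp_all add: integral_completion integrable_completion integral_density integrable_density
        integral_distr integrable_distr_eq)
qed

lemma AE_sphere_norm:
  assumes "r > 0"
  shows "AE x in (sphere_measure r :: 'a::euclidean_space measure). norm x = r"
proof (rule AE_I')
  let ?N = "{x::'a. norm x \<noteq> r}"
  have [measurable]: "?N \<in> sets borel" by measurable
  have "emeasure lborel {x \<in> ball 0 r. (r / norm x) *\<^sub>R x \<in> ?N} \<le> emeasure lborel {0::'a}"
    using assms by (intro emeasure_mono) auto
  then have "emeasure (sphere_measure r) ?N = 0"
    by (subst emeasure_sphere_measure) auto
  moreover have "?N \<in> sets (sphere_measure r)"
    unfolding sphere_measure_def by (rule sets_completionI_sets) simp
  ultimately show "?N \<in> null_sets (sphere_measure r)"
    by auto
qed auto

lemma nn_integral_polar: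
  fixes h :: "'a::euclidean_space \<Rightarrow> ennreal"
  assumes [measurable]: "h \<in> borel_measurable borel"
  shows "(\<integral>\<^sup>+x. h x \<partial>lborel) = (\<integral>\<^sup>+s. (\<integral>\<^sup>+x. h x \<partial>sphere_measure s) * indicator {0<..} s \<partial>lborel)"
proof -
  interpret A: finite_measure "angular_measure :: 'a measure"
    by (rule finite_measure_angular)
  have [measurable]: "(\<lambda>p. h (fst p *\<^sub>R snd p)) \<in> borel_measurable (borel \<Otimes>\<^sub>M borel)"
    by measurable
  have [measurable]: "(\<lambda>s. \<integral>\<^sup>+\<omega>. h (s *\<^sub>R \<omega>) \<partial>angular_measure) \<in> borel_measurable borel"
    using A.borel_measurable_nn_integral[of "\<lambda>s \<omega>. h (s *\<^sub>R \<omega>)" borel] by (simp add: split_beta)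
  have "(\<integral>\<^sup>+x. h x \<partial>lborel) = (\<integral>\<^sup>+x. h (norm x *\<^sub>R (x /\<^sub>R norm x)) \<partial>lborel)"
    by (rule nn_integral_cong) (case_tac "x = 0"; simp)
  also have "\<dots> = (\<integral>\<^sup>+p. h (fst p *\<^sub>R snd p) \<partial>distr lborel (borel \<Otimes>\<^sub>M borel) (\<lambda>x::'a. (norm x, x /\<^sub>R norm x)))"
    by (subst nn_integral_distr) simp_all
  also have "\<dots> = (\<integral>\<^sup>+s. \<integral>\<^sup>+\<omega>. h (s *\<^sub>R \<omega>) \<partial>angular_measure \<partial>radial_measure DIM('a))"
    unfolding polar_coordinates[symmetric] by (subst A.nn_integral_fst[symmetric]) simp_all
  also have "\<dots> = (\<integral>\<^sup>+s. ennreal (indicator {0<..} s * s ^ (DIM('a) - 1)) * (\<integral>\<^sup>+\<omega>. h (s *\<^sub>R \<omega>) \<partial>angular_measure) \<partial>lborel)"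
    unfolding radial_measure_def by (subst nn_integral_density) simp_all
  also have "\<dots> = (\<integral>\<^sup>+s. (\<integral>\<^sup>+x. h x \<partial>sphere_measure s) * indicator {0<..} s \<partial>lborel)"
    by (rule nn_integral_cong) (auto simp: nn_integral_sphere indicator_def)
  finally show ?thesis .
qed

lemma integral_polar_borel:
  fixes h :: "'a::euclidean_space \<Rightarrow> real"
  assumes h: "integrable lborel h"
  shows "AE s in lborel. 0 < s \<longrightarrow> integrable (sphere_measure s) h"
    and "integrable lborel (\<lambda>s. indicator {0<..} s * (\<integral>x. h x \<partial>sphere_measure s))"
    and "(\<integral>x. h x \<partial>lborel) = (\<integral>s. indicator {0<..} s * (\<integral>x. h x \<partial>sphere_measure s) \<partial>lborel)"
proof -
  have [measurable]: "h \<in> borel_measurable borel"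
    using h by auto
  interpret A: finite_measure "angular_measure :: 'a measure"
    by (rule finite_measure_angular)
  interpret R: sigma_finite_measure "radial_measure DIM('a)"
    by (rule sigma_finite_radial)
  interpret P: pair_sigma_finite "radial_measure DIM('a)" "angular_measure :: 'a measure" ..
  let ?H = "\<lambda>p::real \<times> 'a. h (fst p *\<^sub>R snd p)"
  have hx: "h (norm x *\<^sub>R (x /\<^sub>R norm x)) = h x" for x
    by (cases "x = 0") simp_all
  have [measurable]: "?H \<in> borel_measurable (borel \<Otimes>\<^sub>M borel)"
    by measurable
  have "integrable lborel (\<lambda>x. ?H (norm x, x /\<^sub>R norm x))"
    using h by (simp only: fst_conv snd_conv hx)
  then have HI: "integrable (radial_measure DIM('a) \<Otimes>\<^sub>M angular_measure) ?H"
    unfolding polar_coordinates by (subst integrable_distr_eq) simp_all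
  have [measurable]: "(\<lambda>s. \<integral>\<omega>. h (s *\<^sub>R \<omega>) \<partial>angular_measure) \<in> borel_measurable borel"
    using A.borel_measurable_lebesgue_integral[of "\<lambda>s \<omega>. h (s *\<^sub>R \<omega>)" borel] by (simp add: split_beta)
  have "AE s in radial_measure DIM('a). integrable angular_measure (\<lambda>\<omega>. h (s *\<^sub>R \<omega>))"
    using P.AE_integrable_fst'[OF HI] by simp
  then have "AE s in lborel. 0 < s \<longrightarrow> integrable angular_measure (\<lambda>\<omega>. h (s *\<^sub>R \<omega>))"
    unfolding radial_measure_def by (subst (asm) AE_density) (auto elim!: eventually_mono)
  then show "AE s in lborel. 0 < s \<longrightarrow> integrable (sphere_measure s) h"
    by eventually_elim (simp add: integral_sphere)
  have rw: "(indicator {0<..} s * s ^ (DIM('a) - 1)) *\<^sub>R (\<integral>\<omega>. h (s *\<^sub>R \<omega>) \<partial>angular_measure) =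
      indicator {0<..} s * (\<integral>x. h x \<partial>sphere_measure s)" for s
    by (auto simp: indicator_def integral_sphere)
  have "integrable (radial_measure DIM('a)) (\<lambda>s. \<integral>\<omega>. h (s *\<^sub>R \<omega>) \<partial>angular_measure)"
    using P.integrable_fst'[OF HI] by simp
  then show "integrable lborel (\<lambda>s. indicator {0<..} s * (\<integral>x. h x \<partial>sphere_measure s))"
    unfolding radial_measure_def by (subst (asm) integrable_density) (simp_all only: rw, simp_all add: indicator_def)
  have "(\<integral>x. h x \<partial>lborel) = (\<integral>x. ?H (norm x, x /\<^sub>R norm x) \<partial>lborel)"
    by (simp only: fst_conv snd_conv hx)
  also have "\<dots> = integral\<^sup>L (radial_measure DIM('a) \<Otimes>\<^sub>M angular_measure) ?H"
    unfolding polar_coordinates by (subst integral_distr) simp_all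
  also have "\<dots> = (\<integral>s. \<integral>\<omega>. h (s *\<^sub>R \<omega>) \<partial>angular_measure \<partial>radial_measure DIM('a))"
    using P.integral_fst'[OF HI] by simp
  also have "\<dots> = (\<integral>s. indicator {0<..} s * (\<integral>x. h x \<partial>sphere_measure s) \<partial>lborel)"
    unfolding radial_measure_def by (subst integral_density) (simp_all only: rw, simp_all add: indicator_def)
  finally show "(\<integral>x. h x \<partial>lborel) = (\<integral>s. indicator {0<..} s * (\<integral>x. h x \<partial>sphere_measure s) \<partial>lborel)" .
qed

lemma AE_sphere_if_AE:
  fixes P :: "'a::euclidean_space \<Rightarrow> bool"
  assumes "AE x in lebesgue. P x"
  shows "AE s in lborel. 0 < s \<longrightarrow> (AE x in sphere_measure s. P x)"
proof -
  have "AE x in lborel. P x"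
    using assms by (simp add: AE_completion_iff)
  then obtain N where N: "{x. \<not> P x} \<subseteq> N" "N \<in> null_sets lborel"
    by (auto simp: eventually_ae_filter)
  then have [measurable]: "N \<in> sets borel" by auto
  have "(\<integral>\<^sup>+s. emeasure (sphere_measure s) N * indicator {0<..} s \<partial>lborel) = emeasure lborel N"
    using nn_integral_polar[of "indicator N :: 'a \<Rightarrow> ennreal"]
    by (simp add: nn_integral_completion sphere_measure_def)
  also have "\<dots> = 0" using N by auto
  finally have 0: "(\<integral>\<^sup>+s. emeasure (sphere_measure s) N * indicator {0<..} s \<partial>lborel) = 0" .
  interpret A: finite_measure "angular_measure :: 'a measure"
    by (rule finite_measure_angular)
  have "(\<lambda>s. \<integral>\<^sup>+\<omega>. indicator N (s *\<^sub>R \<omega>) \<partial>angular_measure) \<in> borel_measurable borel"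
    using A.borel_measurable_nn_integral[of "\<lambda>s \<omega>. indicator N (s *\<^sub>R \<omega>)" borel] by (simp add: split_beta)
  then have "(\<lambda>s. ennreal (s ^ (DIM('a) - 1)) * (\<integral>\<^sup>+\<omega>. indicator N (s *\<^sub>R \<omega>) \<partial>angular_measure) * indicator {0<..} s) \<in> borel_measurable borel"
    by measurable
  also have "(\<lambda>s. ennreal (s ^ (DIM('a) - 1)) * (\<integral>\<^sup>+\<omega>. indicator N (s *\<^sub>R \<omega>) \<partial>angular_measure) * indicator {0<..} s) =
      (\<lambda>s. emeasure (sphere_measure s) N * indicator {0<..} s)"
  proof
    fix s
    show "ennreal (s ^ (DIM('a) - 1)) * (\<integral>\<^sup>+\<omega>. indicator N (s *\<^sub>R \<omega>) \<partial>angular_measure) * indicator {0<..} s =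
      emeasure (sphere_measure s) N * indicator {0<..} s"
      using nn_integral_sphere[of s "indicator N :: 'a \<Rightarrow> ennreal"]
      by (cases "s > 0") (auto simp: nn_integral_completion sphere_measure_def)
  qed
  finally have "AE s in lborel. emeasure (sphere_measure s) N * indicator {0<..} s = 0"
    using 0 by (subst (asm) nn_integral_0_iff_AE) simp_all
  then show ?thesis
  proof eventually_elim
    case (elim s)
    show ?case
    proof
      assume "0 < s"
      then have "emeasure (sphere_measure s) N = 0"
        using elim by simp
      moreover have "N \<in> sets (sphere_measure s)"
        unfolding sphere_measure_def by (rule sets_completionI_sets) simp
      ultimately show "AE x in sphere_measure s. P x"
        using N(1) by (intro AE_I'[of N]) auto
    qed
  qed
qed

lemma measurable_completion_AE:
  fixes f g :: "'a \<Rightarrow> real"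
  assumes f: "f \<in> borel_measurable (completion M)" and ae: "AE x in completion M. f x = g x"
  shows "g \<in> borel_measurable (completion M)"
proof -
  obtain N where N: "N \<in> null_sets (completion M)" "{x \<in> space (completion M). f x \<noteq> g x} \<subseteq> N"
    using ae by (auto simp: eventually_ae_filter)
  show ?thesis
  proof (rule measurableI)
    fix S :: "real set" assume S: "S \<in> sets borel"
    have "g -` S \<inter> space (completion M) = (f -` S \<inter> space (completion M) - N) \<union> (g -` S \<inter> space (completion M) \<inter> N)"
      using N(2) by auto
    moreover have "f -` S \<inter> space (completion M) - N \<in> sets (completion M)"
      using measurable_sets[OF f S] N(1) by auto
    moreover have "g -` S \<inter> space (completion M) \<inter> N \<in> sets (completion M)"
      by (rule null_setsD2[OF completion.complete2[OF _ N(1)]]) auto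
    ultimately show "g -` S \<inter> space (completion M) \<in> sets (completion M)"
      by (metis sets.Un)
  qed simp
qed

text \<open>A Lebesgue integrable function agrees with a Borel function off a null set. Almost every sphere meets
  this set in a null set, on which completeness of the sphere measure allows arbitrary values.\<close>

lemma integral_polar:
  fixes h :: "'a::euclidean_space \<Rightarrow> real"
  assumes h: "integrable lebesgue h"
  shows "AE s in lborel. 0 < s \<longrightarrow> integrable (sphere_measure s) h"
    and "integrable lebesgue (\<lambda>s. indicator {0<..} s * (\<integral>x. h x \<partial>sphere_measure s))"
    and "(\<integral>x. h x \<partial>lebesgue) = (\<integral>s. indicator {0<..} s * (\<integral>x. h x \<partial>sphere_measure s) \<partial>lebesgue)"
proof -
  obtain h' where h': "h' \<in> borel_measurable lborel" "AE x in lborel. h x = h' x"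
    using completion_ex_borel_measurable_real[OF borel_measurable_integrable[OF h]] by auto
  have ae: "AE x in lebesgue. h x = h' x"
    using h'(2) by (simp add: AE_completion_iff)
  have [measurable]: "h' \<in> borel_measurable borel" "h' \<in> borel_measurable lebesgue"
    using h'(1) by (auto intro: measurable_completion)
  have "integrable lebesgue h'"
    by (rule integrable_cong_AE_imp[OF h]) (use ae in \<open>auto elim: eventually_mono\<close>)
  then have int': "integrable lborel h'"
    by (simp add: integrable_completion)
  note P = integral_polar_borel[OF int']
  have aes: "AE s in lborel. 0 < s \<longrightarrow> (AE x in sphere_measure s. h x = h' x)"
    by (rule AE_sphere_if_AE[OF ae])
  have both: "AE s in lborel. 0 < s \<longrightarrow> integrable (sphere_measure s) h \<and>
      (\<integral>x. h x \<partial>sphere_measure s) = (\<integral>x. h' x \<partial>sphere_measure s)"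
    using aes P(1)
  proof eventually_elim
    case (elim s)
    show ?case
    proof
      assume s: "0 < s"
      have eq: "AE x in sphere_measure s. h' x = h x"
        using elim(1) s by (auto elim: eventually_mono)
      have meas: "h \<in> borel_measurable (sphere_measure s)"
        unfolding sphere_measure_def
        by (rule measurable_completion_AE[OF _ eq[unfolded sphere_measure_def]]) (rule measurable_completion, simp)
      show "integrable (sphere_measure s) h \<and> (\<integral>x. h x \<partial>sphere_measure s) = (\<integral>x. h' x \<partial>sphere_measure s)"
      proof
        have eq': "AE x in sphere_measure s. h x = h' x"
          using elim(1) s by simp
        show "integrable (sphere_measure s) h"
          by (rule integrable_cong_AE_imp[OF _ meas eq]) (use elim s in simp)
        show "(\<integral>x. h x \<partial>sphere_measure s) = (\<integral>x. h' x \<partial>sphere_measure s)"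
          by (rule integral_cong_AE[OF meas _ eq']) simp
      qed
    qed
  qed
  then show "AE s in lborel. 0 < s \<longrightarrow> integrable (sphere_measure s) h"
    by eventually_elim simp
  have eq: "AE s in lebesgue. indicator {0<..} s * (\<integral>x. h' x \<partial>sphere_measure s) =
      indicator {0<..} s * (\<integral>x. h x \<partial>sphere_measure s)"
    unfolding AE_completion_iff using both by eventually_elim (auto simp: indicator_def)
  have m': "(\<lambda>s. indicator {0<..} s * (\<integral>x. h' x \<partial>sphere_measure s)) \<in> borel_measurable lborel"
    using P(2) by (rule borel_measurable_integrable)
  have I': "integrable lebesgue (\<lambda>s. indicator {0<..} s * (\<integral>x. h' x \<partial>sphere_measure s))"
    using P(2) m' by (simp only: integrable_completion)
  have m: "(\<lambda>s. indicator {0<..} s * (\<integral>x. h x \<partial>sphere_measure s)) \<in> borel_measurable lebesgue"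
    by (rule borel_measurable_AE[OF borel_measurable_integrable[OF I'] eq])
  show "integrable lebesgue (\<lambda>s. indicator {0<..} s * (\<integral>x. h x \<partial>sphere_measure s))"
    by (rule integrable_cong_AE_imp[OF I' m]) (use eq in \<open>auto elim: eventually_mono\<close>)
  have "(\<integral>x. h x \<partial>lebesgue) = (\<integral>x. h' x \<partial>lebesgue)"
    using ae h by (intro integral_cong_AE) auto
  also have "\<dots> = (\<integral>s. indicator {0<..} s * (\<integral>x. h' x \<partial>sphere_measure s) \<partial>lebesgue)"
    using P(3) m' by (simp only: integral_completion h'(1))
  also have "\<dots> = (\<integral>s. indicator {0<..} s * (\<integral>x. h x \<partial>sphere_measure s) \<partial>lebesgue)"
    by (rule integral_cong_AE[OF borel_measurable_integrable[OF I'] m eq])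
  finally show "(\<integral>x. h x \<partial>lebesgue) = (\<integral>s. indicator {0<..} s * (\<integral>x. h x \<partial>sphere_measure s) \<partial>lebesgue)" .
qed

section \<open>Traces on spheres\<close>

lemma AE_angular_norm: "AE \<omega> in (angular_measure :: 'a::euclidean_space measure). norm \<omega> = 1"
proof (rule AE_I')
  let ?N = "{x::'a. norm x \<noteq> 1}"
  have [measurable]: "?N \<in> sets borel" by measurable
  have "x = 0" if "norm (x /\<^sub>R norm x) \<noteq> 1" for x :: 'a
    using that by (cases "x = 0") simp_all
  then have "emeasure lborel {x \<in> ball 0 1. x /\<^sub>R norm x \<in> ?N} \<le> emeasure lborel {0::'a}"
    by (intro emeasure_mono) (blast, simp)
  then show "?N \<in> null_sets angular_measure"
    by (auto simp: null_sets_def emeasure_angular_measure)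
qed auto

lemma isCont_ray:
  fixes h :: "'a::euclidean_space \<Rightarrow> 'b::real_normed_vector"
  assumes "continuous_on UNIV h"
  shows "isCont (\<lambda>s::real. h (s *\<^sub>R \<omega>)) s"
proof -
  have "continuous_on UNIV (\<lambda>s::real. h (s *\<^sub>R \<omega>))"
    by (rule continuous_on_compose2[OF assms]) (auto intro!: continuous_intros)
  then show ?thesis
    by (simp add: continuous_on_eq_continuous_at)
qed

text \<open>The fundamental theorem of calculus for \<open>s \<mapsto> s\<^sup>d w(s\<omega>)\<^sup>2\<close> on each ray bounds the mass on the sphere
  by the \<open>H\<^sup>1\<close> norm in the ball.\<close>

lemma trace_inequality_ray:
  fixes w :: "'a::euclidean_space \<Rightarrow> real" and \<omega> :: 'a
  assumes w: "smooth w" and r: "r > 0" and \<omega>: "norm \<omega> = 1"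
  defines "q \<equiv> \<lambda>x. (real DIM('a) + r) * (w x)\<^sup>2 + r * (norm (gradient w x))\<^sup>2"
  shows "ennreal (r ^ DIM('a) * (w (r *\<^sub>R \<omega>))\<^sup>2) \<le>
    (\<integral>\<^sup>+s. ennreal (q (s *\<^sub>R \<omega>)) * indicator (ball 0 r) (s *\<^sub>R \<omega>) \<partial>radial_measure DIM('a))"
proof -
  let ?d = "DIM('a)"
  \<comment> \<open>The factor \<open>s\<^sup>d\<close> kills the value at the centre; one power of \<open>s\<close> more than the radial density
    leaves a weight that is bounded by \<open>r\<close>.\<close>
  define D where "D s = s ^ ?d * (w (s *\<^sub>R \<omega>))\<^sup>2" for s
  define D' where "D' s = real ?d * s ^ (?d - 1) * (w (s *\<^sub>R \<omega>))\<^sup>2 +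
    s ^ ?d * (2 * w (s *\<^sub>R \<omega>) * (gradient w (s *\<^sub>R \<omega>) \<bullet> \<omega>))" for s
  define \<kappa> where "\<kappa> s = s ^ (?d - 1) * q (s *\<^sub>R \<omega>)" for s
  have cq: "continuous_on UNIV q"
    unfolding q_def by (intro continuous_intros smooth_continuous_on smooth_continuous_on_gradient w)
  have [measurable]: "q \<in> borel_measurable borel"
    using cq by (rule borel_measurable_continuous_onI)
  have cont: "isCont D' s" "isCont \<kappa> s" for s
    unfolding D'_def \<kappa>_def
    by (intro continuous_intros isCont_ray cq smooth_continuous_on smooth_continuous_on_gradient w)+
  have deriv: "(D has_real_derivative D' s) (at s)" for s
    using smooth_ray_derivative[OF w, of 0 \<omega> s] unfolding D_def D'_def
    by (auto intro!: derivative_eq_intros)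
  have le: "D' s \<le> \<kappa> s" if s: "0 \<le> s" "s \<le> r" for s
  proof -
    let ?w = "w (s *\<^sub>R \<omega>)" and ?g = "gradient w (s *\<^sub>R \<omega>)"
    have "?w * (?g \<bullet> \<omega>) \<le> \<bar>?w\<bar> * \<bar>?g \<bullet> \<omega>\<bar>"
      by (metis abs_ge_self abs_mult)
    also have "\<dots> \<le> \<bar>?w\<bar> * norm ?g"
      using Cauchy_Schwarz_ineq2[of ?g \<omega>] \<omega> by (intro mult_left_mono) simp_all
    finally have "2 * ?w * (?g \<bullet> \<omega>) \<le> 2 * \<bar>?w\<bar> * norm ?g"
      by simp
    also have "\<dots> \<le> ?w\<^sup>2 + (norm ?g)\<^sup>2"
      using sum_squares_bound[of "\<bar>?w\<bar>" "norm ?g"] by simp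
    finally have "s * (2 * ?w * (?g \<bullet> \<omega>)) \<le> s * (?w\<^sup>2 + (norm ?g)\<^sup>2)"
      using s by (intro mult_left_mono)
    also have "\<dots> \<le> r * (?w\<^sup>2 + (norm ?g)\<^sup>2)"
      using s by (intro mult_right_mono) auto
    finally have "real ?d * ?w\<^sup>2 + s * (2 * ?w * (?g \<bullet> \<omega>)) \<le> q (s *\<^sub>R \<omega>)"
      by (simp add: q_def algebra_simps)
    then have "s ^ (?d - 1) * (real ?d * ?w\<^sup>2 + s * (2 * ?w * (?g \<bullet> \<omega>))) \<le> s ^ (?d - 1) * q (s *\<^sub>R \<omega>)"
      using s by (intro mult_left_mono) auto
    moreover have "s ^ ?d = s ^ (?d - 1) * s"
      by (simp add: power_eq_if)
    ultimately show ?thesis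
      by (simp add: D'_def \<kappa>_def algebra_simps)
  qed
  have \<kappa>_int: "integrable lborel (\<lambda>s. \<kappa> s * indicator {0..r} s)"
    using cont by (intro borel_integrable_atLeastAtMost) auto
  have "r ^ ?d * (w (r *\<^sub>R \<omega>))\<^sup>2 = D r - D 0"
    by (simp add: D_def)
  also have "\<dots> = (\<integral>s. D' s * indicator {0..r} s \<partial>lborel)"
    using r deriv cont by (intro integral_FTC_Icc_real[symmetric]) auto
  also have "\<dots> \<le> (\<integral>s. \<kappa> s * indicator {0..r} s \<partial>lborel)"
    by (intro integral_mono \<kappa>_int borel_integrable_atLeastAtMost cont)
      (use le in \<open>auto simp: indicator_def\<close>)
  finally have "ennreal (r ^ ?d * (w (r *\<^sub>R \<omega>))\<^sup>2) \<le> ennreal (\<integral>s. \<kappa> s * indicator {0..r} s \<partial>lborel)"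
    by (rule ennreal_leI)
  also have "\<dots> = (\<integral>\<^sup>+s. ennreal (\<kappa> s * indicator {0..r} s) \<partial>lborel)"
    by (rule nn_integral_eq_integral[symmetric, OF \<kappa>_int]) (use r in \<open>auto simp: \<kappa>_def q_def indicator_def\<close>)
  also have "\<dots> = (\<integral>\<^sup>+s. ennreal (indicator {0<..} s * s ^ (?d - 1)) *
      (ennreal (q (s *\<^sub>R \<omega>)) * indicator (ball 0 r) (s *\<^sub>R \<omega>)) \<partial>lborel)"
  proof (rule nn_integral_cong_AE)
    have "AE s in lborel. s \<noteq> (0::real) \<and> s \<noteq> r"
      using AE_lborel_singleton[of 0] AE_lborel_singleton[of r] by eventually_elim simp
    then show "AE s in lborel. ennreal (\<kappa> s * indicator {0..r} s) = ennreal (indicator {0<..} s * s ^ (?d - 1)) *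
      (ennreal (q (s *\<^sub>R \<omega>)) * indicator (ball 0 r) (s *\<^sub>R \<omega>))"
    proof eventually_elim
      case (elim s)
      show ?case
      proof (cases "0 < s \<and> s < r")
        case True
        then show ?thesis
          using r \<omega> by (simp add: \<kappa>_def q_def ennreal_mult')
      next
        case False
        then show ?thesis
          using elim \<omega> by (auto simp: indicator_def)
      qed
    qed
  qed
  also have "\<dots> = (\<integral>\<^sup>+s. ennreal (q (s *\<^sub>R \<omega>)) * indicator (ball 0 r) (s *\<^sub>R \<omega>) \<partial>radial_measure ?d)"
  proof -
    have h: "(\<lambda>x. ennreal (q x) * indicator (ball 0 r) x) \<in> borel_measurable borel"
      by (intro borel_measurable_times_ennreal borel_measurable_indicator) simp_all
    have "(\<lambda>s. ennreal (q (s *\<^sub>R \<omega>)) * indicator (ball 0 r) (s *\<^sub>R \<omega>)) \<in> borel_measurable borel"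
      by (rule measurable_compose[OF _ h]) simp
    then show ?thesis
      unfolding radial_measure_def by (subst nn_integral_density) simp_all
  qed
  finally show ?thesis .
qed

lemma trace_inequality:
  fixes w :: "'a::euclidean_space \<Rightarrow> real"
  assumes w: "smooth w" and r: "r > 0"
  shows "ennreal r * (\<integral>\<^sup>+x. ennreal ((w x)\<^sup>2) \<partial>sphere_measure r) \<le>
    (\<integral>\<^sup>+x. ennreal ((real DIM('a) + r) * (w x)\<^sup>2 + r * (norm (gradient w x))\<^sup>2) * indicator (ball 0 r) x \<partial>lborel)"
proof -
  let ?d = "DIM('a)"
  define q where "q x = (real ?d + r) * (w x)\<^sup>2 + r * (norm (gradient w x))\<^sup>2" for x
  have [measurable]: "w \<in> borel_measurable borel" "gradient w \<in> borel_measurable borel"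
    using w by (auto intro: borel_measurable_smooth borel_measurable_gradient)
  have [measurable]: "q \<in> borel_measurable borel"
    unfolding q_def by measurable
  interpret A: finite_measure "angular_measure :: 'a measure"
    by (rule finite_measure_angular)
  interpret R: sigma_finite_measure "radial_measure ?d"
    by (rule sigma_finite_radial)
  interpret P: pair_sigma_finite "radial_measure ?d" "angular_measure :: 'a measure" ..
  let ?h = "\<lambda>x::'a. ennreal (q x) * indicator (ball 0 r) x"
  have h: "?h \<in> borel_measurable borel"
    by (intro borel_measurable_times_ennreal borel_measurable_indicator) simp_all
  have hp: "(\<lambda>p. ?h (fst p *\<^sub>R snd p)) \<in> borel_measurable (borel \<Otimes>\<^sub>M borel)"
    by (rule measurable_compose[OF _ h]) measurable
  have "ennreal r * (\<integral>\<^sup>+x. ennreal ((w x)\<^sup>2) \<partial>sphere_measure r) =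
      ennreal r * (ennreal (r ^ (?d - 1)) * (\<integral>\<^sup>+\<omega>. ennreal ((w (r *\<^sub>R \<omega>))\<^sup>2) \<partial>angular_measure))"
    by (subst nn_integral_sphere[OF r]) simp_all
  also have "\<dots> = ennreal (r ^ ?d) * (\<integral>\<^sup>+\<omega>. ennreal ((w (r *\<^sub>R \<omega>))\<^sup>2) \<partial>angular_measure)"
  proof -
    have "r * r ^ (?d - 1) = r ^ ?d"
      by (simp add: power_eq_if)
    then have "ennreal r * ennreal (r ^ (?d - 1)) = ennreal (r ^ ?d)"
      using r by (simp only: ennreal_mult[symmetric] less_imp_le zero_le_power)
    then show ?thesis
      by (simp only: mult.assoc[symmetric])
  qed
  also have "\<dots> = (\<integral>\<^sup>+\<omega>. ennreal (r ^ ?d * (w (r *\<^sub>R \<omega>))\<^sup>2) \<partial>angular_measure)"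
  proof -
    have "(\<lambda>\<omega>. w (r *\<^sub>R \<omega>)) \<in> borel_measurable angular_measure"
      by (rule measurable_compose[of "\<lambda>\<omega>. r *\<^sub>R \<omega>" _ borel]) simp_all
    then have "(\<integral>\<^sup>+\<omega>. ennreal (r ^ ?d) * ennreal ((w (r *\<^sub>R \<omega>))\<^sup>2) \<partial>angular_measure) =
        ennreal (r ^ ?d) * (\<integral>\<^sup>+\<omega>. ennreal ((w (r *\<^sub>R \<omega>))\<^sup>2) \<partial>angular_measure)"
      by (intro nn_integral_cmult) simp
    then show ?thesis
      using r by (simp add: ennreal_mult)
  qed
  also have "\<dots> \<le> (\<integral>\<^sup>+\<omega>. \<integral>\<^sup>+s. ?h (s *\<^sub>R \<omega>) \<partial>radial_measure ?d \<partial>angular_measure)"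
    using AE_angular_norm unfolding q_def
    by (intro nn_integral_mono_AE) (auto elim!: eventually_mono intro: trace_inequality_ray[OF w r])
  also have "\<dots> = integral\<^sup>N (radial_measure ?d \<Otimes>\<^sub>M angular_measure) (\<lambda>p. ?h (fst p *\<^sub>R snd p))"
    using P.nn_integral_snd[of "\<lambda>p. ?h (fst p *\<^sub>R snd p)"] hp by simp
  also have "\<dots> = (\<integral>\<^sup>+x. ?h (norm x *\<^sub>R (x /\<^sub>R norm x)) \<partial>lborel)"
    unfolding polar_coordinates using hp by (subst nn_integral_distr) simp_all
  also have "\<dots> = (\<integral>\<^sup>+x. ?h x \<partial>lborel)"
    by (rule nn_integral_cong) (case_tac "x = 0"; simp)
  finally show ?thesis
    by (simp add: q_def)
qed

lemma finite_measure_sphere: "r > 0 \<Longrightarrow> finite_measure (sphere_measure r :: 'a::euclidean_space measure)"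
proof
  assume "r > 0"
  have "space (sphere_measure r :: 'a measure) = UNIV"
    unfolding sphere_measure_eq[OF \<open>r > 0\<close>] by simp
  then show "emeasure (sphere_measure r :: 'a measure) (space (sphere_measure r)) \<noteq> \<infinity>"
    using emeasure_sphere_measure_UNIV[OF \<open>r > 0\<close>, where 'a = 'a] by simp
qed

lemma L2_sphere_continuous:
  fixes h :: "'a::euclidean_space \<Rightarrow> real"
  assumes "continuous_on UNIV h" "r > 0"
  shows "L2 (sphere_measure r) h"
proof -
  have "compact (h ` sphere 0 r)"
    by (intro compact_continuous_image continuous_on_subset[OF assms(1)]) auto
  then obtain C where C: "\<And>x. norm x = r \<Longrightarrow> \<bar>h x\<bar> \<le> C"
    using compact_imp_bounded by (force simp: bounded_iff)
  have m [measurable]: "h \<in> borel_measurable (sphere_measure r)"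
    using assms by (simp add: borel_measurable_continuous_onI sphere_measurable_borel)
  interpret finite_measure "sphere_measure r :: 'a measure"
    by (rule finite_measure_sphere[OF assms(2)])
  have "integrable (sphere_measure r) (\<lambda>x. (norm (h x))\<^sup>2)"
  proof (rule integrable_const_bound[where B = "C\<^sup>2"])
    show "AE x in sphere_measure r. norm ((norm (h x))\<^sup>2) \<le> C\<^sup>2"
      using AE_sphere_norm[OF assms(2)]
    proof eventually_elim
      case (elim x)
      then show ?case using power_mono[OF C[OF elim], of 2] by simp
    qed
  qed simp
  with m show ?thesis by (simp add: L2_def)
qed

lemma trace_inequality_integral:
  fixes w :: "'a::euclidean_space \<Rightarrow> real"
  assumes w: "smooth w" and r: "r > 0"
  shows "r * (\<integral>x. (w x)\<^sup>2 \<partial>sphere_measure r) \<le>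
    (real DIM('a) + r) * (\<integral>x. (w x)\<^sup>2 \<partial>lebesgue_on (ball 0 r)) +
    r * (\<integral>x. (norm (gradient w x))\<^sup>2 \<partial>lebesgue_on (ball 0 r))"
proof -
  let ?M = "lebesgue_on (ball 0 r :: 'a set)"
  let ?q = "\<lambda>x. (real DIM('a) + r) * (w x)\<^sup>2 + r * (norm (gradient w x))\<^sup>2"
  have [measurable]: "w \<in> borel_measurable borel" "gradient w \<in> borel_measurable borel"
    using w by (auto intro: borel_measurable_smooth borel_measurable_gradient)
  have L2: "integrable ?M (\<lambda>x. (w x)\<^sup>2)" "integrable ?M (\<lambda>x. (norm (gradient w x))\<^sup>2)"
    using L2_continuous[OF smooth_continuous_on[OF w], of r] L2_continuous[OF smooth_continuous_on_gradient[OF w], of r]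
    by (auto simp: L2_def)
  have int: "integrable ?M ?q"
    by (intro Bochner_Integration.integrable_add integrable_mult_right L2)
  have "ennreal (r * (\<integral>x. (w x)\<^sup>2 \<partial>sphere_measure r)) = ennreal r * (\<integral>\<^sup>+x. ennreal ((w x)\<^sup>2) \<partial>sphere_measure r)"
    using L2_sphere_continuous[OF smooth_continuous_on[OF w] r] r
    by (subst nn_integral_eq_integral) (auto simp: L2_def ennreal_mult)
  also have "\<dots> \<le> (\<integral>\<^sup>+x. ennreal (?q x) * indicator (ball 0 r) x \<partial>lborel)"
    by (rule trace_inequality[OF w r])
  also have "\<dots> = (\<integral>\<^sup>+x. ennreal (?q x) \<partial>?M)"
    by (simp add: nn_integral_restrict_space nn_integral_completion)
  also have "\<dots> = ennreal (\<integral>x. ?q x \<partial>?M)"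
    using r by (intro nn_integral_eq_integral int) auto
  finally have "r * (\<integral>x. (w x)\<^sup>2 \<partial>sphere_measure r) \<le> (\<integral>x. ?q x \<partial>?M)"
    using r by (subst (asm) ennreal_le_iff) (auto intro!: integral_nonneg_AE)
  also have "\<dots> = (real DIM('a) + r) * (\<integral>x. (w x)\<^sup>2 \<partial>?M) + r * (\<integral>x. (norm (gradient w x))\<^sup>2 \<partial>?M)"
    using L2 by simp
  finally show ?thesis .
qed

lemma L2_dist_triangle:
  fixes X Y Z :: "'a \<Rightarrow> 'b::euclidean_space"
  assumes "L2 M X" "L2 M Y" "L2 M Z"
  shows "(\<integral>x. (norm (X x - Z x))\<^sup>2 \<partial>M) \<le> 2 * (\<integral>x. (norm (X x - Y x))\<^sup>2 \<partial>M) + 2 * (\<integral>x. (norm (Z x - Y x))\<^sup>2 \<partial>M)"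
proof -
  have i: "integrable M (\<lambda>x. (norm (X x - Z x))\<^sup>2)" "integrable M (\<lambda>x. (norm (X x - Y x))\<^sup>2)"
    "integrable M (\<lambda>x. (norm (Z x - Y x))\<^sup>2)"
    using L2_diff[OF assms(1,3)] L2_diff[OF assms(1,2)] L2_diff[OF assms(3,2)] by (auto simp: L2_def)
  have "(\<integral>x. (norm (X x - Z x))\<^sup>2 \<partial>M) \<le> (\<integral>x. 2 * (norm (X x - Y x))\<^sup>2 + 2 * (norm (Z x - Y x))\<^sup>2 \<partial>M)"
  proof (intro integral_mono Bochner_Integration.integrable_add integrable_mult_right i)
    fix x show "(norm (X x - Z x))\<^sup>2 \<le> 2 * (norm (X x - Y x))\<^sup>2 + 2 * (norm (Z x - Y x))\<^sup>2"
      using norm_add_square_le[of "X x - Y x" "Y x - Z x"] by (simp add: norm_minus_commute)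
  qed
  then show ?thesis using i by simp
qed

text \<open>By the trace inequality two smooth approximations of \<open>v\<close> approach each other on the sphere as well.\<close>

lemma has_trace_unique:
  fixes v :: "'a::euclidean_space \<Rightarrow> real"
  assumes v: "v \<in> H1 (ball 0 r)" and r: "r > 0" and \<tau>: "has_trace r v \<tau>" and \<sigma>: "has_trace r v \<sigma>"
  shows "AE x in sphere_measure r. \<tau> x = \<sigma> x"
proof -
  let ?M = "lebesgue_on (ball 0 r :: 'a set)" and ?S = "sphere_measure r :: 'a measure"
  obtain \<phi> where \<phi>: "\<And>n. smooth (\<phi> n)" "(\<lambda>n. H1_norm (ball 0 r) (\<lambda>x. \<phi> n x - v x)) \<longlonglongrightarrow> 0"
    "(\<lambda>n::nat. LINT x|?S. (\<phi> n x - \<tau> x)\<^sup>2) \<longlonglongrightarrow> 0"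
    using \<tau> unfolding has_trace_def by blast
  obtain \<psi> where \<psi>: "\<And>n. smooth (\<psi> n)" "(\<lambda>n. H1_norm (ball 0 r) (\<lambda>x. \<psi> n x - v x)) \<longlonglongrightarrow> 0"
    "(\<lambda>n::nat. LINT x|?S. (\<psi> n x - \<sigma> x)\<^sup>2) \<longlonglongrightarrow> 0"
    using \<sigma> unfolding has_trace_def by blast
  note c\<phi> = H1_smooth_convergence[OF v \<phi>(1,2)]
  note c\<psi> = H1_smooth_convergence[OF v \<psi>(1,2)]
  define w where "w n x = \<phi> n x - \<psi> n x" for n x
  have w: "smooth (w n)" for n
    unfolding w_def by (intro smooth_intros \<phi> \<psi>)
  have gw: "gradient (w n) x = gradient (\<phi> n) x - gradient (\<psi> n) x" for n x
    unfolding w_def by (rule gradient_diff[OF \<phi>(1) \<psi>(1)])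
  have diff0: "(\<lambda>n. \<integral>x. (norm (X n x - Y n x))\<^sup>2 \<partial>M) \<longlonglongrightarrow> 0"
    if "L2_converges M X Z" "L2_converges M Y Z" for M and X Y :: "nat \<Rightarrow> 'a \<Rightarrow> 'b::euclidean_space" and Z
  proof (rule tendsto_sandwich[where f = "\<lambda>_. 0"])
    have "(\<lambda>n. 2 * (\<integral>x. (norm (X n x - Z x))\<^sup>2 \<partial>M) + 2 * (\<integral>x. (norm (Y n x - Z x))\<^sup>2 \<partial>M)) \<longlonglongrightarrow> 2 * 0 + 2 * 0"
      using that by (intro tendsto_intros) (auto simp: L2_converges_def)
    then show "(\<lambda>n. 2 * (\<integral>x. (norm (X n x - Z x))\<^sup>2 \<partial>M) + 2 * (\<integral>x. (norm (Y n x - Z x))\<^sup>2 \<partial>M)) \<longlonglongrightarrow> 0"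
      by simp
    show "\<forall>\<^sub>F n in sequentially. (\<integral>x. (norm (X n x - Y n x))\<^sup>2 \<partial>M) \<le>
        2 * (\<integral>x. (norm (X n x - Z x))\<^sup>2 \<partial>M) + 2 * (\<integral>x. (norm (Y n x - Z x))\<^sup>2 \<partial>M)"
      using that by (intro always_eventually allI L2_dist_triangle) (auto simp: L2_converges_def)
  qed simp_all
  have L2: "L2 ?S (\<phi> n)" "L2 ?S (\<psi> n)" "L2 ?S \<tau>" "L2 ?S \<sigma>" for n
    using \<tau> \<sigma> r \<phi>(1) \<psi>(1) by (auto simp: has_trace_def intro!: L2_sphere_continuous smooth_continuous_on)
  have "(\<lambda>n. \<integral>x. (w n x)\<^sup>2 \<partial>?S) \<longlonglongrightarrow> 0"
  proof (rule tendsto_sandwich[where f = "\<lambda>_. 0"])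
    have "(\<lambda>n. ((real DIM('a) + r) * (\<integral>x. (w n x)\<^sup>2 \<partial>?M) + r * (\<integral>x. (norm (gradient (w n) x))\<^sup>2 \<partial>?M)) / r)
        \<longlonglongrightarrow> ((real DIM('a) + r) * 0 + r * 0) / r"
      using diff0[OF c\<phi>(1) c\<psi>(1)] diff0[OF c\<phi>(2) c\<psi>(2)] r
      by (intro tendsto_intros) (auto simp: w_def[symmetric] gw)
    then show "(\<lambda>n. ((real DIM('a) + r) * (\<integral>x. (w n x)\<^sup>2 \<partial>?M) + r * (\<integral>x. (norm (gradient (w n) x))\<^sup>2 \<partial>?M)) / r)
        \<longlonglongrightarrow> 0"
      by simp
    show "\<forall>\<^sub>F n in sequentially. (\<integral>x. (w n x)\<^sup>2 \<partial>?S) \<le>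
        ((real DIM('a) + r) * (\<integral>x. (w n x)\<^sup>2 \<partial>?M) + r * (\<integral>x. (norm (gradient (w n) x))\<^sup>2 \<partial>?M)) / r"
      using trace_inequality_integral[OF w r] r
      by (intro always_eventually allI) (simp add: pos_le_divide_eq mult.commute)
  qed simp_all
  then have w0: "(\<lambda>n. \<integral>x. (norm (\<phi> n x - \<psi> n x))\<^sup>2 \<partial>?S) \<longlonglongrightarrow> 0"
    by (simp add: w_def)
  have "(\<integral>x. (norm (\<tau> x - \<sigma> x))\<^sup>2 \<partial>?S) \<le> 0"
  proof (rule LIMSEQ_le_const)
    have "(\<lambda>n. 2 * (\<integral>x. (norm (\<phi> n x - \<tau> x))\<^sup>2 \<partial>?S) + 2 * (2 * (\<integral>x. (norm (\<psi> n x - \<sigma> x))\<^sup>2 \<partial>?S) +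
        2 * (\<integral>x. (norm (\<phi> n x - \<psi> n x))\<^sup>2 \<partial>?S))) \<longlonglongrightarrow> 2 * 0 + 2 * (2 * 0 + 2 * 0)"
      using \<phi>(3) \<psi>(3) w0 by (intro tendsto_intros) simp_all
    then show "(\<lambda>n. 2 * (\<integral>x. (norm (\<phi> n x - \<tau> x))\<^sup>2 \<partial>?S) + 2 * (2 * (\<integral>x. (norm (\<psi> n x - \<sigma> x))\<^sup>2 \<partial>?S) +
        2 * (\<integral>x. (norm (\<phi> n x - \<psi> n x))\<^sup>2 \<partial>?S))) \<longlonglongrightarrow> 0"
      by simp
    have "(\<integral>x. (norm (\<tau> x - \<sigma> x))\<^sup>2 \<partial>?S) \<le> 2 * (\<integral>x. (norm (\<phi> n x - \<tau> x))\<^sup>2 \<partial>?S) +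
        2 * (2 * (\<integral>x. (norm (\<psi> n x - \<sigma> x))\<^sup>2 \<partial>?S) + 2 * (\<integral>x. (norm (\<phi> n x - \<psi> n x))\<^sup>2 \<partial>?S))" for n
      using L2_dist_triangle[OF L2(3,1,4), of n] L2_dist_triangle[OF L2(4,2,1), of n n]
      by (simp add: power2_commute)
    then show "\<exists>N. \<forall>n\<ge>N. (\<integral>x. (norm (\<tau> x - \<sigma> x))\<^sup>2 \<partial>?S) \<le> 2 * (\<integral>x. (norm (\<phi> n x - \<tau> x))\<^sup>2 \<partial>?S) +
        2 * (2 * (\<integral>x. (norm (\<psi> n x - \<sigma> x))\<^sup>2 \<partial>?S) + 2 * (\<integral>x. (norm (\<phi> n x - \<psi> n x))\<^sup>2 \<partial>?S))"
      by blast
  qed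
  moreover have int: "integrable ?S (\<lambda>x. (norm (\<tau> x - \<sigma> x))\<^sup>2)"
    using L2_diff[OF L2(3,4)] by (simp add: L2_def)
  moreover have "(\<integral>x. (norm (\<tau> x - \<sigma> x))\<^sup>2 \<partial>?S) \<ge> 0"
    by simp
  ultimately have "(\<integral>x. (norm (\<tau> x - \<sigma> x))\<^sup>2 \<partial>?S) = 0"
    by linarith
  then have "AE x in ?S. (norm (\<tau> x - \<sigma> x))\<^sup>2 = 0"
    using integral_nonneg_eq_0_iff_AE[OF int] by simp
  then show ?thesis
    by eventually_elim simp
qed

lemma sphere_trace_AE_eq:
  fixes v :: "'a::euclidean_space \<Rightarrow> real"
  assumes "v \<in> H1 (ball 0 r)" "r > 0" "has_trace r v \<tau>"
  shows "AE x in sphere_measure r. sphere_trace r v x = \<tau> x" and "L2 (sphere_measure r) (sphere_trace r v)"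
proof -
  have "has_trace r v (sphere_trace r v)"
    unfolding sphere_trace_def by (rule someI[of "has_trace r v"]) (rule assms(3))
  then show "AE x in sphere_measure r. sphere_trace r v x = \<tau> x" "L2 (sphere_measure r) (sphere_trace r v)"
    using has_trace_unique[OF assms(1,2) _ assms(3)] by (auto simp: has_trace_def)
qed

lemma L2_converges_subset:
  fixes X :: "nat \<Rightarrow> 'a::euclidean_space \<Rightarrow> 'b::euclidean_space"
  assumes "L2_converges (lebesgue_on \<Omega>) X Y" "\<Omega>' \<subseteq> \<Omega>" "\<Omega> \<in> sets lebesgue" "\<Omega>' \<in> sets lebesgue"
  shows "L2_converges (lebesgue_on \<Omega>') X Y"
proof -
  have L2: "L2 (lebesgue_on \<Omega>) (X n)" "L2 (lebesgue_on \<Omega>) Y" for n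
    using assms(1) by (auto simp: L2_converges_def)
  have le: "(\<integral>x. (norm (X n x - Y x))\<^sup>2 \<partial>lebesgue_on \<Omega>') \<le> (\<integral>x. (norm (X n x - Y x))\<^sup>2 \<partial>lebesgue_on \<Omega>)" for n
  proof -
    have d: "L2 (lebesgue_on \<Omega>) (\<lambda>x. X n x - Y x)"
      by (intro L2_diff L2)
    have "L2 (lebesgue_on \<Omega>') (\<lambda>x. X n x - Y x)"
      by (rule L2_lebesgue_on_subset[OF d assms(2-4)])
    then show ?thesis
      using d assms(2-4)
      unfolding L2_def by (auto simp: integral_restrict_space integrable_restrict_space indicator_def intro!: integral_mono)
  qed
  have "(\<lambda>n. \<integral>x. (norm (X n x - Y x))\<^sup>2 \<partial>lebesgue_on \<Omega>') \<longlonglongrightarrow> 0"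
    by (rule tendsto_sandwich[where f = "\<lambda>_. 0" and h = "\<lambda>n. \<integral>x. (norm (X n x - Y x))\<^sup>2 \<partial>lebesgue_on \<Omega>"])
      (use assms(1) le in \<open>auto simp: L2_converges_def\<close>)
  then show ?thesis
    unfolding L2_converges_def using L2_lebesgue_on_subset[OF L2(1) assms(2-4)] L2_lebesgue_on_subset[OF L2(2) assms(2-4)]
    by blast
qed

lemma L2_converges_cong_AE:
  fixes X :: "nat \<Rightarrow> 'a::euclidean_space \<Rightarrow> 'b::euclidean_space"
  assumes X: "L2_converges (lebesgue_on \<Omega>) X Y" and \<Omega>: "\<Omega> \<in> sets lebesgue"
    and Y: "AE x in lebesgue. x \<in> \<Omega> \<longrightarrow> Y x = Z x"
  shows "L2_converges (lebesgue_on \<Omega>) X Z"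
proof -
  have L2: "L2 (lebesgue_on \<Omega>) (X n)" "L2 (lebesgue_on \<Omega>) Y" "L2 (lebesgue_on \<Omega>) Z" for n
    using X L2_cong_AE[OF _ \<Omega> Y] by (auto simp: L2_converges_def)
  then have [measurable]: "X n \<in> borel_measurable (lebesgue_on \<Omega>)" "Y \<in> borel_measurable (lebesgue_on \<Omega>)"
    "Z \<in> borel_measurable (lebesgue_on \<Omega>)" for n
    by (auto simp: L2_def)
  have "(\<integral>x. (norm (X n x - Y x))\<^sup>2 \<partial>lebesgue_on \<Omega>) = (\<integral>x. (norm (X n x - Z x))\<^sup>2 \<partial>lebesgue_on \<Omega>)" for n
    using Y \<Omega> by (intro integral_cong_AE) (auto simp: AE_restrict_space_iff elim: eventually_mono)
  then show ?thesis
    using X L2 by (auto simp: L2_converges_def)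
qed

text \<open>By Fubini in polar coordinates, the \<open>L\<^sup>2\<close> distances of the approximations to \<open>v\<close> on the spheres tend to
  zero in the mean over the radius, hence at almost every radius along a subsequence.\<close>

lemma AE_has_trace_self:
  fixes v :: "'a::euclidean_space \<Rightarrow> real"
  assumes v: "v \<in> H1 (ball 0 R)" and w: "\<And>n. smooth (w n)"
    and conv: "(\<lambda>n. H1_norm (ball 0 R) (\<lambda>x. w n x - v x)) \<longlonglongrightarrow> 0"
  shows "AE r in lborel. 0 < r \<and> r < R \<longrightarrow> has_trace r v v"
proof -
  let ?B = "ball 0 R :: 'a set"
  note c = H1_smooth_convergence[OF v w conv]
  have L2: "L2 (lebesgue_on ?B) (w n)" "L2 (lebesgue_on ?B) v" for n
    using c(1) by (auto simp: L2_converges_def)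
  define h where "h n x = indicator ?B x * (w n x - v x)\<^sup>2" for n x
  have h_int: "integrable lebesgue (h n)" for n
    using L2_diff[OF L2, of n] by (simp add: L2_def integrable_restrict_space h_def[abs_def])
  have h_lim: "(\<lambda>n. \<integral>x. h n x \<partial>lebesgue) \<longlonglongrightarrow> 0"
    using c(1) by (simp add: L2_converges_def integral_restrict_space h_def)
  define E where "E n s = indicator {0<..} s * (\<integral>x. h n x \<partial>sphere_measure s)" for n s
  have E_nonneg: "E n s \<ge> 0" for n s
    by (auto simp: E_def h_def intro!: mult_nonneg_nonneg integral_nonneg_AE)
  have "\<exists>k::nat\<Rightarrow>nat. strict_mono k \<and> (AE s in lebesgue. (\<lambda>n. E (k n) s) \<longlonglongrightarrow> 0)"
  proof (rule tendsto_L1_AE_subseq)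
    show "integrable lebesgue (E n)" for n
      unfolding E_def by (rule integral_polar(2)[OF h_int])
    have "(\<integral>s. norm (E n s) \<partial>lebesgue) = (\<integral>x. h n x \<partial>lebesgue)" for n
      using integral_polar(3)[OF h_int, of n] E_nonneg by (simp add: E_def)
    then show "(\<lambda>n. \<integral>s. norm (E n s) \<partial>lebesgue) \<longlonglongrightarrow> 0"
      using h_lim by simp
  qed
  then obtain k :: "nat \<Rightarrow> nat" where k: "strict_mono k" "AE s in lborel. (\<lambda>n. E (k n) s) \<longlonglongrightarrow> 0"
    by (auto simp: AE_completion_iff)
  have "integrable lebesgue (\<lambda>x. indicator ?B x * (v x)\<^sup>2)"
    using L2(2) by (simp add: L2_def integrable_restrict_space)
  then have v_sphere: "AE s in lborel. 0 < s \<longrightarrow> integrable (sphere_measure s) (\<lambda>x. indicator ?B x * (v x)\<^sup>2)"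
    by (rule integral_polar(1))
  have "(\<lambda>x. if x \<in> ?B then v x else 0) \<in> borel_measurable lebesgue"
    using L2(2) borel_measurable_if[of ?B v] unfolding L2_def by fastforce
  then obtain v' where v': "v' \<in> borel_measurable lborel" "AE x in lborel. (if x \<in> ?B then v x else 0) = v' x"
    using completion_ex_borel_measurable_real by blast
  have v'_sphere: "AE s in lborel. 0 < s \<longrightarrow> (AE x in sphere_measure s. (if x \<in> ?B then v x else 0) = v' x)"
    by (rule AE_sphere_if_AE) (use v'(2) in \<open>simp add: AE_completion_iff\<close>)
  show ?thesis
    using k(2) v_sphere v'_sphere
  proof eventually_elim
    case (elim s)
    show ?case
    proof
      assume s: "0 < s \<and> s < R"
      let ?S = "sphere_measure s :: 'a measure"
      have norm_s: "AE x in ?S. norm x = s"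
        using s by (intro AE_sphere_norm) simp
      have v_meas: "v \<in> borel_measurable ?S"
      proof -
        have "AE x in ?S. (if x \<in> ?B then v x else 0) = v' x"
          using elim(3) s by blast
        then have eq: "AE x in ?S. v' x = v x"
          using norm_s by eventually_elim (use s in auto)
        show ?thesis
          unfolding sphere_measure_def
          by (rule measurable_completion_AE[OF _ eq[unfolded sphere_measure_def]])
            (rule measurable_completion, use v'(1) in simp)
      qed
      then have [measurable]: "v \<in> borel_measurable ?S" .
      have [measurable]: "w n \<in> borel_measurable ?S" for n
        by (intro sphere_measurable_borel borel_measurable_smooth w)
      have ind: "AE x in ?S. indicator ?B x = (1::real)"
        using norm_s by eventually_elim (use s in auto)
      have [measurable]: "?B \<in> sets ?S"
        unfolding sphere_measure_def by (rule sets_completionI_sets) simp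
      have "integrable ?S (\<lambda>x. (v x)\<^sup>2)"
        by (rule integrable_cong_AE_imp[of _ "\<lambda>x. indicator ?B x * (v x)\<^sup>2"])
          (use elim(2) s ind in \<open>auto elim: eventually_mono\<close>)
      then have v_L2: "L2 ?S v"
        using v_meas by (simp add: L2_def)
      have "E (k n) s = (\<integral>x. (w (k n) x - v x)\<^sup>2 \<partial>?S)" for n
      proof -
        have "(\<integral>x. h (k n) x \<partial>?S) = (\<integral>x. (w (k n) x - v x)\<^sup>2 \<partial>?S)"
          unfolding h_def by (rule integral_cong_AE) (use ind in \<open>auto elim: eventually_mono\<close>)
        then show ?thesis
          using s by (simp add: E_def)
      qed
      then have lim_S: "(\<lambda>n. \<integral>x. (w (k n) x - v x)\<^sup>2 \<partial>?S) \<longlonglongrightarrow> 0"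
        using elim(1) by simp
      have sR: "s \<le> R" "ball 0 s \<subseteq> ?B"
        using s by (auto intro: subset_ball)
      note sub = H1_ball_subset[OF v sR(1)]
      have "L2_converges (lebesgue_on (ball 0 s)) w v"
        by (rule L2_converges_subset[OF c(1) sR(2)]) auto
      moreover have "L2_converges (lebesgue_on (ball 0 s)) (\<lambda>n. gradient (w n)) (weak_gradient (ball 0 s) v)"
        by (rule L2_converges_cong_AE[OF L2_converges_subset[OF c(2) sR(2)]])
          (use sub(2) in \<open>auto elim: eventually_mono\<close>)
      ultimately have "(\<lambda>n. H1_norm (ball 0 s) (\<lambda>x. w n x - v x)) \<longlonglongrightarrow> 0"
        by (rule H1_norm_tendstoI[OF sub(1) w])
      then have "(\<lambda>n. H1_norm (ball 0 s) (\<lambda>x. w (k n) x - v x)) \<longlonglongrightarrow> 0"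
        using LIMSEQ_subseq_LIMSEQ[OF _ k(1)] by (auto simp: o_def)
      then show "has_trace s v v"
        unfolding has_trace_def using v_L2 lim_S w by (intro conjI exI[of _ "\<lambda>n. w (k n)"]) auto
    qed
  qed
qed

section \<open>From radial cutoffs to balls and spheres\<close>

text \<open>Cutoffs are functions of \<open>|x|\<^sup>2\<close>, which makes them smooth on the whole space; their support is a
  compact annulus that avoids the centre, where the potential is singular.\<close>

definition radial_cutoff :: "real \<Rightarrow> (real \<Rightarrow> real) \<Rightarrow> (real \<Rightarrow> real) \<Rightarrow> bool" where
  "radial_cutoff R \<Phi> \<Phi>' \<longleftrightarrow> smooth \<Phi> \<and> smooth \<Phi>' \<and> (\<forall>y. (\<Phi> has_real_derivative \<Phi>' y) (at y)) \<and>
     (\<forall>y. 0 \<le> \<Phi> y) \<and>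
     (\<exists>a b. 0 < a \<and> a < b \<and> b < R\<^sup>2 \<and> (\<forall>y. \<not> (a < y \<and> y < b) \<longrightarrow> \<Phi> y = 0 \<and> \<Phi>' y = 0))"

lemma integrable_bounded_mult:
  fixes f q :: "'a \<Rightarrow> real"
  assumes f: "integrable M f" and q: "q \<in> borel_measurable M" "AE x in M. \<bar>q x\<bar> \<le> C"
  shows "integrable M (\<lambda>x. q x * f x)"
proof (rule Bochner_Integration.integrable_bound)
  show "integrable M (\<lambda>x. C * f x)" "(\<lambda>x. q x * f x) \<in> borel_measurable M"
    using f q(1) by auto
  show "AE x in M. norm (q x * f x) \<le> norm (C * f x)"
    using q(2)
  proof eventually_elim
    case (elim x)
    then have "\<bar>q x\<bar> * \<bar>f x\<bar> \<le> \<bar>C\<bar> * \<bar>f x\<bar>"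
      by (intro mult_right_mono) auto
    then show ?case by (simp add: abs_mult)
  qed
qed

lemma borel_measurable_radial:
  fixes F :: "real \<Rightarrow> real"
  assumes "F \<in> borel_measurable borel"
  shows "(\<lambda>x::'a::euclidean_space. F ((norm x)\<^sup>2)) \<in> borel_measurable borel"
    and "(\<lambda>x::'a. F ((norm x)\<^sup>2)) \<in> borel_measurable lebesgue"
    and "(\<lambda>x::'a. F ((norm x)\<^sup>2)) \<in> borel_measurable (lebesgue_on \<Omega>)"
proof -
  show 1: "(\<lambda>x::'a. F ((norm x)\<^sup>2)) \<in> borel_measurable borel"
    by (rule measurable_compose[OF _ assms]) simp
  show 2: "(\<lambda>x::'a. F ((norm x)\<^sup>2)) \<in> borel_measurable lebesgue"
    by (rule measurable_completion) (use 1 in simp)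
  show "(\<lambda>x::'a. F ((norm x)\<^sup>2)) \<in> borel_measurable (lebesgue_on \<Omega>)"
    by (rule measurable_restrict_space1[OF 2])
qed

lemma AE_sphere_integrable:
  fixes B :: "'a::euclidean_space \<Rightarrow> real"
  assumes "integrable (lebesgue_on (ball 0 R)) B"
  shows "AE s in lborel. 0 < s \<and> s < R \<longrightarrow> integrable (sphere_measure s) B \<and>
    (\<integral>x. indicator (ball 0 R) x * B x \<partial>sphere_measure s) = (\<integral>x. B x \<partial>sphere_measure s)"
proof -
  let ?B = "\<lambda>x. indicator (ball 0 R) x * B x"
  have "integrable lebesgue ?B"
    using assms by (simp add: integrable_restrict_space)
  from integral_polar(1)[OF this] show ?thesis
  proof eventually_elim
    case (elim s)
    show ?case
    proof
      assume s: "0 < s \<and> s < R"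
      then have int: "integrable (sphere_measure s) ?B"
        using elim by simp
      have eq: "AE x in sphere_measure s. ?B x = B x"
        using AE_sphere_norm[of s] s by (auto elim!: eventually_mono)
      have meas: "B \<in> borel_measurable (sphere_measure s)"
        unfolding sphere_measure_def
        by (rule measurable_completion_AE[OF _ eq[unfolded sphere_measure_def]])
          (rule borel_measurable_integrable[OF int[unfolded sphere_measure_def]])
      show "integrable (sphere_measure s) B \<and> (\<integral>x. ?B x \<partial>sphere_measure s) = (\<integral>x. B x \<partial>sphere_measure s)"
        using integrable_cong_AE_imp[OF int meas] eq integral_cong_AE[OF borel_measurable_integrable[OF int] meas eq]
        by (auto elim!: eventually_mono)
    qed
  qed
qed

text \<open>On each sphere the weight is constant.\<close>

lemma integral_radial_weight:
  fixes B :: "'a::euclidean_space \<Rightarrow> real"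
  assumes B: "integrable (lebesgue_on (ball 0 R)) B"
    and \<rho>: "\<rho> \<in> borel_measurable borel" "\<And>y. \<bar>\<rho> y\<bar> \<le> C"
  defines "b \<equiv> \<lambda>s. indicator {0<..<R} s * (\<integral>x. indicator (ball 0 R) x * B x \<partial>sphere_measure s)"
  shows "integrable lebesgue b"
    and "(\<integral>x. \<rho> ((norm x)\<^sup>2) * B x \<partial>lebesgue_on (ball 0 R)) = (\<integral>s. \<rho> (s\<^sup>2) * b s \<partial>lebesgue)"
proof -
  note [measurable] = \<rho>(1)
  let ?B = "\<lambda>x. indicator (ball 0 R) x * B x"
  have B_int: "integrable lebesgue ?B"
    using B by (simp add: integrable_restrict_space)
  let ?b = "\<lambda>s. indicator {0<..} s * (\<integral>x. ?B x \<partial>sphere_measure s)"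
  have b_eq: "b s = ?b s" for s
  proof (cases "0 < s \<and> \<not> s < R")
    case True
    have "(\<integral>x. ?B x \<partial>sphere_measure s) = 0"
      by (rule integral_eq_zero_AE) (use AE_sphere_norm[of s] True in \<open>auto elim!: eventually_mono simp: indicator_def\<close>)
    then show ?thesis by (simp add: b_def)
  qed (auto simp: b_def indicator_def)
  show "integrable lebesgue b"
    unfolding b_eq by (rule integral_polar(2)[OF B_int])
  have h_int: "integrable lebesgue (\<lambda>x. \<rho> ((norm x)\<^sup>2) * ?B x)"
    by (rule integrable_bounded_mult[OF B_int borel_measurable_radial(2)[OF \<rho>(1)]]) (use \<rho>(2) in auto)
  have sphere: "indicator {0<..} s * (\<integral>x. \<rho> ((norm x)\<^sup>2) * ?B x \<partial>sphere_measure s) = \<rho> (s\<^sup>2) * b s"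
    if "0 < s \<longrightarrow> integrable (sphere_measure s) ?B" for s
  proof (cases "0 < s")
    case True
    then have m: "?B \<in> borel_measurable (sphere_measure s)"
      using that by (intro borel_measurable_integrable) simp
    have m': "(\<lambda>x. \<rho> ((norm x)\<^sup>2)) \<in> borel_measurable (sphere_measure s)"
      by (rule sphere_measurable_borel[OF borel_measurable_radial(1)[OF \<rho>(1)]])
    have "(\<integral>x. \<rho> ((norm x)\<^sup>2) * ?B x \<partial>sphere_measure s) = (\<integral>x. \<rho> (s\<^sup>2) * ?B x \<partial>sphere_measure s)"
      by (intro integral_cong_AE borel_measurable_times m m' borel_measurable_const)
        (use AE_sphere_norm[OF True] in \<open>auto elim!: eventually_mono\<close>)
    then show ?thesis
      using True by (simp add: b_eq)
  qed (simp add: b_eq)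
  have ae: "AE s in lebesgue. indicator {0<..} s * (\<integral>x. \<rho> ((norm x)\<^sup>2) * ?B x \<partial>sphere_measure s) = \<rho> (s\<^sup>2) * b s"
    unfolding AE_completion_iff using integral_polar(1)[OF B_int] by eventually_elim (rule sphere)
  have "(\<integral>x. \<rho> ((norm x)\<^sup>2) * B x \<partial>lebesgue_on (ball 0 R)) = (\<integral>x. \<rho> ((norm x)\<^sup>2) * ?B x \<partial>lebesgue)"
    by (simp add: integral_restrict_space mult.left_commute)
  also have "\<dots> = (\<integral>s. indicator {0<..} s * (\<integral>x. \<rho> ((norm x)\<^sup>2) * ?B x \<partial>sphere_measure s) \<partial>lebesgue)"
    by (rule integral_polar(3)[OF h_int])
  also have "\<dots> = (\<integral>s. \<rho> (s\<^sup>2) * b s \<partial>lebesgue)"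
  proof (rule integral_cong_AE[OF _ _ ae])
    show "(\<lambda>s. indicator {0<..} s * (\<integral>x. \<rho> ((norm x)\<^sup>2) * ?B x \<partial>sphere_measure s)) \<in> borel_measurable lebesgue"
      by (rule borel_measurable_integrable[OF integral_polar(2)[OF h_int]])
    have "(\<lambda>s. \<rho> (s\<^sup>2)) \<in> borel_measurable lebesgue"
      by (rule measurable_completion, rule measurable_compose[OF _ \<rho>(1)]) simp
    then show "(\<lambda>s. \<rho> (s\<^sup>2) * b s) \<in> borel_measurable lebesgue"
      using \<open>integrable lebesgue b\<close> by (intro borel_measurable_times) auto
  qed
  finally show "(\<integral>x. \<rho> ((norm x)\<^sup>2) * B x \<partial>lebesgue_on (ball 0 R)) = (\<integral>s. \<rho> (s\<^sup>2) * b s \<partial>lebesgue)" .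
qed

text \<open>For \<open>T\<close> with derivative \<open>\<rho>\<close> the weight \<open>T(R\<^sup>2) - T(|x|\<^sup>2)\<close> is the integral of \<open>2 s \<rho>(s\<^sup>2)\<close> over
  \<open>|x| < s < R\<close>, so integrating it against \<open>A\<close> averages the integrals of \<open>A\<close> over balls.\<close>

lemma integral_primitive_weight:
  fixes A :: "'a::euclidean_space \<Rightarrow> real"
  assumes A: "integrable (lebesgue_on (ball 0 R)) A" and "R > 0"
    and T: "\<And>y. (T has_real_derivative \<rho> y) (at y)" "continuous_on UNIV \<rho>" "\<And>y. \<bar>\<rho> y\<bar> \<le> C"
  defines "\<alpha> \<equiv> \<lambda>s. indicator {0<..<R} s * (\<integral>x. indicator (ball 0 s) x * A x \<partial>lebesgue_on (ball 0 R))"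
  shows "\<alpha> \<in> borel_measurable borel" and "\<bar>\<alpha> s\<bar> \<le> (\<integral>x. \<bar>A x\<bar> \<partial>lebesgue_on (ball 0 R)) * indicator {0<..<R} s"
    and "(\<integral>x. (T (R\<^sup>2) - T ((norm x)\<^sup>2)) * A x \<partial>lebesgue_on (ball 0 R)) = (\<integral>s. \<rho> (s\<^sup>2) * (2 * s * \<alpha> s) \<partial>lborel)"
proof -
  let ?M = "lebesgue_on (ball 0 R :: 'a set)"
  interpret M: finite_measure ?M
    by (rule finite_measure_lebesgue_on) simp
  interpret P: pair_sigma_finite "lborel :: real measure" ?M ..
  have [measurable]: "\<rho> \<in> borel_measurable borel" "A \<in> borel_measurable ?M"
    using T(2) A by (auto intro: borel_measurable_continuous_onI)
  have [measurable]: "(norm :: 'a \<Rightarrow> real) \<in> borel_measurable ?M"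
    by (intro measurable_restrict_space1 measurable_completion) simp
  have ball_eq: "indicator (ball 0 s) x * A x = (if norm x < s then A x else 0)" for s x
    by (simp add: indicator_def)
  show "\<alpha> \<in> borel_measurable borel"
    unfolding \<alpha>_def ball_eq by measurable
  show bound: "\<bar>\<alpha> s\<bar> \<le> (\<integral>x. \<bar>A x\<bar> \<partial>?M) * indicator {0<..<R} s" for s
  proof -
    have "integrable ?M (\<lambda>x. if norm x < s then A x else 0)"
      by (rule Bochner_Integration.integrable_bound[OF A]) auto
    then have "\<bar>\<integral>x. indicator (ball 0 s) x * A x \<partial>?M\<bar> \<le> (\<integral>x. \<bar>A x\<bar> \<partial>?M)"
      unfolding ball_eq using A
      by (intro order_trans[OF integral_abs_bound] integral_mono integrable_abs) auto
    then show ?thesis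
      by (auto simp: \<alpha>_def indicator_def)
  qed
  define F where "F = (\<lambda>(s, x). indicator {0<..<R} s * (2 * s * \<rho> (s\<^sup>2)) * (if norm x < s then A x else 0))"
  have F_meas [measurable]: "F \<in> borel_measurable (lborel \<Otimes>\<^sub>M ?M)"
    unfolding F_def by measurable
  have cont\<rho>: "isCont (\<lambda>s. 2 * s * \<rho> (s\<^sup>2)) s" for s
  proof -
    have "continuous_on UNIV (\<lambda>s. \<rho> (s\<^sup>2))"
      by (rule continuous_on_compose2[OF T(2)]) (auto intro!: continuous_intros)
    then show ?thesis
      by (intro continuous_intros) (simp add: continuous_on_eq_continuous_at)
  qed
  have inner: "(\<integral>s. F (s, x) \<partial>lborel) = (T (R\<^sup>2) - T ((norm x)\<^sup>2)) * A x" if x: "norm x < R" for x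
  proof -
    have "(\<integral>s. F (s, x) \<partial>lborel) = (\<integral>s. A x * (2 * s * \<rho> (s\<^sup>2) * indicator {norm x..R} s) \<partial>lborel)"
    proof (rule integral_cong_AE)
      have "AE s in lborel. s \<noteq> norm x \<and> s \<noteq> R"
        using AE_lborel_singleton[of "norm x"] AE_lborel_singleton[of R] by eventually_elim simp
      then show "AE s in lborel. F (s, x) = A x * (2 * s * \<rho> (s\<^sup>2) * indicator {norm x..R} s)"
      proof eventually_elim
        case (elim s)
        then show ?case
          using norm_ge_zero[of x] by (auto simp: F_def indicator_def simp del: norm_ge_zero)
      qed
    qed (auto simp: F_def)
    also have "\<dots> = A x * (\<integral>s. 2 * s * \<rho> (s\<^sup>2) * indicator {norm x..R} s \<partial>lborel)"
      by simp
    also have "(\<integral>s. 2 * s * \<rho> (s\<^sup>2) * indicator {norm x..R} s \<partial>lborel) = T (R\<^sup>2) - T ((norm x)\<^sup>2)"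
    proof (rule integral_FTC_Icc_real)
      show "((\<lambda>s. T (s\<^sup>2)) has_real_derivative 2 * s * \<rho> (s\<^sup>2)) (at s)" for s
        by (rule DERIV_cong[OF DERIV_chain2[OF T(1)]]) (auto intro!: derivative_eq_intros)
    qed (use x cont\<rho> in auto)
    finally show ?thesis by simp
  qed
  have C0: "C \<ge> 0" using T(3)[of 0] by linarith
  have F_int: "integrable (lborel \<Otimes>\<^sub>M ?M) F"
  proof (rule P.Fubini_integrable[OF F_meas])
    have slice: "integrable ?M (\<lambda>x. F (s, x))" for s
      unfolding F_def using A
      by (auto intro!: integrable_mult_right Bochner_Integration.integrable_bound[OF A])
    then show "AE s in lborel. integrable ?M (\<lambda>x. F (s, x))" by simp
    have "integrable lborel (\<lambda>s. (2 * R * C * (\<integral>x. \<bar>A x\<bar> \<partial>?M)) * indicator {0<..<R} s)"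
      using \<open>R > 0\<close> by (intro integrable_mult_right integrable_real_indicator) simp_all
    then show "integrable lborel (\<lambda>s. \<integral>x. norm (F (s, x)) \<partial>?M)"
    proof (rule Bochner_Integration.integrable_bound)
      show "(\<lambda>s. \<integral>x. norm (F (s, x)) \<partial>?M) \<in> borel_measurable lborel"
        by (rule M.borel_measurable_lebesgue_integral) simp
      show "AE s in lborel. norm (\<integral>x. norm (F (s, x)) \<partial>?M) \<le> norm ((2 * R * C * (\<integral>x. \<bar>A x\<bar> \<partial>?M)) * indicator {0<..<R} s)"
      proof (rule AE_I2)
        fix s :: real
        show "norm (\<integral>x. norm (F (s, x)) \<partial>?M) \<le> norm ((2 * R * C * (\<integral>x. \<bar>A x\<bar> \<partial>?M)) * indicator {0<..<R} s)"
        proof (cases "s \<in> {0<..<R}")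
          case True
          have "(\<integral>x. norm (F (s, x)) \<partial>?M) \<le> (\<integral>x. 2 * R * C * \<bar>A x\<bar> \<partial>?M)"
          proof (intro integral_mono integrable_norm slice integrable_mult_right integrable_abs A)
            fix x
            have "\<bar>2 * s * \<rho> (s\<^sup>2)\<bar> \<le> 2 * R * C"
              unfolding abs_mult using True T(3)[of "s\<^sup>2"] by (intro mult_mono) auto
            then have "\<bar>2 * s * \<rho> (s\<^sup>2)\<bar> * \<bar>A x\<bar> \<le> 2 * R * C * \<bar>A x\<bar>"
              by (intro mult_right_mono) simp_all
            then show "norm (F (s, x)) \<le> 2 * R * C * \<bar>A x\<bar>"
              using True \<open>R > 0\<close> C0 by (cases "norm x < s") (simp_all add: F_def abs_mult)
          qed
          then show ?thesis
            using True \<open>R > 0\<close> C0 by (simp add: integral_nonneg_AE abs_mult)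
        next
          case False
          then show ?thesis by (simp add: F_def)
        qed
      qed
    qed
  qed
  have "(\<integral>x. (T (R\<^sup>2) - T ((norm x)\<^sup>2)) * A x \<partial>?M) = (\<integral>x. (\<integral>s. F (s, x) \<partial>lborel) \<partial>?M)"
    by (rule Bochner_Integration.integral_cong) (auto simp: inner space_restrict_space)
  also have "\<dots> = (\<integral>s. (\<integral>x. F (s, x) \<partial>?M) \<partial>lborel)"
    using P.Fubini_integral[of "\<lambda>s x. F (s, x)"] F_int by (simp add: split_beta')
  also have "\<dots> = (\<integral>s. \<rho> (s\<^sup>2) * (2 * s * \<alpha> s) \<partial>lborel)"
    unfolding \<alpha>_def ball_eq F_def by (rule Bochner_Integration.integral_cong) (simp_all add: mult_ac)
  finally show "(\<integral>x. (T (R\<^sup>2) - T ((norm x)\<^sup>2)) * A x \<partial>?M) = (\<integral>s. \<rho> (s\<^sup>2) * (2 * s * \<alpha> s) \<partial>lborel)" .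
qed

text \<open>Cutting off the origin costs nothing in the limit: the derivative of the inner cutoff at scale
  \<open>\<epsilon>\<close> is of size \<open>1 / |x|\<^sup>2\<close> on a shell that shrinks to the origin.\<close>

lemma inner_cutoff_removal:
  fixes A B :: "'a::euclidean_space \<Rightarrow> real"
  assumes "R > 0" and A: "integrable (lebesgue_on (ball 0 R)) A" and B: "integrable (lebesgue_on (ball 0 R)) B"
    and B2: "integrable (lebesgue_on (ball 0 R)) (\<lambda>x. B x / (norm x)\<^sup>2)"
    and cutoff: "\<And>\<Phi> \<Phi>'. radial_cutoff R \<Phi> \<Phi>' \<Longrightarrow>
      (\<integral>x. \<Phi> ((norm x)\<^sup>2) * A x + \<Phi>' ((norm x)\<^sup>2) * B x \<partial>lebesgue_on (ball 0 R)) \<ge> 0"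
    and pq: "0 < p" "p < q" "q < R\<^sup>2"
    and \<rho>: "smooth \<rho>" "\<And>y. 0 \<le> \<rho> y" "\<And>y. \<rho> y \<le> 1" "\<And>y. \<not> (p < y \<and> y < q) \<Longrightarrow> \<rho> y = 0"
    and T: "smooth T" "\<And>y. (T has_real_derivative \<rho> y) (at y)"
  shows "(\<integral>x. (T q - T ((norm x)\<^sup>2)) * A x - \<rho> ((norm x)\<^sup>2) * B x \<partial>lebesgue_on (ball 0 R)) \<ge> 0"
proof -
  let ?M = "lebesgue_on (ball 0 R :: 'a set)"
  obtain S S' :: "real \<Rightarrow> real" and C where S: "smooth S" "smooth S'"
    "\<And>x. (S has_real_derivative S' x) (at x)"
    "\<And>x. x \<le> 0 \<Longrightarrow> S x = 0" "\<And>x. x \<ge> 1 \<Longrightarrow> S x = 1" "\<And>x. 0 \<le> S x" "\<And>x. S x \<le> 1"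
    "\<And>x. x \<le> 0 \<Longrightarrow> S' x = 0" "\<And>x. x \<ge> 1 \<Longrightarrow> S' x = 0"
    and C: "\<And>x. \<bar>S' x\<bar> \<le> C"
    by (rule smooth_step_exists) blast
  have C0: "C \<ge> 0" using C[of 0] by linarith
  have T_mono: "T x \<le> T y" if "x \<le> y" for x y
    using DERIV_nonneg_imp_nondecreasing[OF that, of T] T(2) \<rho>(2) by blast
  have T_q: "T y = T q" if y: "y \<ge> q" for y
  proof (cases "y = q")
    case False
    then obtain z where z: "q < z" "T y - T q = (y - q) * \<rho> z"
      using MVT2[of q y T \<rho>] T(2) y by auto
    then show ?thesis using \<rho>(4)[of z] by simp
  qed simp
  define L where "L = T q - T 0"
  have T_diff: "0 \<le> T q - T y" "T q - T y \<le> L" if "y \<ge> 0" for y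
    using T_mono[OF that] T_mono[of y q] T_q[of y] by (auto simp: L_def not_le intro: le_cases[of y q])
  have L0: "L \<ge> 0" using T_diff[of 0] by simp
  \<comment> \<open>The inner cutoff \<open>S(k\<^sub>m |x|\<^sup>2 - 1)\<close> rises from \<open>|x|\<^sup>2 = 1/k\<^sub>m\<close> to \<open>2/k\<^sub>m \<le> p\<close>; the summand two keeps the whole
    rise inside \<open>|x|\<^sup>2 \<le> p\<close>.\<close>
  define k where "k m = (real m + 2) / p" for m
  define \<Phi> where "\<Phi> m y = S (k m * y - 1) * (T q - T y)" for m y
  define \<Phi>' where "\<Phi>' m y = S' (k m * y - 1) * k m * (T q - T y) - S (k m * y - 1) * \<rho> y" for m y
  have k: "k m > 0" for m using pq by (simp add: k_def)
  have "radial_cutoff R (\<Phi> m) (\<Phi>' m)" for m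
    unfolding radial_cutoff_def
  proof (intro conjI allI)
    show "smooth (\<Phi> m)" "smooth (\<Phi>' m)"
      unfolding \<Phi>_def \<Phi>'_def by (intro smooth_intros smooth_compose[OF S(1)] smooth_compose[OF S(2)] T \<rho>)+
    show "(\<Phi> m has_real_derivative \<Phi>' m y) (at y)" for y
    proof -
      have "((\<lambda>y. S (k m * y - 1)) has_real_derivative S' (k m * y - 1) * k m) (at y)"
        by (rule DERIV_chain2[OF S(3)]) (auto intro!: derivative_eq_intros)
      moreover have "((\<lambda>y. T q - T y) has_real_derivative (- \<rho> y)) (at y)"
        using T(2) by (auto intro!: derivative_eq_intros)
      ultimately show ?thesis
        unfolding \<Phi>_def \<Phi>'_def by (rule DERIV_cong[OF DERIV_mult]) simp
    qed
    have zero: "\<Phi> m y = 0 \<and> \<Phi>' m y = 0" if y: "\<not> (1 / k m < y \<and> y < q)" for y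
    proof (cases "y < q")
      case True
      then have "k m * y - 1 \<le> 0"
        using y k[of m] by (simp add: field_simps not_less)
      then show ?thesis
        using S by (simp add: \<Phi>_def \<Phi>'_def)
    next
      case False
      then show ?thesis
        using T_q[of y] \<rho>(4)[of y] by (simp add: \<Phi>_def \<Phi>'_def)
    qed
    show "0 \<le> \<Phi> m y" for y
    proof (cases "1 / k m < y \<and> y < q")
      case True
      moreover have "1 / k m > 0" using k[of m] by simp
      ultimately have "y \<ge> 0" by linarith
      then show ?thesis
        unfolding \<Phi>_def by (intro mult_nonneg_nonneg S T_diff)
    qed (use zero in simp)
    have "1 / k m < q"
    proof -
      have "1 / k m = p / (real m + 2)"
        by (simp add: k_def)
      also have "\<dots> \<le> p"
        using pq by (simp add: divide_le_eq)
      finally show ?thesis using pq by simp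
    qed
    then show "\<exists>a b. 0 < a \<and> a < b \<and> b < R\<^sup>2 \<and> (\<forall>y. \<not> (a < y \<and> y < b) \<longrightarrow> \<Phi> m y = 0 \<and> \<Phi>' m y = 0)"
      using zero k[of m] pq by (intro exI[of _ "1 / k m"] exI[of _ q]) auto
  qed
  then have nonneg: "(\<integral>x. \<Phi> m ((norm x)\<^sup>2) * A x + \<Phi>' m ((norm x)\<^sup>2) * B x \<partial>?M) \<ge> 0" for m
    by (rule cutoff)
  note meas = borel_measurable_radial(3)[OF borel_measurable_smooth]
  have [measurable]: "A \<in> borel_measurable ?M" "B \<in> borel_measurable ?M"
    using A B by auto
  have ae0: "AE x in ?M. x \<noteq> 0"
    by (subst AE_restrict_space_iff) (auto intro!: AE_completion eventually_mono[OF AE_lborel_singleton[of 0]])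
  have "(\<lambda>m. \<integral>x. \<Phi> m ((norm x)\<^sup>2) * A x + \<Phi>' m ((norm x)\<^sup>2) * B x \<partial>?M) \<longlonglongrightarrow>
      (\<integral>x. (T q - T ((norm x)\<^sup>2)) * A x - \<rho> ((norm x)\<^sup>2) * B x \<partial>?M)"
  proof (rule integral_dominated_convergence)
    show "integrable ?M (\<lambda>x. L * \<bar>A x\<bar> + (2 * C * L * \<bar>B x / (norm x)\<^sup>2\<bar> + \<bar>B x\<bar>))"
      by (intro Bochner_Integration.integrable_add integrable_mult_right integrable_abs A B B2)
    show "(\<lambda>x. \<Phi> m ((norm x)\<^sup>2) * A x + \<Phi>' m ((norm x)\<^sup>2) * B x) \<in> borel_measurable ?M" for m
      unfolding \<Phi>_def \<Phi>'_def
      by (intro borel_measurable_add borel_measurable_times meas[where F = "\<lambda>y. S (k m * y - 1) * (T q - T y)"]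
          meas[where F = "\<lambda>y. S' (k m * y - 1) * k m * (T q - T y) - S (k m * y - 1) * \<rho> y"]
          smooth_intros smooth_compose[OF S(1)] smooth_compose[OF S(2)] T \<rho>) simp_all
    show "(\<lambda>x. (T q - T ((norm x)\<^sup>2)) * A x - \<rho> ((norm x)\<^sup>2) * B x) \<in> borel_measurable ?M"
      by (intro borel_measurable_diff borel_measurable_times meas[where F = "\<lambda>y. T q - T y"] meas
          smooth_intros T \<rho>) simp_all
    show "AE x in ?M. (\<lambda>m. \<Phi> m ((norm x)\<^sup>2) * A x + \<Phi>' m ((norm x)\<^sup>2) * B x) \<longlonglongrightarrow>
        (T q - T ((norm x)\<^sup>2)) * A x - \<rho> ((norm x)\<^sup>2) * B x"
      using ae0
    proof eventually_elim
      case (elim x)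
      define y where "y = (norm x)\<^sup>2"
      have y: "y > 0" using elim by (simp add: y_def)
      obtain N :: nat where N: "2 * p < real N * y"
        using reals_Archimedean3[OF y] by blast
      have "\<forall>\<^sub>F m in sequentially. \<Phi> m y * A x + \<Phi>' m y * B x = (T q - T y) * A x - \<rho> y * B x"
        using eventually_ge_at_top[of N]
      proof eventually_elim
        case (elim m)
        have "2 * p \<le> real N * y" using N by simp
        also have "\<dots> \<le> (real m + 2) * y"
          using elim y by (intro mult_right_mono) auto
        finally have "k m * y - 1 \<ge> 1"
          using pq by (simp add: k_def field_simps)
        then show ?case
          using S by (simp add: \<Phi>_def \<Phi>'_def)
      qed
      then show ?case
        unfolding y_def[symmetric] by (rule tendsto_eventually)
    qed
    show "AE x in ?M. norm (\<Phi> m ((norm x)\<^sup>2) * A x + \<Phi>' m ((norm x)\<^sup>2) * B x) \<le>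
        L * \<bar>A x\<bar> + (2 * C * L * \<bar>B x / (norm x)\<^sup>2\<bar> + \<bar>B x\<bar>)" for m
      using ae0
    proof eventually_elim
      case (elim x)
      define y where "y = (norm x)\<^sup>2"
      have y: "y > 0" using elim by (simp add: y_def)
      have 1: "\<bar>\<Phi> m y\<bar> \<le> L"
        using mult_mono[of "\<bar>S (k m * y - 1)\<bar>" 1 "\<bar>T q - T y\<bar>" L] S(6,7)[of "k m * y - 1"] T_diff[of y] y
        by (simp add: \<Phi>_def abs_mult)
      have 2: "\<bar>S' (k m * y - 1) * k m\<bar> \<le> 2 * C / y"
      proof (cases "S' (k m * y - 1) = 0")
        case True
        then show ?thesis using C0 y by simp
      next
        case False
        then have "k m * y - 1 < 1"
          using S(9)[of "k m * y - 1"] by (meson not_le)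
        then have "k m \<le> 2 / y"
          using y by (simp add: field_simps)
        then have "\<bar>S' (k m * y - 1)\<bar> * k m \<le> C * (2 / y)"
          using C k[of m] C0 by (intro mult_mono) (auto intro: less_imp_le)
        then show ?thesis
          using k[of m] by (simp add: abs_mult mult.commute)
      qed
      have "\<bar>\<Phi>' m y\<bar> \<le> \<bar>S' (k m * y - 1) * k m\<bar> * \<bar>T q - T y\<bar> + \<bar>S (k m * y - 1)\<bar> * \<bar>\<rho> y\<bar>"
        unfolding \<Phi>'_def abs_mult[symmetric] by (rule abs_triangle_ineq4)
      also have "\<dots> \<le> 2 * C / y * L + 1 * 1"
        using 2 T_diff[of y] y S(6,7)[of "k m * y - 1"] \<rho>(2,3)[of y] C0
        by (intro add_mono mult_mono) auto
      finally have 3: "\<bar>\<Phi>' m y\<bar> \<le> 2 * C * L / y + 1"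
        by simp
      have "\<bar>\<Phi> m y * A x + \<Phi>' m y * B x\<bar> \<le> \<bar>\<Phi> m y\<bar> * \<bar>A x\<bar> + \<bar>\<Phi>' m y\<bar> * \<bar>B x\<bar>"
        unfolding abs_mult[symmetric] by (rule abs_triangle_ineq)
      also have "\<dots> \<le> L * \<bar>A x\<bar> + (2 * C * L / y + 1) * \<bar>B x\<bar>"
        using 1 3 by (intro add_mono mult_right_mono) auto
      also have "\<dots> = L * \<bar>A x\<bar> + (2 * C * L * \<bar>B x / y\<bar> + \<bar>B x\<bar>)"
        using y by (simp add: algebra_simps)
      finally show ?case
        by (simp add: y_def)
    qed
  qed
  then show ?thesis
    by (rule LIMSEQ_le_const) (use nonneg in blast)
qed

text \<open>Take \<open>\<Phi> = T(R\<^sup>2) - T\<close> with \<open>T\<close> a primitive of a bump \<open>\<rho>\<close>. In polar coordinates the hypothesis says that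
  the integral of \<open>\<rho>(s\<^sup>2) \<kappa>(s)\<close> is nonnegative, where \<open>\<kappa>(s)\<close> is the left-hand side of the conclusion at
  \<open>s\<close>. The bumps approximate indicators of intervals, so \<open>\<kappa> \<ge> 0\<close> almost everywhere.\<close>

lemma AE_ball_sphere_inequality:
  fixes A B :: "'a::euclidean_space \<Rightarrow> real"
  assumes "R > 0" and A: "integrable (lebesgue_on (ball 0 R)) A" and B: "integrable (lebesgue_on (ball 0 R)) B"
    and B2: "integrable (lebesgue_on (ball 0 R)) (\<lambda>x. B x / (norm x)\<^sup>2)"
    and cutoff: "\<And>\<Phi> \<Phi>'. radial_cutoff R \<Phi> \<Phi>' \<Longrightarrow>
      (\<integral>x. \<Phi> ((norm x)\<^sup>2) * A x + \<Phi>' ((norm x)\<^sup>2) * B x \<partial>lebesgue_on (ball 0 R)) \<ge> 0"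
  shows "AE r in lborel. 0 < r \<and> r < R \<longrightarrow>
    2 * r * (\<integral>x. A x \<partial>lebesgue_on (ball 0 r)) - (\<integral>x. B x \<partial>sphere_measure r) \<ge> 0"
proof -
  let ?M = "lebesgue_on (ball 0 R :: 'a set)"
  define \<alpha> where "\<alpha> s = indicator {0<..<R} s * (\<integral>x. indicator (ball 0 s) x * A x \<partial>?M)" for s
  define b where "b s = indicator {0<..<R} s * (\<integral>x. indicator (ball 0 R) x * B x \<partial>sphere_measure s)" for s
  define \<kappa> where "\<kappa> s = 2 * s * \<alpha> s - b s" for s
  have b_int: "integrable lebesgue b"
    unfolding b_def by (rule integral_radial_weight(1)[OF B, of "\<lambda>_. 0" 0]) simp_all
  have \<alpha>_meas [measurable]: "\<alpha> \<in> borel_measurable borel"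
    and \<alpha>_bound: "\<bar>\<alpha> s\<bar> \<le> (\<integral>x. \<bar>A x\<bar> \<partial>?M) * indicator {0<..<R} s" for s
    unfolding \<alpha>_def
    by (rule integral_primitive_weight(1)[OF A \<open>R > 0\<close>, of "\<lambda>_. 0" "\<lambda>_. 0" 0]; simp)
      (rule integral_primitive_weight(2)[OF A \<open>R > 0\<close>, of "\<lambda>_. 0" "\<lambda>_. 0" 0]; simp)
  have \<alpha>_int: "integrable lborel (\<lambda>s. 2 * s * \<alpha> s)"
  proof (rule Bochner_Integration.integrable_bound)
    show "integrable lborel (\<lambda>s. (2 * R * (\<integral>x. \<bar>A x\<bar> \<partial>?M)) * indicator {0<..<R} s)"
      using \<open>R > 0\<close> by (intro integrable_mult_right integrable_real_indicator) simp_all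
    show "AE s in lborel. norm (2 * s * \<alpha> s) \<le> norm ((2 * R * (\<integral>x. \<bar>A x\<bar> \<partial>?M)) * indicator {0<..<R} s)"
    proof (rule AE_I2)
      fix s :: real
      show "norm (2 * s * \<alpha> s) \<le> norm ((2 * R * (\<integral>x. \<bar>A x\<bar> \<partial>?M)) * indicator {0<..<R} s)"
      proof (cases "s \<in> {0<..<R}")
        case True
        then have "\<bar>s\<bar> * \<bar>\<alpha> s\<bar> \<le> R * (\<integral>x. \<bar>A x\<bar> \<partial>?M)"
          using \<alpha>_bound[of s] by (intro mult_mono) auto
        then show ?thesis
          using True \<open>R > 0\<close> by (simp add: abs_mult integral_nonneg_AE)
      next
        case False
        then show ?thesis by (simp add: \<alpha>_def)
      qed
    qed
  qed simp
  have \<alpha>_int': "integrable lebesgue (\<lambda>s. 2 * s * \<alpha> s)"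
    using \<alpha>_int by (subst integrable_completion) simp_all
  have \<kappa>_int: "integrable lebesgue \<kappa>"
    unfolding \<kappa>_def by (intro Bochner_Integration.integrable_diff \<alpha>_int' b_int)
  obtain \<beta> :: "nat \<Rightarrow> real \<Rightarrow> real \<Rightarrow> real \<Rightarrow> real" where \<beta>:
    "\<And>n p q. smooth (\<beta> n p q)" "\<And>n p q x. 0 \<le> \<beta> n p q x" "\<And>n p q x. \<beta> n p q x \<le> 1"
    "\<And>n p q x. \<not> (p < x \<and> x < q) \<Longrightarrow> \<beta> n p q x = 0"
    "\<And>p q x. (\<lambda>n. \<beta> n p q x) \<longlonglongrightarrow> indicator {p<..<q} x"
    using smooth_approx_interval by blast
  have shell: "(\<integral>s. indicator {p<..<q} (s\<^sup>2) * \<kappa> s \<partial>lebesgue) \<ge> 0" if pq: "0 < p" "p < q" "q < R\<^sup>2" for p q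
  proof -
    have \<beta>_meas: "(\<lambda>s. \<beta> n p q (s\<^sup>2)) \<in> borel_measurable borel" for n
      by (rule measurable_compose[OF _ borel_measurable_smooth[OF \<beta>(1)]]) simp
    have \<beta>_bound: "\<bar>\<beta> n p q y\<bar> \<le> 1" for n y
      using \<beta>(2,3)[of n p q y] by simp
    have \<beta>_int: "integrable lebesgue (\<lambda>s. \<beta> n p q (s\<^sup>2) * \<kappa> s)" if "integrable lebesgue \<kappa>" for n \<kappa>
      by (rule integrable_bounded_mult[OF that measurable_completion, where C = 1]) (use \<beta>_meas \<beta>_bound in auto)
    have pos: "(\<integral>s. \<beta> n p q (s\<^sup>2) * \<kappa> s \<partial>lebesgue) \<ge> 0" for n
    proof -
      let ?\<rho> = "\<beta> n p q"
      \<comment> \<open>\<open>T\<close> is constant beyond \<open>q\<close>, so \<open>T(q)\<close>, the value needed to make \<open>\<Phi>\<close> vanish there, is \<open>T(R\<^sup>2)\<close>.\<close>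
      obtain T where T: "smooth T" "\<And>y. (T has_real_derivative ?\<rho> y) (at y)"
        "\<And>x. x \<ge> q \<Longrightarrow> T x = integral {p..q} ?\<rho>"
        using smooth_bump_primitive[OF \<beta>(1) \<beta>(4) pq(2)] by metis
      have Tq: "T q = T (R\<^sup>2)"
        using T(3)[of q] T(3)[of "R\<^sup>2"] pq by simp
      have A': "integrable ?M (\<lambda>x. (T (R\<^sup>2) - T ((norm x)\<^sup>2)) * A x)"
      proof -
        have "compact ((\<lambda>y. T (R\<^sup>2) - T y) ` {0..R\<^sup>2})"
          by (intro compact_continuous_image continuous_intros smooth_continuous_on T) simp
        then obtain K where K: "\<And>y. y \<in> {0..R\<^sup>2} \<Longrightarrow> \<bar>T (R\<^sup>2) - T y\<bar> \<le> K"
          using compact_imp_bounded by (force simp: bounded_iff)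
        show ?thesis
        proof (rule integrable_bounded_mult[OF A, where C = K])
          show "(\<lambda>x. T (R\<^sup>2) - T ((norm x)\<^sup>2)) \<in> borel_measurable ?M"
            by (rule borel_measurable_radial(3)[where F = "\<lambda>y. T (R\<^sup>2) - T y"])
              (intro borel_measurable_smooth smooth_intros T)
          show "AE x in ?M. \<bar>T (R\<^sup>2) - T ((norm x)\<^sup>2)\<bar> \<le> K"
          proof (rule AE_I2)
            fix x assume "x \<in> space ?M"
            then have "(norm x)\<^sup>2 \<in> {0..R\<^sup>2}"
              by (auto simp: space_restrict_space intro!: power_mono)
            then show "\<bar>T (R\<^sup>2) - T ((norm x)\<^sup>2)\<bar> \<le> K"
              by (rule K)
          qed
        qed
      qed
      have \<rho>_borel: "?\<rho> \<in> borel_measurable borel"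
        by (rule borel_measurable_smooth[OF \<beta>(1)])
      have B': "integrable ?M (\<lambda>x. ?\<rho> ((norm x)\<^sup>2) * B x)"
        by (rule integrable_bounded_mult[OF B borel_measurable_radial(3)[OF \<rho>_borel], where C = 1])
          (use \<beta>_bound in auto)
      have "0 \<le> (\<integral>x. (T q - T ((norm x)\<^sup>2)) * A x - ?\<rho> ((norm x)\<^sup>2) * B x \<partial>?M)"
        by (rule inner_cutoff_removal[OF \<open>R > 0\<close> A B B2 cutoff pq \<beta>(1-4) T(1,2)])
      also have "\<dots> = (\<integral>x. (T (R\<^sup>2) - T ((norm x)\<^sup>2)) * A x \<partial>?M) - (\<integral>x. ?\<rho> ((norm x)\<^sup>2) * B x \<partial>?M)"
        unfolding Tq by (rule Bochner_Integration.integral_diff[OF A' B'])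
      also have "(\<integral>x. (T (R\<^sup>2) - T ((norm x)\<^sup>2)) * A x \<partial>?M) = (\<integral>s. ?\<rho> (s\<^sup>2) * (2 * s * \<alpha> s) \<partial>lborel)"
        unfolding \<alpha>_def
        by (rule integral_primitive_weight(3)[OF A \<open>R > 0\<close> T(2) smooth_continuous_on[OF \<beta>(1)] \<beta>_bound])
      also have "\<dots> = (\<integral>s. ?\<rho> (s\<^sup>2) * (2 * s * \<alpha> s) \<partial>lebesgue)"
        using \<beta>_meas by (subst integral_completion) simp_all
      also have "(\<integral>x. ?\<rho> ((norm x)\<^sup>2) * B x \<partial>?M) = (\<integral>s. ?\<rho> (s\<^sup>2) * b s \<partial>lebesgue)"
        unfolding b_def by (rule integral_radial_weight(2)[OF B \<rho>_borel \<beta>_bound])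
      also have "(\<integral>s. ?\<rho> (s\<^sup>2) * (2 * s * \<alpha> s) \<partial>lebesgue) - (\<integral>s. ?\<rho> (s\<^sup>2) * b s \<partial>lebesgue) =
          (\<integral>s. ?\<rho> (s\<^sup>2) * (2 * s * \<alpha> s) - ?\<rho> (s\<^sup>2) * b s \<partial>lebesgue)"
        by (rule Bochner_Integration.integral_diff[symmetric, OF \<beta>_int[OF \<alpha>_int'] \<beta>_int[OF b_int]])
      also have "\<dots> = (\<integral>s. ?\<rho> (s\<^sup>2) * \<kappa> s \<partial>lebesgue)"
        by (simp add: \<kappa>_def right_diff_distrib)
      finally show ?thesis .
    qed
    have "(\<lambda>n. \<integral>s. \<beta> n p q (s\<^sup>2) * \<kappa> s \<partial>lebesgue) \<longlonglongrightarrow> (\<integral>s. indicator {p<..<q} (s\<^sup>2) * \<kappa> s \<partial>lebesgue)"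
    proof (rule integral_dominated_convergence)
      show "integrable lebesgue (\<lambda>s. \<bar>\<kappa> s\<bar>)"
        using \<kappa>_int by (rule integrable_abs)
      show "(\<lambda>s. \<beta> n p q (s\<^sup>2) * \<kappa> s) \<in> borel_measurable lebesgue" for n
        by (rule borel_measurable_integrable[OF \<beta>_int[OF \<kappa>_int]])
      have "(\<lambda>s::real. indicator {p<..<q} (s\<^sup>2) :: real) \<in> borel_measurable borel"
        by measurable
      then show "(\<lambda>s. indicator {p<..<q} (s\<^sup>2) * \<kappa> s) \<in> borel_measurable lebesgue"
        using \<kappa>_int by (intro borel_measurable_times) (auto intro: measurable_completion)
      show "AE s in lebesgue. (\<lambda>n. \<beta> n p q (s\<^sup>2) * \<kappa> s) \<longlonglongrightarrow> indicator {p<..<q} (s\<^sup>2) * \<kappa> s"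
        by (intro AE_I2 tendsto_mult \<beta>(5) tendsto_const)
      show "AE s in lebesgue. norm (\<beta> n p q (s\<^sup>2) * \<kappa> s) \<le> \<bar>\<kappa> s\<bar>" for n
        using \<beta>_bound by (intro AE_I2) (auto simp: abs_mult intro!: mult_left_le_one_le)
    qed
    then show ?thesis
      by (rule LIMSEQ_le_const) (use pos in blast)
  qed
  have "AE s in lebesgue. s \<in> {0<..<R} \<longrightarrow> \<kappa> s \<ge> 0"
  proof (rule AE_nonneg_if_box_integrals_nonneg)
    fix c d :: real assume cd: "cbox c d \<subseteq> {0<..<R}"
    have \<kappa>_set: "set_integrable lebesgue (cbox c d) \<kappa>"
      unfolding set_integrable_def
      by (rule integrable_mult_indicator[OF _ \<kappa>_int]) simp
    then show "\<kappa> integrable_on cbox c d"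
      by (rule set_lebesgue_integral_eq_integral)
    show "integral (cbox c d) \<kappa> \<ge> 0"
    proof (cases "c < d")
      case True
      then have c: "0 < c" "d < R"
        using cd by (auto simp: subset_eq)
      have sq: "c\<^sup>2 < s\<^sup>2 \<and> s\<^sup>2 < d\<^sup>2 \<longleftrightarrow> c < s \<and> s < d" if "s > 0" for s
        using that c True power2_less_imp_less[of c s] power_strict_mono[of c s 2]
          power2_less_imp_less[of s d] power_strict_mono[of s d 2] by auto
      have "integral (cbox c d) \<kappa> = (\<integral>s. indicator (cbox c d) s * \<kappa> s \<partial>lebesgue)"
        using set_lebesgue_integral_eq_integral(2)[OF \<kappa>_set] by (simp add: set_lebesgue_integral_def)
      also have "\<dots> = (\<integral>s. indicator {c\<^sup>2<..<d\<^sup>2} (s\<^sup>2) * \<kappa> s \<partial>lebesgue)"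
      proof (rule integral_cong_AE)
        show "(\<lambda>s. indicator (cbox c d) s * \<kappa> s) \<in> borel_measurable lebesgue"
          using \<kappa>_int by (intro borel_measurable_times borel_measurable_indicator) auto
        have "(\<lambda>s::real. indicator {c\<^sup>2<..<d\<^sup>2} (s\<^sup>2) :: real) \<in> borel_measurable borel"
          by measurable
        then show "(\<lambda>s. indicator {c\<^sup>2<..<d\<^sup>2} (s\<^sup>2) * \<kappa> s) \<in> borel_measurable lebesgue"
          using \<kappa>_int by (intro borel_measurable_times) (auto intro: measurable_completion)
        have "AE s in lebesgue. s \<noteq> c \<and> s \<noteq> d"
          unfolding AE_completion_iff
          using AE_lborel_singleton[of c] AE_lborel_singleton[of d] by eventually_elim simp
        then show "AE s in lebesgue. indicator (cbox c d) s * \<kappa> s = indicator {c\<^sup>2<..<d\<^sup>2} (s\<^sup>2) * \<kappa> s"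
        proof eventually_elim
          case (elim s)
          show ?case
          proof (cases "s > 0")
            case True
            then show ?thesis
              using elim sq[OF True] by (auto simp: indicator_def)
          next
            case False
            then show ?thesis by (simp add: \<kappa>_def \<alpha>_def b_def)
          qed
        qed
      qed
      also have "\<dots> \<ge> 0"
        using True c by (intro shell) (auto intro!: power_strict_mono)
      finally show ?thesis .
    next
      case False
      then show ?thesis
        by (cases "c = d") auto
    qed
  qed simp
  then have "AE s in lborel. s \<in> {0<..<R} \<longrightarrow> \<kappa> s \<ge> 0"
    by (simp add: AE_completion_iff)
  then show ?thesis
    using AE_sphere_integrable[OF B]
  proof eventually_elim
    case (elim r)
    show ?case
    proof
      assume r: "0 < r \<and> r < R"
      have "\<alpha> r = (\<integral>x. A x \<partial>lebesgue_on (ball 0 r))"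
      proof -
        have "\<alpha> r = (\<integral>x. indicator (ball 0 R) x * (indicator (ball 0 r) x * A x) \<partial>lebesgue)"
          using r by (simp add: \<alpha>_def integral_restrict_space)
        also have "\<dots> = (\<integral>x. indicator (ball 0 r) x * A x \<partial>lebesgue)"
          using r by (intro Bochner_Integration.integral_cong) (auto simp: indicator_def)
        finally show ?thesis
          by (simp add: integral_restrict_space)
      qed
      moreover have "b r = (\<integral>x. B x \<partial>sphere_measure r)"
        using elim(2) r by (simp add: b_def)
      ultimately show "2 * r * (\<integral>x. A x \<partial>lebesgue_on (ball 0 r)) - (\<integral>x. B x \<partial>sphere_measure r) \<ge> 0"
        using elim(1) r by (simp add: \<kappa>_def)
    qed
  qed
qed

section \<open>Hardy inequality\<close>

lemma integrable_bounded_support: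
  fixes h :: "'a::euclidean_space \<Rightarrow> real"
  assumes "h \<in> borel_measurable borel" "\<And>x. \<bar>h x\<bar> \<le> C * indicator (cball 0 b) x"
  shows "integrable lborel h"
proof (rule Bochner_Integration.integrable_bound)
  have "emeasure lborel (cball (0::'a) b) < \<infinity>"
    by (intro emeasure_bounded_finite) simp
  then show "integrable lborel (\<lambda>x::'a. C * indicator (cball 0 b) x)"
    by (intro integrable_mult_right integrable_real_indicator) simp_all
  show "h \<in> borel_measurable lborel" using assms(1) by simp
  show "AE x in lborel. norm (h x) \<le> norm (C * indicator (cball 0 b) x)"
    using assms(2) by (intro AE_I2) (auto intro: order_trans[OF _ abs_ge_self])
qed

text \<open>Differentiating \<open>\<integral> v(tx)\<^sup>2 / |x|\<^sup>2 dx = t\<^sup>2\<^sup>-\<^sup>d \<integral> v\<^sup>2 / |x|\<^sup>2 dx\<close> at \<open>t = 1\<close> expresses the weighted norm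
  through the radial derivative of \<open>v\<close>.\<close>

lemma hardy_inequality:
  fixes v :: "'a::euclidean_space \<Rightarrow> real"
  assumes v: "smooth v" and a: "0 < a" "\<And>x. norm x < a \<Longrightarrow> v x = 0"
    and b: "\<And>x. norm x > b \<Longrightarrow> v x = 0" and dim: "DIM('a) \<ge> 3"
  shows "integrable lborel (\<lambda>x. (v x)\<^sup>2 / (norm x)\<^sup>2)"
    and "(\<integral>x. (v x)\<^sup>2 / (norm x)\<^sup>2 \<partial>lborel) \<le> 4 * (\<integral>x. (norm (gradient v x))\<^sup>2 \<partial>lborel)"
proof -
  let ?d = "DIM('a)"
  have v0: "v x = 0" if "x \<notin> cball 0 b" for x
    using b that by simp
  have g0: "gradient v x = 0" if "x \<notin> cball 0 b" for x
    by (rule gradient_eq_0_outside[OF compact_cball v0 that])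
  have cv: "continuous_on UNIV v" and cg: "continuous_on UNIV (gradient v)"
    using v by (auto intro: smooth_continuous_on smooth_continuous_on_gradient)
  have [measurable]: "v \<in> borel_measurable borel" "gradient v \<in> borel_measurable borel"
    using v by (auto intro: borel_measurable_smooth borel_measurable_gradient)
  obtain C where C: "\<And>x. \<bar>v x\<bar> \<le> C" "\<And>x. norm (gradient v x) \<le> C" "C \<ge> 0"
  proof -
    have "compact (v ` cball 0 b)" "compact (gradient v ` cball 0 b)"
      by (intro compact_continuous_image continuous_on_subset[OF cv] continuous_on_subset[OF cg]; simp)+
    then obtain C1 C2 where "\<And>x. x \<in> cball 0 b \<Longrightarrow> \<bar>v x\<bar> \<le> C1" "\<And>x. x \<in> cball 0 b \<Longrightarrow> norm (gradient v x) \<le> C2"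
      by (force dest!: compact_imp_bounded simp: bounded_iff)
    then have "\<bar>v x\<bar> \<le> max 0 (max C1 C2)" "norm (gradient v x) \<le> max 0 (max C1 C2)" for x
      using v0[of x] g0[of x] by (cases "x \<in> cball 0 b"; fastforce)+
    then show thesis by (rule that) simp
  qed
  define h where "h x = (v x)\<^sup>2 / (norm x)\<^sup>2" for x
  have [measurable]: "h \<in> borel_measurable borel"
    unfolding h_def by measurable
  define H where "H t x = (v (t *\<^sub>R x))\<^sup>2 / (norm x)\<^sup>2" for t x
  define H' where "H' t x = 2 * v (t *\<^sub>R x) * (gradient v (t *\<^sub>R x) \<bullet> x) / (norm x)\<^sup>2" for t x
  have supp: "v (t *\<^sub>R x) = 0" if "1 / 2 < t" "t < 2" "norm x < a / 2 \<or> norm x > 2 * b" for t x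
  proof -
    from that(3) have "norm (t *\<^sub>R x) < a \<or> norm (t *\<^sub>R x) > b"
    proof
      assume "norm x < a / 2"
      then have "t * norm x \<le> 2 * norm x" "2 * norm x < a"
        using that by (auto intro: mult_right_mono)
      then show ?thesis using that by simp
    next
      assume x: "norm x > 2 * b"
      have "1 / 2 * norm x \<le> t * norm x"
        using that by (intro mult_right_mono) auto
      then have "b < t * norm x" using x by linarith
      then show ?thesis using that by simp
    qed
    then show ?thesis using a(2) b by blast
  qed
  have H_bound: "\<bar>H t x\<bar> \<le> 4 * C\<^sup>2 / a\<^sup>2 * indicator (cball 0 (2 * b)) x" if t: "1 / 2 < t" "t < 2" for t x
  proof (cases "norm x < a / 2 \<or> norm x > 2 * b")
    case True
    then show ?thesis using supp[OF t True] by (simp add: H_def indicator_def)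
  next
    case False
    have "(v (t *\<^sub>R x))\<^sup>2 \<le> C\<^sup>2"
      using power_mono[OF C(1)[of "t *\<^sub>R x"], of 2] by simp
    moreover have "(a / 2)\<^sup>2 \<le> (norm x)\<^sup>2"
      using False a by (intro power_mono) auto
    ultimately have "H t x \<le> C\<^sup>2 / (a / 2)\<^sup>2"
      unfolding H_def using a by (intro frac_le) auto
    then show ?thesis
      using False by (simp add: H_def power_divide mult.commute)
  qed
  have H'_abs: "\<bar>H' t x\<bar> = 2 * (\<bar>v (t *\<^sub>R x)\<bar> * \<bar>gradient v (t *\<^sub>R x) \<bullet> x\<bar>) / (norm x)\<^sup>2" for t x
    by (simp add: H'_def abs_mult)
  have H'_bound: "\<bar>H' t x\<bar> \<le> 4 * C\<^sup>2 / a * indicator (cball 0 (2 * b)) x" if t: "1 / 2 < t" "t < 2" for t x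
  proof (cases "norm x < a / 2 \<or> norm x > 2 * b")
    case True
    then show ?thesis using supp[OF t True] a C(3) by (simp add: H'_def indicator_def)
  next
    case False
    then have nx: "norm x > 0" "norm x \<ge> a / 2" using a by auto
    have "\<bar>gradient v (t *\<^sub>R x) \<bullet> x\<bar> \<le> C * norm x"
      using order_trans[OF Cauchy_Schwarz_ineq2 mult_right_mono[OF C(2)]] by simp
    then have "\<bar>v (t *\<^sub>R x)\<bar> * \<bar>gradient v (t *\<^sub>R x) \<bullet> x\<bar> \<le> C * (C * norm x)"
      using C by (intro mult_mono) auto
    then have "\<bar>H' t x\<bar> \<le> 2 * (C * (C * norm x)) / (norm x)\<^sup>2"
      unfolding H'_abs by (intro divide_right_mono mult_left_mono) auto
    also have "\<dots> = 2 * C\<^sup>2 / norm x"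
      using nx by (simp add: power2_eq_square)
    also have "\<dots> \<le> 2 * C\<^sup>2 / (a / 2)"
      using nx a by (intro divide_left_mono) auto
    finally show ?thesis using False by simp
  qed
  have H_int: "integrable lborel (H t)" if "1 / 2 < t" "t < 2" for t
  proof (rule integrable_bounded_support[OF _ H_bound[OF that]])
    show "H t \<in> borel_measurable borel"
      unfolding H_def by measurable
  qed
  have H1: "H 1 = h" by (auto simp: H_def h_def)
  have h_int: "integrable lborel h" using H_int[of 1] by (simp add: H1)
  then show "integrable lborel (\<lambda>x. (v x)\<^sup>2 / (norm x)\<^sup>2)"
    by (simp add: h_def[abs_def])
  define N where "N = (\<integral>x. h x \<partial>lborel)"
  have scale: "(\<integral>x. H t x \<partial>lborel) = t\<^sup>2 * (1 / t) ^ ?d * N" if "t > 0" for t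
  proof -
    have "H t x = t\<^sup>2 * h (t *\<^sub>R x)" for x
      using that by (simp add: H_def h_def power_mult_distrib)
    then have "(\<integral>x. H t x \<partial>lborel) = t\<^sup>2 * (\<integral>x. h (t *\<^sub>R x) \<partial>lborel)"
      by simp
    then show ?thesis
      using that by (simp add: integral_dilation N_def)
  qed
  have deriv: "((\<lambda>t. \<integral>x. H t x \<partial>lborel) has_real_derivative (\<integral>x. H' 1 x \<partial>lborel)) (at 1)"
  proof (rule has_derivative_under_integral[where a = "1 / 2" and b = 2
        and B = "\<lambda>x. 4 * C\<^sup>2 / a * indicator (cball 0 (2 * b)) x"])
    show "((\<lambda>t. H t x) has_real_derivative H' t x) (at t)" for t x
      using smooth_ray_derivative[OF v, of 0 x t] unfolding H_def H'_def
      by (auto intro!: derivative_eq_intros simp: divide_inverse)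
    show "integrable lborel (\<lambda>x::'a. 4 * C\<^sup>2 / a * indicator (cball 0 (2 * b)) x)"
    proof (rule integrable_bounded_support[where C = "4 * C\<^sup>2 / a" and b = "2 * b"])
      show "(\<lambda>x::'a. 4 * C\<^sup>2 / a * indicator (cball 0 (2 * b)) x) \<in> borel_measurable borel"
        by (intro borel_measurable_times borel_measurable_const borel_measurable_indicator) simp
    qed (use a in simp)
  qed (use H_int H'_bound in auto)
  have "((\<lambda>t. t\<^sup>2 * (1 / t) ^ ?d * N) has_real_derivative (2 - real ?d) * N) (at 1)"
    by (auto intro!: derivative_eq_intros simp: algebra_simps)
  then have "((\<lambda>t. \<integral>x. H t x \<partial>lborel) has_real_derivative (2 - real ?d) * N) (at 1)"
    by (rule has_field_derivative_transform_within_open[where S = "{0<..}"]) (auto simp: scale)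
  then have I: "(2 - real ?d) * N = (\<integral>x. H' 1 x \<partial>lborel)"
    using deriv DERIV_unique by blast
  have D_int: "integrable lborel (\<lambda>x. (norm (gradient v x))\<^sup>2)"
    by (rule integrable_continuous_compact_support[OF _ compact_cball[of 0 b]])
      (use g0 in \<open>auto intro!: continuous_intros cg\<close>)
  have H'_int: "integrable lborel (H' 1)"
  proof (rule integrable_bounded_support[OF _ H'_bound])
    show "H' 1 \<in> borel_measurable borel"
      unfolding H'_def by measurable
  qed auto
  \<comment> \<open>Young's inequality, weighted so that half of \<open>N\<close> has to be absorbed; \<open>d - 2 \<ge> 1\<close> leaves the other half.\<close>
  have young: "- H' 1 x \<le> 1 / 2 * h x + 2 * (norm (gradient v x))\<^sup>2" for x
  proof (cases "x = 0")
    case False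
    let ?g = "norm (gradient v x)"
    have "\<bar>v x\<bar> * \<bar>gradient v x \<bullet> x\<bar> \<le> \<bar>v x\<bar> * (?g * norm x)"
      by (intro mult_left_mono Cauchy_Schwarz_ineq2) simp
    then have "\<bar>H' 1 x\<bar> \<le> 2 * (\<bar>v x\<bar> * (?g * norm x)) / (norm x)\<^sup>2"
      unfolding H'_abs by (intro divide_right_mono mult_left_mono) auto
    also have "\<dots> = 2 * (\<bar>v x\<bar> / norm x) * ?g"
      using False by (simp add: power2_eq_square)
    also have "\<dots> \<le> 1 / 2 * (\<bar>v x\<bar> / norm x)\<^sup>2 + 2 * ?g\<^sup>2"
      using zero_le_power2[of "\<bar>v x\<bar> / norm x - 2 * ?g"] unfolding power2_diff power_mult_distrib by simp
    finally show ?thesis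
      by (simp add: h_def power_divide abs_le_iff)
  qed (simp add: H'_def h_def)
  have "(real ?d - 2) * N = (\<integral>x. - H' 1 x \<partial>lborel)"
    using I by (simp add: algebra_simps)
  also have "\<dots> \<le> (\<integral>x. 1 / 2 * h x + 2 * (norm (gradient v x))\<^sup>2 \<partial>lborel)"
    by (intro integral_mono Bochner_Integration.integrable_add integrable_mult_right integrable_minus H'_int h_int D_int young)
  also have "\<dots> = 1 / 2 * N + 2 * (\<integral>x. (norm (gradient v x))\<^sup>2 \<partial>lborel)"
    using h_int D_int by (simp add: N_def)
  finally have "(real ?d - 2) * N \<le> 1 / 2 * N + 2 * (\<integral>x. (norm (gradient v x))\<^sup>2 \<partial>lborel)" .
  moreover have "1 * N \<le> (real ?d - 2) * N"
    using dim by (intro mult_right_mono) (auto simp: N_def h_def)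
  ultimately show "(\<integral>x. (v x)\<^sup>2 / (norm x)\<^sup>2 \<partial>lborel) \<le> 4 * (\<integral>x. (norm (gradient v x))\<^sup>2 \<partial>lborel)"
    by (simp add: N_def h_def)
qed

text \<open>The approximations \<open>w\<^sub>n\<close> vanish near the centre; cut off at the outer boundary they satisfy Hardy's
  inequality with a bound independent of \<open>n\<close>, and Fatou's lemma passes it on to \<open>u\<close>.\<close>

lemma hardy_integrable:
  fixes u :: "'a::euclidean_space \<Rightarrow> real"
  assumes w: "\<And>n. smooth (w n)" "\<And>n. \<exists>\<delta>>0. \<forall>x. norm x < \<delta> \<longrightarrow> w n x = 0"
    and u: "L2_converges (lebesgue_on (ball 0 R)) w u"
    and G: "L2_converges (lebesgue_on (ball 0 R)) (\<lambda>n. gradient (w n)) G"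
    and \<rho>: "0 < \<rho>" "\<rho> < R" and dim: "DIM('a) \<ge> 3"
  shows "integrable (lebesgue_on (ball 0 \<rho>)) (\<lambda>x. (u x)\<^sup>2 / (norm x)\<^sup>2)"
proof -
  let ?M = "lebesgue_on (ball 0 R :: 'a set)" and ?N = "lebesgue_on (ball 0 \<rho> :: 'a set)"
  define R1 where "R1 = (\<rho> + R) / 2"
  have R1: "\<rho> < R1" "R1 < R" using \<rho> by (auto simp: R1_def)
  obtain S S' :: "real \<Rightarrow> real" and CS where S: "smooth S" "smooth S'"
    "\<And>x. (S has_real_derivative S' x) (at x)"
    "\<And>x. x \<le> 0 \<Longrightarrow> S x = 0" "\<And>x. x \<ge> 1 \<Longrightarrow> S x = 1" "\<And>x. 0 \<le> S x" "\<And>x. S x \<le> 1"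
    "\<And>x. x \<le> 0 \<Longrightarrow> S' x = 0" "\<And>x. x \<ge> 1 \<Longrightarrow> S' x = 0"
    and CS: "\<And>x. \<bar>S' x\<bar> \<le> CS"
    by (rule smooth_step_exists) blast
  define k where "k = 1 / (R1\<^sup>2 - \<rho>\<^sup>2)"
  have k: "k > 0"
    using R1 \<rho> by (simp add: k_def power_strict_mono)
  define X where "X y = S (k * (R1\<^sup>2 - y))" for y
  define X' where "X' y = S' (k * (R1\<^sup>2 - y)) * (- k)" for y
  have X: "smooth X" "smooth X'"
    unfolding X_def X'_def by (intro smooth_intros smooth_compose[OF S(1)] smooth_compose[OF S(2)])+
  have X_deriv: "(X has_real_derivative X' y) (at y)" for y
    unfolding X_def X'_def by (rule DERIV_chain2[OF S(3)]) (auto intro!: derivative_eq_intros)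
  have X1: "X ((norm x)\<^sup>2) = 1" if "norm x < \<rho>" for x :: 'a
  proof -
    have "(norm x)\<^sup>2 \<le> \<rho>\<^sup>2" using that by (intro power_mono) auto
    then have "k * (R1\<^sup>2 - (norm x)\<^sup>2) \<ge> k * (R1\<^sup>2 - \<rho>\<^sup>2)"
      using k by (intro mult_left_mono) auto
    also have "k * (R1\<^sup>2 - \<rho>\<^sup>2) = 1" using k by (auto simp: k_def)
    finally show ?thesis by (simp add: X_def S(5))
  qed
  have X0: "X ((norm x)\<^sup>2) = 0" if "norm x > R1" for x :: 'a
  proof -
    have "(norm x)\<^sup>2 \<ge> R1\<^sup>2" using that R1 \<rho> by (intro power_mono) auto
    then show ?thesis
      using k by (simp add: X_def S(4) mult_le_0_iff)
  qed
  define C where "C = CS * k"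
  have C: "\<bar>X' y\<bar> \<le> C" "C \<ge> 0" for y
    using k CS[of 0] CS[of "k * (R1\<^sup>2 - y)"] by (auto simp: C_def X'_def abs_mult intro: mult_right_mono)
  define v where "v n x = X ((norm x)\<^sup>2) * w n x" for n x
  have v: "smooth (v n)" for n
    unfolding v_def by (intro smooth_intros smooth_compose[OF X(1)] w)
  have gv: "gradient (v n) x = X ((norm x)\<^sup>2) *\<^sub>R gradient (w n) x + w n x *\<^sub>R ((2 * X' ((norm x)\<^sup>2)) *\<^sub>R x)" for n x
    unfolding v_def gradient_mult[OF smooth_compose[OF X(1) smooth_norm_square] w(1)] gradient_radial[OF X_deriv] ..
  have v_out: "v n x = 0" if "norm x > R1" for n x
    using X0[OF that] by (simp add: v_def)
  then have gv_out: "gradient (v n) x = 0" if "norm x > R1" for n x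
    using that by (intro gradient_eq_0_outside[OF compact_cball[of 0 R1]]) auto
  have bd: "(norm (gradient (v n) x))\<^sup>2 \<le> 2 * (norm (gradient (w n) x))\<^sup>2 + 2 * (2 * C * R)\<^sup>2 * (w n x)\<^sup>2"
    if "norm x < R" for n x
  proof -
    have "(norm (gradient (v n) x))\<^sup>2 \<le> 2 * (norm (X ((norm x)\<^sup>2) *\<^sub>R gradient (w n) x))\<^sup>2 +
        2 * (norm (w n x *\<^sub>R ((2 * X' ((norm x)\<^sup>2)) *\<^sub>R x)))\<^sup>2"
      unfolding gv by (rule norm_add_square_le)
    also have "(norm (X ((norm x)\<^sup>2) *\<^sub>R gradient (w n) x))\<^sup>2 \<le> (norm (gradient (w n) x))\<^sup>2"
      using S(6,7) by (intro power_mono) (auto simp: X_def intro!: mult_left_le_one_le)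
    also have "(norm (w n x *\<^sub>R ((2 * X' ((norm x)\<^sup>2)) *\<^sub>R x)))\<^sup>2 \<le> (2 * C * R)\<^sup>2 * (w n x)\<^sup>2"
    proof -
      have "2 * \<bar>X' ((norm x)\<^sup>2)\<bar> * norm x \<le> 2 * C * R"
        using C that by (intro mult_mono) auto
      then have "(2 * \<bar>X' ((norm x)\<^sup>2)\<bar> * norm x)\<^sup>2 * (w n x)\<^sup>2 \<le> (2 * C * R)\<^sup>2 * (w n x)\<^sup>2"
        by (intro mult_right_mono power_mono) auto
      then show ?thesis
        by (simp add: power_mult_distrib mult_ac)
    qed
    finally show ?thesis by simp
  qed
  have wL2: "integrable ?M (\<lambda>x. (w n x)\<^sup>2)" "integrable ?M (\<lambda>x. (norm (gradient (w n) x))\<^sup>2)" for n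
    using u G by (auto simp: L2_converges_def L2_def)
  obtain K1 where K1: "\<And>n. (\<integral>x. (w n x)\<^sup>2 \<partial>?M) \<le> K1"
  proof -
    have "convergent (\<lambda>n. \<integral>x. (w n x)\<^sup>2 \<partial>?M)"
      using L2_converges_inner[OF u u] by (auto simp: convergent_def power2_eq_square)
    then have "Bseq (\<lambda>n. \<integral>x. (w n x)\<^sup>2 \<partial>?M)" by (rule convergent_imp_Bseq)
    then show thesis using that by (force simp: Bseq_def abs_le_iff)
  qed
  obtain K2 where K2: "\<And>n. (\<integral>x. (norm (gradient (w n) x))\<^sup>2 \<partial>?M) \<le> K2"
  proof -
    have "convergent (\<lambda>n. \<integral>x. (norm (gradient (w n) x))\<^sup>2 \<partial>?M)"
      using L2_converges_inner[OF G G] by (auto simp: convergent_def power2_norm_eq_inner)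
    then have "Bseq (\<lambda>n. \<integral>x. (norm (gradient (w n) x))\<^sup>2 \<partial>?M)" by (rule convergent_imp_Bseq)
    then show thesis using that by (force simp: Bseq_def abs_le_iff)
  qed
  define K where "K = 4 * (2 * K2 + 2 * (2 * C * R)\<^sup>2 * K1)"
  have bound: "(\<integral>\<^sup>+x. ennreal ((w n x)\<^sup>2 / (norm x)\<^sup>2) \<partial>?N) \<le> ennreal K" for n
  proof -
    obtain \<delta> where \<delta>: "\<delta> > 0" "\<And>x. norm x < \<delta> \<Longrightarrow> w n x = 0"
      using w(2)[of n] by blast
    then have v_in: "v n x = 0" if "norm x < \<delta>" for x
      using that by (simp add: v_def)
    have hardy: "integrable lborel (\<lambda>x. (v n x)\<^sup>2 / (norm x)\<^sup>2)"
      "(\<integral>x. (v n x)\<^sup>2 / (norm x)\<^sup>2 \<partial>lborel) \<le> 4 * (\<integral>x. (norm (gradient (v n) x))\<^sup>2 \<partial>lborel)"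
      by (rule hardy_inequality[OF v[of n] \<delta>(1) _ _ dim, where b = R1]; simp add: v_in v_out)+
    have gm: "(\<lambda>x. (norm (gradient (v n) x))\<^sup>2) \<in> borel_measurable borel"
      using borel_measurable_gradient[OF v[of n]] by measurable
    have "(\<integral>x. (norm (gradient (v n) x))\<^sup>2 \<partial>lborel) = (\<integral>x. (norm (gradient (v n) x))\<^sup>2 \<partial>?M)"
      by (rule lint_lebesgue_on_eq_lborel[symmetric, OF gm]) (use gv_out R1 in auto)
    also have "\<dots> \<le> (\<integral>x. 2 * (norm (gradient (w n) x))\<^sup>2 + 2 * (2 * C * R)\<^sup>2 * (w n x)\<^sup>2 \<partial>?M)"
    proof (rule integral_mono)
      show "integrable ?M (\<lambda>x. (norm (gradient (v n) x))\<^sup>2)"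
        using L2_continuous[OF smooth_continuous_on_gradient[OF v[of n]], of R] by (simp add: L2_def)
      show "integrable ?M (\<lambda>x. 2 * (norm (gradient (w n) x))\<^sup>2 + 2 * (2 * C * R)\<^sup>2 * (w n x)\<^sup>2)"
        by (intro Bochner_Integration.integrable_add integrable_mult_right wL2)
    qed (use bd in \<open>auto simp: space_restrict_space\<close>)
    also have "\<dots> = 2 * (\<integral>x. (norm (gradient (w n) x))\<^sup>2 \<partial>?M) + 2 * (2 * C * R)\<^sup>2 * (\<integral>x. (w n x)\<^sup>2 \<partial>?M)"
      using wL2 by simp
    also have "\<dots> \<le> 2 * K2 + 2 * (2 * C * R)\<^sup>2 * K1"
      by (intro add_mono mult_left_mono K1 K2) auto
    finally have le: "(\<integral>x. (v n x)\<^sup>2 / (norm x)\<^sup>2 \<partial>lborel) \<le> K"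
      unfolding K_def by (intro order_trans[OF hardy(2) mult_left_mono]) simp_all
    have "(\<integral>\<^sup>+x. ennreal ((w n x)\<^sup>2 / (norm x)\<^sup>2) \<partial>?N) =
        (\<integral>\<^sup>+x. ennreal ((w n x)\<^sup>2 / (norm x)\<^sup>2) * indicator (ball 0 \<rho>) x \<partial>lborel)"
      by (simp add: nn_integral_restrict_space nn_integral_completion)
    also have "\<dots> \<le> (\<integral>\<^sup>+x. ennreal ((v n x)\<^sup>2 / (norm x)\<^sup>2) \<partial>lborel)"
      by (intro nn_integral_mono) (auto simp: indicator_def v_def X1)
    also have "\<dots> = ennreal (\<integral>x. (v n x)\<^sup>2 / (norm x)\<^sup>2 \<partial>lborel)"
      by (intro nn_integral_eq_integral hardy(1)) auto
    also have "\<dots> \<le> ennreal K"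
      using le by (rule ennreal_leI)
    finally show ?thesis .
  qed
  obtain r :: "nat \<Rightarrow> nat" where r: "AE x in ?M. (\<lambda>n. w (r n) x) \<longlonglongrightarrow> u x"
    using L2_converges_AE_subseq[OF u] by blast
  then have r': "AE x in ?N. (\<lambda>n. w (r n) x) \<longlonglongrightarrow> u x"
    using \<rho>(2) by (auto simp: AE_restrict_space_iff elim!: eventually_mono)
  have um: "u \<in> borel_measurable ?N"
  proof -
    have "ball 0 \<rho> \<subseteq> (ball 0 R :: 'a set)"
      using \<rho> by (intro subset_ball) simp
    then have "L2 ?N u"
      using u by (intro L2_lebesgue_on_subset[of "ball 0 R" u "ball 0 \<rho>"]) (auto simp: L2_converges_def)
    then show ?thesis by (simp add: L2_def)
  qed
  have nm: "(norm :: 'a \<Rightarrow> real) \<in> borel_measurable ?N"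
    by (intro measurable_restrict_space1 measurable_completion) simp
  have wm: "w n \<in> borel_measurable ?N" for n
    by (intro measurable_restrict_space1 measurable_completion) (simp add: borel_measurable_smooth w)
  note [measurable] = um nm wm
  have "(\<integral>\<^sup>+x. ennreal ((u x)\<^sup>2 / (norm x)\<^sup>2) \<partial>?N) = (\<integral>\<^sup>+x. liminf (\<lambda>n. ennreal ((w (r n) x)\<^sup>2 / (norm x)\<^sup>2)) \<partial>?N)"
  proof (rule nn_integral_cong_AE)
    show "AE x in ?N. ennreal ((u x)\<^sup>2 / (norm x)\<^sup>2) = liminf (\<lambda>n. ennreal ((w (r n) x)\<^sup>2 / (norm x)\<^sup>2))"
      using r'
    proof eventually_elim
      case (elim x)
      then have "(\<lambda>n. ennreal ((w (r n) x)\<^sup>2 * inverse ((norm x)\<^sup>2))) \<longlonglongrightarrow> ennreal ((u x)\<^sup>2 * inverse ((norm x)\<^sup>2))"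
        by (intro tendsto_ennrealI tendsto_mult tendsto_power tendsto_const)
      then show ?case
        unfolding divide_inverse by (rule lim_imp_Liminf[symmetric, rotated]) simp
    qed
  qed
  also have "\<dots> \<le> liminf (\<lambda>n. \<integral>\<^sup>+x. ennreal ((w (r n) x)\<^sup>2 / (norm x)\<^sup>2) \<partial>?N)"
    by (rule nn_integral_liminf) measurable
  also have "\<dots> \<le> ennreal K"
    by (intro Liminf_le always_eventually allI bound) simp
  also have "\<dots> < \<infinity>"
    by simp
  finally have "(\<integral>\<^sup>+x. ennreal ((u x)\<^sup>2 / (norm x)\<^sup>2) \<partial>?N) < \<infinity>" .
  then show ?thesis
    by (intro integrableI_bounded) auto
qed

section \<open>Testing the equation with dilations\<close>

lemma L2_inner_bounded:
  fixes X c :: "'a \<Rightarrow> 'b::euclidean_space"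
  assumes "L2 M X" and [measurable]: "c \<in> borel_measurable M" and C: "AE x in M. norm (c x) \<le> C"
  shows "L2 M (\<lambda>x. X x \<bullet> c x)"
proof -
  have [measurable]: "X \<in> borel_measurable M" and int: "integrable M (\<lambda>x. C\<^sup>2 * (norm (X x))\<^sup>2)"
    using assms by (auto simp: L2_def)
  have "integrable M (\<lambda>x. (norm (X x \<bullet> c x))\<^sup>2)"
  proof (rule Bochner_Integration.integrable_bound[OF int])
    show "AE x in M. norm ((norm (X x \<bullet> c x))\<^sup>2) \<le> norm (C\<^sup>2 * (norm (X x))\<^sup>2)"
      using C
    proof eventually_elim
      case (elim x)
      have "\<bar>X x \<bullet> c x\<bar> \<le> norm (X x) * C"
        by (rule order_trans[OF Cauchy_Schwarz_ineq2 mult_left_mono[OF elim]]) simp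
      then have "\<bar>X x \<bullet> c x\<bar>\<^sup>2 \<le> (norm (X x) * C)\<^sup>2"
        by (intro power_mono) auto
      then show ?case
        by (simp add: power_mult_distrib mult.commute)
    qed
  qed simp
  then show ?thesis by (simp add: L2_def)
qed

lemma radial_cutoff_bounded:
  assumes "radial_cutoff R \<Phi> \<Phi>'"
  obtains C where "C \<ge> 0" "\<And>y. \<bar>\<Phi> y\<bar> \<le> C" "\<And>y. \<bar>\<Phi>' y\<bar> \<le> C"
proof -
  obtain a b where ab: "smooth \<Phi>" "smooth \<Phi>'" "\<And>y. \<not> (a < y \<and> y < b) \<Longrightarrow> \<Phi> y = 0 \<and> \<Phi>' y = 0"
    using assms unfolding radial_cutoff_def by blast
  have "compact (\<Phi> ` {a..b})" "compact (\<Phi>' ` {a..b})"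
    by (intro compact_continuous_image smooth_continuous_on ab; simp)+
  then obtain C1 C2 where C: "\<And>x. x \<in> {a..b} \<Longrightarrow> \<bar>\<Phi> x\<bar> \<le> C1" "\<And>x. x \<in> {a..b} \<Longrightarrow> \<bar>\<Phi>' x\<bar> \<le> C2"
    by (force dest!: compact_imp_bounded simp: bounded_iff)
  show thesis
  proof (rule that[of "max 0 (max C1 C2)"])
    show "\<bar>\<Phi> y\<bar> \<le> max 0 (max C1 C2)" for y
      using C(1)[of y] ab(3)[of y] by (cases "y \<in> {a..b}") (auto simp: le_max_iff_disj)
    show "\<bar>\<Phi>' y\<bar> \<le> max 0 (max C1 C2)" for y
      using C(2)[of y] ab(3)[of y] by (cases "y \<in> {a..b}") (auto simp: le_max_iff_disj)
  qed simp
qed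

lemma borel_measurable_lebesgue_on_continuous:
  fixes h :: "'a::euclidean_space \<Rightarrow> 'b::euclidean_space"
  assumes "continuous_on UNIV h"
  shows "h \<in> borel_measurable (lebesgue_on \<Omega>)"
  using assms by (intro measurable_restrict_space1 measurable_completion) (simp add: borel_measurable_continuous_onI)

text \<open>What the starshapedness of the complement of the crack provides: \<open>u\<close> is the limit of smooth
  functions all of whose outward dilations \<open>w\<^sub>n(tx)\<close>, \<open>t \<ge> 1\<close>, may be used, times a cutoff, as test
  functions in the equation of \<open>u\<close>. The condition \<open>t\<^sup>2 b < R\<^sup>2\<close> says that only values of \<open>w\<^sub>n\<close> inside the ball
  enter, where \<open>w\<^sub>n\<close> is known to vanish near the crack.\<close>

locale dilation_testable =
  fixes R :: real and f u :: "'a::euclidean_space \<Rightarrow> real" and G :: "'a \<Rightarrow> 'a" and w :: "nat \<Rightarrow> 'a \<Rightarrow> real"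
  assumes R_pos: "R > 0" and dim: "DIM('a) \<ge> 3"
    and w_smooth: "\<And>n. smooth (w n)"
    and conv_u: "L2_converges (lebesgue_on (ball 0 R)) w u"
    and conv_G: "L2_converges (lebesgue_on (ball 0 R)) (\<lambda>n. gradient (w n)) G"
    and f_meas: "f \<in> borel_measurable (lebesgue_on (ball 0 R))"
    and f_bounded: "\<And>\<delta>. 0 < \<delta> \<Longrightarrow> \<delta> < R \<Longrightarrow> \<exists>C. \<forall>x \<in> ball 0 R - ball 0 \<delta>. \<bar>f x\<bar> \<le> C"
    and equation: "\<And>n t b \<Phi> \<Phi>'. radial_cutoff R \<Phi> \<Phi>' \<Longrightarrow> 1 \<le> t \<Longrightarrow>
      (\<And>y. y \<ge> b \<Longrightarrow> \<Phi> y = 0) \<Longrightarrow> t\<^sup>2 * b < R\<^sup>2 \<Longrightarrow>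
      (\<integral>x. G x \<bullet> gradient (\<lambda>x. \<Phi> ((norm x)\<^sup>2) * w n (t *\<^sub>R x)) x \<partial>lebesgue_on (ball 0 R)) =
      (\<integral>x. f x * u x * (\<Phi> ((norm x)\<^sup>2) * w n (t *\<^sub>R x)) \<partial>lebesgue_on (ball 0 R))"
begin

abbreviation M :: "'a measure" where "M \<equiv> lebesgue_on (ball 0 R)"

lemma u_L2: "L2 M u" and G_L2: "L2 M G"
  using conv_u conv_G by (auto simp: L2_converges_def)

lemma space_M: "x \<in> space M \<longleftrightarrow> norm x < R"
  by (simp add: space_restrict_space)

lemma integrable_continuous_M:
  fixes h :: "'a \<Rightarrow> real"
  assumes "continuous_on UNIV h"
  shows "integrable M h"
proof -
  have "L2 M (\<lambda>x. 1::real)"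
    by (rule L2_continuous) simp
  from L2_Cauchy_Schwarz(1)[OF L2_continuous[OF assms] this] show ?thesis
    by simp
qed

lemma cutoff_annulus:
  assumes "radial_cutoff R \<Phi> \<Phi>'"
  obtains a b where "0 < a" "a < b" "b < R\<^sup>2" "\<And>y. \<not> (a < y \<and> y < b) \<Longrightarrow> \<Phi> y = 0"
    "\<And>y. \<not> (a < y \<and> y < b) \<Longrightarrow> \<Phi>' y = 0"
  using assms unfolding radial_cutoff_def by blast

lemma cutoff_potential_bounded:
  assumes "radial_cutoff R \<Phi> \<Phi>'"
  obtains C where "\<And>x. norm x < R \<Longrightarrow> \<bar>f x * \<Phi> ((norm x)\<^sup>2)\<bar> \<le> C"
proof -
  obtain a b where ab: "0 < a" "a < b" "b < R\<^sup>2" "\<And>y. \<not> (a < y \<and> y < b) \<Longrightarrow> \<Phi> y = 0"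
    using cutoff_annulus[OF assms] by metis
  obtain K where K: "K \<ge> 0" "\<And>y. \<bar>\<Phi> y\<bar> \<le> K"
    using radial_cutoff_bounded[OF assms] by metis
  have "a < R\<^sup>2" using ab by simp
  then have "sqrt a < R"
    using R_pos by (intro real_less_lsqrt) auto
  then obtain C where C: "\<And>x. x \<in> ball 0 R - ball 0 (sqrt a) \<Longrightarrow> \<bar>f x\<bar> \<le> C"
    using f_bounded[OF _ \<open>sqrt a < R\<close>] ab(1) by (metis real_sqrt_gt_zero)
  show thesis
  proof (rule that)
    fix x :: 'a assume x: "norm x < R"
    show "\<bar>f x * \<Phi> ((norm x)\<^sup>2)\<bar> \<le> \<bar>C\<bar> * K"
    proof (cases "norm x < sqrt a")
      case True
      then have "(norm x)\<^sup>2 < (sqrt a)\<^sup>2"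
        by (intro power_strict_mono) auto
      then have "\<Phi> ((norm x)\<^sup>2) = 0"
        using ab by simp
      then show ?thesis using K by simp
    next
      case False
      then have "\<bar>f x\<bar> \<le> \<bar>C\<bar>"
        using C[of x] x by auto
      then show ?thesis
        unfolding abs_mult using K by (intro mult_mono) auto
    qed
  qed
qed

context
  fixes \<Phi> \<Phi>' assumes cut: "radial_cutoff R \<Phi> \<Phi>'"
begin

lemma cut_smooth: "smooth \<Phi>" "smooth \<Phi>'" "(\<Phi> has_real_derivative \<Phi>' y) (at y)" "0 \<le> \<Phi> y"
  using cut by (auto simp: radial_cutoff_def)

lemma cut_continuous: "continuous_on UNIV (\<lambda>x::'a. \<Phi> ((norm x)\<^sup>2))" "continuous_on UNIV (\<lambda>x::'a. \<Phi>' ((norm x)\<^sup>2))"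
  by (rule smooth_continuous_on; intro smooth_compose[OF cut_smooth(1)] smooth_compose[OF cut_smooth(2)] smooth_intros)+

lemma cut_measurable [measurable]: "(\<lambda>x. \<Phi> ((norm x)\<^sup>2)) \<in> borel_measurable M" "(\<lambda>x. \<Phi>' ((norm x)\<^sup>2)) \<in> borel_measurable M"
  by (intro borel_measurable_lebesgue_on_continuous cut_continuous)+

text \<open>The equation tested with \<open>\<Phi>(|x|\<^sup>2) w\<^sub>n(tx)\<close> pairs \<open>w\<^sub>n(tx)\<close> and its gradient with these two
  square integrable fields.\<close>

definition h :: "'a \<Rightarrow> real" where
  "h x = 2 * \<Phi>' ((norm x)\<^sup>2) * (G x \<bullet> x) - f x * u x * \<Phi> ((norm x)\<^sup>2)"

definition \<Phi>G :: "'a \<Rightarrow> 'a" where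
  "\<Phi>G x = \<Phi> ((norm x)\<^sup>2) *\<^sub>R G x"

lemma \<Phi>G_L2: "L2 M \<Phi>G"
proof -
  obtain C where "\<And>y. \<bar>\<Phi> y\<bar> \<le> C" using radial_cutoff_bounded[OF cut] by metis
  then show ?thesis
    unfolding \<Phi>G_def[abs_def] by (intro L2_bounded_mult[OF G_L2 cut_measurable(1)]) auto
qed

lemma xG_L2: "L2 M (\<lambda>x. G x \<bullet> x)"
  by (rule L2_inner_bounded[OF G_L2, where C = R])
    (auto intro!: borel_measurable_lebesgue_on_continuous simp: space_M)

lemma fu\<Phi>_L2: "L2 M (\<lambda>x. f x * u x * \<Phi> ((norm x)\<^sup>2))"
proof -
  obtain C where C: "\<And>x. norm x < R \<Longrightarrow> \<bar>f x * \<Phi> ((norm x)\<^sup>2)\<bar> \<le> C"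
    using cutoff_potential_bounded[OF cut] by metis
  have "L2 M (\<lambda>x. (f x * \<Phi> ((norm x)\<^sup>2)) *\<^sub>R u x)"
    by (rule L2_bounded_mult[OF u_L2, where C = C]) (use f_meas C in \<open>auto simp: space_M\<close>)
  then show ?thesis
    by (simp add: mult_ac)
qed

lemma \<Phi>'xG_L2: "L2 M (\<lambda>x. 2 * \<Phi>' ((norm x)\<^sup>2) * (G x \<bullet> x))"
proof -
  obtain C where C: "\<And>y. \<bar>\<Phi>' y\<bar> \<le> C" using radial_cutoff_bounded[OF cut] by metis
  have "L2 M (\<lambda>x. (2 * \<Phi>' ((norm x)\<^sup>2)) *\<^sub>R (G x \<bullet> x))"
    by (rule L2_bounded_mult[OF xG_L2, where C = "2 * C"]) (use C in \<open>auto simp: abs_mult\<close>)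
  then show ?thesis by simp
qed

lemma h_L2: "L2 M h"
  unfolding h_def[abs_def] by (rule L2_diff[OF \<Phi>'xG_L2 fu\<Phi>_L2])

lemma hx_L2: "L2 M (\<lambda>x. h x *\<^sub>R x)"
proof -
  have m: "(\<lambda>x. h x *\<^sub>R x) \<in> borel_measurable M"
    using h_L2 by (intro borel_measurable_scaleR) (auto simp: L2_def intro!: borel_measurable_lebesgue_on_continuous)
  have "L2 M (\<lambda>x. norm x *\<^sub>R h x)"
    by (rule L2_bounded_mult[OF h_L2, where C = R])
      (auto intro!: borel_measurable_lebesgue_on_continuous continuous_intros simp: space_M)
  with m show ?thesis by (simp add: L2_def mult.commute power_mult_distrib)
qed

lemma continuous_dilation:
  fixes X :: "'a \<Rightarrow> 'b::euclidean_space"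
  assumes "continuous_on UNIV X"
  shows "continuous_on UNIV (\<lambda>x. X (t *\<^sub>R x))"
  by (rule continuous_on_compose2[OF assms]) (auto intro!: continuous_intros)

lemma w_dilated_L2: "L2 M (\<lambda>x. w n (t *\<^sub>R x))" "L2 M (\<lambda>x. gradient (w n) (t *\<^sub>R x))"
  by (intro L2_continuous continuous_dilation smooth_continuous_on smooth_continuous_on_gradient w_smooth)+

lemma tested_equation:
  assumes t: "1 \<le> t" "\<And>y. y \<ge> b \<Longrightarrow> \<Phi> y = 0" "t\<^sup>2 * b < R\<^sup>2"
  shows "(\<integral>x. \<Phi>G x \<bullet> (t *\<^sub>R gradient (w n) (t *\<^sub>R x)) \<partial>M) + (\<integral>x. h x * w n (t *\<^sub>R x) \<partial>M) = 0"
proof -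
  let ?v = "\<lambda>x. \<Phi> ((norm x)\<^sup>2) * w n (t *\<^sub>R x)"
  have g: "gradient ?v x = \<Phi> ((norm x)\<^sup>2) *\<^sub>R (t *\<^sub>R gradient (w n) (t *\<^sub>R x)) + w n (t *\<^sub>R x) *\<^sub>R ((2 * \<Phi>' ((norm x)\<^sup>2)) *\<^sub>R x)" for x
    unfolding gradient_mult[OF smooth_compose[OF cut_smooth(1) smooth_norm_square] smooth_dilation[OF w_smooth]]
      gradient_dilation[OF w_smooth] gradient_radial[OF cut_smooth(3)] ..
  have smooth_v: "smooth ?v"
    by (intro smooth_intros smooth_compose[OF cut_smooth(1)] w_smooth)
  have i: "integrable M (\<lambda>x. G x \<bullet> gradient ?v x)"
    by (intro L2_Cauchy_Schwarz(1) G_L2 L2_continuous smooth_continuous_on_gradient smooth_v)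
  have j: "integrable M (\<lambda>x. f x * u x * ?v x)"
    using L2_Cauchy_Schwarz(1)[OF fu\<Phi>_L2 w_dilated_L2(1)] by (simp add: mult_ac)
  have "0 = (\<integral>x. G x \<bullet> gradient ?v x - f x * u x * ?v x \<partial>M)"
    using equation[OF cut t] i j by simp
  also have "\<dots> = (\<integral>x. \<Phi>G x \<bullet> (t *\<^sub>R gradient (w n) (t *\<^sub>R x)) + h x * w n (t *\<^sub>R x) \<partial>M)"
    unfolding g by (rule Bochner_Integration.integral_cong) (simp_all add: \<Phi>G_def h_def inner_add_right algebra_simps)
  also have "\<dots> = (\<integral>x. \<Phi>G x \<bullet> (t *\<^sub>R gradient (w n) (t *\<^sub>R x)) \<partial>M) + (\<integral>x. h x * w n (t *\<^sub>R x) \<partial>M)"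
  proof (rule Bochner_Integration.integral_add)
    show "integrable M (\<lambda>x. \<Phi>G x \<bullet> (t *\<^sub>R gradient (w n) (t *\<^sub>R x)))"
      using L2_Cauchy_Schwarz(1)[OF \<Phi>G_L2 w_dilated_L2(2)] by simp
    show "integrable M (\<lambda>x. h x * w n (t *\<^sub>R x))"
      using L2_Cauchy_Schwarz(1)[OF h_L2 w_dilated_L2(1)] by simp
  qed
  finally show ?thesis by simp
qed

lemma tested_equation_undilated:
  "(\<integral>x. \<Phi>G x \<bullet> gradient (w n) x \<partial>M) + (\<integral>x. h x * w n x \<partial>M) = 0"
proof -
  obtain a b where "b < R\<^sup>2" "\<And>y. \<not> (a < y \<and> y < b) \<Longrightarrow> \<Phi> y = 0"
    using cutoff_annulus[OF cut] by metis
  then show ?thesis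
    using tested_equation[of 1 b n] by simp
qed

text \<open>The limit of the equation tested with \<open>\<Phi>(|x|\<^sup>2) w\<^sub>n\<close>.\<close>

lemma cutoff_energy:
  "(\<integral>x. \<Phi> ((norm x)\<^sup>2) * ((norm (G x))\<^sup>2 - f x * (u x)\<^sup>2) + \<Phi>' ((norm x)\<^sup>2) * (2 * u x * (G x \<bullet> x)) \<partial>M) = 0"
proof -
  have "(\<lambda>n. (\<integral>x. \<Phi>G x \<bullet> gradient (w n) x \<partial>M) + (\<integral>x. h x * w n x \<partial>M)) \<longlonglongrightarrow>
      (\<integral>x. \<Phi>G x \<bullet> G x \<partial>M) + (\<integral>x. h x * u x \<partial>M)"
    using L2_converges_inner[OF L2_converges_const[OF \<Phi>G_L2] conv_G]
      L2_converges_inner[OF L2_converges_const[OF h_L2] conv_u] by (intro tendsto_add) simp_all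
  then have "0 = (\<integral>x. \<Phi>G x \<bullet> G x \<partial>M) + (\<integral>x. h x * u x \<partial>M)"
    by (simp add: tested_equation_undilated LIMSEQ_const_iff)
  also have "\<dots> = (\<integral>x. \<Phi>G x \<bullet> G x + h x * u x \<partial>M)"
    using L2_Cauchy_Schwarz(1)[OF \<Phi>G_L2 G_L2] L2_Cauchy_Schwarz(1)[OF h_L2 u_L2] by simp
  also have "\<dots> = (\<integral>x. \<Phi> ((norm x)\<^sup>2) * ((norm (G x))\<^sup>2 - f x * (u x)\<^sup>2) + \<Phi>' ((norm x)\<^sup>2) * (2 * u x * (G x \<bullet> x)) \<partial>M)"
    by (rule Bochner_Integration.integral_cong)
      (simp_all add: \<Phi>G_def h_def power2_norm_eq_inner[symmetric] power2_eq_square[of "u _"] algebra_simps)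
  finally show ?thesis by simp
qed

definition pairing :: "nat \<Rightarrow> real \<Rightarrow> real" where
  "pairing n t = (\<integral>x. h x * w n (t *\<^sub>R x) \<partial>M)"

definition pairing_slope :: "nat \<Rightarrow> real \<Rightarrow> real" where
  "pairing_slope n t = (\<integral>x. h x * (gradient (w n) (t *\<^sub>R x) \<bullet> x) \<partial>M)"

lemma pairing_derivative:
  assumes "0 < t" "t < 2"
  shows "(pairing n has_real_derivative pairing_slope n t) (at t)"
proof -
  have "compact (gradient (w n) ` cball 0 (2 * R))"
    by (intro compact_continuous_image smooth_continuous_on_gradient w_smooth) simp
  then obtain C where C: "\<And>x. x \<in> cball 0 (2 * R) \<Longrightarrow> norm (gradient (w n) x) \<le> C"
    using compact_imp_bounded by (force simp: bounded_iff)
  have one: "L2 M (\<lambda>x. 1::real)"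
    by (rule L2_continuous) simp
  have h_int: "integrable M h"
    using L2_Cauchy_Schwarz(1)[OF h_L2 one] by simp
  show ?thesis
    unfolding pairing_def[abs_def] pairing_slope_def
  proof (rule has_derivative_under_integral[OF assms, where B = "\<lambda>x. C * R * \<bar>h x\<bar>"])
    show "((\<lambda>t. h x * w n (t *\<^sub>R x)) has_real_derivative h x * (gradient (w n) (t *\<^sub>R x) \<bullet> x)) (at t)" for t x
      using DERIV_cmult[OF smooth_ray_derivative[OF w_smooth, where a = 0 and b = x and t = t]] by simp
    show "integrable M (\<lambda>x. h x * w n (t *\<^sub>R x))" for t
      using L2_Cauchy_Schwarz(1)[OF h_L2 w_dilated_L2(1)] by simp
    show "integrable M (\<lambda>x. C * R * \<bar>h x\<bar>)"
      using h_int by simp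
    show "\<bar>h x * (gradient (w n) (t *\<^sub>R x) \<bullet> x)\<bar> \<le> C * R * \<bar>h x\<bar>" if t: "0 < t" "t < 2" and x: "x \<in> space M" for t x
    proof -
      have nx: "norm x \<le> R" using x by (simp add: space_M)
      have "t * norm x \<le> 2 * R"
        using t nx by (intro mult_mono) auto
      then have g: "norm (gradient (w n) (t *\<^sub>R x)) \<le> C"
        using t by (intro C) simp
      have "\<bar>gradient (w n) (t *\<^sub>R x) \<bullet> x\<bar> \<le> norm (gradient (w n) (t *\<^sub>R x)) * norm x"
        by (rule Cauchy_Schwarz_ineq2)
      also have "\<dots> \<le> C * R"
        using g nx order_trans[OF norm_ge_zero g] by (intro mult_mono) auto
      finally show ?thesis
        unfolding abs_mult mult.commute[of "\<bar>h x\<bar>"] by (rule mult_right_mono) simp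
    qed
  qed
qed

lemma cut_dilation_in_ball:
  obtains b T where "T > 1" "T \<le> 2" "0 < b" "\<And>y. y \<ge> b \<Longrightarrow> \<Phi> y = 0" "\<And>y. y \<ge> b \<Longrightarrow> \<Phi>' y = 0"
    "\<And>t. 1 \<le> t \<Longrightarrow> t < T \<Longrightarrow> t\<^sup>2 * b < R\<^sup>2"
proof -
  obtain a b where ab: "0 < a" "a < b" "b < R\<^sup>2" "\<And>y. \<not> (a < y \<and> y < b) \<Longrightarrow> \<Phi> y = 0"
    "\<And>y. \<not> (a < y \<and> y < b) \<Longrightarrow> \<Phi>' y = 0"
    using cutoff_annulus[OF cut] by metis
  have b: "b > 0" using ab by simp
  have "sqrt b < R"
    using ab b R_pos by (simp add: real_less_lsqrt)
  then have "1 < R / sqrt b"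
    using b by simp
  show thesis
  proof (rule that[of "min 2 (R / sqrt b)" b])
    show "t\<^sup>2 * b < R\<^sup>2" if "1 \<le> t" "t < min 2 (R / sqrt b)" for t
    proof -
      have "t * sqrt b < R"
        using that b by (simp add: field_simps)
      then have "(t * sqrt b)\<^sup>2 < R\<^sup>2"
        using that b by (intro power_strict_mono) auto
      then show ?thesis
        using b by (simp add: power_mult_distrib)
    qed
  qed (use ab b \<open>1 < R / sqrt b\<close> in auto)
qed

definition gradient_error :: "nat \<Rightarrow> real" where
  "gradient_error n = (\<integral>x. (norm (gradient (w n) x - G x))\<^sup>2 \<partial>M)"

definition hx_norm :: real where
  "hx_norm = sqrt (\<integral>x. (norm (h x *\<^sub>R x))\<^sup>2 \<partial>M)"

text \<open>Increments of \<open>t \<mapsto> \<integral> h(x) w\<^sub>n(tx) dx\<close> are Cauchy in \<open>n\<close>, uniformly at rate \<open>t - 1\<close>: by the mean value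
  theorem they are \<open>t - 1\<close> times the pairing of \<open>h(x) x\<close> with the gradient of \<open>w\<^sub>n\<close> at \<open>sx\<close>, and a change of
  variables bounds the \<open>L\<^sup>2\<close> distance of two such gradients by their distance in the ball. So \<open>n \<rightarrow> \<infinity>\<close>
  at fixed \<open>t\<close> costs an error that, relative to \<open>t - 1\<close>, still vanishes as \<open>m \<rightarrow> \<infinity>\<close>.\<close>

lemma pairing_increment:
  assumes b: "0 < b" "\<And>y. y \<ge> b \<Longrightarrow> \<Phi> y = 0" "\<And>y. y \<ge> b \<Longrightarrow> \<Phi>' y = 0"
    and t: "1 < t" "t < 2" "t\<^sup>2 * b < R\<^sup>2"
  shows "pairing n t - pairing n 1 \<le> pairing m t - pairing m 1 + (t - 1) * (hx_norm * sqrt (2 * gradient_error n + 2 * gradient_error m))"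
proof -
  define D where "D x = gradient (w n) x - gradient (w m) x" for x
  have D_cont: "continuous_on UNIV D"
    unfolding D_def by (intro continuous_intros smooth_continuous_on_gradient w_smooth)
  have gL2: "L2 M (gradient (w k))" for k
    by (intro L2_continuous smooth_continuous_on_gradient w_smooth)
  have "((\<lambda>t. pairing n t - pairing m t) has_real_derivative (pairing_slope n s - pairing_slope m s)) (at s)" if "1 \<le> s" "s \<le> t" for s
    using that t by (intro DERIV_diff pairing_derivative) auto
  then obtain s where s: "1 < s" "s < t" "(pairing n t - pairing m t) - (pairing n 1 - pairing m 1) = (t - 1) * (pairing_slope n s - pairing_slope m s)"
    using MVT2[of 1 t "\<lambda>t. pairing n t - pairing m t" "\<lambda>s. pairing_slope n s - pairing_slope m s"] t(1) by blast
  have h0: "h x = 0" if "(norm x)\<^sup>2 \<ge> b" for x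
    using b that by (simp add: h_def)
  \<comment> \<open>Where \<open>h\<close> vanishes the second factor may be set to zero; \<open>sx\<close> then stays in the ball.\<close>
  define Y where "Y x = indicator {x. (norm x)\<^sup>2 < b} x *\<^sub>R D (s *\<^sub>R x)" for x
  have Y_L2: "L2 M Y"
    unfolding Y_def
  proof (rule L2_bounded_mult[where C = 1])
    show "L2 M (\<lambda>x. D (s *\<^sub>R x))"
      by (intro L2_continuous continuous_dilation D_cont)
    show "indicator {x. (norm x)\<^sup>2 < b} \<in> borel_measurable M"
      by (intro measurable_restrict_space1 measurable_completion) measurable
  qed auto
  have "pairing_slope n s - pairing_slope m s = (\<integral>x. h x * (gradient (w n) (s *\<^sub>R x) \<bullet> x) - h x * (gradient (w m) (s *\<^sub>R x) \<bullet> x) \<partial>M)"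
  proof -
    have "integrable M (\<lambda>x. h x * (gradient (w k) (s *\<^sub>R x) \<bullet> x))" for k
      using L2_Cauchy_Schwarz(1)[OF hx_L2 w_dilated_L2(2), of k s] by (simp add: inner_commute)
    then show ?thesis unfolding pairing_slope_def by simp
  qed
  also have "\<dots> = (\<integral>x. (h x *\<^sub>R x) \<bullet> Y x \<partial>M)"
  proof (rule Bochner_Integration.integral_cong)
    fix x
    show "h x * (gradient (w n) (s *\<^sub>R x) \<bullet> x) - h x * (gradient (w m) (s *\<^sub>R x) \<bullet> x) = (h x *\<^sub>R x) \<bullet> Y x"
      using h0[of x] by (cases "(norm x)\<^sup>2 < b") (auto simp: Y_def D_def inner_diff_right inner_commute algebra_simps)
  qed simp
  also have "\<dots> \<le> hx_norm * sqrt (\<integral>x. (norm (Y x))\<^sup>2 \<partial>M)"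
    using L2_Cauchy_Schwarz(2)[OF hx_L2 Y_L2] unfolding hx_norm_def by linarith
  also have "\<dots> \<le> hx_norm * sqrt (2 * gradient_error n + 2 * gradient_error m)"
  proof (intro mult_left_mono real_sqrt_le_mono)
    show "hx_norm \<ge> 0" by (simp add: hx_norm_def)
    define k where "k y = indicator {y. (norm y)\<^sup>2 < s\<^sup>2 * b} y * (norm (D y))\<^sup>2" for y
    have sb: "s\<^sup>2 * b < R\<^sup>2"
    proof -
      have "s\<^sup>2 * b \<le> t\<^sup>2 * b"
        using s b by (intro mult_right_mono power_mono) auto
      then show ?thesis using t by simp
    qed
    have small: "norm y < R" if "(norm y)\<^sup>2 < s\<^sup>2 * b" for y :: 'a
      using power_less_imp_less_base[of "norm y" 2 R] that sb R_pos by simp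
    have [measurable]: "D \<in> borel_measurable borel"
      using D_cont by (rule borel_measurable_continuous_onI)
    have k_meas: "k \<in> borel_measurable borel"
      unfolding k_def by measurable
    have kY: "(norm (Y x))\<^sup>2 = k (s *\<^sub>R x)" for x
      using s b by (auto simp: Y_def k_def indicator_def power_mult_distrib)
    have "(\<integral>x. (norm (Y x))\<^sup>2 \<partial>M) = (\<integral>x. k (s *\<^sub>R x) \<partial>lborel)"
      unfolding kY
    proof (rule lint_lebesgue_on_eq_lborel)
      show "(\<lambda>x. k (s *\<^sub>R x)) \<in> borel_measurable borel"
        by (rule measurable_compose[OF _ k_meas]) simp
      show "k (s *\<^sub>R x) = 0" if "x \<notin> ball 0 R" for x
      proof -
        have "\<not> norm (s *\<^sub>R x) < R"
          using that s mult_right_mono[of 1 s "norm x"] by auto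
        then have "\<not> (norm (s *\<^sub>R x))\<^sup>2 < s\<^sup>2 * b"
          using small by blast
        then show ?thesis by (simp add: k_def)
      qed
    qed simp
    also have "\<dots> = (1 / s) ^ DIM('a) * (\<integral>x. k x \<partial>lborel)"
      using s k_meas by (intro integral_dilation) auto
    also have "\<dots> \<le> 1 * (\<integral>x. k x \<partial>lborel)"
      using s by (intro mult_right_mono power_le_one integral_nonneg_AE) (auto simp: k_def)
    also have "(\<integral>x. k x \<partial>lborel) = (\<integral>x. k x \<partial>M)"
      by (rule lint_lebesgue_on_eq_lborel[symmetric, OF k_meas]) (use small in \<open>auto simp: k_def indicator_def\<close>)
    also have "\<dots> \<le> (\<integral>x. (norm (D x))\<^sup>2 \<partial>M)"
    proof (rule integral_mono)
      have DL2: "L2 M D" by (rule L2_continuous[OF D_cont])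
      then show "integrable M (\<lambda>x. (norm (D x))\<^sup>2)" by (simp add: L2_def)
      then show "integrable M k"
        unfolding k_def
        by (rule integrable_bounded_mult[where C = 1])
          (auto intro!: measurable_restrict_space1 measurable_completion)
      show "k x \<le> (norm (D x))\<^sup>2" for x
        by (auto simp: k_def indicator_def)
    qed
    also have "\<dots> \<le> 2 * gradient_error n + 2 * gradient_error m"
      unfolding D_def gradient_error_def by (rule L2_dist_triangle[OF gL2 G_L2 gL2])
    finally show "(\<integral>x. (norm (Y x))\<^sup>2 \<partial>M) \<le> 2 * gradient_error n + 2 * gradient_error m"
      by simp
  qed
  finally have "(t - 1) * (pairing_slope n s - pairing_slope m s) \<le> (t - 1) * (hx_norm * sqrt (2 * gradient_error n + 2 * gradient_error m))"
    using t by (intro mult_left_mono) auto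
  then show ?thesis
    using s(3) by linarith
qed

text \<open>The weighted energy \<open>\<integral> \<Phi>(|x|\<^sup>2) |\<nabla>(v(tx))|\<^sup>2 dx\<close> of a dilation equals \<open>scaled_energy\<close> at \<open>s = 1/t\<close>, with \<open>X\<close> the
  gradient of \<open>v\<close>.\<close>

definition scaled_energy :: "('a \<Rightarrow> 'a) \<Rightarrow> real \<Rightarrow> real" where
  "scaled_energy X s = s ^ (DIM('a) - 2) * (\<integral>x. \<Phi> (s\<^sup>2 * (norm x)\<^sup>2) * (norm (X x))\<^sup>2 \<partial>M)"

lemma scaled_energy_gradient:
  assumes b: "0 < b" "\<And>y. y \<ge> b \<Longrightarrow> \<Phi> y = 0" and t: "1 \<le> t" "t\<^sup>2 * b < R\<^sup>2"
  shows "(\<integral>x. \<Phi> ((norm x)\<^sup>2) * (norm (t *\<^sub>R gradient (w n) (t *\<^sub>R x)))\<^sup>2 \<partial>M) = scaled_energy (gradient (w n)) (1 / t)"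
proof -
  define k where "k y = t\<^sup>2 * (\<Phi> ((1 / t)\<^sup>2 * (norm y)\<^sup>2) * (norm (gradient (w n) y))\<^sup>2)" for y
  have k_cont: "continuous_on UNIV k"
    unfolding k_def
    by (intro continuous_intros continuous_on_compose2[OF smooth_continuous_on[OF cut_smooth(1)]]
        smooth_continuous_on_gradient w_smooth) auto
  have k_meas: "k \<in> borel_measurable borel"
    using k_cont by (rule borel_measurable_continuous_onI)
  have k0: "k y = 0" if "y \<notin> ball 0 R" for y
  proof -
    have "R\<^sup>2 \<le> (norm y)\<^sup>2" using that R_pos by (intro power_mono) auto
    then have "t\<^sup>2 * b \<le> (norm y)\<^sup>2" using t by simp
    then have "b \<le> (1 / t)\<^sup>2 * (norm y)\<^sup>2"
      using t by (simp add: power_divide field_simps)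
    then show ?thesis using b by (simp add: k_def)
  qed
  have eq: "\<Phi> ((norm x)\<^sup>2) * (norm (t *\<^sub>R gradient (w n) (t *\<^sub>R x)))\<^sup>2 = k (t *\<^sub>R x)" for x
    using t by (simp add: k_def power_mult_distrib power_divide)
  have "(\<integral>x. \<Phi> ((norm x)\<^sup>2) * (norm (t *\<^sub>R gradient (w n) (t *\<^sub>R x)))\<^sup>2 \<partial>M) = (\<integral>x. k (t *\<^sub>R x) \<partial>lborel)"
    unfolding eq
  proof (rule lint_lebesgue_on_eq_lborel)
    show "(\<lambda>x. k (t *\<^sub>R x)) \<in> borel_measurable borel"
      by (rule measurable_compose[OF _ k_meas]) simp
    show "k (t *\<^sub>R x) = 0" if "x \<notin> ball 0 R" for x
      using that t mult_right_mono[of 1 t "norm x"] by (intro k0) auto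
  qed simp
  also have "\<dots> = (1 / t) ^ DIM('a) * (\<integral>x. k x \<partial>lborel)"
    using t k_meas by (intro integral_dilation) auto
  also have "(\<integral>x. k x \<partial>lborel) = (\<integral>x. k x \<partial>M)"
    by (rule lint_lebesgue_on_eq_lborel[symmetric, OF k_meas k0]) simp_all
  also have "\<dots> = t\<^sup>2 * (\<integral>x. \<Phi> ((1 / t)\<^sup>2 * (norm x)\<^sup>2) * (norm (gradient (w n) x))\<^sup>2 \<partial>M)"
    unfolding k_def by simp
  also have "(1 / t) ^ DIM('a) * \<dots> = scaled_energy (gradient (w n)) (1 / t)"
  proof -
    have "DIM('a) = DIM('a) - 2 + 2"
      using dim by simp
    then have "(1 / t) ^ DIM('a) = (1 / t) ^ (DIM('a) - 2) * (1 / t)\<^sup>2"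
      by (metis power_add)
    then show ?thesis
      using t by (simp add: scaled_energy_def power_divide)
  qed
  finally show ?thesis .
qed

text \<open>Subtract the equation tested with \<open>\<Phi>(|x|\<^sup>2) w\<^sub>n\<close> from the one tested with \<open>\<Phi>(|x|\<^sup>2) w\<^sub>n(tx)\<close>. Young's inequality
  bounds the pairing of \<open>G\<close> with the gradient of \<open>w\<^sub>n(tx)\<close> by half the sum of the two weighted energies, and
  \<open>n \<rightarrow> \<infinity>\<close>. In the pairing with \<open>h\<close> the index is first frozen at \<open>m\<close>, at the cost of an error of order
  \<open>t - 1\<close>, so that this term remains differentiable in \<open>t\<close>.\<close>

lemma dilation_inequality:
  assumes b: "0 < b" "\<And>y. y \<ge> b \<Longrightarrow> \<Phi> y = 0" "\<And>y. y \<ge> b \<Longrightarrow> \<Phi>' y = 0"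
    and t: "1 < t" "t < 2" "t\<^sup>2 * b < R\<^sup>2"
  shows "0 \<le> pairing m t - pairing m 1 + (t - 1) * (hx_norm * sqrt (2 * gradient_error m)) + 1 / 2 * scaled_energy G (1 / t) - 1 / 2 * scaled_energy G 1"
proof -
  let ?Q = "\<integral>x. \<Phi>G x \<bullet> G x \<partial>M"
  have \<Phi>_meas: "(\<lambda>x. \<Phi> (s\<^sup>2 * (norm x)\<^sup>2)) \<in> borel_measurable M" for s
    by (intro borel_measurable_lebesgue_on_continuous continuous_on_compose2[OF smooth_continuous_on[OF cut_smooth(1)]]
        continuous_intros) auto
  obtain C where C: "\<And>y. \<bar>\<Phi> y\<bar> \<le> C" using radial_cutoff_bounded[OF cut] by metis
  have int: "integrable M (\<lambda>x. \<Phi>G x \<bullet> G x)"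
    by (rule L2_Cauchy_Schwarz(1)[OF \<Phi>G_L2 G_L2])
  have step: "0 \<le> (pairing m t - pairing m 1 + (t - 1) * (hx_norm * sqrt (2 * gradient_error n + 2 * gradient_error m))) + 1 / 2 * scaled_energy (gradient (w n)) (1 / t) +
      1 / 2 * ?Q - (\<integral>x. \<Phi>G x \<bullet> gradient (w n) x \<partial>M)" for n
  proof -
    let ?g = "\<lambda>x. t *\<^sub>R gradient (w n) (t *\<^sub>R x)"
    have g_cont: "continuous_on UNIV ?g"
      by (intro continuous_intros continuous_dilation smooth_continuous_on_gradient w_smooth)
    have "(\<integral>x. \<Phi>G x \<bullet> ?g x \<partial>M) \<le> (\<integral>x. 1 / 2 * (\<Phi>G x \<bullet> G x) + 1 / 2 * (\<Phi> ((norm x)\<^sup>2) * (norm (?g x))\<^sup>2) \<partial>M)"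
    proof (rule integral_mono)
      show "integrable M (\<lambda>x. \<Phi>G x \<bullet> ?g x)"
        by (intro L2_Cauchy_Schwarz(1) \<Phi>G_L2 L2_continuous g_cont)
      show "integrable M (\<lambda>x. 1 / 2 * (\<Phi>G x \<bullet> G x) + 1 / 2 * (\<Phi> ((norm x)\<^sup>2) * (norm (?g x))\<^sup>2))"
        by (intro Bochner_Integration.integrable_add integrable_mult_right int integrable_continuous_M
            continuous_intros cut_continuous g_cont)
      fix x
      have "2 * (G x \<bullet> ?g x) \<le> (norm (G x))\<^sup>2 + (norm (?g x))\<^sup>2"
        using zero_le_power2[of "norm (G x - ?g x)"]
        by (simp only: power2_norm_eq_inner inner_diff inner_commute)
      then have "\<Phi> ((norm x)\<^sup>2) * (2 * (G x \<bullet> ?g x)) \<le> \<Phi> ((norm x)\<^sup>2) * ((norm (G x))\<^sup>2 + (norm (?g x))\<^sup>2)"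
        by (rule mult_left_mono[OF _ cut_smooth(4)])
      then show "\<Phi>G x \<bullet> ?g x \<le> 1 / 2 * (\<Phi>G x \<bullet> G x) + 1 / 2 * (\<Phi> ((norm x)\<^sup>2) * (norm (?g x))\<^sup>2)"
        unfolding \<Phi>G_def inner_scaleR_left power2_norm_eq_inner[of "G x", symmetric] by argo
    qed
    also have "\<dots> = 1 / 2 * ?Q + 1 / 2 * (\<integral>x. \<Phi> ((norm x)\<^sup>2) * (norm (?g x))\<^sup>2 \<partial>M)"
    proof -
      have "integrable M (\<lambda>x. \<Phi> ((norm x)\<^sup>2) * (norm (?g x))\<^sup>2)"
        by (intro integrable_continuous_M continuous_intros cut_continuous g_cont)
      then show ?thesis
        using int by (simp only: Bochner_Integration.integral_add integral_mult_right_zero integrable_mult_right)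
    qed
    also have "(\<integral>x. \<Phi> ((norm x)\<^sup>2) * (norm (?g x))\<^sup>2 \<partial>M) = scaled_energy (gradient (w n)) (1 / t)"
      by (rule scaled_energy_gradient[OF b(1,2)]) (use t in auto)
    finally have 1: "(\<integral>x. \<Phi>G x \<bullet> ?g x \<partial>M) \<le> 1 / 2 * ?Q + 1 / 2 * scaled_energy (gradient (w n)) (1 / t)" .
    have 2: "(\<integral>x. \<Phi>G x \<bullet> ?g x \<partial>M) + pairing n t = 0"
      using tested_equation[of t b n] t b unfolding pairing_def by simp
    have 3: "(\<integral>x. \<Phi>G x \<bullet> gradient (w n) x \<partial>M) + pairing n 1 = 0"
      using tested_equation_undilated[of n] unfolding pairing_def by simp
    show ?thesis
      using 1 2 3 pairing_increment[OF b t, of n m] by linarith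
  qed
  have E0: "gradient_error \<longlonglongrightarrow> 0"
    using conv_G by (simp add: L2_converges_def gradient_error_def[abs_def])
  have Plim: "(\<lambda>n. scaled_energy (gradient (w n)) s) \<longlonglongrightarrow> scaled_energy G s" for s
  proof -
    have "L2_converges M (\<lambda>n x. \<Phi> (s\<^sup>2 * (norm x)\<^sup>2) *\<^sub>R gradient (w n) x) (\<lambda>x. \<Phi> (s\<^sup>2 * (norm x)\<^sup>2) *\<^sub>R G x)"
      by (rule L2_converges_bounded_mult[OF conv_G \<Phi>_meas]) (use C in auto)
    from L2_converges_inner[OF this conv_G] show ?thesis
      unfolding scaled_energy_def by (intro tendsto_mult tendsto_const) (simp add: power2_norm_eq_inner)
  qed
  have "(\<lambda>n. (pairing m t - pairing m 1 + (t - 1) * (hx_norm * sqrt (2 * gradient_error n + 2 * gradient_error m))) + 1 / 2 * scaled_energy (gradient (w n)) (1 / t) +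
      1 / 2 * ?Q - (\<integral>x. \<Phi>G x \<bullet> gradient (w n) x \<partial>M)) \<longlonglongrightarrow>
      (pairing m t - pairing m 1 + (t - 1) * (hx_norm * sqrt (2 * 0 + 2 * gradient_error m))) + 1 / 2 * scaled_energy G (1 / t) + 1 / 2 * ?Q - ?Q"
    by (intro tendsto_intros E0 Plim L2_converges_inner[OF L2_converges_const[OF \<Phi>G_L2] conv_G])
  then have "0 \<le> (pairing m t - pairing m 1 + (t - 1) * (hx_norm * sqrt (2 * 0 + 2 * gradient_error m))) + 1 / 2 * scaled_energy G (1 / t) + 1 / 2 * ?Q - ?Q"
    by (rule LIMSEQ_le_const) (use step in blast)
  moreover have "scaled_energy G 1 = ?Q"
    by (simp add: scaled_energy_def \<Phi>G_def power2_norm_eq_inner)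
  ultimately show ?thesis by simp
qed

lemma scaled_energy_derivative:
  "(scaled_energy G has_real_derivative (\<integral>x. ((real DIM('a) - 2) * \<Phi> ((norm x)\<^sup>2) + 2 * (norm x)\<^sup>2 * \<Phi>' ((norm x)\<^sup>2)) * (norm (G x))\<^sup>2 \<partial>M)) (at 1)"
proof -
  let ?k = "DIM('a) - 2"
  obtain C where C: "C \<ge> 0" "\<And>y. \<bar>\<Phi> y\<bar> \<le> C" "\<And>y. \<bar>\<Phi>' y\<bar> \<le> C" using radial_cutoff_bounded[OF cut] by metis
  define H where "H s x = s ^ ?k * \<Phi> (s\<^sup>2 * (norm x)\<^sup>2) * (norm (G x))\<^sup>2" for s and x :: 'a
  define c where "c s x = real ?k * s ^ (?k - 1) * \<Phi> (s\<^sup>2 * (norm x)\<^sup>2) + s ^ ?k * (2 * s * (norm x)\<^sup>2 * \<Phi>' (s\<^sup>2 * (norm x)\<^sup>2))" for s and x :: 'a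
  have G2: "integrable M (\<lambda>x. (norm (G x))\<^sup>2)" using G_L2 by (simp add: L2_def)
  have "((\<lambda>s. \<integral>x. H s x \<partial>M) has_real_derivative (\<integral>x. c 1 x * (norm (G x))\<^sup>2 \<partial>M)) (at 1)"
  proof (rule has_derivative_under_integral[where a = 0 and b = 2
        and B = "\<lambda>x. (real ?k * 2 ^ (?k - 1) * C + 2 ^ ?k * (2 * 2 * R\<^sup>2 * C)) * (norm (G x))\<^sup>2"])
    show "((\<lambda>s. H s x) has_real_derivative c s x * (norm (G x))\<^sup>2) (at s)" for s x
    proof -
      have "((\<lambda>s. \<Phi> (s\<^sup>2 * (norm x)\<^sup>2)) has_real_derivative \<Phi>' (s\<^sup>2 * (norm x)\<^sup>2) * (2 * s * (norm x)\<^sup>2)) (at s)"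
        by (rule DERIV_chain2[OF cut_smooth(3)]) (auto intro!: derivative_eq_intros)
      then show ?thesis
        unfolding H_def c_def
        by (intro DERIV_cmult_right) (auto intro!: derivative_eq_intros simp: algebra_simps)
    qed
    show "integrable M (H s)" for s
    proof -
      have "integrable M (\<lambda>x. s ^ ?k * (\<Phi> (s\<^sup>2 * (norm x)\<^sup>2) * (norm (G x))\<^sup>2))"
        by (intro integrable_mult_right integrable_bounded_mult[OF G2, where C = C]
            borel_measurable_lebesgue_on_continuous continuous_on_compose2[OF smooth_continuous_on[OF cut_smooth(1)]]
            continuous_intros) (use C in auto)
      then show ?thesis by (simp add: H_def[abs_def] mult.assoc)
    qed
    show "integrable M (\<lambda>x. (real ?k * 2 ^ (?k - 1) * C + 2 ^ ?k * (2 * 2 * R\<^sup>2 * C)) * (norm (G x))\<^sup>2)"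
      using G2 by simp
    show "\<bar>c s x * (norm (G x))\<^sup>2\<bar> \<le> (real ?k * 2 ^ (?k - 1) * C + 2 ^ ?k * (2 * 2 * R\<^sup>2 * C)) * (norm (G x))\<^sup>2"
      if s: "0 < s" "s < 2" and x: "x \<in> space M" for s x
    proof -
      have x2: "(norm x)\<^sup>2 \<le> R\<^sup>2" using x by (intro power_mono) (auto simp: space_M)
      have p: "s ^ j \<le> 2 ^ j" "0 \<le> s ^ j" for j using s by (auto intro: power_mono)
      have "\<bar>real ?k * s ^ (?k - 1) * \<Phi> (s\<^sup>2 * (norm x)\<^sup>2)\<bar> \<le> real ?k * 2 ^ (?k - 1) * C"
        unfolding abs_mult using p C by (intro mult_mono) auto
      moreover have "\<bar>s ^ ?k * (2 * s * (norm x)\<^sup>2 * \<Phi>' (s\<^sup>2 * (norm x)\<^sup>2))\<bar> \<le> 2 ^ ?k * (2 * 2 * R\<^sup>2 * C)"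
        unfolding abs_mult using p C x2 s by (intro mult_mono) auto
      ultimately have "\<bar>c s x\<bar> \<le> real ?k * 2 ^ (?k - 1) * C + 2 ^ ?k * (2 * 2 * R\<^sup>2 * C)"
        unfolding c_def by linarith
      then show ?thesis
        by (simp add: abs_mult mult_right_mono)
    qed
  qed auto
  moreover have "(\<lambda>s. \<integral>x. H s x \<partial>M) = scaled_energy G"
    by (auto simp: H_def scaled_energy_def fun_eq_iff mult.assoc)
  moreover have "c 1 x = (real DIM('a) - 2) * \<Phi> ((norm x)\<^sup>2) + 2 * (norm x)\<^sup>2 * \<Phi>' ((norm x)\<^sup>2)" for x
    using dim by (simp add: c_def of_nat_diff)
  ultimately show ?thesis by simp
qed

text \<open>The right-hand side of \<open>dilation_inequality\<close> vanishes at \<open>t = 1\<close> and is nonnegative for \<open>t > 1\<close> close to one,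
  so its derivative at one is nonnegative; then \<open>m \<rightarrow> \<infinity>\<close>.\<close>

lemma cutoff_pohozaev:
  "(\<integral>x. \<Phi> ((norm x)\<^sup>2) * ((2 - real DIM('a)) / 2 * (norm (G x))\<^sup>2 - f x * u x * (G x \<bullet> x)) +
     \<Phi>' ((norm x)\<^sup>2) * (2 * (G x \<bullet> x)\<^sup>2 - (norm x)\<^sup>2 * (norm (G x))\<^sup>2) \<partial>M) \<ge> 0"
proof -
  obtain b T where T: "T > 1" "T \<le> 2" and b: "0 < b" "\<And>y. y \<ge> b \<Longrightarrow> \<Phi> y = 0" "\<And>y. y \<ge> b \<Longrightarrow> \<Phi>' y = 0"
    and tb: "\<And>t. 1 \<le> t \<Longrightarrow> t < T \<Longrightarrow> t\<^sup>2 * b < R\<^sup>2"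
    using cut_dilation_in_ball by metis
  define P' where "P' = (\<integral>x. ((real DIM('a) - 2) * \<Phi> ((norm x)\<^sup>2) + 2 * (norm x)\<^sup>2 * \<Phi>' ((norm x)\<^sup>2)) * (norm (G x))\<^sup>2 \<partial>M)"
  have slope: "0 \<le> pairing_slope m 1 + hx_norm * sqrt (2 * gradient_error m) - 1 / 2 * P'" for m
  proof (rule ccontr)
    define Q where "Q t = pairing m t - pairing m 1 + (t - 1) * (hx_norm * sqrt (2 * gradient_error m)) + 1 / 2 * scaled_energy G (1 / t) - 1 / 2 * scaled_energy G 1" for t
    assume neg: "\<not> 0 \<le> pairing_slope m 1 + hx_norm * sqrt (2 * gradient_error m) - 1 / 2 * P'"
    have "((\<lambda>t. 1 / t) has_real_derivative - 1) (at (1::real))"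
      by (auto intro!: derivative_eq_intros)
    then have "((\<lambda>t. scaled_energy G (1 / t)) has_real_derivative P' * (- 1)) (at 1)"
      using scaled_energy_derivative unfolding P'_def by (intro DERIV_chain2[of "scaled_energy G"]) simp_all
    then have "(Q has_real_derivative pairing_slope m 1 + hx_norm * sqrt (2 * gradient_error m) - 1 / 2 * P') (at 1)"
      unfolding Q_def using pairing_derivative[of 1 m] by (auto intro!: derivative_eq_intros)
    from DERIV_neg_dec_right[OF this] neg obtain d where d: "d > 0" "\<And>e. 0 < e \<Longrightarrow> e < d \<Longrightarrow> Q (1 + e) < Q 1"
      by auto
    define e where "e = min (d / 2) ((T - 1) / 2)"
    have e: "0 < e" "e < d" "1 + e < T"
      using d T by (auto simp: e_def min_def field_simps)
    have "0 \<le> Q (1 + e)"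
      unfolding Q_def by (rule dilation_inequality[OF b]) (use e T tb[of "1 + e"] in auto)
    moreover have "Q 1 = 0" by (simp add: Q_def)
    ultimately show False using d(2)[OF e(1,2)] by simp
  qed
  have E0: "gradient_error \<longlonglongrightarrow> 0"
    using conv_G by (simp add: L2_converges_def gradient_error_def[abs_def])
  have "(\<lambda>m. pairing_slope m 1) \<longlonglongrightarrow> (\<integral>x. h x * (G x \<bullet> x) \<partial>M)"
    using L2_converges_inner[OF L2_converges_const[OF hx_L2] conv_G] unfolding pairing_slope_def by (simp add: inner_commute)
  then have "(\<lambda>m. pairing_slope m 1 + hx_norm * sqrt (2 * gradient_error m) - 1 / 2 * P') \<longlonglongrightarrow>
      (\<integral>x. h x * (G x \<bullet> x) \<partial>M) + hx_norm * sqrt (2 * 0) - 1 / 2 * P'"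
    by (intro tendsto_intros E0)
  then have "0 \<le> (\<integral>x. h x * (G x \<bullet> x) \<partial>M) + hx_norm * sqrt (2 * 0) - 1 / 2 * P'"
    by (rule LIMSEQ_le_const) (use slope in blast)
  then have "0 \<le> (\<integral>x. h x * (G x \<bullet> x) \<partial>M) - (\<integral>x. 1 / 2 * (((real DIM('a) - 2) * \<Phi> ((norm x)\<^sup>2) +
      2 * (norm x)\<^sup>2 * \<Phi>' ((norm x)\<^sup>2)) * (norm (G x))\<^sup>2) \<partial>M)"
    by (simp add: P'_def)
  also have "\<dots> = (\<integral>x. h x * (G x \<bullet> x) - 1 / 2 * (((real DIM('a) - 2) * \<Phi> ((norm x)\<^sup>2) +
      2 * (norm x)\<^sup>2 * \<Phi>' ((norm x)\<^sup>2)) * (norm (G x))\<^sup>2) \<partial>M)"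
  proof (rule Bochner_Integration.integral_diff[symmetric])
    show "integrable M (\<lambda>x. h x * (G x \<bullet> x))"
      using L2_Cauchy_Schwarz(1)[OF h_L2 xG_L2] by simp
    obtain C where C: "C \<ge> 0" "\<And>y. \<bar>\<Phi> y\<bar> \<le> C" "\<And>y. \<bar>\<Phi>' y\<bar> \<le> C" using radial_cutoff_bounded[OF cut] by metis
    have "integrable M (\<lambda>x. ((real DIM('a) - 2) * \<Phi> ((norm x)\<^sup>2) + 2 * (norm x)\<^sup>2 * \<Phi>' ((norm x)\<^sup>2)) * (norm (G x))\<^sup>2)"
    proof (rule integrable_bounded_mult[where C = "(real DIM('a) - 2) * C + 2 * R\<^sup>2 * C"])
      show "integrable M (\<lambda>x. (norm (G x))\<^sup>2)" using G_L2 by (simp add: L2_def)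
      show "(\<lambda>x. (real DIM('a) - 2) * \<Phi> ((norm x)\<^sup>2) + 2 * (norm x)\<^sup>2 * \<Phi>' ((norm x)\<^sup>2)) \<in> borel_measurable M"
        by (intro borel_measurable_lebesgue_on_continuous continuous_intros cut_continuous)
      show "AE x in M. \<bar>(real DIM('a) - 2) * \<Phi> ((norm x)\<^sup>2) + 2 * (norm x)\<^sup>2 * \<Phi>' ((norm x)\<^sup>2)\<bar> \<le>
          (real DIM('a) - 2) * C + 2 * R\<^sup>2 * C"
      proof (rule AE_I2)
        fix x assume x: "x \<in> space M"
        have x2: "(norm x)\<^sup>2 \<le> R\<^sup>2" using x by (intro power_mono) (auto simp: space_M)
        have "\<bar>(real DIM('a) - 2) * \<Phi> ((norm x)\<^sup>2)\<bar> \<le> (real DIM('a) - 2) * C"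
          unfolding abs_mult using C dim by (intro mult_mono) auto
        moreover have "\<bar>2 * (norm x)\<^sup>2 * \<Phi>' ((norm x)\<^sup>2)\<bar> \<le> 2 * R\<^sup>2 * C"
          unfolding abs_mult using C x2 by (intro mult_mono) auto
        ultimately show "\<bar>(real DIM('a) - 2) * \<Phi> ((norm x)\<^sup>2) + 2 * (norm x)\<^sup>2 * \<Phi>' ((norm x)\<^sup>2)\<bar> \<le>
          (real DIM('a) - 2) * C + 2 * R\<^sup>2 * C" by linarith
      qed
    qed
    then show "integrable M (\<lambda>x. 1 / 2 * (((real DIM('a) - 2) * \<Phi> ((norm x)\<^sup>2) +
      2 * (norm x)\<^sup>2 * \<Phi>' ((norm x)\<^sup>2)) * (norm (G x))\<^sup>2))"
      by (rule integrable_mult_right)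
  qed
  also have "\<dots> = (\<integral>x. \<Phi> ((norm x)\<^sup>2) * ((2 - real DIM('a)) / 2 * (norm (G x))\<^sup>2 - f x * u x * (G x \<bullet> x)) +
     \<Phi>' ((norm x)\<^sup>2) * (2 * (G x \<bullet> x)\<^sup>2 - (norm x)\<^sup>2 * (norm (G x))\<^sup>2) \<partial>M)"
    by (rule Bochner_Integration.integral_cong) (simp_all add: h_def power2_eq_square[of "G _ \<bullet> _"] field_simps)
  finally show ?thesis .
qed

end

end

section \<open>The identities on almost every sphere\<close>

lemma integral_sphere_cong_AE:
  fixes f g :: "'a::euclidean_space \<Rightarrow> real"
  assumes f: "integrable (sphere_measure r) f" and ae: "AE x in sphere_measure r. f x = g x"
  shows "(\<integral>x. g x \<partial>sphere_measure r) = (\<integral>x. f x \<partial>sphere_measure r)"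
proof -
  have g: "g \<in> borel_measurable (sphere_measure r)"
    using measurable_completion_AE[OF borel_measurable_integrable[OF f[unfolded sphere_measure_def]] ae[unfolded sphere_measure_def]]
    by (simp only: sphere_measure_def)
  show ?thesis
    by (rule integral_cong_AE[OF g borel_measurable_integrable[OF f]]) (use ae in \<open>auto elim: eventually_mono\<close>)
qed

lemma integrable_ball_subset:
  fixes f :: "'a::euclidean_space \<Rightarrow> real"
  assumes "integrable (lebesgue_on (ball 0 R)) f" "r \<le> R"
  shows "integrable (lebesgue_on (ball 0 r)) f"
proof -
  have "set_integrable lebesgue (ball 0 R) f"
    using assms(1) by (simp add: set_integrable_def integrable_restrict_space)
  then have "set_integrable lebesgue (ball 0 r) f"
    by (rule set_integrable_subset) (use assms(2) in \<open>auto intro: subset_ball\<close>)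
  then show ?thesis
    by (simp add: set_integrable_def integrable_restrict_space)
qed

lemma radial_cutoff_mono:
  assumes "radial_cutoff \<rho> \<Phi> \<Phi>'" "0 < \<rho>" "\<rho> \<le> R"
  shows "radial_cutoff R \<Phi> \<Phi>'"
proof -
  have "\<rho>\<^sup>2 \<le> R\<^sup>2" using assms by (intro power_mono) auto
  then show ?thesis
    using assms(1) unfolding radial_cutoff_def by (meson less_le_trans)
qed

lemma radial_cutoff_integral_subset:
  fixes A B :: "'a::euclidean_space \<Rightarrow> real"
  assumes "radial_cutoff \<rho> \<Phi> \<Phi>'" "0 < \<rho>" "\<rho> \<le> R"
  shows "(\<integral>x. \<Phi> ((norm x)\<^sup>2) * A x + \<Phi>' ((norm x)\<^sup>2) * B x \<partial>lebesgue_on (ball 0 R)) =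
    (\<integral>x. \<Phi> ((norm x)\<^sup>2) * A x + \<Phi>' ((norm x)\<^sup>2) * B x \<partial>lebesgue_on (ball 0 \<rho>))"
proof -
  obtain a b where ab: "b < \<rho>\<^sup>2" "\<And>y. \<not> (a < y \<and> y < b) \<Longrightarrow> \<Phi> y = 0 \<and> \<Phi>' y = 0"
    using assms(1) unfolding radial_cutoff_def by blast
  have "\<Phi> ((norm x)\<^sup>2) = 0 \<and> \<Phi>' ((norm x)\<^sup>2) = 0" if "\<not> norm x < \<rho>" for x :: 'a
  proof (rule ab(2))
    have "\<rho>\<^sup>2 \<le> (norm x)\<^sup>2" using that assms by (intro power_mono) auto
    then show "\<not> (a < (norm x)\<^sup>2 \<and> (norm x)\<^sup>2 < b)" using ab(1) by linarith
  qed
  then show ?thesis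
    using assms(3) by (auto simp: integral_restrict_space indicator_def intro!: Bochner_Integration.integral_cong)
qed

text \<open>The components of the field \<open>\<theta>(x) x\<close>, whose divergence is \<open>d \<theta> + \<nabla>\<theta> \<cdot> x\<close>, serve as test functions.\<close>

lemma weak_radial_derivative:
  fixes f \<theta> :: "'a::euclidean_space \<Rightarrow> real" and F :: "'a \<Rightarrow> 'a"
  assumes F: "has_weak_gradient \<Omega> f F" and \<theta>: "smooth \<theta>" "compact K" "K \<subseteq> \<Omega>" "\<And>x. x \<notin> K \<Longrightarrow> \<theta> x = 0"
  shows "(\<integral>x. f x * (real DIM('a) * \<theta> x + gradient \<theta> x \<bullet> x) \<partial>lebesgue) = - (\<integral>x. \<theta> x * (F x \<bullet> x) \<partial>lebesgue)"
proof -
  have loc: "loc_integrable \<Omega> f" "loc_integrable \<Omega> F"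
    using F by (auto simp: has_weak_gradient_def)
  define \<psi> where "\<psi> i x = (x \<bullet> i) * \<theta> x" for i x
  have \<psi>: "smooth (\<psi> i)" "\<And>x. x \<notin> K \<Longrightarrow> \<psi> i x = 0" for i
    unfolding \<psi>_def using \<theta>(4) by (auto intro!: smooth_intros \<theta>)
  have g0: "gradient (\<psi> i) x = 0" if "x \<notin> K" for i x
    by (rule gradient_eq_0_outside[OF \<theta>(2) \<psi>(2) that])
  have g: "gradient (\<psi> i) x = (x \<bullet> i) *\<^sub>R gradient \<theta> x + \<theta> x *\<^sub>R i" for i x
    unfolding \<psi>_def gradient_mult[OF smooth_inner \<theta>(1)] gradient_inner ..
  have restrict: "(LINT x:\<Omega>|lebesgue. X x) = (\<integral>x. X x \<partial>lebesgue)" if "\<And>x. x \<notin> K \<Longrightarrow> X x = 0" for X :: "'a \<Rightarrow> 'a"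
    unfolding set_lebesgue_integral_def
    by (rule Bochner_Integration.integral_cong) (use that \<theta>(3) in \<open>force simp: indicator_def\<close>)+
  have i1: "integrable lebesgue (\<lambda>x. f x *\<^sub>R gradient (\<psi> i) x)" for i
    by (rule integrable_test_gradient[OF loc(1) \<psi>(1) \<theta>(2,3) g0])
  have i2: "integrable lebesgue (\<lambda>x. \<psi> i x *\<^sub>R F x)" for i
    by (rule integrable_test_mult[OF loc(2) \<theta>(2,3) smooth_continuous_on[OF \<psi>(1)] \<psi>(2)])
  have comp: "(\<integral>x. (f x *\<^sub>R gradient (\<psi> i) x) \<bullet> i \<partial>lebesgue) = - (\<integral>x. (\<psi> i x *\<^sub>R F x) \<bullet> i \<partial>lebesgue)" for i
  proof -
    have "\<psi> i \<in> test_functions \<Omega>"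
      by (rule test_functionsI[OF \<psi>(1) \<theta>(2,3) \<psi>(2)])
    then have "(LINT x:\<Omega>|lebesgue. f x *\<^sub>R gradient (\<psi> i) x) = - (LINT x:\<Omega>|lebesgue. \<psi> i x *\<^sub>R F x)"
      using F by (simp add: has_weak_gradient_def)
    then have "(\<integral>x. f x *\<^sub>R gradient (\<psi> i) x \<partial>lebesgue) = - (\<integral>x. \<psi> i x *\<^sub>R F x \<partial>lebesgue)"
      using g0 \<psi>(2) by (simp add: restrict)
    then have "(\<integral>x. f x *\<^sub>R gradient (\<psi> i) x \<partial>lebesgue) \<bullet> i = - ((\<integral>x. \<psi> i x *\<^sub>R F x \<partial>lebesgue) \<bullet> i)"
      by simp
    then show ?thesis
      using integral_inner_left[of i lebesgue "\<lambda>x. f x *\<^sub>R gradient (\<psi> i) x"] i1[of i]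
        integral_inner_left[of i lebesgue "\<lambda>x. \<psi> i x *\<^sub>R F x"] i2[of i] by simp
  qed
  have basis: "(\<Sum>i\<in>Basis. (x \<bullet> i) * (y \<bullet> i)) = y \<bullet> x" for x y :: 'a
    by (subst euclidean_inner) (simp add: mult.commute)
  have "f x * (real DIM('a) * \<theta> x + gradient \<theta> x \<bullet> x) = (\<Sum>i\<in>Basis. (f x *\<^sub>R gradient (\<psi> i) x) \<bullet> i)" for x
  proof -
    have "(\<Sum>i\<in>Basis. (f x *\<^sub>R gradient (\<psi> i) x) \<bullet> i) = f x * (\<Sum>i\<in>Basis. (x \<bullet> i) * (gradient \<theta> x \<bullet> i) + \<theta> x)"
      unfolding sum_distrib_left by (intro sum.cong) (simp_all add: g inner_add_left)
    then show ?thesis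
      by (simp add: sum.distrib basis)
  qed
  then have "(\<integral>x. f x * (real DIM('a) * \<theta> x + gradient \<theta> x \<bullet> x) \<partial>lebesgue) =
      (\<integral>x. (\<Sum>i\<in>Basis. (f x *\<^sub>R gradient (\<psi> i) x) \<bullet> i) \<partial>lebesgue)"
    by simp
  also have "\<dots> = (\<Sum>i\<in>Basis. (\<integral>x. (f x *\<^sub>R gradient (\<psi> i) x) \<bullet> i \<partial>lebesgue))"
    by (intro Bochner_Integration.integral_sum integrable_inner_left i1)
  also have "\<dots> = - (\<Sum>i\<in>Basis. (\<integral>x. (\<psi> i x *\<^sub>R F x) \<bullet> i \<partial>lebesgue))"
    by (simp only: comp sum_negf)
  also have "(\<Sum>i\<in>Basis. (\<integral>x. (\<psi> i x *\<^sub>R F x) \<bullet> i \<partial>lebesgue)) = (\<integral>x. (\<Sum>i\<in>Basis. (\<psi> i x *\<^sub>R F x) \<bullet> i) \<partial>lebesgue)"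
    by (intro Bochner_Integration.integral_sum[symmetric] integrable_inner_left i2)
  also have "(\<lambda>x. \<Sum>i\<in>Basis. (\<psi> i x *\<^sub>R F x) \<bullet> i) = (\<lambda>x. \<theta> x * (F x \<bullet> x))"
  proof
    fix x
    have "(\<Sum>i\<in>Basis. (\<psi> i x *\<^sub>R F x) \<bullet> i) = \<theta> x * (\<Sum>i\<in>Basis. (x \<bullet> i) * (F x \<bullet> i))"
      unfolding sum_distrib_left by (intro sum.cong) (simp_all add: \<psi>_def)
    then show "(\<Sum>i\<in>Basis. (\<psi> i x *\<^sub>R F x) \<bullet> i) = \<theta> x * (F x \<bullet> x)"
      by (simp add: basis)
  qed
  finally show ?thesis .
qed

context dilation_testable
begin

text \<open>Integrability up to the centre of all densities involved rests on \<open>u/|x| \<in> L\<^sup>2\<close>.\<close>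

context
  fixes \<rho> :: real
  assumes \<rho>: "0 < \<rho>" "\<rho> < R"
    and hardy: "integrable (lebesgue_on (ball 0 \<rho>)) (\<lambda>x. (u x)\<^sup>2 / (norm x)\<^sup>2)"
begin

abbreviation N :: "'a measure" where "N \<equiv> lebesgue_on (ball 0 \<rho>)"

lemma ball_\<rho>_subset: "ball 0 \<rho> \<subseteq> (ball 0 R :: 'a set)"
  using \<rho> by (intro subset_ball) simp

lemma space_N: "x \<in> space N \<longleftrightarrow> norm x < \<rho>"
  by (simp add: space_restrict_space)

lemma AE_N_nonzero: "AE x in N. x \<noteq> 0"
  by (subst AE_restrict_space_iff) (auto intro!: AE_completion eventually_mono[OF AE_lborel_singleton[of 0]])

lemma borel_imp_N: "k \<in> borel_measurable borel \<Longrightarrow> k \<in> borel_measurable N"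
  by (intro measurable_restrict_space1 measurable_completion) simp

lemma u_N: "L2 N u" and G_N: "L2 N G"
  using L2_lebesgue_on_subset[OF u_L2 ball_\<rho>_subset] L2_lebesgue_on_subset[OF G_L2 ball_\<rho>_subset] by auto

lemma f_N: "f \<in> borel_measurable N"
  using f_meas ball_\<rho>_subset measurable_restrict_mono by blast

lemma u_over_norm_L2: "L2 N (\<lambda>x. u x / norm x)"
proof -
  have "u \<in> borel_measurable N" using u_N by (simp add: L2_def)
  then have "(\<lambda>x. u x / norm x) \<in> borel_measurable N"
    by (rule borel_measurable_divide) (rule borel_imp_N, simp)
  then show ?thesis
    using hardy by (simp add: L2_def power_divide)
qed

lemma xG_N: "L2 N (\<lambda>x. G x \<bullet> x)"
  by (rule L2_inner_bounded[OF G_N, where C = \<rho>]) (auto intro!: borel_imp_N simp: space_N)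

lemma radial_G_N: "L2 N (\<lambda>x. G x \<bullet> (x /\<^sub>R norm x))"
proof (rule L2_inner_bounded[OF G_N, where C = 1])
  show "(\<lambda>x. x /\<^sub>R norm x) \<in> borel_measurable N"
    by (rule borel_imp_N) measurable
  have "norm (x /\<^sub>R norm x) \<le> 1" for x :: 'a
    by (cases "x = 0") simp_all
  then show "AE x in N. norm (x /\<^sub>R norm x) \<le> 1"
    by simp
qed

lemma G_square_N: "integrable N (\<lambda>x. (norm (G x))\<^sup>2)"
  using G_N by (simp add: L2_def)

lemma xG_square_N: "integrable N (\<lambda>x. (G x \<bullet> x)\<^sup>2)"
  using xG_N by (simp add: L2_def)

lemma u_radial_integrable: "integrable N (\<lambda>x. u x * (G x \<bullet> x))" "integrable N (\<lambda>x. u x * (G x \<bullet> x) / (norm x)\<^sup>2)"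
proof -
  show "integrable N (\<lambda>x. u x * (G x \<bullet> x))"
    using L2_Cauchy_Schwarz(1)[OF u_N xG_N] by simp
  have "u x * (G x \<bullet> x) / (norm x)\<^sup>2 = (u x / norm x) * (G x \<bullet> (x /\<^sub>R norm x))" for x
    by (simp add: divide_inverse power2_eq_square)
  then show "integrable N (\<lambda>x. u x * (G x \<bullet> x) / (norm x)\<^sup>2)"
    using L2_Cauchy_Schwarz(1)[OF u_over_norm_L2 radial_G_N] by simp
qed

text \<open>The energy identity for cutoffs is a pair of inequalities, so \<open>AE_ball_sphere_inequality\<close> applies to it
  with both signs.\<close>

lemma AE_energy_identity:
  assumes fu2: "integrable N (\<lambda>x. f x * (u x)\<^sup>2)"
  shows "AE r in lborel. 0 < r \<and> r < \<rho> \<longrightarrow>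
    integrable (sphere_measure r) (\<lambda>x. u x * (G x \<bullet> x)) \<and>
    (\<integral>x. (norm (G x))\<^sup>2 \<partial>lebesgue_on (ball 0 r)) = (\<integral>x. f x * (u x)\<^sup>2 \<partial>lebesgue_on (ball 0 r)) +
      1 / r * (\<integral>x. u x * (G x \<bullet> x) \<partial>sphere_measure r)"
proof -
  define A where "A x = (norm (G x))\<^sup>2 - f x * (u x)\<^sup>2" for x
  define B where "B x = 2 * u x * (G x \<bullet> x)" for x
  have A_int: "integrable N A"
    unfolding A_def by (intro Bochner_Integration.integrable_diff G_square_N fu2)
  have B_int: "integrable N B" "integrable N (\<lambda>x. B x / (norm x)\<^sup>2)"
    unfolding B_def using u_radial_integrable(1) integrable_mult_right[OF u_radial_integrable(2), of 2] by (simp_all add: mult.assoc)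
  have zero: "(\<integral>x. \<Phi> ((norm x)\<^sup>2) * A x + \<Phi>' ((norm x)\<^sup>2) * B x \<partial>N) = 0" if "radial_cutoff \<rho> \<Phi> \<Phi>'" for \<Phi> \<Phi>'
    using cutoff_energy[OF radial_cutoff_mono[OF that \<rho>(1)]] radial_cutoff_integral_subset[OF that \<rho>(1), of R A B] \<rho>(2)
    by (simp add: A_def B_def)
  have "AE r in lborel. 0 < r \<and> r < \<rho> \<longrightarrow>
      2 * r * (\<integral>x. A x \<partial>lebesgue_on (ball 0 r)) - (\<integral>x. B x \<partial>sphere_measure r) \<ge> 0"
    by (rule AE_ball_sphere_inequality[OF \<rho>(1) A_int B_int]) (simp add: zero)
  moreover have "AE r in lborel. 0 < r \<and> r < \<rho> \<longrightarrow>
      2 * r * (\<integral>x. - A x \<partial>lebesgue_on (ball 0 r)) - (\<integral>x. - B x \<partial>sphere_measure r) \<ge> 0"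
  proof (rule AE_ball_sphere_inequality[OF \<rho>(1)])
    show "integrable N (\<lambda>x. - A x)" "integrable N (\<lambda>x. - B x)" "integrable N (\<lambda>x. - B x / (norm x)\<^sup>2)"
      using A_int B_int by simp_all
    have eq: "\<Phi> ((norm x)\<^sup>2) * - A x + \<Phi>' ((norm x)\<^sup>2) * - B x = - (\<Phi> ((norm x)\<^sup>2) * A x + \<Phi>' ((norm x)\<^sup>2) * B x)"
      for \<Phi> \<Phi>' and x by simp
    show "(\<integral>x. \<Phi> ((norm x)\<^sup>2) * - A x + \<Phi>' ((norm x)\<^sup>2) * - B x \<partial>N) \<ge> 0" if "radial_cutoff \<rho> \<Phi> \<Phi>'" for \<Phi> \<Phi>'
      unfolding eq Bochner_Integration.integral_minus zero[OF that] by simp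
  qed
  moreover note AE_sphere_integrable[OF u_radial_integrable(1)]
  ultimately show ?thesis
  proof eventually_elim
    case (elim r)
    show ?case
    proof
      assume r: "0 < r \<and> r < \<rho>"
      have sub: "integrable (lebesgue_on (ball 0 r)) (\<lambda>x. (norm (G x))\<^sup>2)"
        "integrable (lebesgue_on (ball 0 r)) (\<lambda>x. f x * (u x)\<^sup>2)"
        using r by (auto intro: integrable_ball_subset[OF G_square_N] integrable_ball_subset[OF fu2])
      have "2 * r * (\<integral>x. A x \<partial>lebesgue_on (ball 0 r)) = (\<integral>x. B x \<partial>sphere_measure r)"
        using elim(1,2) r by simp
      also have "(\<integral>x. A x \<partial>lebesgue_on (ball 0 r)) =
          (\<integral>x. (norm (G x))\<^sup>2 \<partial>lebesgue_on (ball 0 r)) - (\<integral>x. f x * (u x)\<^sup>2 \<partial>lebesgue_on (ball 0 r))"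
        unfolding A_def using sub by simp
      also have "(\<integral>x. B x \<partial>sphere_measure r) = 2 * (\<integral>x. u x * (G x \<bullet> x) \<partial>sphere_measure r)"
        by (simp add: B_def mult.assoc)
      finally have eq: "r * ((\<integral>x. (norm (G x))\<^sup>2 \<partial>lebesgue_on (ball 0 r)) - (\<integral>x. f x * (u x)\<^sup>2 \<partial>lebesgue_on (ball 0 r))) =
          (\<integral>x. u x * (G x \<bullet> x) \<partial>sphere_measure r)"
        by simp
      show "integrable (sphere_measure r) (\<lambda>x. u x * (G x \<bullet> x)) \<and>
        (\<integral>x. (norm (G x))\<^sup>2 \<partial>lebesgue_on (ball 0 r)) = (\<integral>x. f x * (u x)\<^sup>2 \<partial>lebesgue_on (ball 0 r)) +
          1 / r * (\<integral>x. u x * (G x \<bullet> x) \<partial>sphere_measure r)"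
        using elim(3) r unfolding eq[symmetric] by simp
    qed
  qed
qed

text \<open>The potential enters through any densities \<open>A\<close>, \<open>B\<close> that represent the integrals of
  \<open>f u x \<cdot> \<nabla>u\<close> against cutoffs; integrating by parts or not is left open here.\<close>

lemma AE_pohozaev_inequality:
  assumes A: "integrable N A" and B: "integrable N B" "integrable N (\<lambda>x. B x / (norm x)\<^sup>2)"
    and AB: "\<And>\<Phi> \<Phi>'. radial_cutoff \<rho> \<Phi> \<Phi>' \<Longrightarrow> (\<integral>x. \<Phi> ((norm x)\<^sup>2) * (f x * u x * (G x \<bullet> x)) \<partial>M) =
      (\<integral>x. \<Phi> ((norm x)\<^sup>2) * A x + \<Phi>' ((norm x)\<^sup>2) * B x \<partial>M)"
  shows "AE r in lborel. 0 < r \<and> r < \<rho> \<longrightarrow>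
    integrable (sphere_measure r) (\<lambda>x. (norm (G x))\<^sup>2) \<and> integrable (sphere_measure r) (\<lambda>x. (G x \<bullet> x)\<^sup>2) \<and>
    integrable (sphere_measure r) B \<and>
    (2 - real DIM('a)) / 2 * (\<integral>x. (norm (G x))\<^sup>2 \<partial>lebesgue_on (ball 0 r)) +
      r / 2 * (\<integral>x. (norm (G x))\<^sup>2 \<partial>sphere_measure r) - 1 / r * (\<integral>x. (G x \<bullet> x)\<^sup>2 \<partial>sphere_measure r) -
      ((\<integral>x. A x \<partial>lebesgue_on (ball 0 r)) - 1 / (2 * r) * (\<integral>x. B x \<partial>sphere_measure r)) \<ge> 0"
proof -
  define A' where "A' x = (2 - real DIM('a)) / 2 * (norm (G x))\<^sup>2 - A x" for x
  define B' where "B' x = (2 * (G x \<bullet> x)\<^sup>2 - (norm x)\<^sup>2 * (norm (G x))\<^sup>2) - B x" for x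
  have A'_int: "integrable N A'"
    unfolding A'_def by (intro Bochner_Integration.integrable_diff integrable_mult_right G_square_N A)
  have nG: "integrable N (\<lambda>x. (norm x)\<^sup>2 * (norm (G x))\<^sup>2)"
    by (rule integrable_bounded_mult[OF G_square_N, where C = "\<rho>\<^sup>2"])
      (auto intro!: borel_imp_N power_mono simp: space_N)
  have B'_int: "integrable N B'"
    unfolding B'_def by (intro Bochner_Integration.integrable_diff integrable_mult_right xG_square_N nG B)
  have B'2_int: "integrable N (\<lambda>x. B' x / (norm x)\<^sup>2)"
  proof -
    have int: "integrable N (\<lambda>x. (2 * (G x \<bullet> (x /\<^sub>R norm x))\<^sup>2 - (norm (G x))\<^sup>2) - B x / (norm x)\<^sup>2)"
      using radial_G_N by (intro Bochner_Integration.integrable_diff integrable_mult_right G_square_N B) (simp add: L2_def)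
    show ?thesis
    proof (rule integrable_cong_AE_imp[OF int])
      show "(\<lambda>x. B' x / (norm x)\<^sup>2) \<in> borel_measurable N"
        using borel_measurable_integrable[OF B'_int] by (rule borel_measurable_divide) (rule borel_imp_N, simp)
      show "AE x in N. (2 * (G x \<bullet> (x /\<^sub>R norm x))\<^sup>2 - (norm (G x))\<^sup>2) - B x / (norm x)\<^sup>2 = B' x / (norm x)\<^sup>2"
        using AE_N_nonzero
      proof eventually_elim
        case (elim x)
        then show ?case
          by (simp add: B'_def power_mult_distrib power_inverse field_simps)
      qed
    qed
  qed
  have "AE r in lborel. 0 < r \<and> r < \<rho> \<longrightarrow>
      2 * r * (\<integral>x. A' x \<partial>lebesgue_on (ball 0 r)) - (\<integral>x. B' x \<partial>sphere_measure r) \<ge> 0"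
  proof (rule AE_ball_sphere_inequality[OF \<rho>(1) A'_int B'_int B'2_int])
    fix \<Phi> \<Phi>' assume cut: "radial_cutoff \<rho> \<Phi> \<Phi>'"
    have cutR: "radial_cutoff R \<Phi> \<Phi>'"
      using radial_cutoff_mono[OF cut \<rho>(1)] \<rho>(2) by simp
    obtain C where C: "C \<ge> 0" "\<And>y. \<bar>\<Phi> y\<bar> \<le> C" "\<And>y. \<bar>\<Phi>' y\<bar> \<le> C"
      using radial_cutoff_bounded[OF cut] by metis
    note meas = cut_measurable[OF cutR]
    have i1: "integrable M (\<lambda>x. \<Phi> ((norm x)\<^sup>2) * ((2 - real DIM('a)) / 2 * (norm (G x))\<^sup>2) +
        \<Phi>' ((norm x)\<^sup>2) * (2 * (G x \<bullet> x)\<^sup>2 - (norm x)\<^sup>2 * (norm (G x))\<^sup>2))" (is "integrable M ?E")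
    proof -
      have g: "integrable M (\<lambda>x. (norm (G x))\<^sup>2)" "integrable M (\<lambda>x. (G x \<bullet> x)\<^sup>2)"
        using G_L2 xG_L2[OF cutR] by (auto simp: L2_def)
      have "integrable M (\<lambda>x. (norm x)\<^sup>2 * (norm (G x))\<^sup>2)"
        by (rule integrable_bounded_mult[OF g(1), where C = "R\<^sup>2"])
          (auto intro!: borel_measurable_lebesgue_on_continuous continuous_intros power_mono simp: space_M)
      then show ?thesis
        using g C
        by (intro Bochner_Integration.integrable_add integrable_bounded_mult[where q = "\<lambda>x. \<Phi> ((norm x)\<^sup>2)" and C = C]
            integrable_bounded_mult[where q = "\<lambda>x. \<Phi>' ((norm x)\<^sup>2)" and C = C] meas
            Bochner_Integration.integrable_diff integrable_mult_right) auto
    qed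
    have i2: "integrable M (\<lambda>x. \<Phi> ((norm x)\<^sup>2) * (f x * u x * (G x \<bullet> x)))"
      using L2_Cauchy_Schwarz(1)[OF fu\<Phi>_L2[OF cutR] xG_L2[OF cutR]] by (simp add: mult_ac)
    have i3: "integrable M (\<lambda>x. \<Phi> ((norm x)\<^sup>2) * A x + \<Phi>' ((norm x)\<^sup>2) * B x)" (is "integrable M ?F")
    proof -
      have "integrable N ?F"
        using A B(1) C meas
        by (intro Bochner_Integration.integrable_add integrable_bounded_mult[where q = "\<lambda>x. \<Phi> ((norm x)\<^sup>2)" and C = C]
            integrable_bounded_mult[where q = "\<lambda>x. \<Phi>' ((norm x)\<^sup>2)" and C = C]
            borel_imp_N borel_measurable_radial(1) borel_measurable_smooth cut_smooth[OF cutR]) auto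
      then have "integrable lebesgue (\<lambda>x. indicator (ball 0 \<rho>) x * ?F x)"
        by (simp add: integrable_restrict_space)
      also have "(\<lambda>x. indicator (ball 0 \<rho>) x * ?F x) = (\<lambda>x. indicator (ball 0 R) x * ?F x)"
      proof
        fix x
        obtain a b where ab: "b < \<rho>\<^sup>2" "\<And>y. \<not> (a < y \<and> y < b) \<Longrightarrow> \<Phi> y = 0 \<and> \<Phi>' y = 0"
          using cut unfolding radial_cutoff_def by blast
        show "indicator (ball 0 \<rho>) x * ?F x = indicator (ball 0 R) x * ?F x"
        proof (cases "norm x < \<rho>")
          case True
          then show ?thesis using \<rho> by simp
        next
          case False
          then have "\<rho>\<^sup>2 \<le> (norm x)\<^sup>2" using \<rho> by (intro power_mono) auto
          then show ?thesis using ab(1) ab(2)[of "(norm x)\<^sup>2"] by auto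
        qed
      qed
      finally show ?thesis
        by (simp add: integrable_restrict_space)
    qed
    have "0 \<le> (\<integral>x. ?E x - \<Phi> ((norm x)\<^sup>2) * (f x * u x * (G x \<bullet> x)) \<partial>M)"
      using cutoff_pohozaev[OF cutR] by (simp add: algebra_simps)
    also have "\<dots> = (\<integral>x. ?E x - ?F x \<partial>M)"
      using i1 i2 i3 AB[OF cut] by simp
    also have "\<dots> = (\<integral>x. \<Phi> ((norm x)\<^sup>2) * A' x + \<Phi>' ((norm x)\<^sup>2) * B' x \<partial>M)"
      by (rule Bochner_Integration.integral_cong) (simp_all add: A'_def B'_def algebra_simps)
    also have "\<dots> = (\<integral>x. \<Phi> ((norm x)\<^sup>2) * A' x + \<Phi>' ((norm x)\<^sup>2) * B' x \<partial>N)"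
      by (rule radial_cutoff_integral_subset[OF cut \<rho>(1) less_imp_le[OF \<rho>(2)]])
    finally show "0 \<le> (\<integral>x. \<Phi> ((norm x)\<^sup>2) * A' x + \<Phi>' ((norm x)\<^sup>2) * B' x \<partial>N)" .
  qed
  then show ?thesis
    using AE_sphere_integrable[OF G_square_N] AE_sphere_integrable[OF xG_square_N] AE_sphere_integrable[OF B(1)]
  proof eventually_elim
    case (elim r)
    show ?case
    proof
      assume r: "0 < r \<and> r < \<rho>"
      let ?g = "\<integral>x. (norm (G x))\<^sup>2 \<partial>sphere_measure r" and ?x = "\<integral>x. (G x \<bullet> x)\<^sup>2 \<partial>sphere_measure r"
        and ?b = "\<integral>x. B x \<partial>sphere_measure r"
      have s: "integrable (sphere_measure r) (\<lambda>x. (norm (G x))\<^sup>2)" "integrable (sphere_measure r) (\<lambda>x. (G x \<bullet> x)\<^sup>2)"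
        "integrable (sphere_measure r) B"
        using elim(2-4) r by simp_all
      have sub: "integrable (lebesgue_on (ball 0 r)) (\<lambda>x. (norm (G x))\<^sup>2)" "integrable (lebesgue_on (ball 0 r)) A"
        using r by (auto intro: integrable_ball_subset[OF G_square_N] integrable_ball_subset[OF A])
      have "(\<integral>x. B' x \<partial>sphere_measure r) = (\<integral>x. 2 * (G x \<bullet> x)\<^sup>2 - r\<^sup>2 * (norm (G x))\<^sup>2 - B x \<partial>sphere_measure r)"
      proof (rule integral_sphere_cong_AE)
        show "integrable (sphere_measure r) (\<lambda>x. 2 * (G x \<bullet> x)\<^sup>2 - r\<^sup>2 * (norm (G x))\<^sup>2 - B x)"
          using s by simp
        show "AE x in sphere_measure r. 2 * (G x \<bullet> x)\<^sup>2 - r\<^sup>2 * (norm (G x))\<^sup>2 - B x = B' x"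
          using AE_sphere_norm[of r] r by (auto elim!: eventually_mono simp: B'_def)
      qed
      also have "\<dots> = 2 * ?x - r\<^sup>2 * ?g - ?b"
        using s by simp
      finally have B': "(\<integral>x. B' x \<partial>sphere_measure r) = 2 * ?x - r\<^sup>2 * ?g - ?b" .
      have A': "(\<integral>x. A' x \<partial>lebesgue_on (ball 0 r)) = (2 - real DIM('a)) / 2 * (\<integral>x. (norm (G x))\<^sup>2 \<partial>lebesgue_on (ball 0 r)) -
          (\<integral>x. A x \<partial>lebesgue_on (ball 0 r))"
        unfolding A'_def using sub by simp
      have "0 \<le> (2 * r * (\<integral>x. A' x \<partial>lebesgue_on (ball 0 r)) - (2 * ?x - r\<^sup>2 * ?g - ?b)) / (2 * r)"
        using elim(1) r B' by simp
      also have "\<dots> = (\<integral>x. A' x \<partial>lebesgue_on (ball 0 r)) - 1 / r * ?x + r / 2 * ?g + 1 / (2 * r) * ?b"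
        using r by (simp add: field_simps power2_eq_square)
      finally show "integrable (sphere_measure r) (\<lambda>x. (norm (G x))\<^sup>2) \<and> integrable (sphere_measure r) (\<lambda>x. (G x \<bullet> x)\<^sup>2) \<and>
        integrable (sphere_measure r) B \<and>
        (2 - real DIM('a)) / 2 * (\<integral>x. (norm (G x))\<^sup>2 \<partial>lebesgue_on (ball 0 r)) +
          r / 2 * ?g - 1 / r * ?x - ((\<integral>x. A x \<partial>lebesgue_on (ball 0 r)) - 1 / (2 * r) * ?b) \<ge> 0"
        using s A' by simp
    qed
  qed
qed

end

text \<open>Since \<open>2 u \<nabla>u = \<nabla>(u\<^sup>2)\<close>, this is \<open>weak_radial_derivative\<close> for \<open>\<theta> = \<Phi>(|x|\<^sup>2) u\<^sup>2\<close>, obtained as the limit of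
  \<open>\<Phi>(|x|\<^sup>2) w\<^sub>n\<^sup>2\<close>. On the annulus where the cutoff lives, \<open>f\<close> and its gradient are bounded.\<close>

lemma cutoff_potential_by_parts:
  fixes F :: "'a \<Rightarrow> 'a"
  assumes cut: "radial_cutoff R \<Phi> \<Phi>'" and F: "has_weak_gradient (ball 0 R - {0}) f F"
    and Fb: "loc_ess_bounded (ball 0 R - {0}) F"
  shows "(\<integral>x. \<Phi> ((norm x)\<^sup>2) * (f x * u x * (G x \<bullet> x)) \<partial>M) =
    (\<integral>x. \<Phi> ((norm x)\<^sup>2) * (- 1 / 2 * ((F x \<bullet> x + real DIM('a) * f x) * (u x)\<^sup>2)) +
      \<Phi>' ((norm x)\<^sup>2) * (- ((norm x)\<^sup>2 * (f x * (u x)\<^sup>2))) \<partial>M)"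
proof -
  let ?\<phi> = "\<lambda>x::'a. \<Phi> ((norm x)\<^sup>2)" and ?\<phi>' = "\<lambda>x::'a. \<Phi>' ((norm x)\<^sup>2)" and ?d = "real DIM('a)"
  let ?\<Omega> = "ball 0 R - {0} :: 'a set"
  obtain a b where ab: "0 < a" "a < b" "b < R\<^sup>2" "\<And>y. \<not> (a < y \<and> y < b) \<Longrightarrow> \<Phi> y = 0"
    "\<And>y. \<not> (a < y \<and> y < b) \<Longrightarrow> \<Phi>' y = 0"
    using cutoff_annulus[OF cut] by metis
  define L where "L = {x::'a. a \<le> (norm x)\<^sup>2 \<and> (norm x)\<^sup>2 \<le> b}"
  have L_in: "norm x < R \<and> x \<noteq> 0" if "x \<in> L" for x
  proof -
    have "(norm x)\<^sup>2 < R\<^sup>2" using that ab by (simp add: L_def)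
    moreover have "x \<noteq> 0" using that ab by (auto simp: L_def)
    ultimately show ?thesis
      using R_pos by (simp add: power_less_imp_less_base)
  qed
  have "closed L"
    unfolding L_def by (intro closed_Collect_conj closed_Collect_le continuous_intros)
  moreover have "bounded L"
    using L_in by (intro boundedI[of _ R]) (auto intro: less_imp_le)
  ultimately have L: "compact L" "L \<subseteq> ?\<Omega>"
    using L_in by (auto simp: compact_eq_bounded_closed)
  have \<phi>0: "?\<phi> x = 0" "?\<phi>' x = 0" if "x \<notin> L" for x
    using that ab by (auto simp: L_def)
  obtain C where C: "C \<ge> 0" "\<And>y. \<bar>\<Phi> y\<bar> \<le> C" "\<And>y. \<bar>\<Phi>' y\<bar> \<le> C"
    using radial_cutoff_bounded[OF cut] by metis
  have sm: "smooth \<Phi>" "smooth \<Phi>'" "\<And>y. (\<Phi> has_real_derivative \<Phi>' y) (at y)"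
    using cut_smooth[OF cut] by auto
  note [measurable] = cut_measurable[OF cut] f_meas
  have norm_meas [measurable]: "(norm :: 'a \<Rightarrow> real) \<in> borel_measurable M" "(\<lambda>x. x) \<in> borel_measurable M"
    by (intro borel_measurable_lebesgue_on_continuous continuous_intros)+
  \<comment> \<open>The three weights that multiply products of \<open>w\<^sub>n\<close> and its radial derivative are bounded.\<close>
  define q1 where "q1 x = f x * (?d * ?\<phi> x + 2 * ?\<phi>' x * (norm x)\<^sup>2)" for x
  define q2 where "q2 x = 2 * (f x * ?\<phi> x)" for x
  define q3 where "q3 x = ?\<phi> x * (F x \<bullet> x)" for x
  obtain Cf where Cf: "\<And>x. norm x < R \<Longrightarrow> x \<in> L \<Longrightarrow> \<bar>f x\<bar> \<le> Cf"
  proof -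
    have "sqrt a < R"
      using ab R_pos by (intro real_less_lsqrt) auto
    then obtain K where K: "\<And>x. x \<in> ball 0 R - ball 0 (sqrt a) \<Longrightarrow> \<bar>f x\<bar> \<le> K"
      using f_bounded[OF _ \<open>sqrt a < R\<close>] ab(1) by (metis real_sqrt_gt_zero)
    have "x \<in> ball 0 R - ball 0 (sqrt a)" if "norm x < R" "x \<in> L" for x
      using that real_le_lsqrt[of "norm x" a] by (auto simp: L_def)
    then show thesis using K that by blast
  qed
  obtain CF where CF: "AE x in lebesgue. x \<in> L \<longrightarrow> norm (F x) \<le> CF"
    using Fb L unfolding loc_ess_bounded_def by blast
  have F_meas: "F \<in> borel_measurable M"
  proof -
    have "(\<lambda>x. if x \<in> ?\<Omega> then F x else 0) \<in> borel_measurable lebesgue"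
      using Fb borel_measurable_if[of ?\<Omega> F] by (auto simp: loc_ess_bounded_def)
    then have "(\<lambda>x. if x \<in> ball 0 R then F x else 0) \<in> borel_measurable lebesgue"
    proof (rule borel_measurable_AE)
      have "AE x in lebesgue. x \<noteq> (0::'a)"
        by (rule AE_completion[OF AE_lborel_singleton])
      then show "AE x in lebesgue. (if x \<in> ?\<Omega> then F x else 0) = (if x \<in> ball 0 R then F x else 0)"
        by eventually_elim simp
    qed
    then show ?thesis
      using borel_measurable_if[of "ball 0 R" F] by auto
  qed
  note [measurable] = F_meas
  have b1: "AE x in M. \<bar>q1 x\<bar> \<le> \<bar>Cf\<bar> * (?d * C + 2 * C * R\<^sup>2)"
  proof (rule AE_I2)
    fix x assume "x \<in> space M"
    then have x: "norm x < R" by (simp add: space_M)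
    show "\<bar>q1 x\<bar> \<le> \<bar>Cf\<bar> * (?d * C + 2 * C * R\<^sup>2)"
    proof (cases "x \<in> L")
      case True
      have "(norm x)\<^sup>2 \<le> R\<^sup>2" using x by (intro power_mono) auto
      then have "\<bar>2 * ?\<phi>' x * (norm x)\<^sup>2\<bar> \<le> 2 * C * R\<^sup>2"
        unfolding abs_mult using C by (intro mult_mono) auto
      moreover have "\<bar>?d * ?\<phi> x\<bar> \<le> ?d * C"
        unfolding abs_mult using C by (intro mult_mono) auto
      ultimately have "\<bar>?d * ?\<phi> x + 2 * ?\<phi>' x * (norm x)\<^sup>2\<bar> \<le> ?d * C + 2 * C * R\<^sup>2" by linarith
      then show ?thesis
        unfolding q1_def abs_mult[of "f x"] using Cf[OF x True] by (intro mult_mono) auto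
    next
      case False
      then show ?thesis using C \<phi>0[OF False] by (simp add: q1_def)
    qed
  qed
  have b2: "AE x in M. \<bar>q2 x\<bar> \<le> 2 * (\<bar>Cf\<bar> * C)"
  proof (rule AE_I2)
    fix x assume "x \<in> space M"
    then have x: "norm x < R" by (simp add: space_M)
    show "\<bar>q2 x\<bar> \<le> 2 * (\<bar>Cf\<bar> * C)"
    proof (cases "x \<in> L")
      case True
      then have "\<bar>f x\<bar> * \<bar>?\<phi> x\<bar> \<le> \<bar>Cf\<bar> * C"
        using Cf[OF x True] C by (intro mult_mono) auto
      then show ?thesis by (simp add: q2_def abs_mult)
    next
      case False
      then show ?thesis using C \<phi>0[OF False] by (simp add: q2_def)
    qed
  qed
  have b3: "AE x in M. \<bar>q3 x\<bar> \<le> C * (\<bar>CF\<bar> * R)"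
  proof -
    have "AE x in M. x \<in> L \<longrightarrow> norm (F x) \<le> CF"
      using CF by (subst AE_restrict_space_iff) (auto elim: eventually_mono)
    then have "AE x in M. x \<in> space M \<and> (x \<in> L \<longrightarrow> norm (F x) \<le> CF)"
      by (auto intro: AE_conjI)
    then show ?thesis
    proof eventually_elim
      case (elim x)
      show ?case
      proof (cases "x \<in> L")
        case True
        then have "\<bar>F x \<bullet> x\<bar> \<le> \<bar>CF\<bar> * R"
          using elim by (intro order_trans[OF Cauchy_Schwarz_ineq2] mult_mono) (auto simp: space_M)
        then show ?thesis
          unfolding q3_def abs_mult using C by (intro mult_mono) auto
      next
        case False
        then show ?thesis using C R_pos \<phi>0[OF False] by (simp add: q3_def)
      qed
    qed
  qed
  have m: "q1 \<in> borel_measurable M" "q2 \<in> borel_measurable M" "q3 \<in> borel_measurable M"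
    unfolding q1_def q2_def q3_def by measurable
  have xg_conv: "L2_converges M (\<lambda>n x. gradient (w n) x \<bullet> x) (\<lambda>x. G x \<bullet> x)"
    unfolding L2_converges_def
  proof (intro conjI allI)
    show "L2 M (\<lambda>x. gradient (w n) x \<bullet> x)" for n
      by (intro L2_continuous continuous_intros smooth_continuous_on_gradient w_smooth)
    show "L2 M (\<lambda>x. G x \<bullet> x)" by (rule xG_L2[OF cut])
    have d: "L2 M (\<lambda>x. gradient (w n) x - G x)" for n
      by (intro L2_diff L2_continuous smooth_continuous_on_gradient w_smooth G_L2)
    show "(\<lambda>n. \<integral>x. (norm (gradient (w n) x \<bullet> x - G x \<bullet> x))\<^sup>2 \<partial>M) \<longlonglongrightarrow> 0"
    proof (rule tendsto_sandwich[where f = "\<lambda>_. 0"])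
      show "(\<lambda>n. R\<^sup>2 * (\<integral>x. (norm (gradient (w n) x - G x))\<^sup>2 \<partial>M)) \<longlonglongrightarrow> 0"
        using conv_G by (auto simp: L2_converges_def intro: tendsto_mult_right_zero)
      have "(\<integral>x. (norm (gradient (w n) x \<bullet> x - G x \<bullet> x))\<^sup>2 \<partial>M) \<le> (\<integral>x. R\<^sup>2 * (norm (gradient (w n) x - G x))\<^sup>2 \<partial>M)" for n
      proof (rule integral_mono)
        show "integrable M (\<lambda>x. (norm (gradient (w n) x \<bullet> x - G x \<bullet> x))\<^sup>2)"
          using L2_diff[OF L2_continuous xG_L2[OF cut], of "\<lambda>x. gradient (w n) x \<bullet> x"] w_smooth
          by (simp add: L2_def continuous_intros smooth_continuous_on_gradient)
        show "integrable M (\<lambda>x. R\<^sup>2 * (norm (gradient (w n) x - G x))\<^sup>2)"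
          using d[of n] by (simp add: L2_def)
        fix x assume "x \<in> space M"
        then have "\<bar>(gradient (w n) x - G x) \<bullet> x\<bar> \<le> norm (gradient (w n) x - G x) * R"
          by (intro order_trans[OF Cauchy_Schwarz_ineq2] mult_left_mono) (auto simp: space_M)
        then have "\<bar>(gradient (w n) x - G x) \<bullet> x\<bar>\<^sup>2 \<le> (norm (gradient (w n) x - G x) * R)\<^sup>2"
          by (intro power_mono) auto
        then show "(norm (gradient (w n) x \<bullet> x - G x \<bullet> x))\<^sup>2 \<le> R\<^sup>2 * (norm (gradient (w n) x - G x))\<^sup>2"
          by (simp add: inner_diff_left power_mult_distrib mult.commute)
      qed
      then show "\<forall>\<^sub>F n in sequentially. (\<integral>x. (norm (gradient (w n) x \<bullet> x - G x \<bullet> x))\<^sup>2 \<partial>M) \<le> R\<^sup>2 * (\<integral>x. (norm (gradient (w n) x - G x))\<^sup>2 \<partial>M)"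
        by simp
    qed simp_all
  qed
  have c1: "L2_converges M (\<lambda>n x. q1 x *\<^sub>R w n x) (\<lambda>x. q1 x *\<^sub>R u x)"
    and c2: "L2_converges M (\<lambda>n x. q2 x *\<^sub>R w n x) (\<lambda>x. q2 x *\<^sub>R u x)"
    and c3: "L2_converges M (\<lambda>n x. q3 x *\<^sub>R w n x) (\<lambda>x. q3 x *\<^sub>R u x)"
    by (rule L2_converges_bounded_mult[OF conv_u m(1) b1] L2_converges_bounded_mult[OF conv_u m(2) b2]
        L2_converges_bounded_mult[OF conv_u m(3) b3])+
  note lim = L2_converges_inner[OF c1 conv_u] L2_converges_inner[OF c2 xg_conv] L2_converges_inner[OF c3 conv_u]
  have int: "integrable M (\<lambda>x. (q1 x *\<^sub>R v x) \<bullet> v x)" "integrable M (\<lambda>x. (q2 x *\<^sub>R v x) \<bullet> v' x)"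
    "integrable M (\<lambda>x. (q3 x *\<^sub>R v x) \<bullet> v x)" if "L2 M v" "L2 M v'" for v v' :: "'a \<Rightarrow> real"
    by (intro L2_Cauchy_Schwarz(1) that L2_bounded_mult[OF that(1) m(1) b1] L2_bounded_mult[OF that(1) m(2) b2]
        L2_bounded_mult[OF that(1) m(3) b3])+
  have approx: "(\<integral>x. (q1 x *\<^sub>R w n x) \<bullet> w n x \<partial>M) + (\<integral>x. (q2 x *\<^sub>R w n x) \<bullet> (gradient (w n) x \<bullet> x) \<partial>M) +
      (\<integral>x. (q3 x *\<^sub>R w n x) \<bullet> w n x \<partial>M) = 0" for n
  proof -
    define \<theta> where "\<theta> x = ?\<phi> x * (w n x * w n x)" for x
    have \<theta>_sm: "smooth \<theta>"
      unfolding \<theta>_def by (intro smooth_intros smooth_compose[OF sm(1)] w_smooth)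
    have \<theta>0: "\<theta> x = 0" if "x \<notin> L" for x
      using \<phi>0(1)[OF that] by (simp add: \<theta>_def)
    have g: "gradient \<theta> x = ?\<phi> x *\<^sub>R (w n x *\<^sub>R gradient (w n) x + w n x *\<^sub>R gradient (w n) x) + (w n x * w n x) *\<^sub>R ((2 * ?\<phi>' x) *\<^sub>R x)" for x
      unfolding \<theta>_def gradient_mult[OF smooth_compose[OF sm(1) smooth_norm_square] smooth_mult[OF w_smooth w_smooth]]
        gradient_mult[OF w_smooth w_smooth] gradient_radial[OF sm(3)] ..
    have gL: "gradient \<theta> x = 0" if "x \<notin> L" for x
      by (rule gradient_eq_0_outside[OF L(1) \<theta>0 that])
    have toM: "(\<integral>x. k x \<partial>lebesgue) = (\<integral>x. k x \<partial>M)" if "\<And>x. x \<notin> L \<Longrightarrow> k x = 0" for k :: "'a \<Rightarrow> real"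
    proof -
      have "(\<integral>x. k x \<partial>M) = (\<integral>x. indicator (ball 0 R) x *\<^sub>R k x \<partial>lebesgue)"
        by (simp add: integral_restrict_space)
      also have "\<dots> = (\<integral>x. k x \<partial>lebesgue)"
        by (rule Bochner_Integration.integral_cong) (use that L_in in \<open>auto simp: indicator_def\<close>)
      finally show ?thesis ..
    qed
    have "(\<integral>x. f x * (?d * \<theta> x + gradient \<theta> x \<bullet> x) \<partial>M) = - (\<integral>x. \<theta> x * (F x \<bullet> x) \<partial>M)"
      using weak_radial_derivative[OF F \<theta>_sm L \<theta>0] \<theta>0 gL by (simp add: toM)
    also have "(\<integral>x. f x * (?d * \<theta> x + gradient \<theta> x \<bullet> x) \<partial>M) =
        (\<integral>x. (q1 x *\<^sub>R w n x) \<bullet> w n x + (q2 x *\<^sub>R w n x) \<bullet> (gradient (w n) x \<bullet> x) \<partial>M)"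
      by (rule Bochner_Integration.integral_cong)
        (simp_all add: g \<theta>_def q1_def q2_def inner_add_left power2_norm_eq_inner algebra_simps)
    also have "\<dots> = (\<integral>x. (q1 x *\<^sub>R w n x) \<bullet> w n x \<partial>M) + (\<integral>x. (q2 x *\<^sub>R w n x) \<bullet> (gradient (w n) x \<bullet> x) \<partial>M)"
      using conv_u xg_conv by (intro Bochner_Integration.integral_add int) (auto simp: L2_converges_def)
    also have "(\<integral>x. \<theta> x * (F x \<bullet> x) \<partial>M) = (\<integral>x. (q3 x *\<^sub>R w n x) \<bullet> w n x \<partial>M)"
      by (rule Bochner_Integration.integral_cong) (simp_all add: \<theta>_def q3_def mult_ac)
    finally show ?thesis by simp
  qed
  have "(\<lambda>n. (\<integral>x. (q1 x *\<^sub>R w n x) \<bullet> w n x \<partial>M) + (\<integral>x. (q2 x *\<^sub>R w n x) \<bullet> (gradient (w n) x \<bullet> x) \<partial>M) +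
      (\<integral>x. (q3 x *\<^sub>R w n x) \<bullet> w n x \<partial>M)) \<longlonglongrightarrow>
      (\<integral>x. (q1 x *\<^sub>R u x) \<bullet> u x \<partial>M) + (\<integral>x. (q2 x *\<^sub>R u x) \<bullet> (G x \<bullet> x) \<partial>M) + (\<integral>x. (q3 x *\<^sub>R u x) \<bullet> u x \<partial>M)"
    by (intro tendsto_add lim)
  then have sum: "(\<integral>x. (q1 x *\<^sub>R u x) \<bullet> u x \<partial>M) + (\<integral>x. (q2 x *\<^sub>R u x) \<bullet> (G x \<bullet> x) \<partial>M) + (\<integral>x. (q3 x *\<^sub>R u x) \<bullet> u x \<partial>M) = 0"
    by (simp only: approx LIMSEQ_const_iff)
  note i = int[OF u_L2 xG_L2[OF cut]]
  have half: "(\<integral>x. - 1 / 2 * ((q1 x *\<^sub>R u x) \<bullet> u x + (q3 x *\<^sub>R u x) \<bullet> u x) \<partial>M) =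
      - 1 / 2 * ((\<integral>x. (q1 x *\<^sub>R u x) \<bullet> u x \<partial>M) + (\<integral>x. (q3 x *\<^sub>R u x) \<bullet> u x \<partial>M))"
    using i by simp
  have arith: "y = 2 * (- 1 / 2 * (x + z))" if "x + y + z = 0" for x y z :: real
  proof -
    have "2 * (- 1 / 2 * (x + z)) = (2 * (- 1 / 2)) * (x + z)"
      by (simp only: mult.assoc)
    also have "\<dots> = - (x + z)"
      by simp
    finally show ?thesis
      using that by linarith
  qed
  have "(\<integral>x. (q2 x *\<^sub>R u x) \<bullet> (G x \<bullet> x) \<partial>M) = 2 * (\<integral>x. - 1 / 2 * ((q1 x *\<^sub>R u x) \<bullet> u x + (q3 x *\<^sub>R u x) \<bullet> u x) \<partial>M)"
    unfolding half by (rule arith[OF sum])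
  moreover have "(\<integral>x. (q2 x *\<^sub>R u x) \<bullet> (G x \<bullet> x) \<partial>M) = (\<integral>x. 2 * (?\<phi> x * (f x * u x * (G x \<bullet> x))) \<partial>M)"
    by (rule Bochner_Integration.integral_cong) (simp_all add: q2_def mult_ac)
  moreover have "(\<integral>x. - 1 / 2 * ((q1 x *\<^sub>R u x) \<bullet> u x + (q3 x *\<^sub>R u x) \<bullet> u x) \<partial>M) =
      (\<integral>x. ?\<phi> x * (- 1 / 2 * ((F x \<bullet> x + ?d * f x) * (u x)\<^sup>2)) + ?\<phi>' x * (- ((norm x)\<^sup>2 * (f x * (u x)\<^sup>2))) \<partial>M)"
    by (rule Bochner_Integration.integral_cong) (simp_all add: q1_def q3_def power2_eq_square[of "u _"] field_simps)
  ultimately show ?thesis by simp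
qed

end

section \<open>The crack\<close>

text \<open>The hypothesis on \<open>g\<close> says that \<open>s \<mapsto> g(sx') / s\<close> is nonincreasing: the crack is mapped into itself
  by dilations with factor at least one.\<close>

lemma crack_dilation:
  fixes g :: "real ^ 'n::finite \<Rightarrow> real" and x :: "'n pt"
  assumes g: "admissible_profile R g" and x: "x \<in> crack g" and t: "1 \<le> t" "norm (t *\<^sub>R x) < R"
  shows "t *\<^sub>R x \<in> crack g"
proof -
  obtain y a where xy: "x = (y, a, 0)" "a \<ge> g y"
    using x by (auto simp: crack_def)
  have "norm (t *\<^sub>R y) \<le> norm (t *\<^sub>R x)"
    using norm_fst_le[of "t *\<^sub>R y" "(t * a, 0 :: real)"] by (simp only: xy(1) scaleR_Pair real_scaleR_def mult_zero_right)
  then have ty: "t * norm y < R"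
    using t by (simp only: norm_scaleR abs_of_nonneg)
  have g_deriv: "(g has_derivative (\<lambda>v. gradient g z \<bullet> v)) (at z)" for z
  proof (rule has_derivative_gradient)
    show "g differentiable at z"
      using g by (simp add: admissible_profile_def numeral_2_eq_2)
  qed
  have deriv: "((\<lambda>s. g (s *\<^sub>R y)) has_real_derivative gradient g (s *\<^sub>R y) \<bullet> y) (at s)" for s
    unfolding has_field_derivative_def
    by (rule has_derivative_eq_rhs[OF has_derivative_compose[OF _ g_deriv]])
      (auto intro!: derivative_eq_intros)
  have "g (t *\<^sub>R y) / t \<le> g (1 *\<^sub>R y) / 1"
  proof (rule DERIV_nonpos_imp_nonincreasing[OF t(1), of "\<lambda>s. g (s *\<^sub>R y) / s"])
    fix s :: real assume s: "1 \<le> s" "s \<le> t"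
    have "norm (s *\<^sub>R y) < R"
      using s ty mult_right_mono[of s t "norm y"] by simp
    then have sg: "g (s *\<^sub>R y) - (s *\<^sub>R y) \<bullet> gradient g (s *\<^sub>R y) \<ge> 0"
      using g unfolding admissible_profile_def by blast
    have "((\<lambda>s. g (s *\<^sub>R y) / s) has_real_derivative
        ((gradient g (s *\<^sub>R y) \<bullet> y) * s - g (s *\<^sub>R y) * 1) / (s * s)) (at s)"
      using s by (intro DERIV_divide deriv DERIV_ident) simp
    moreover have "((gradient g (s *\<^sub>R y) \<bullet> y) * s - g (s *\<^sub>R y) * 1) / (s * s) \<le> 0"
      using sg s by (intro divide_nonpos_nonneg) (simp_all add: inner_commute mult.commute)
    ultimately show "\<exists>d. ((\<lambda>s. g (s *\<^sub>R y) / s) has_real_derivative d) (at s) \<and> d \<le> 0"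
      by blast
  qed
  then have "g (t *\<^sub>R y) \<le> t * g y"
    using t by (simp add: field_simps)
  also have "\<dots> \<le> t * a"
    using xy t by (intro mult_left_mono) auto
  finally show ?thesis
    by (simp add: crack_def xy)
qed

lemma dilated_test_function:
  fixes g :: "real ^ 'n::finite \<Rightarrow> real"
  assumes R: "R > 0" and g: "admissible_profile R g" and w: "w \<in> smooth_off_crack R g"
    and cut: "radial_cutoff R \<Phi> \<Phi>'" and t: "1 \<le> t" "\<And>y. y \<ge> b \<Longrightarrow> \<Phi> y = 0" "t\<^sup>2 * b < R\<^sup>2"
  shows "(\<lambda>x. \<Phi> ((norm x)\<^sup>2) * w (t *\<^sub>R x)) \<in> test_functions (ball 0 R - crack g)"
proof -
  obtain U where w_smooth: "smooth w" and U: "open U" "crack g \<subseteq> U" "\<And>x. x \<in> U \<Longrightarrow> x \<in> cball 0 R \<Longrightarrow> w x = 0"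
    using w by (auto simp: smooth_off_crack_def)
  have \<Phi>: "smooth \<Phi>" using cut by (simp add: radial_cutoff_def)
  \<comment> \<open>Where the cutoff does not vanish and \<open>tx\<close> avoids the neighbourhood \<open>U\<close> of the crack, \<open>x\<close> is off the crack.\<close>
  define Z where "Z = {x :: 'n pt. (norm x)\<^sup>2 \<le> b} \<inter> (\<lambda>x. t *\<^sub>R x) -` (- U)"
  have inside: "norm (t *\<^sub>R x) < R" if "(norm x)\<^sup>2 \<le> b" for x :: "'n pt"
  proof -
    have "t\<^sup>2 * (norm x)\<^sup>2 \<le> t\<^sup>2 * b"
      using that by (intro mult_left_mono) auto
    moreover have "(norm (t *\<^sub>R x))\<^sup>2 = t\<^sup>2 * (norm x)\<^sup>2"
      by (simp add: power_mult_distrib)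
    ultimately have "(norm (t *\<^sub>R x))\<^sup>2 < R\<^sup>2" using t by linarith
    then show ?thesis using R by (simp add: power_less_imp_less_base)
  qed
  have in_ball: "norm x < R" if "(norm x)\<^sup>2 \<le> b" for x :: "'n pt"
    using inside[OF that] t mult_right_mono[of 1 t "norm x"] by simp
  show ?thesis
  proof (rule test_functionsI[where K = Z])
    show "smooth (\<lambda>x. \<Phi> ((norm x)\<^sup>2) * w (t *\<^sub>R x))"
      by (intro smooth_intros smooth_compose[OF \<Phi>] w_smooth)
    have "closed Z"
      unfolding Z_def using U
      by (intro closed_Int closed_Collect_le closed_vimage continuous_intros) auto
    moreover have "bounded Z"
      using in_ball by (intro boundedI[of _ R]) (auto simp: Z_def intro: less_imp_le)
    ultimately show "compact Z"
      by (simp add: compact_eq_bounded_closed)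
    show "Z \<subseteq> ball 0 R - crack g"
    proof
      fix x assume x: "x \<in> Z"
      then have b: "(norm x)\<^sup>2 \<le> b" "t *\<^sub>R x \<notin> U" by (auto simp: Z_def)
      then have "x \<notin> crack g"
        using crack_dilation[OF g _ t(1) inside[OF b(1)]] U(2) by blast
      then show "x \<in> ball 0 R - crack g"
        using in_ball[OF b(1)] by simp
    qed
    show "\<Phi> ((norm x)\<^sup>2) * w (t *\<^sub>R x) = 0" if "x \<notin> Z" for x
    proof (cases "(norm x)\<^sup>2 \<le> b")
      case True
      then have "t *\<^sub>R x \<in> U" using that by (simp add: Z_def)
      then show ?thesis using U(3) inside[OF True] by simp
    next
      case False
      then show ?thesis using t(2) by simp
    qed
  qed
qed

text \<open>The origin lies on the crack, because \<open>g(0) = 0\<close>.\<close>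

lemma smooth_off_crack_zero_near_origin:
  fixes g :: "real ^ 'n::finite \<Rightarrow> real"
  assumes "R > 0" "admissible_profile R g" "w \<in> smooth_off_crack R g"
  shows "\<exists>\<delta>>0. \<forall>x. norm x < \<delta> \<longrightarrow> w x = 0"
proof -
  obtain U where U: "open U" "crack g \<subseteq> U" "\<And>x. x \<in> U \<Longrightarrow> x \<in> cball 0 R \<Longrightarrow> w x = 0"
    using assms(3) by (auto simp: smooth_off_crack_def)
  have "(0, 0, 0) \<in> crack g"
    using assms(2) by (simp add: crack_def admissible_profile_def)
  then have "0 \<in> U"
    using U(2) by (auto simp: zero_prod_def)
  then obtain \<delta> where "\<delta> > 0" "ball 0 \<delta> \<subseteq> U"
    using U(1) open_contains_ball by blast
  then show ?thesis
    using U(3) assms(1) by (intro exI[of _ "min \<delta> R"]) (auto simp: subset_eq)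
qed

lemma H1_crack_approximation:
  fixes g :: "real ^ 'n::finite \<Rightarrow> real"
  assumes "u \<in> H1_crack R g"
  obtains w where "\<And>n::nat. w n \<in> smooth_off_crack R g"
    "(\<lambda>n. H1_norm (ball 0 R) (\<lambda>x. w n x - u x)) \<longlonglongrightarrow> 0"
proof -
  have u: "u \<in> H1 (ball 0 R)"
    and approx: "\<And>\<epsilon>. \<epsilon> > 0 \<Longrightarrow> \<exists>\<phi>\<in>smooth_off_crack R g. H1_norm (ball 0 R) (\<lambda>x. u x - \<phi> x) < \<epsilon>"
    using assms by (auto simp: H1_crack_def)
  have "\<forall>n. \<exists>\<phi>. \<phi> \<in> smooth_off_crack R g \<and> H1_norm (ball 0 R) (\<lambda>x. u x - \<phi> x) < inverse (real (Suc n))"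
    using approx by (metis inverse_positive_iff_positive of_nat_0_less_iff zero_less_Suc)
  then obtain w where w: "\<And>n. w n \<in> smooth_off_crack R g"
    "\<And>n. H1_norm (ball 0 R) (\<lambda>x. u x - w n x) < inverse (real (Suc n))"
    by metis
  have sm: "smooth (w n)" for n
    using w(1) by (simp add: smooth_off_crack_def)
  have nonneg: "H1_norm \<Omega> v \<ge> 0" for \<Omega> and v :: "'n pt \<Rightarrow> real"
    unfolding H1_norm_def set_lebesgue_integral_def
    by (intro real_sqrt_ge_zero add_nonneg_nonneg integral_nonneg_AE) auto
  have "(\<lambda>n. H1_norm (ball 0 R) (\<lambda>x. w n x - u x)) \<longlonglongrightarrow> 0"
  proof (rule tendsto_sandwich[OF _ _ tendsto_const LIMSEQ_inverse_real_of_nat])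
    show "\<forall>\<^sub>F n in sequentially. H1_norm (ball 0 R) (\<lambda>x. w n x - u x) \<le> inverse (real (Suc n))"
      using w(2) H1_norm_diff_smooth(2)[OF u sm] by (intro always_eventually allI) (simp add: less_imp_le)
  qed (use nonneg in simp)
  with w(1) show thesis by (rule that)
qed

lemma weak_solution_dilation_testable:
  fixes g :: "real ^ 'n::finite \<Rightarrow> real" and f u :: "'n pt \<Rightarrow> real"
  assumes R: "R > 0" and g: "admissible_profile R g" and f: "admissible_potential R f"
    and u: "weak_solution R g f u" and w: "\<And>n. w n \<in> smooth_off_crack R g"
    and conv: "(\<lambda>n. H1_norm (ball 0 R) (\<lambda>x. w n x - u x)) \<longlonglongrightarrow> 0"
  shows "dilation_testable R f u (weak_gradient (ball 0 R) u) w"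
proof
  have uH: "u \<in> H1 (ball 0 R)"
    using u by (simp add: weak_solution_def H1_crack_def)
  show sm: "smooth (w n)" for n
    using w by (simp add: smooth_off_crack_def)
  show "L2_converges (lebesgue_on (ball 0 R)) w u"
    "L2_converges (lebesgue_on (ball 0 R)) (\<lambda>n. gradient (w n)) (weak_gradient (ball 0 R) u)"
    by (rule H1_smooth_convergence[OF uH sm conv])+
  show "f \<in> borel_measurable (lebesgue_on (ball 0 R))"
    using f by (simp add: admissible_potential_def)
  show "\<exists>C. \<forall>x\<in>ball 0 R - ball 0 \<delta>. \<bar>f x\<bar> \<le> C" if "0 < \<delta>" "\<delta> < R" for \<delta>
    using f that unfolding admissible_potential_def by blast
  show "DIM('n pt) \<ge> 3" by (simp add: Suc_le_eq)
  fix n :: nat and t b :: real and \<Phi> \<Phi>' :: "real \<Rightarrow> real"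
  assume cut: "radial_cutoff R \<Phi> \<Phi>'" and t: "1 \<le> t" "\<And>y. y \<ge> b \<Longrightarrow> \<Phi> y = 0" "t\<^sup>2 * b < R\<^sup>2"
  have "(\<lambda>x. \<Phi> ((norm x)\<^sup>2) * w n (t *\<^sub>R x)) \<in> test_functions (ball 0 R - crack g)"
    by (rule dilated_test_function[OF R g w cut t])
  then show "(\<integral>x. weak_gradient (ball 0 R) u x \<bullet> gradient (\<lambda>x. \<Phi> ((norm x)\<^sup>2) * w n (t *\<^sub>R x)) x \<partial>lebesgue_on (ball 0 R)) =
      (\<integral>x. f x * u x * (\<Phi> ((norm x)\<^sup>2) * w n (t *\<^sub>R x)) \<partial>lebesgue_on (ball 0 R))"
    using u unfolding weak_solution_def by (simp add: set_lint_eq_lebesgue_on)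
qed (rule R)

section \<open>Integrability of the potential terms\<close>

text \<open>Near the origin the bound comes from \<open>\<xi>\<^sub>f(r) \<rightarrow> 0\<close>, away from it from the boundedness of \<open>f\<close>.\<close>

lemma xi_bound:
  fixes f :: "'n::finite pt \<Rightarrow> real"
  assumes f: "admissible_potential R f" and A: "assumption_A R f" and \<rho>: "0 < \<rho>" "\<rho> < R"
  obtains C where "\<And>x. norm x < \<rho> \<Longrightarrow> \<bar>f x * (norm x)\<^sup>2\<bar> \<le> C"
proof -
  have "\<forall>\<^sub>F r in at_right 0. xi f r < 1"
    using A by (intro order_tendstoD(2)[of "xi f" 0]) (auto simp: assumption_A_def)
  then obtain d where d: "d > 0" "\<And>r. 0 < r \<Longrightarrow> r < d \<Longrightarrow> xi f r < 1"
    by (auto simp: eventually_at_right_field)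
  define r where "r = min (d / 2) (\<rho> / 2)"
  have r: "0 < r" "r < d" "r < R" using d \<rho> by (auto simp: r_def)
  obtain K where K: "\<And>x. x \<in> ball 0 R - ball 0 r \<Longrightarrow> \<bar>f x\<bar> \<le> K"
    using f r unfolding admissible_potential_def by blast
  show thesis
  proof (rule that)
    fix x :: "'n pt" assume x: "norm x < \<rho>"
    show "\<bar>f x * (norm x)\<^sup>2\<bar> \<le> max 1 (\<bar>K\<bar> * \<rho>\<^sup>2)"
    proof (cases "norm x < r")
      case True
      then have "ennreal ((norm x)\<^sup>2 * \<bar>f x\<bar>) \<le> xi f r"
        unfolding xi_def by (intro SUP_upper) auto
      also have "\<dots> < ennreal 1" using d(2)[OF r(1,2)] by simp
      finally have "(norm x)\<^sup>2 * \<bar>f x\<bar> < 1"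
        by (simp add: ennreal_less_iff)
      then show ?thesis by (simp add: abs_mult mult.commute)
    next
      case False
      then have "\<bar>f x\<bar> \<le> \<bar>K\<bar>" using K[of x] x \<rho> by force
      moreover have "(norm x)\<^sup>2 \<le> \<rho>\<^sup>2" using x by (intro power_mono) auto
      ultimately have "\<bar>f x\<bar> * (norm x)\<^sup>2 \<le> \<bar>K\<bar> * \<rho>\<^sup>2" by (intro mult_mono) auto
      then show ?thesis by (simp add: abs_mult)
    qed
  qed
qed

text \<open>At almost every radius \<open>\<eta>(r, h)\<close> is finite and \<open>u\<close> is its own trace. Then \<open>u\<close>, unless it vanishes, is a
  competitor in the supremum with finite denominator, so the numerator is finite as well.\<close>

lemma eta_finite_mass:
  fixes h u :: "'n::finite pt \<Rightarrow> real"
  assumes u: "u \<in> H1 (ball 0 R)" and trace: "AE r in lborel. 0 < r \<and> r < R \<longrightarrow> has_trace r u u"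
    and dini: "dini_conditions R (eta h)" and \<rho>: "0 < \<rho>" "\<rho> < R"
  obtains r where "0 < r" "r < \<rho>" "(\<integral>\<^sup>+x. ennreal (\<bar>h x\<bar> * (u x)\<^sup>2) \<partial>lebesgue_on (ball 0 r)) < \<infinity>"
proof -
  have L1: "(\<lambda>r. eta h r / ennreal r) \<in> borel_measurable (lebesgue_on {0<..<R})"
    "(\<integral>\<^sup>+r. eta h r / ennreal r \<partial>lebesgue_on {0<..<R}) \<noteq> \<infinity>"
    using dini by (auto simp: dini_conditions_def L1_interval_def)
  have "AE r in lebesgue_on {0<..<R}. eta h r / ennreal r \<noteq> \<infinity>"
    by (rule nn_integral_PInf_AE[OF L1])
  then have eta_ae: "AE r in lebesgue. r \<in> {0<..<R} \<longrightarrow> eta h r / ennreal r \<noteq> \<infinity>"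
    by (subst (asm) AE_restrict_space_iff) auto
  have "\<exists>r. r \<in> {0<..<\<rho>} \<and> has_trace r u u \<and> eta h r / ennreal r \<noteq> \<infinity>"
  proof (rule ccontr)
    assume none: "\<nexists>r. r \<in> {0<..<\<rho>} \<and> has_trace r u u \<and> eta h r / ennreal r \<noteq> \<infinity>"
    have "AE r in lebesgue. r \<notin> {0<..<\<rho>}"
      using eta_ae AE_completion[OF trace]
    proof eventually_elim
      case (elim r)
      then show ?case using none \<rho> by auto
    qed
    then have "{0<..<\<rho>} \<in> null_sets lebesgue"
      by (subst AE_iff_null_sets) auto
    then have "emeasure lborel {0<..<\<rho>} = 0"
      by (auto simp: null_sets_def)
    then show False using \<rho> by simp
  qed
  then obtain r where r: "0 < r" "r < \<rho>" "has_trace r u u" "eta h r / ennreal r \<noteq> \<infinity>"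
    by auto
  have fin: "eta h r < \<infinity>"
  proof (rule ccontr)
    assume "\<not> eta h r < \<infinity>"
    then have "eta h r = top" by (metis infinity_ennreal_def top.not_eq_extremum)
    then show False using r(4) by (simp add: ennreal_top_divide)
  qed
  have ur: "u \<in> H1 (ball 0 r)"
    using H1_ball_subset(1)[OF u] r \<rho> by simp
  let ?num = "\<integral>\<^sup>+x. ennreal (\<bar>h x\<bar> * (u x)\<^sup>2) \<partial>lebesgue_on (ball 0 r)"
  have "?num < \<infinity>"
  proof (cases "AE x in lebesgue. x \<in> ball 0 r \<longrightarrow> u x = 0")
    case True
    then have "AE x in lebesgue_on (ball 0 r). u x = 0"
      by (subst AE_restrict_space_iff) auto
    then have "?num = (\<integral>\<^sup>+x. 0 \<partial>lebesgue_on (ball 0 r :: 'n pt set))"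
      by (intro nn_integral_cong_AE) (auto elim!: eventually_mono)
    then show ?thesis by simp
  next
    case False
    let ?den = "(\<integral>\<^sup>+x. ennreal ((norm (weak_gradient (ball 0 r) u x))\<^sup>2) \<partial>lebesgue_on (ball 0 r)) +
      ennreal (real CARD('n) / (2 * r)) * (\<integral>\<^sup>+x. ennreal ((sphere_trace r u x)\<^sup>2) \<partial>sphere_measure r)"
    have "?num / ?den \<le> eta h r"
      unfolding eta_def by (rule SUP_upper) (use ur False in auto)
    then have ratio: "?num / ?den < \<infinity>"
      using fin by (rule le_less_trans)
    have fin1: "(\<integral>\<^sup>+x. ennreal ((norm (weak_gradient (ball 0 r) u x))\<^sup>2) \<partial>lebesgue_on (ball 0 r)) < \<infinity>"
      using H1_D(3)[OF ur open_ball] by (subst nn_integral_eq_integral) (auto simp: L2_def)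
    have fin2: "(\<integral>\<^sup>+x. ennreal ((sphere_trace r u x)\<^sup>2) \<partial>sphere_measure r) < \<infinity>"
      using sphere_trace_AE_eq(2)[OF ur r(1,3)] by (subst nn_integral_eq_integral) (auto simp: L2_def)
    have "?den < \<infinity>"
      using fin1 fin2 by (simp add: ennreal_mult_less_top)
    moreover have "a < \<infinity>" if "a / b < \<infinity>" "b < \<infinity>" for a b :: ennreal
      using that by (cases "a = top") (auto simp: ennreal_top_divide top.not_eq_extremum split: if_splits)
    ultimately show ?thesis using ratio by blast
  qed
  with r show thesis by (intro that)
qed

lemma integrable_potential_term:
  fixes h u :: "'a::euclidean_space \<Rightarrow> real"
  assumes h: "h \<in> borel_measurable (lebesgue_on (ball 0 \<rho>))" and u: "L2 (lebesgue_on (ball 0 \<rho>)) u"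
    and r: "0 < r" "r < \<rho>" "(\<integral>\<^sup>+x. ennreal (\<bar>h x\<bar> * (u x)\<^sup>2) \<partial>lebesgue_on (ball 0 r)) < \<infinity>"
    and C: "AE x in lebesgue. x \<in> ball 0 \<rho> \<and> x \<notin> ball 0 r \<longrightarrow> \<bar>h x\<bar> \<le> C"
  shows "integrable (lebesgue_on (ball 0 \<rho>)) (\<lambda>x. h x * (u x)\<^sup>2)"
proof (rule integrableI_bounded)
  let ?N = "lebesgue_on (ball 0 \<rho> :: 'a set)"
  note [measurable] = h
  have [measurable]: "u \<in> borel_measurable ?N" and u2: "integrable ?N (\<lambda>x. \<bar>C\<bar> * (u x)\<^sup>2)"
    using u by (auto simp: L2_def)
  show "(\<lambda>x. h x * (u x)\<^sup>2) \<in> borel_measurable ?N" by measurable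
  have ball_meas: "(\<lambda>x. indicator (ball 0 r) x :: ennreal) \<in> borel_measurable ?N"
    by (intro measurable_restrict_space1 measurable_completion borel_measurable_indicator) simp
  have ae: "AE x in ?N. x \<notin> ball 0 r \<longrightarrow> \<bar>h x\<bar> \<le> C"
    using C by (subst AE_restrict_space_iff) (auto elim: eventually_mono)
  have "(\<integral>\<^sup>+x. ennreal (norm (h x * (u x)\<^sup>2)) \<partial>?N) \<le>
      (\<integral>\<^sup>+x. ennreal (\<bar>h x\<bar> * (u x)\<^sup>2) * indicator (ball 0 r) x + ennreal (\<bar>C\<bar> * (u x)\<^sup>2) \<partial>?N)"
  proof (rule nn_integral_mono_AE)
    show "AE x in ?N. ennreal (norm (h x * (u x)\<^sup>2)) \<le>
        ennreal (\<bar>h x\<bar> * (u x)\<^sup>2) * indicator (ball 0 r) x + ennreal (\<bar>C\<bar> * (u x)\<^sup>2)"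
      using ae
    proof eventually_elim
      case (elim x)
      show ?case
      proof (cases "x \<in> ball 0 r")
        case True
        then show ?thesis by (simp add: abs_mult)
      next
        case False
        then have "\<bar>h x\<bar> * (u x)\<^sup>2 \<le> \<bar>C\<bar> * (u x)\<^sup>2"
          using elim by (intro mult_right_mono) auto
        then show ?thesis
          using False by (simp add: abs_mult ennreal_leI)
      qed
    qed
  qed
  also have "\<dots> = (\<integral>\<^sup>+x. ennreal (\<bar>h x\<bar> * (u x)\<^sup>2) * indicator (ball 0 r) x \<partial>?N) + (\<integral>\<^sup>+x. ennreal (\<bar>C\<bar> * (u x)\<^sup>2) \<partial>?N)"
    using ball_meas by (intro nn_integral_add) auto
  also have "(\<integral>\<^sup>+x. ennreal (\<bar>h x\<bar> * (u x)\<^sup>2) * indicator (ball 0 r) x \<partial>?N) =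
      (\<integral>\<^sup>+x. ennreal (\<bar>h x\<bar> * (u x)\<^sup>2) \<partial>lebesgue_on (ball 0 r))"
  proof -
    have "(\<integral>\<^sup>+x. ennreal (\<bar>h x\<bar> * (u x)\<^sup>2) * indicator (ball 0 r) x * indicator (ball 0 \<rho>) x \<partial>lebesgue) =
        (\<integral>\<^sup>+x. ennreal (\<bar>h x\<bar> * (u x)\<^sup>2) * indicator (ball 0 r) x \<partial>lebesgue)"
      using r by (intro nn_integral_cong) (auto simp: indicator_def)
    then show ?thesis by (simp add: nn_integral_restrict_space)
  qed
  also have "(\<integral>\<^sup>+x. ennreal (\<bar>C\<bar> * (u x)\<^sup>2) \<partial>?N) = ennreal (\<integral>x. \<bar>C\<bar> * (u x)\<^sup>2 \<partial>?N)"
    by (rule nn_integral_eq_integral[OF u2]) simp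
  finally show "(\<integral>\<^sup>+x. ennreal (norm (h x * (u x)\<^sup>2)) \<partial>?N) < \<infinity>"
    using r(3) by (simp add: order_le_less_trans)
qed

text \<open>In both cases the potential enters the inequality through densities \<open>A\<close> in the ball and \<open>B\<close> on the
  sphere whose combination is the remainder term.\<close>

lemma remainder_densities_A:
  fixes f u :: "'n::finite pt \<Rightarrow> real"
  assumes D: "dilation_testable R f u G w" and uH: "u \<in> H1 (ball 0 R)" and G: "G = weak_gradient (ball 0 R) u"
    and f: "admissible_potential R f" and A: "assumption_A R f" and \<rho>: "0 < \<rho>" "\<rho> < R"
    and hardy: "integrable (lebesgue_on (ball 0 \<rho>)) (\<lambda>x. (u x)\<^sup>2 / (norm x)\<^sup>2)"
  shows "integrable (lebesgue_on (ball 0 \<rho>)) (\<lambda>x. f x * (u x)\<^sup>2)"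
    and "integrable (lebesgue_on (ball 0 \<rho>)) (\<lambda>x. f x * u x * (G x \<bullet> x))"
    and "0 < r \<Longrightarrow> r < \<rho> \<Longrightarrow> remainder_A f r u = (\<integral>x. f x * u x * (G x \<bullet> x) \<partial>lebesgue_on (ball 0 r))"
proof -
  interpret dilation_testable R f u G w by (rule D)
  let ?N = "lebesgue_on (ball 0 \<rho> :: 'n pt set)"
  obtain C where C: "\<And>x. norm x < \<rho> \<Longrightarrow> \<bar>f x * (norm x)\<^sup>2\<bar> \<le> C"
    using xi_bound[OF f A \<rho>] by blast
  note fN = f_N[OF \<rho> hardy]
  have uN: "u \<in> borel_measurable ?N" and xGN: "(\<lambda>x. G x \<bullet> x) \<in> borel_measurable ?N"
    using u_N[OF \<rho> hardy] xG_N[OF \<rho> hardy] by (auto simp: L2_def)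
  have q: "(\<lambda>x. f x * (norm x)\<^sup>2) \<in> borel_measurable ?N"
    by (intro borel_measurable_times fN borel_imp_N[OF \<rho> hardy]) simp
  have qC: "AE x in ?N. \<bar>f x * (norm x)\<^sup>2\<bar> \<le> C"
    using C by (intro AE_I2) (simp add: space_restrict_space)
  note nz = AE_N_nonzero[OF \<rho> hardy]
  show "integrable ?N (\<lambda>x. f x * (u x)\<^sup>2)"
  proof (rule integrable_cong_AE_imp[OF integrable_bounded_mult[OF hardy q qC]])
    show "(\<lambda>x. f x * (u x)\<^sup>2) \<in> borel_measurable ?N"
      using fN uN by measurable
    show "AE x in ?N. f x * (norm x)\<^sup>2 * ((u x)\<^sup>2 / (norm x)\<^sup>2) = f x * (u x)\<^sup>2"
      using nz by eventually_elim simp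
  qed
  show "integrable ?N (\<lambda>x. f x * u x * (G x \<bullet> x))"
  proof (rule integrable_cong_AE_imp[OF integrable_bounded_mult[OF u_radial_integrable(2)[OF \<rho> hardy] q qC]])
    show "(\<lambda>x. f x * u x * (G x \<bullet> x)) \<in> borel_measurable ?N"
      using fN uN xGN by measurable
    show "AE x in ?N. f x * (norm x)\<^sup>2 * (u x * (G x \<bullet> x) / (norm x)\<^sup>2) = f x * u x * (G x \<bullet> x)"
      using nz by eventually_elim simp
  qed
  assume r: "0 < r" "r < \<rho>"
  let ?L = "lebesgue_on (ball 0 r :: 'n pt set)"
  have sub: "ball 0 r \<subseteq> (ball 0 \<rho> :: 'n pt set)" using r by (intro subset_ball) simp
  have m: "f \<in> borel_measurable ?L" "u \<in> borel_measurable ?L" "(\<lambda>x. G x \<bullet> x) \<in> borel_measurable ?L"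
    using fN uN xGN measurable_restrict_mono[OF _ sub] by blast+
  have wg: "weak_gradient (ball 0 r) u \<in> borel_measurable ?L"
    using H1_D(3)[OF H1_ball_subset(1)[OF uH]] r \<rho> by (auto simp: L2_def)
  have id: "(\<lambda>x. x) \<in> borel_measurable ?L"
    by (intro borel_measurable_lebesgue_on_continuous continuous_intros)
  have "remainder_A f r u = (\<integral>x. f x * u x * (x \<bullet> weak_gradient (ball 0 r) u x) \<partial>?L)"
    by (simp add: remainder_A_def set_lint_eq_lebesgue_on)
  also have "\<dots> = (\<integral>x. f x * u x * (G x \<bullet> x) \<partial>?L)"
  proof (rule integral_cong_AE)
    show "(\<lambda>x. f x * u x * (x \<bullet> weak_gradient (ball 0 r) u x)) \<in> borel_measurable ?L"
      by (intro borel_measurable_times borel_measurable_inner m wg id)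
    show "(\<lambda>x. f x * u x * (G x \<bullet> x)) \<in> borel_measurable ?L"
      by (intro borel_measurable_times m)
    have "AE x in ?L. weak_gradient (ball 0 r) u x = G x"
      using H1_ball_subset(2)[OF uH, of r] r \<rho> unfolding G by (subst AE_restrict_space_iff) auto
    then show "AE x in ?L. f x * u x * (x \<bullet> weak_gradient (ball 0 r) u x) = f x * u x * (G x \<bullet> x)"
      by eventually_elim (simp add: inner_commute)
  qed
  finally show "remainder_A f r u = (\<integral>x. f x * u x * (G x \<bullet> x) \<partial>?L)" .
qed

lemma remainder_densities_B:
  fixes f u :: "'n::finite pt \<Rightarrow> real"
  assumes D: "dilation_testable R f u G w" and uH: "u \<in> H1 (ball 0 R)"
    and trace: "AE r in lborel. 0 < r \<and> r < R \<longrightarrow> has_trace r u u"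
    and B: "assumption_B R f" and \<rho>: "0 < \<rho>" "\<rho> < R"
    and hardy: "integrable (lebesgue_on (ball 0 \<rho>)) (\<lambda>x. (u x)\<^sup>2 / (norm x)\<^sup>2)"
  defines "A \<equiv> \<lambda>x. - 1 / 2 * ((potential_gradient R f x \<bullet> x + real DIM('n pt) * f x) * (u x)\<^sup>2)"
    and "b \<equiv> \<lambda>x. - ((norm x)\<^sup>2 * (f x * (u x)\<^sup>2))"
  shows "integrable (lebesgue_on (ball 0 \<rho>)) (\<lambda>x. f x * (u x)\<^sup>2)"
    and "integrable (lebesgue_on (ball 0 \<rho>)) A" and "integrable (lebesgue_on (ball 0 \<rho>)) b"
    and "integrable (lebesgue_on (ball 0 \<rho>)) (\<lambda>x. b x / (norm x)\<^sup>2)"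
    and "0 < r \<Longrightarrow> r < \<rho> \<Longrightarrow> has_trace r u u \<Longrightarrow> integrable (sphere_measure r) b \<Longrightarrow>
      remainder_B R f r u = (\<integral>x. A x \<partial>lebesgue_on (ball 0 r)) - 1 / (2 * r) * (\<integral>x. b x \<partial>sphere_measure r)"
proof -
  interpret dilation_testable R f u G w by (rule D)
  let ?N = "lebesgue_on (ball 0 \<rho> :: 'n pt set)" and ?F = "potential_gradient R f"
  have B': "dini_conditions R (eta f)" "dini_conditions R (eta (\<lambda>x. ?F x \<bullet> x))"
    "loc_ess_bounded (ball 0 R - {0}) ?F"
    using B by (auto simp: assumption_B_def)
  note fN = f_N[OF \<rho> hardy] and uL2 = u_N[OF \<rho> hardy] and nz = AE_N_nonzero[OF \<rho> hardy]
  have uN: "u \<in> borel_measurable ?N" using uL2 by (simp add: L2_def)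
  show fu2: "integrable ?N (\<lambda>x. f x * (u x)\<^sup>2)"
  proof -
    obtain r where r: "0 < r" "r < \<rho>" "(\<integral>\<^sup>+x. ennreal (\<bar>f x\<bar> * (u x)\<^sup>2) \<partial>lebesgue_on (ball 0 r)) < \<infinity>"
      using eta_finite_mass[OF uH trace B'(1) \<rho>] by blast
    obtain C where C: "\<And>x. x \<in> ball 0 R - ball 0 r \<Longrightarrow> \<bar>f x\<bar> \<le> C"
      using f_bounded[OF r(1) less_trans[OF r(2) \<rho>(2)]] by blast
    show ?thesis
      by (rule integrable_potential_term[OF fN uL2 r, where C = C]) (use C \<rho> in auto)
  qed
  have F_meas: "(\<lambda>x. ?F x \<bullet> x) \<in> borel_measurable ?N"
  proof -
    have "?F \<in> borel_measurable (lebesgue_on (ball 0 R - {0}))"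
      using B'(3) by (simp add: loc_ess_bounded_def)
    then have "(\<lambda>x. if x \<in> ball 0 R - {0} then ?F x else 0) \<in> borel_measurable lebesgue"
      using borel_measurable_if[of "ball 0 R - {0}" ?F] by auto
    then have "(\<lambda>x. if x \<in> ball 0 R then ?F x else 0) \<in> borel_measurable lebesgue"
    proof (rule borel_measurable_AE)
      have "AE x in lebesgue. x \<noteq> (0 :: 'n pt)"
        by (rule AE_completion[OF AE_lborel_singleton])
      then show "AE x in lebesgue. (if x \<in> ball 0 R - {0} then ?F x else 0) = (if x \<in> ball 0 R then ?F x else 0)"
        by eventually_elim simp
    qed
    then have "?F \<in> borel_measurable (lebesgue_on (ball 0 R))"
      using borel_measurable_if[of "ball 0 R" ?F] by auto
    then have "?F \<in> borel_measurable ?N"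
      using measurable_restrict_mono[OF _ ball_\<rho>_subset[OF \<rho> hardy]] by blast
    then show ?thesis
      by (rule borel_measurable_inner) (rule borel_imp_N[OF \<rho> hardy], simp)
  qed
  have Fu2: "integrable ?N (\<lambda>x. (?F x \<bullet> x) * (u x)\<^sup>2)"
  proof -
    obtain r where r: "0 < r" "r < \<rho>" "(\<integral>\<^sup>+x. ennreal (\<bar>?F x \<bullet> x\<bar> * (u x)\<^sup>2) \<partial>lebesgue_on (ball 0 r)) < \<infinity>"
      using eta_finite_mass[OF uH trace B'(2) \<rho>] by blast
    let ?Z = "cball 0 \<rho> - ball 0 r :: 'n pt set"
    have "compact ?Z" "?Z \<subseteq> ball 0 R - {0}"
      using r \<rho> by (auto intro: compact_diff)
    then obtain C where C: "AE x in lebesgue. x \<in> ?Z \<longrightarrow> norm (?F x) \<le> C"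
      using B'(3) unfolding loc_ess_bounded_def by blast
    have "AE x in lebesgue. x \<in> ball 0 \<rho> \<and> x \<notin> ball 0 r \<longrightarrow> \<bar>?F x \<bullet> x\<bar> \<le> \<bar>C\<bar> * \<rho>"
      using C
    proof eventually_elim
      case (elim x)
      show ?case
      proof
        assume x: "x \<in> ball 0 \<rho> \<and> x \<notin> ball 0 r"
        then have "norm (?F x) * norm x \<le> \<bar>C\<bar> * \<rho>"
          using elim by (intro mult_mono) auto
        then show "\<bar>?F x \<bullet> x\<bar> \<le> \<bar>C\<bar> * \<rho>"
          using Cauchy_Schwarz_ineq2[of "?F x" x] by linarith
      qed
    qed
    then show ?thesis
      by (rule integrable_potential_term[OF F_meas uL2 r])
  qed
  have "integrable ?N (\<lambda>x. - 1 / 2 * ((?F x \<bullet> x) * (u x)\<^sup>2 + real DIM('n pt) * (f x * (u x)\<^sup>2)))"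
    by (intro integrable_mult_right Bochner_Integration.integrable_add Fu2 fu2)
  then show A_int: "integrable ?N A"
    by (simp add: A_def distrib_right mult.assoc)
  have "integrable ?N (\<lambda>x. (norm x)\<^sup>2 * (f x * (u x)\<^sup>2))"
    by (rule integrable_bounded_mult[OF fu2, where C = "\<rho>\<^sup>2"])
      (auto intro!: borel_imp_N[OF \<rho> hardy] power_mono simp: space_restrict_space)
  then show b_int: "integrable ?N b"
    by (simp add: b_def)
  show "integrable ?N (\<lambda>x. b x / (norm x)\<^sup>2)"
  proof (rule integrable_cong_AE_imp)
    show "integrable ?N (\<lambda>x. - (f x * (u x)\<^sup>2))" using fu2 by simp
    show "(\<lambda>x. b x / (norm x)\<^sup>2) \<in> borel_measurable ?N"
      using borel_measurable_integrable[OF b_int] by (rule borel_measurable_divide) (rule borel_imp_N[OF \<rho> hardy], simp)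
    show "AE x in ?N. - (f x * (u x)\<^sup>2) = b x / (norm x)\<^sup>2"
      using nz by eventually_elim (simp add: b_def)
  qed
  assume r: "0 < r" "r < \<rho>" and tr: "has_trace r u u" and b_sphere: "integrable (sphere_measure r) b"
  have ur: "u \<in> H1 (ball 0 r)"
    using H1_ball_subset(1)[OF uH] r \<rho> by simp
  have "(\<integral>x. f x * (sphere_trace r u x)\<^sup>2 \<partial>sphere_measure r) = (\<integral>x. - 1 / r\<^sup>2 * b x \<partial>sphere_measure r)"
  proof (rule integral_sphere_cong_AE)
    show "integrable (sphere_measure r) (\<lambda>x. - 1 / r\<^sup>2 * b x)" using b_sphere by simp
    show "AE x in sphere_measure r. - 1 / r\<^sup>2 * b x = f x * (sphere_trace r u x)\<^sup>2"
      using sphere_trace_AE_eq(1)[OF ur r(1) tr] AE_sphere_norm[OF r(1)]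
      by eventually_elim (use r in \<open>simp add: b_def\<close>)
  qed
  also have "\<dots> = - 1 / r\<^sup>2 * (\<integral>x. b x \<partial>sphere_measure r)"
    by (rule integral_mult_right_zero)
  finally have s: "(\<integral>x. f x * (sphere_trace r u x)\<^sup>2 \<partial>sphere_measure r) = - 1 / r\<^sup>2 * (\<integral>x. b x \<partial>sphere_measure r)" .
  have v: "(LINT x:ball 0 r|lebesgue. (?F x \<bullet> x + real (CARD('n) + 2) * f x) * (u x)\<^sup>2) =
      - 2 * (\<integral>x. A x \<partial>lebesgue_on (ball 0 r))"
    by (simp add: A_def set_lint_eq_lebesgue_on)
  show "remainder_B R f r u = (\<integral>x. A x \<partial>lebesgue_on (ball 0 r)) - 1 / (2 * r) * (\<integral>x. b x \<partial>sphere_measure r)"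
    unfolding remainder_B_def s v using r by (simp add: power2_eq_square)
qed

theorem proposition3p3:
  fixes g :: "real ^ 'n::finite \<Rightarrow> real"
    and f u :: "'n pt \<Rightarrow> real"
    and R r0 :: real
    and \<omega> :: "real \<Rightarrow> ennreal"
    and Rem :: "real \<Rightarrow> ('n pt \<Rightarrow> real) \<Rightarrow> real"
  assumes "R > 0"
    and "admissible_profile R g"
    and "admissible_potential R f"
    and "(assumption_A R f \<and> \<omega> = omega_A f \<and> Rem = remainder_A f) \<or>
         (assumption_B R f \<and> \<omega> = omega_B f \<and> Rem = remainder_B R f)"
    and "admissible_radius R f \<omega> r0"
    and "weak_solution R g f u"
  shows "AE r in lebesgue. 0 < r \<and> r < r0 \<longrightarrow>
    - (real CARD('n) / 2) * (LINT x:ball 0 r|lebesgue. (norm (weak_gradient (ball 0 R) u x))\<^sup>2)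
      + r / 2 * (LINT x|sphere_measure r. (norm (weak_gradient (ball 0 R) u x))\<^sup>2)
      - r * (LINT x|sphere_measure r. \<bar>normal_derivative R u x\<bar>\<^sup>2)
      - Rem r u \<ge> 0
    \<and>
    (LINT x:ball 0 r|lebesgue. (norm (weak_gradient (ball 0 R) u x))\<^sup>2) =
      (LINT x:ball 0 r|lebesgue. f x * (u x)\<^sup>2)
      + (LINT x|sphere_measure r. sphere_trace r u x * normal_derivative R u x)"
proof -
  define G where "G = weak_gradient (ball 0 R) u"
  have uc: "u \<in> H1_crack R g" and uH: "u \<in> H1 (ball 0 R)"
    using assms(6) by (auto simp: weak_solution_def H1_crack_def)
  have r0: "0 < r0" "r0 < R"
    using assms(5) by (auto simp: admissible_radius_def)
  obtain w where w: "\<And>n::nat. w n \<in> smooth_off_crack R g"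
    and conv: "(\<lambda>n. H1_norm (ball 0 R) (\<lambda>x. w n x - u x)) \<longlonglongrightarrow> 0"
    using H1_crack_approximation[OF uc] by blast
  have sm: "smooth (w n)" for n
    using w by (simp add: smooth_off_crack_def)
  have D: "dilation_testable R f u G w"
    unfolding G_def by (rule weak_solution_dilation_testable[OF assms(1-3,6) w conv])
  then interpret dilation_testable R f u G w .
  have trace: "AE r in lborel. 0 < r \<and> r < R \<longrightarrow> has_trace r u u"
    by (rule AE_has_trace_self[OF uH sm conv])
  have hardy: "integrable (lebesgue_on (ball 0 r0)) (\<lambda>x. (u x)\<^sup>2 / (norm x)\<^sup>2)"
    by (rule hardy_integrable[OF sm smooth_off_crack_zero_near_origin[OF assms(1,2) w] conv_u conv_G r0 dim])
  let ?N = "lebesgue_on (ball 0 r0 :: 'n pt set)"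
  obtain A B where fu2: "integrable ?N (\<lambda>x. f x * (u x)\<^sup>2)" and A: "integrable ?N A"
    and B: "integrable ?N B" "integrable ?N (\<lambda>x. B x / (norm x)\<^sup>2)"
    and AB: "\<And>\<Phi> \<Phi>'. radial_cutoff r0 \<Phi> \<Phi>' \<Longrightarrow> (\<integral>x. \<Phi> ((norm x)\<^sup>2) * (f x * u x * (G x \<bullet> x)) \<partial>lebesgue_on (ball 0 R)) =
      (\<integral>x. \<Phi> ((norm x)\<^sup>2) * A x + \<Phi>' ((norm x)\<^sup>2) * B x \<partial>lebesgue_on (ball 0 R))"
    and Rem: "\<And>r. 0 < r \<Longrightarrow> r < r0 \<Longrightarrow> has_trace r u u \<Longrightarrow> integrable (sphere_measure r) B \<Longrightarrow>
      Rem r u = (\<integral>x. A x \<partial>lebesgue_on (ball 0 r)) - 1 / (2 * r) * (\<integral>x. B x \<partial>sphere_measure r)"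
    using assms(4)
  proof
    assume case_A: "assumption_A R f \<and> \<omega> = omega_A f \<and> Rem = remainder_A f"
    note dens = remainder_densities_A[OF D uH G_def assms(3) conjunct1[OF case_A] r0 hardy]
    show thesis
      by (rule that[OF dens(1,2), of "\<lambda>_. 0"]) (use case_A dens(3) in simp_all)
  next
    assume case_B: "assumption_B R f \<and> \<omega> = omega_B f \<and> Rem = remainder_B R f"
    note dens = remainder_densities_B[OF D uH trace conjunct1[OF case_B] r0 hardy]
    have F: "has_weak_gradient (ball 0 R - {0}) f (potential_gradient R f)"
      "loc_ess_bounded (ball 0 R - {0}) (potential_gradient R f)"
      using case_B by (auto simp: assumption_B_def)
    show thesis
    proof (rule that[OF dens(1-4)])
      show "Rem r u = (\<integral>x. - 1 / 2 * ((potential_gradient R f x \<bullet> x + real DIM('n pt) * f x) * (u x)\<^sup>2) \<partial>lebesgue_on (ball 0 r)) -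
          1 / (2 * r) * (\<integral>x. - ((norm x)\<^sup>2 * (f x * (u x)\<^sup>2)) \<partial>sphere_measure r)"
        if "0 < r" "r < r0" "has_trace r u u"
          "integrable (sphere_measure r) (\<lambda>x. - ((norm x)\<^sup>2 * (f x * (u x)\<^sup>2)))" for r
        using dens(5)[OF that] case_B by blast
    qed (rule cutoff_potential_by_parts[OF radial_cutoff_mono[OF _ r0(1) less_imp_le[OF r0(2)]] F])
  qed
  have pohozaev: "AE r in lborel. 0 < r \<and> r < r0 \<longrightarrow>
    integrable (sphere_measure r) (\<lambda>x. (norm (G x))\<^sup>2) \<and> integrable (sphere_measure r) (\<lambda>x. (G x \<bullet> x)\<^sup>2) \<and>
    integrable (sphere_measure r) B \<and>
    (2 - real DIM('n pt)) / 2 * (\<integral>x. (norm (G x))\<^sup>2 \<partial>lebesgue_on (ball 0 r)) +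
      r / 2 * (\<integral>x. (norm (G x))\<^sup>2 \<partial>sphere_measure r) - 1 / r * (\<integral>x. (G x \<bullet> x)\<^sup>2 \<partial>sphere_measure r) -
      ((\<integral>x. A x \<partial>lebesgue_on (ball 0 r)) - 1 / (2 * r) * (\<integral>x. B x \<partial>sphere_measure r)) \<ge> 0"
    by (rule AE_pohozaev_inequality[OF r0 hardy A B]) (rule AB)
  have "AE r in lborel. 0 < r \<and> r < r0 \<longrightarrow>
    - (real CARD('n) / 2) * (\<integral>x. (norm (G x))\<^sup>2 \<partial>lebesgue_on (ball 0 r))
      + r / 2 * (LINT x|sphere_measure r. (norm (G x))\<^sup>2)
      - r * (LINT x|sphere_measure r. \<bar>normal_derivative R u x\<bar>\<^sup>2)
      - Rem r u \<ge> 0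
    \<and> (\<integral>x. (norm (G x))\<^sup>2 \<partial>lebesgue_on (ball 0 r)) = (\<integral>x. f x * (u x)\<^sup>2 \<partial>lebesgue_on (ball 0 r))
      + (LINT x|sphere_measure r. sphere_trace r u x * normal_derivative R u x)"
    using AE_energy_identity[OF r0 hardy fu2] pohozaev trace
  proof eventually_elim
    case (elim r)
    show ?case
    proof
      assume r: "0 < r \<and> r < r0"
      have tr: "has_trace r u u"
        using elim(3) r r0 by simp
      have ur: "u \<in> H1 (ball 0 r)"
        using H1_ball_subset(1)[OF uH] r r0 by simp
      have norm_r: "AE x in sphere_measure r. norm (x :: 'n pt) = r"
        using r by (intro AE_sphere_norm) simp
      have s: "integrable (sphere_measure r) (\<lambda>x. u x * (G x \<bullet> x))" "integrable (sphere_measure r) (\<lambda>x. (G x \<bullet> x)\<^sup>2)"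
        "integrable (sphere_measure r) B"
        using elim(1,2) r by simp_all
      have nd: "normal_derivative R u x = 1 / r * (G x \<bullet> x)" if "norm x = r" for x
        using that by (simp add: normal_derivative_def G_def divide_inverse)
      have nd2: "(LINT x|sphere_measure r. \<bar>normal_derivative R u x\<bar>\<^sup>2) = 1 / r\<^sup>2 * (\<integral>x. (G x \<bullet> x)\<^sup>2 \<partial>sphere_measure r)"
      proof -
        have "(LINT x|sphere_measure r. \<bar>normal_derivative R u x\<bar>\<^sup>2) = (\<integral>x. 1 / r\<^sup>2 * (G x \<bullet> x)\<^sup>2 \<partial>sphere_measure r)"
        proof (rule integral_sphere_cong_AE)
          show "integrable (sphere_measure r) (\<lambda>x. 1 / r\<^sup>2 * (G x \<bullet> x)\<^sup>2)"
            using s(2) by (rule integrable_mult_right)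
          show "AE x in sphere_measure r. 1 / r\<^sup>2 * (G x \<bullet> x)\<^sup>2 = \<bar>normal_derivative R u x\<bar>\<^sup>2"
            using norm_r by eventually_elim (simp add: nd power_divide)
        qed
        then show ?thesis
          by (simp only: integral_mult_right_zero)
      qed
      have und: "(LINT x|sphere_measure r. sphere_trace r u x * normal_derivative R u x) =
          1 / r * (\<integral>x. u x * (G x \<bullet> x) \<partial>sphere_measure r)"
      proof -
        have "(LINT x|sphere_measure r. sphere_trace r u x * normal_derivative R u x) =
            (\<integral>x. 1 / r * (u x * (G x \<bullet> x)) \<partial>sphere_measure r)"
        proof (rule integral_sphere_cong_AE)
          show "integrable (sphere_measure r) (\<lambda>x. 1 / r * (u x * (G x \<bullet> x)))"
            using s(1) by (rule integrable_mult_right)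
          show "AE x in sphere_measure r. 1 / r * (u x * (G x \<bullet> x)) = sphere_trace r u x * normal_derivative R u x"
            using norm_r sphere_trace_AE_eq(1)[OF ur conjunct1[OF r] tr] by eventually_elim (simp add: nd)
        qed
        then show ?thesis
          by (simp only: integral_mult_right_zero)
      qed
      have half_dim: "(2 - real DIM('n pt)) / 2 = - (real CARD('n) / 2)"
        by simp
      have flux: "r * (1 / r\<^sup>2 * X) = 1 / r * X" for X :: real
        using r by (simp add: power2_eq_square)
      show "- (real CARD('n) / 2) * (\<integral>x. (norm (G x))\<^sup>2 \<partial>lebesgue_on (ball 0 r))
          + r / 2 * (LINT x|sphere_measure r. (norm (G x))\<^sup>2)
          - r * (LINT x|sphere_measure r. \<bar>normal_derivative R u x\<bar>\<^sup>2) - Rem r u \<ge> 0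
        \<and> (\<integral>x. (norm (G x))\<^sup>2 \<partial>lebesgue_on (ball 0 r)) = (\<integral>x. f x * (u x)\<^sup>2 \<partial>lebesgue_on (ball 0 r))
          + (LINT x|sphere_measure r. sphere_trace r u x * normal_derivative R u x)"
        unfolding nd2 und flux half_dim[symmetric] Rem[OF conjunct1[OF r] conjunct2[OF r] tr s(3)]
        using elim(1,2) r by blast
    qed
  qed
  then show ?thesis
    unfolding G_def by (simp add: AE_completion_iff set_lint_eq_lebesgue_on)
qed

end
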